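(* Let $k \in \mathbb{N}$ and $p \in [1,\infty)$. Let $\Lambda \subset \mathbb{R}^d$ be a bounded domain and let $E$ be a closed part of its boundary. Assume that for every $\mathrm{x} \in \overline{\partial\Lambda \setminus E}$ there is an open neighborhood $U_{\mathrm{x}}$ of $\mathrm{x}$ such that $\Lambda \cap U_{\mathrm{x}}$ is a $W^{k,p}$-extension domain. Then there exists a continuous extension operator $$\mathfrak{E}_{k,p} : W^{k,p}_E(\Lambda) \to W^{k,p}_E(\mathbb{R}^d).$$
   Context: The space dimension is $d \ge 1$; $\mathbb{N} = \{1,2,\dots\}$; a domain is a non-empty connected open set. For $\Lambda \subset \mathbb{R}^d$ open, $E \subset \overline{\Lambda}$ closed, $k \in \mathbb{N}$ and $p \in [1,\infty)$, put $C^\infty_E(\Lambda) := \{ v|_\Lambda : v \in C_0^\infty(\mathbb{R}^d),\ \operatorname{supp}(v) \cap E = \emptyset \}$, and let $W^{k,p}_E(\Lambda)$ be the closure of $C^\infty_E(\Lambda)$ with respect to the norm $v \mapsto \big( \int_\Lambda \sum_{j=0}^k |D^j v|^p \, d\mathrm{x} \big)^{1/p}$. The same definition with $\Lambda$ replaced by $\mathbb{R}^d$ gives $W^{k,p}_E(\mathbb{R}^d)$. $W^{k,p}(\Lambda)$ is the usual space of $L^p(\Lambda)$ functions with distributional derivatives up to order $k$ in $L^p(\Lambda)$, equipped with the natural norm. Extension operators are linear maps whose values restrict on $\Lambda$ to the original function. A domain $\Lambda \subset \mathbb{R}^d$ is a $W^{k,p}$-extension domain if there exists a continuous extension operator $W^{k,p}(\Lambda)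 \to W^{k,p}(\mathbb{R}^d)$. *)

theory Defs
  imports "HOL-Analysis.Analysis"
begin

text \<open>
  The space \<open>\<real>\<^sup>d\<close> is a type \<open>'a :: euclidean_space\<close>. The scalar field is a type
  \<open>'b :: {real_normed_field, euclidean_space}\<close>, which covers both real-valued and
  complex-valued functions.

  Elements of the function spaces over an open set \<open>\<Lambda>\<close> are represented by total functions
  \<open>'a \<Rightarrow> 'b\<close>. Two of them represent the same element iff they agree almost everywhere with
  respect to \<open>lebesgue_on \<Lambda>\<close>; the values outside \<open>\<Lambda>\<close> are irrelevant.
\<close>

definition is_domain :: "'a::euclidean_space set \<Rightarrow> bool" where
  "is_domain \<Lambda> \<longleftrightarrow> open \<Lambda> \<and> connected \<Lambda> \<and> \<Lambda> \<noteq> {}"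


subsection \<open>Smooth functions\<close>

definition pderiv_dir :: "'a::euclidean_space \<Rightarrow> ('a \<Rightarrow> 'b::real_normed_vector) \<Rightarrow> 'a \<Rightarrow> 'b" where
  "pderiv_dir b f = (\<lambda>x. frechet_derivative f (at x) b)"

text \<open>
  A list \<open>[b\<^sub>1, \<dots>, b\<^sub>j]\<close> of basis vectors stands for the iterated partial derivative
  \<open>\<partial>\<^sub>b\<^sub>1 \<dots> \<partial>\<^sub>b\<^sub>j\<close>, i.e. for one component of the derivative tensor \<open>D\<^sup>j\<close>.
\<close>

primrec iter_pderiv :: "'a::euclidean_space list \<Rightarrow> ('a \<Rightarrow> 'b::real_normed_vector) \<Rightarrow> 'a \<Rightarrow> 'b" where
  "iter_pderiv [] f = f"
| "iter_pderiv (b # bs) f = pderiv_dir b (iter_pderiv bs f)"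

definition dirs :: "nat \<Rightarrow> 'a::euclidean_space list set" where
  "dirs j = {bs. set bs \<subseteq> Basis \<and> length bs = j}"

primrec C_k :: "nat \<Rightarrow> ('a::euclidean_space \<Rightarrow> 'b::real_normed_vector) \<Rightarrow> bool" where
  "C_k 0 f \<longleftrightarrow> continuous_on UNIV f"
| "C_k (Suc n) f \<longleftrightarrow> (\<forall>x. f differentiable (at x)) \<and> (\<forall>b\<in>Basis. C_k n (pderiv_dir b f))"

definition C_infinity :: "('a::euclidean_space \<Rightarrow> 'b::real_normed_vector) \<Rightarrow> bool" where
  "C_infinity f \<longleftrightarrow> (\<forall>n. C_k n f)"

definition supp :: "('a::topological_space \<Rightarrow> 'b::zero) \<Rightarrow> 'a set" where
  "supp f = closure {x. f x \<noteq> 0}"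

text \<open>\<open>C\<^sub>0\<^sup>\<infinity>(\<Lambda>)\<close>, with functions extended by zero outside \<open>\<Lambda>\<close>.\<close>

definition C0_infinity :: "'a::euclidean_space set \<Rightarrow> ('a \<Rightarrow> 'b::real_normed_vector) set" where
  "C0_infinity \<Lambda> = {\<phi>. C_infinity \<phi> \<and> compact (supp \<phi>) \<and> supp \<phi> \<subseteq> \<Lambda>}"


subsection \<open>Sobolev spaces\<close>

definition Lp_space :: "real \<Rightarrow> 'a::euclidean_space set \<Rightarrow> ('a \<Rightarrow> 'b::euclidean_space) set" where
  "Lp_space p \<Lambda> = {f \<in> borel_measurable (lebesgue_on \<Lambda>).
     integrable (lebesgue_on \<Lambda>) (\<lambda>x. norm (f x) powr p)}"

definition locally_integrable :: "'a::euclidean_space set \<Rightarrow> ('a \<Rightarrow> 'b::euclidean_space) \<Rightarrow> bool" where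
  "locally_integrable \<Lambda> f \<longleftrightarrow> f \<in> borel_measurable (lebesgue_on \<Lambda>) \<and>
     (\<forall>K. compact K \<and> K \<subseteq> \<Lambda> \<longrightarrow> integrable (lebesgue_on K) f)"

definition has_weak_deriv ::
  "'a::euclidean_space set \<Rightarrow> ('a \<Rightarrow> 'b::euclidean_space) \<Rightarrow> 'a list \<Rightarrow> ('a \<Rightarrow> 'b) \<Rightarrow> bool" where
  "has_weak_deriv \<Lambda> u bs g \<longleftrightarrow> locally_integrable \<Lambda> u \<and> locally_integrable \<Lambda> g \<and>
     (\<forall>\<phi> :: 'a \<Rightarrow> real. \<phi> \<in> C0_infinity \<Lambda> \<longrightarrow>
        (\<integral>x. iter_pderiv bs \<phi> x *\<^sub>R u x \<partial>lebesgue_on \<Lambda>)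
          = (-1) ^ length bs *\<^sub>R (\<integral>x. \<phi> x *\<^sub>R g x \<partial>lebesgue_on \<Lambda>))"

text \<open>Weak derivatives are unique up to null sets, so the choice does not affect the norm below.\<close>

definition weak_deriv ::
  "'a::euclidean_space set \<Rightarrow> ('a \<Rightarrow> 'b::euclidean_space) \<Rightarrow> 'a list \<Rightarrow> 'a \<Rightarrow> 'b" where
  "weak_deriv \<Lambda> u bs = (SOME g. has_weak_deriv \<Lambda> u bs g)"

definition sobolev :: "nat \<Rightarrow> real \<Rightarrow> 'a::euclidean_space set \<Rightarrow> ('a \<Rightarrow> 'b::euclidean_space) set" where
  "sobolev k p \<Lambda> = {u \<in> Lp_space p \<Lambda>.
     \<forall>j\<le>k. \<forall>bs\<in>dirs j. \<exists>g\<in>Lp_space p \<Lambda>. has_weak_deriv \<Lambda> u bs g}"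

text \<open>The Euclidean norm \<open>|D\<^sup>j u|\<close> of the tensor of all \<open>j\<close>-th order derivatives.\<close>

definition weak_deriv_norm ::
  "'a::euclidean_space set \<Rightarrow> nat \<Rightarrow> ('a \<Rightarrow> 'b::euclidean_space) \<Rightarrow> 'a \<Rightarrow> real" where
  "weak_deriv_norm \<Lambda> j u x = sqrt (\<Sum>bs\<in>dirs j. (norm (weak_deriv \<Lambda> u bs x))\<^sup>2)"

definition sobolev_norm ::
  "nat \<Rightarrow> real \<Rightarrow> 'a::euclidean_space set \<Rightarrow> ('a \<Rightarrow> 'b::euclidean_space) \<Rightarrow> real" where
  "sobolev_norm k p \<Lambda> u =
     (\<integral>x. (\<Sum>j\<le>k. weak_deriv_norm \<Lambda> j u x powr p) \<partial>lebesgue_on \<Lambda>) powr (1 / p)"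

text \<open>\<open>C\<^sub>E\<^sup>\<infinity>(\<Lambda>)\<close>: the restriction \<open>v|\<^sub>\<Lambda>\<close> is represented by any function that agrees with \<open>v\<close> on \<open>\<Lambda>\<close>.\<close>

definition C_infinity_vanishing ::
  "'a::euclidean_space set \<Rightarrow> 'a set \<Rightarrow> ('a \<Rightarrow> 'b::real_normed_vector) set" where
  "C_infinity_vanishing E \<Lambda> =
     {u. \<exists>v\<in>C0_infinity UNIV. supp v \<inter> E = {} \<and> (\<forall>x\<in>\<Lambda>. u x = v x)}"

text \<open>
  \<open>W\<^sub>E\<^sup>k\<^sup>,\<^sup>p(\<Lambda>)\<close>. The elements of \<open>C\<^sub>E\<^sup>\<infinity>(\<Lambda>)\<close> have their classical derivatives as weak
  derivatives and \<open>W\<^sup>k\<^sup>,\<^sup>p(\<Lambda>)\<close> is complete, so the closure is taken inside \<open>W\<^sup>k\<^sup>,\<^sup>p(\<Lambda>)\<close>.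
\<close>

definition sobolev_vanishing ::
  "nat \<Rightarrow> real \<Rightarrow> 'a::euclidean_space set \<Rightarrow> 'a set \<Rightarrow> ('a \<Rightarrow> 'b::euclidean_space) set" where
  "sobolev_vanishing k p E \<Lambda> = {u \<in> sobolev k p \<Lambda>.
     \<forall>\<epsilon>>0. \<exists>v\<in>C_infinity_vanishing E \<Lambda>. sobolev_norm k p \<Lambda> (\<lambda>x. u x - v x) < \<epsilon>}"


subsection \<open>Extension operators\<close>

text \<open>
  \<open>T\<close> induces a continuous linear map from \<open>X\<close> (functions on \<open>\<Lambda>\<close> modulo null sets, with the
  \<open>W\<^sup>k\<^sup>,\<^sup>p(\<Lambda>)\<close>-norm) to \<open>Y\<close> (functions on the whole space modulo null sets, with the
  \<open>W\<^sup>k\<^sup>,\<^sup>p(\<real>\<^sup>d)\<close>-norm) whose values restrict on \<open>\<Lambda>\<close> to the original function. The second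
  conjunct says that \<open>T\<close> is well defined on equivalence classes.
\<close>

definition continuous_extension_operator ::
  "nat \<Rightarrow> real \<Rightarrow> 'a::euclidean_space set \<Rightarrow>
   ('a \<Rightarrow> 'b::{real_normed_field, euclidean_space}) set \<Rightarrow> ('a \<Rightarrow> 'b) set \<Rightarrow>
   (('a \<Rightarrow> 'b) \<Rightarrow> ('a \<Rightarrow> 'b)) \<Rightarrow> bool" where
  "continuous_extension_operator k p \<Lambda> X Y T \<longleftrightarrow>
     (\<forall>u\<in>X. T u \<in> Y) \<and>
     (\<forall>u\<in>X. \<forall>v\<in>X. (AE x in lebesgue_on \<Lambda>. u x = v x) \<longrightarrow> (AE x in lebesgue. T u x = T v x)) \<and>
     (\<forall>u\<in>X. \<forall>v\<in>X. \<forall>a b. AE x in lebesgue.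
        T (\<lambda>y. a * u y + b * v y) x = a * T u x + b * T v x) \<and>
     (\<forall>u\<in>X. AE x in lebesgue_on \<Lambda>. T u x = u x) \<and>
     (\<forall>u\<in>X. \<forall>\<epsilon>>0. \<exists>\<delta>>0. \<forall>v\<in>X. sobolev_norm k p \<Lambda> (\<lambda>x. v x - u x) < \<delta> \<longrightarrow>
        sobolev_norm k p UNIV (\<lambda>x. T v x - T u x) < \<epsilon>)"

text \<open>The argument of type \<open>'b itself\<close> only fixes the scalar field.\<close>

definition sobolev_extension_domain ::
  "'b::{real_normed_field, euclidean_space} itself \<Rightarrow> nat \<Rightarrow> real \<Rightarrow> 'a::euclidean_space set \<Rightarrow> bool"
  where
  "sobolev_extension_domain F k p \<Lambda> \<longleftrightarrow> is_domain \<Lambda> \<and>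
     (\<exists>T :: ('a \<Rightarrow> 'b) \<Rightarrow> ('a \<Rightarrow> 'b).
        continuous_extension_operator k p \<Lambda> (sobolev k p \<Lambda>) (sobolev k p UNIV) T)"

end

theory Submission
  imports Defs
begin

text \<open>
  A smooth partition of unity reduces the claim to extending \<open>\<zeta> u\<close> in two cases. If \<open>\<zeta>\<close> vanishes near
  the closure of \<open>\<partial>\<Lambda> - E\<close>, then \<open>\<zeta> u\<close> is a limit of test functions in \<open>\<Lambda>\<close> and is extended by zero.
  If \<open>\<zeta>\<close> is supported in \<open>U\<close> and \<open>\<Omega> = \<Lambda> \<inter> U\<close> is an extension domain with operator \<open>T\<close>, then \<open>\<zeta> T u\<close>
  is the extension, and the point is that it belongs to the space of functions vanishing on \<open>E\<close>.

  For this it suffices to treat \<open>u\<close> vanishing near \<open>E\<close>. Extension domains satisfy the measure density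
  condition \<open>|\<Omega> \<inter> B(x, R)| \<ge> c R\<^sup>d\<close> for \<open>x\<close> in the closure of \<open>\<Omega>\<close> and small \<open>R\<close>: translation estimates
  applied to the extension of a cutoff times \<open>((z - x\<^sub>0) \<bullet> b)\<^sup>k\<^sup>-\<^sup>1 / (k - 1)!\<close>, iterated over shrinking
  radii, bound the measure from below. Hence near \<open>E\<close> the extended function and its derivatives of
  order below \<open>k\<close> vanish on a set of positive density, and averaging over this set gives a
  Hardy type inequality. It makes the cost of cutting off the function near \<open>E\<close> arbitrarily small.
\<close>

subsection \<open>Calculus of iterated partial derivatives\<close>

text \<open>The obstacle: \<open>T\<close> knows nothing about \<open>E\<close>. Outside \<Lambda>
  the extension is uncontrolled, so even for u vanishing near \<open>E\<close> the function \<zeta>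
  T u need not vanish near \<open>E\<close>; it is only known to vanish on the part of \<Lambda>
  close to \<open>E\<close>. Once that part is fat at every small scale \<rho>, averaging j times
  gains \<rho>^j for derivatives of order k - j, which exactly balances the \<rho>^(-j) lost by j
  derivatives of a cutoff. Smallness remains because the energy sits on neighbourhoods shrinking to
  a set that is null by the same fatness. The density bound must hold for all p and d. A plain
  cutoff at scale R would have k-th derivatives of size R^(-k); the monomial of degree k - 1 brings
  this to R^(-1) while its own derivative of order k - 1 is 1, so a first order estimate suffices.
  Translations by t h are counted in two ways, as a shift of x or as a scaling of h. Splitting at
  the balancing value of t gives the exponents d and d + 1, and the gap between them beats the
  geometric growth of the constants in the iteration over radii.\<close>

lemma pderiv_dir_eq:
  "(f has_derivative f') (at x) \<Longrightarrow> pderiv_dir b f x = f' b"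
  unfolding pderiv_dir_def using frechet_derivative_at by metis

lemma pderiv_dir_bounded_bilinear:
  assumes "bounded_bilinear pr" "f differentiable (at x)" "g differentiable (at x)"
  shows "pderiv_dir b (\<lambda>x. pr (f x) (g x)) x = pr (f x) (pderiv_dir b g x) + pr (pderiv_dir b f x) (g x)"
  unfolding pderiv_dir_def[of b f] pderiv_dir_def[of b g]
  by (rule pderiv_dir_eq[OF bounded_bilinear.FDERIV[OF assms(1)]])
    (use assms(2,3) frechet_derivative_works in blast)+

lemma differentiable_bounded_bilinear:
  assumes "bounded_bilinear pr" "f differentiable (at x)" "g differentiable (at x)"
  shows "(\<lambda>x. pr (f x) (g x)) differentiable (at x)"
  using bounded_bilinear.FDERIV[OF assms(1)] assms(2,3) unfolding differentiable_def by blast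

lemma pderiv_dir_add:
  assumes "f differentiable (at x)" "g differentiable (at x)"
  shows "pderiv_dir b (\<lambda>x. f x + g x) x = pderiv_dir b f x + pderiv_dir b g x"
  unfolding pderiv_dir_def[of b f] pderiv_dir_def[of b g]
  by (rule pderiv_dir_eq) (use assms has_derivative_add frechet_derivative_works in blast)

lemma pderiv_dir_const: "pderiv_dir b (\<lambda>x. c) = (\<lambda>x. 0)"
  by (auto simp: pderiv_dir_def)

lemma pderiv_dir_inner: "pderiv_dir b (\<lambda>x. (x - z) \<bullet> c) = (\<lambda>x. b \<bullet> c)"
proof
  fix x show "pderiv_dir b (\<lambda>x. (x - z) \<bullet> c) x = b \<bullet> c"
    by (rule pderiv_dir_eq) (auto intro!: derivative_eq_intros)
qed

lemma pderiv_dir_affine: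
  fixes f :: "'a::euclidean_space \<Rightarrow> 'b::real_normed_vector"
  assumes "f differentiable (at (c *\<^sub>R x + a))"
  shows "pderiv_dir b (\<lambda>x. f (c *\<^sub>R x + a)) x = c *\<^sub>R pderiv_dir b f (c *\<^sub>R x + a)"
    "(\<lambda>x. f (c *\<^sub>R x + a)) differentiable (at x)"
proof -
  let ?D = "frechet_derivative f (at (c *\<^sub>R x + a))"
  have D: "(f has_derivative ?D) (at (c *\<^sub>R x + a))"
    using assms frechet_derivative_works by blast
  have 1: "((\<lambda>x. f (c *\<^sub>R x + a)) has_derivative (\<lambda>h. ?D (c *\<^sub>R h))) (at x)"
    by (rule has_derivative_compose[where g=f and f="\<lambda>x. c *\<^sub>R x + a" and g'="?D", OF _ D])
       (auto intro!: derivative_eq_intros)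
  then show "(\<lambda>x. f (c *\<^sub>R x + a)) differentiable (at x)" unfolding differentiable_def by blast
  have "?D (c *\<^sub>R b) = c *\<^sub>R ?D b"
    using D has_derivative_bounded_linear bounded_linear.linear linear_cmul by blast
  then show "pderiv_dir b (\<lambda>x. f (c *\<^sub>R x + a)) x = c *\<^sub>R pderiv_dir b f (c *\<^sub>R x + a)"
    using pderiv_dir_eq[OF 1] by (simp add: pderiv_dir_def)
qed

text \<open>\<open>C_k (Suc n)\<close> asks for differentiability of \<open>f\<close>, not for its
  continuity; the base case recovers continuity, and the product rules rely on stepping down by one
  order.\<close>

lemma C_k_Suc_D: "C_k (Suc n) f \<Longrightarrow> C_k n f"
proof (induction n arbitrary: f)
  case 0
  then show ?case by (auto simp: continuous_on_eq_continuous_at differentiable_imp_continuous_within)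
next
  case (Suc n)
  then show ?case by auto
qed

lemma C_k_continuous: "C_k n f \<Longrightarrow> continuous_on UNIV f"
  by (induction n) (use C_k_Suc_D C_k.simps(1) in blast)+

lemma C_k_add: "C_k n f \<Longrightarrow> C_k n g \<Longrightarrow> C_k n (\<lambda>x. f x + g x)"
proof (induction n arbitrary: f g)
  case 0 then show ?case by (auto intro: continuous_on_add)
next
  case (Suc n)
  have "pderiv_dir b (\<lambda>x. f x + g x) = (\<lambda>x. pderiv_dir b f x + pderiv_dir b g x)" for b
    using Suc.prems by (auto simp: pderiv_dir_add)
  then show ?case using Suc by auto
qed

text \<open>For an arbitrary bounded bilinear \<open>pr\<close>, so that scalar multiplication and
  products share one induction. The product rule leaves one factor undifferentiated in each term,
  hence the appeal to \<open>C_k_Suc_D\<close>.\<close>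

lemma C_k_bounded_bilinear:
  assumes "bounded_bilinear pr"
  shows "C_k n f \<Longrightarrow> C_k n g \<Longrightarrow> C_k n (\<lambda>x. pr (f x) (g x))"
proof (induction n arbitrary: f g)
  case 0 then show ?case by (auto intro: bounded_bilinear.continuous_on[OF assms])
next
  case (Suc n)
  have "pderiv_dir b (\<lambda>x. pr (f x) (g x))
      = (\<lambda>x. pr (f x) (pderiv_dir b g x) + pr (pderiv_dir b f x) (g x))" for b
    using Suc.prems by (auto simp: pderiv_dir_bounded_bilinear[OF assms])
  moreover have "C_k n f" "C_k n g" using Suc.prems C_k_Suc_D by blast+
  ultimately show ?case
    using Suc.prems by (auto intro!: C_k_add Suc.IH differentiable_bounded_bilinear[OF assms])
qed

lemma C_k_const: "C_k n (\<lambda>x. c)"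
  by (induction n arbitrary: c) (auto simp: pderiv_dir_const)

lemma C_k_affine:
  fixes f :: "'a::euclidean_space \<Rightarrow> 'b::real_normed_vector"
  shows "C_k n f \<Longrightarrow> C_k n (\<lambda>x. f (c *\<^sub>R x + a))"
proof (induction n arbitrary: f)
  case 0 then show ?case
    by simp (rule continuous_on_compose2[of UNIV f], auto intro!: continuous_intros)
next
  case (Suc n)
  have "pderiv_dir b (\<lambda>x. f (c *\<^sub>R x + a)) = (\<lambda>x. c *\<^sub>R pderiv_dir b f (c *\<^sub>R x + a))" for b
    using Suc.prems by (auto simp: pderiv_dir_affine)
  with Suc show ?case
    by (auto intro!: pderiv_dir_affine C_k_bounded_bilinear[OF bounded_bilinear_scaleR] C_k_const)
qed

lemma C_infinity_differentiable: "C_infinity f \<Longrightarrow> f differentiable (at x)"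
  unfolding C_infinity_def by (metis C_k.simps(2))

lemma C_infinity_pderiv_dir: "C_infinity f \<Longrightarrow> b \<in> Basis \<Longrightarrow> C_infinity (pderiv_dir b f)"
  unfolding C_infinity_def by (metis C_k.simps(2))

lemma C_infinity_iter_pderiv: "C_infinity f \<Longrightarrow> set bs \<subseteq> Basis \<Longrightarrow> C_infinity (iter_pderiv bs f)"
  by (induction bs) (auto intro: C_infinity_pderiv_dir)

lemma C_infinity_continuous: "C_infinity f \<Longrightarrow> continuous_on UNIV f"
  unfolding C_infinity_def using C_k_continuous by blast

lemma C_infinity_borel [measurable_dest]:
  "C_infinity f \<Longrightarrow> f \<in> borel_measurable borel"
  by (intro borel_measurable_continuous_onI C_infinity_continuous)

lemma C_infinity_add: "C_infinity f \<Longrightarrow> C_infinity g \<Longrightarrow> C_infinity (\<lambda>x. f x + g x)"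
  by (simp add: C_infinity_def C_k_add)

lemma C_infinity_const: "C_infinity (\<lambda>x. c)"
  by (simp add: C_infinity_def C_k_const)

lemma C_infinity_bilinear:
  "bounded_bilinear pr \<Longrightarrow> C_infinity f \<Longrightarrow> C_infinity g \<Longrightarrow> C_infinity (\<lambda>x. pr (f x) (g x))"
  by (simp add: C_infinity_def C_k_bounded_bilinear)

lemmas C_infinity_scaleR = C_infinity_bilinear[OF bounded_bilinear_scaleR]
lemmas C_infinity_mult = C_infinity_bilinear[OF bounded_bilinear_mult]

lemma C_infinity_uminus: "C_infinity f \<Longrightarrow> C_infinity (\<lambda>x. - f x)"
  using C_infinity_scaleR[OF C_infinity_const, of f "-1"] by simp

lemma C_infinity_diff: "C_infinity f \<Longrightarrow> C_infinity g \<Longrightarrow> C_infinity (\<lambda>x. f x - g x)"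
  using C_infinity_add[OF _ C_infinity_uminus, of f g] by simp

lemma C_infinity_sum: "(\<And>i. i \<in> I \<Longrightarrow> C_infinity (f i)) \<Longrightarrow> C_infinity (\<lambda>x. \<Sum>i\<in>I. f i x)"
  by (induction I rule: infinite_finite_induct) (auto simp: C_infinity_const intro!: C_infinity_add)

lemma C_infinity_power:
  fixes f :: "'a::euclidean_space \<Rightarrow> 'b::real_normed_field"
  shows "C_infinity f \<Longrightarrow> C_infinity (\<lambda>x. f x ^ n)"
  by (induction n) (auto simp: C_infinity_const intro!: C_infinity_mult)

lemma C_infinity_inner: "C_infinity (\<lambda>x. (x - z) \<bullet> c)"
proof -
  have "C_k n (\<lambda>x. (x - z) \<bullet> c)" for n
    by (cases n) (auto simp: pderiv_dir_inner C_k_const intro!: continuous_intros)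
  then show ?thesis by (simp add: C_infinity_def)
qed

lemma C_infinity_affine:
  fixes f :: "'a::euclidean_space \<Rightarrow> 'b::real_normed_vector"
  shows "C_infinity f \<Longrightarrow> C_infinity (\<lambda>x. f (c *\<^sub>R x + a))"
  by (simp add: C_infinity_def C_k_affine)

lemma iter_pderiv_append: "iter_pderiv (bs @ cs) f = iter_pderiv bs (iter_pderiv cs f)"
  by (induction bs) auto

lemma iter_pderiv_zero: "iter_pderiv bs (\<lambda>x. 0) = (\<lambda>x. 0)"
  by (induction bs) (auto simp: pderiv_dir_const)

lemma iter_pderiv_add:
  assumes "C_infinity f" "C_infinity g" "set bs \<subseteq> Basis"
  shows "iter_pderiv bs (\<lambda>x. f x + g x) = (\<lambda>x. iter_pderiv bs f x + iter_pderiv bs g x)"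
  using assms(3)
proof (induction bs)
  case (Cons b bs)
  then show ?case
    by (auto intro!: pderiv_dir_add ext C_infinity_differentiable C_infinity_iter_pderiv assms)
qed auto

text \<open>Serves two substitutions: \<open>c = 1 / \<delta>\<close> rescales the standard
  mollifier, and \<open>c = -1\<close> reflects a kernel so that a convolution becomes a pairing
  with a test function.\<close>

lemma iter_pderiv_affine:
  fixes f :: "'a::euclidean_space \<Rightarrow> 'b::real_normed_vector"
  assumes "C_infinity f" "set bs \<subseteq> Basis"
  shows "iter_pderiv bs (\<lambda>x. f (c *\<^sub>R x + a)) = (\<lambda>x. c ^ length bs *\<^sub>R iter_pderiv bs f (c *\<^sub>R x + a))"
  using assms(2)
proof (induction bs)
  case (Cons b bs)
  then have d: "iter_pderiv bs f differentiable (at x)" for x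
    by (auto intro!: C_infinity_differentiable C_infinity_iter_pderiv assms)
  show ?case
  proof
    fix x
    have "iter_pderiv (b # bs) (\<lambda>x. f (c *\<^sub>R x + a)) x
       = pderiv_dir b (\<lambda>x. c ^ length bs *\<^sub>R iter_pderiv bs f (c *\<^sub>R x + a)) x"
      using Cons by simp
    also have "\<dots> = c ^ length bs *\<^sub>R pderiv_dir b (\<lambda>x. iter_pderiv bs f (c *\<^sub>R x + a)) x"
      by (subst pderiv_dir_bounded_bilinear[OF bounded_bilinear_scaleR])
         (auto simp: pderiv_dir_const d intro!: pderiv_dir_affine)
    also have "\<dots> = c ^ length (b # bs) *\<^sub>R iter_pderiv (b # bs) f (c *\<^sub>R x + a)"
      by (simp add: pderiv_dir_affine d)
    finally show "iter_pderiv (b # bs) (\<lambda>x. f (c *\<^sub>R x + a)) x = \<dots>" .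
  qed
qed auto

section \<open>Supports and test functions\<close>

lemma pderiv_dir_eq_0_open:
  assumes "open S" "x \<in> S" "\<And>y. y \<in> S \<Longrightarrow> f y = 0"
  shows "pderiv_dir b f x = 0"
proof -
  have "(f has_derivative (\<lambda>h. 0)) (at x)"
    using has_derivative_transform_within_open[OF has_derivative_const[of 0] assms(1,2)] assms(3) by metis
  then show ?thesis by (rule pderiv_dir_eq)
qed

lemma iter_pderiv_eq_0_open:
  assumes "open S" "\<And>y. y \<in> S \<Longrightarrow> f y = 0"
  shows "x \<in> S \<Longrightarrow> iter_pderiv bs f x = 0"
proof (induction bs arbitrary: x)
  case (Cons b bs)
  then show ?case using pderiv_dir_eq_0_open[OF assms(1), of x "iter_pderiv bs f" b] by simp
qed (use assms in auto)

lemma iter_pderiv_notin_supp: "x \<notin> supp f \<Longrightarrow> iter_pderiv bs f x = 0"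
  by (rule iter_pderiv_eq_0_open[of "- supp f"])
     (auto simp: supp_def open_Compl intro: closure_subset[THEN subsetD])

lemma supp_notin: "x \<notin> supp f \<Longrightarrow> f x = 0"
  by (auto simp: supp_def intro: closure_subset[THEN subsetD])

lemma closed_supp [simp]: "closed (supp f)"
  by (simp add: supp_def)

lemma supp_subset: "closed K \<Longrightarrow> (\<And>x. x \<notin> K \<Longrightarrow> f x = 0) \<Longrightarrow> supp f \<subseteq> K"
  unfolding supp_def by (rule closure_minimal) auto

lemma C0_infinityI:
  assumes "C_infinity f" "compact K" "K \<subseteq> \<Omega>" "\<And>x. x \<notin> K \<Longrightarrow> f x = 0"
  shows "f \<in> C0_infinity \<Omega>"
proof -
  have "supp f \<subseteq> K" by (rule supp_subset) (use assms compact_imp_closed in auto)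
  then show ?thesis
    unfolding C0_infinity_def using assms(1-3) compact_Int_closed[OF assms(2), of "supp f"]
    by (auto simp: Int_absorb1)
qed

lemma C0_infinity_D:
  assumes "f \<in> C0_infinity \<Omega>"
  shows "C_infinity f" "compact (supp f)" "supp f \<subseteq> \<Omega>"
  using assms by (auto simp: C0_infinity_def)

lemma C0_infinity_mono: "f \<in> C0_infinity \<Omega> \<Longrightarrow> \<Omega> \<subseteq> \<Omega>' \<Longrightarrow> f \<in> C0_infinity \<Omega>'"
  by (auto simp: C0_infinity_def)

lemma C0_infinity_iter_pderiv:
  "f \<in> C0_infinity \<Omega> \<Longrightarrow> set bs \<subseteq> Basis \<Longrightarrow> iter_pderiv bs f \<in> C0_infinity \<Omega>"
  by (rule C0_infinityI[of _ "supp f"])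
     (auto dest: C0_infinity_D simp: iter_pderiv_notin_supp C_infinity_iter_pderiv)

lemma C0_infinity_bilinear:
  assumes "bounded_bilinear pr" "C_infinity f" "g \<in> C0_infinity \<Omega>"
  shows "(\<lambda>x. pr (f x) (g x)) \<in> C0_infinity \<Omega>"
proof (rule C0_infinityI[of _ "supp g"])
  show "C_infinity (\<lambda>x. pr (f x) (g x))"
    by (rule C_infinity_bilinear[OF assms(1,2) C0_infinity_D(1)[OF assms(3)]])
qed (use C0_infinity_D[OF assms(3)] in \<open>auto simp: supp_notin bounded_bilinear.zero_right[OF assms(1)]\<close>)

lemmas C0_infinity_mult = C0_infinity_bilinear[OF bounded_bilinear_mult]

lemma C0_infinity_scaleR_left:
  assumes "f \<in> C0_infinity \<Omega>" "C_infinity g"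
  shows "(\<lambda>x. f x *\<^sub>R g x) \<in> C0_infinity \<Omega>"
proof (rule C0_infinityI[of _ "supp f"])
  show "C_infinity (\<lambda>x. f x *\<^sub>R g x)"
    by (rule C_infinity_scaleR[OF C0_infinity_D(1)[OF assms(1)] assms(2)])
qed (use C0_infinity_D[OF assms(1)] in \<open>auto simp: supp_notin\<close>)

lemma C0_infinity_bounded:
  assumes "f \<in> C0_infinity \<Omega>"
  obtains B where "B > 0" "\<And>x. norm (f x) \<le> B"
proof -
  have "compact (f ` supp f)"
    using C0_infinity_D[OF assms] by (intro compact_continuous_image)
      (auto intro: continuous_on_subset[OF C_infinity_continuous])
  then obtain B where B: "B > 0" "\<And>y. y \<in> f ` supp f \<Longrightarrow> norm y \<le> B"
    using compact_imp_bounded bounded_pos by metis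
  have "norm (f x) \<le> B" for x
    by (cases "x \<in> supp f") (use B in \<open>auto simp: supp_notin\<close>)
  then show ?thesis using that B by blast
qed

subsection \<open>A smooth bump function\<close>

text \<open>The factor \<open>1 / t ^ n\<close> makes the family closed under differentiation: the
  derivative of member n is a combination of members n + 1 and n + 2. The smooth function wanted is
  member 0.\<close>

definition flat_exp :: "nat \<Rightarrow> real \<Rightarrow> real" where
  "flat_exp n t = (if t > 0 then exp (- (1 / t)) / t ^ n else 0)"

text \<open>On the right, the substitution x = 1 / t turns the claim into
  \<open>x ^ n / exp x\<close> tending to 0; on the left the function is 0.\<close>

lemma flat_exp_tendsto: "(flat_exp n \<longlongrightarrow> 0) (at 0)"
proof -
  have "((\<lambda>x::real. x ^ n / exp x) \<longlongrightarrow> 0) at_top" by (rule tendsto_power_div_exp_0)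
  then have "((\<lambda>t::real. inverse t ^ n / exp (inverse t)) \<longlongrightarrow> 0) (at_right 0)"
    by (rule filterlim_compose[OF _ filterlim_inverse_at_top_right])
  moreover have "eventually (\<lambda>t. inverse t ^ n / exp (inverse t) = flat_exp n t) (at_right 0)"
    unfolding eventually_at_filter
    by (rule always_eventually) (auto simp: flat_exp_def exp_minus divide_simps power_inverse)
  ultimately have r: "(flat_exp n \<longlongrightarrow> 0) (at_right 0)"
    by (rule Lim_transform_eventually)
  have "eventually (\<lambda>t. flat_exp n t = 0) (at_left (0::real))"
    unfolding eventually_at_filter by (rule always_eventually) (auto simp: flat_exp_def)
  then have "(flat_exp n \<longlongrightarrow> 0) (at_left 0)" by (rule tendsto_eventually)
  with r show ?thesis by (simp add: filterlim_split_at)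
qed

lemma flat_exp_deriv:
  "(flat_exp n has_real_derivative flat_exp (n + 2) t - real n * flat_exp (n + 1) t) (at t)"
proof -
  consider "t > 0" | "t < 0" | "t = 0" by linarith
  then show ?thesis
  proof cases
    case 1
    have "((\<lambda>t. exp (- (1 / t)) / t ^ n) has_real_derivative
        flat_exp (n + 2) t - real n * flat_exp (n + 1) t) (at t)"
    proof (cases n)
      case 0
      with 1 show ?thesis
        by (auto intro!: derivative_eq_intros simp: flat_exp_def power2_eq_square field_simps)
    next
      case (Suc m)
      have "m = 0 \<or> t ^ m = t * t ^ (m - Suc 0)" by (cases m) auto
      with 1 Suc show ?thesis
        by (auto intro!: derivative_eq_intros simp: flat_exp_def power2_eq_square field_simps)
    qed
    then show ?thesis
      by (rule has_field_derivative_transform_within_open[of _ _ _ "{0<..}"])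
         (use 1 in \<open>auto simp: flat_exp_def\<close>)
  next
    case 2
    then have "flat_exp (n + 2) t - real n * flat_exp (n + 1) t = 0" by (simp add: flat_exp_def)
    then show ?thesis
      using has_field_derivative_transform_within_open[of "\<lambda>_. 0" 0 t "{..<0}" "flat_exp n"] 2
      by (auto simp: flat_exp_def)
  next
    case 3
    \<comment> \<open>The difference quotient of member n at 0 is member n + 1, whose limit is
      known.\<close>
    have "((\<lambda>h. (flat_exp n (0 + h) - flat_exp n 0) / h) \<longlongrightarrow> 0) (at 0)"
      using flat_exp_tendsto[of "Suc n"]
      by (rule Lim_transform_eventually)
         (auto simp: flat_exp_def eventually_at_filter field_simps intro!: always_eventually)
    with 3 show ?thesis unfolding DERIV_def by (simp add: flat_exp_def)
  qed
qed

text \<open>The induction on the order keeps \<open>n\<close> arbitrary, since each derivative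
  raises it by one or two.\<close>

lemma C_infinity_flat_exp_comp:
  fixes q :: "'a::euclidean_space \<Rightarrow> real"
  assumes "C_infinity q"
  shows "C_infinity (\<lambda>x. flat_exp n (q x))"
proof -
  have d: "((\<lambda>x. flat_exp n (q x)) has_derivative (\<lambda>h. (flat_exp (n + 2) (q x) - real n * flat_exp (n + 1) (q x)) * frechet_derivative q (at x) h)) (at x)" for n x
  proof -
    have "(q has_derivative frechet_derivative q (at x)) (at x)"
      using C_infinity_differentiable[OF assms] frechet_derivative_works by blast
    from has_derivative_compose[OF this flat_exp_deriv[unfolded has_field_derivative_def]]
    show ?thesis .
  qed
  have p: "pderiv_dir b (\<lambda>x. flat_exp n (q x))
     = (\<lambda>x. (flat_exp (n + 2) (q x) + (- real n) * flat_exp (n + 1) (q x)) * pderiv_dir b q x)" for b n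
    by (rule ext) (use pderiv_dir_eq[OF d] in \<open>simp add: pderiv_dir_def\<close>)
  have "C_k m (\<lambda>x. flat_exp n (q x))" for m n
  proof (induction m arbitrary: n)
    case 0
    have "(\<lambda>x. flat_exp n (q x)) differentiable (at x)" for x using d unfolding differentiable_def by blast
    then show ?case
      by (auto simp: continuous_on_eq_continuous_at differentiable_imp_continuous_within)
  next
    case (Suc m)
    have "(\<lambda>x. flat_exp n (q x)) differentiable (at x)" for x using d unfolding differentiable_def by blast
    moreover have "C_k m (pderiv_dir b q)" if "b \<in> Basis" for b
      using C_infinity_pderiv_dir[OF assms that] by (simp add: C_infinity_def)
    ultimately show ?case unfolding C_k.simps p
      by (intro conjI ballI allI C_k_bounded_bilinear[OF bounded_bilinear_mult] C_k_add Suc.IH C_k_const) auto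
  qed
  then show ?thesis by (simp add: C_infinity_def)
qed

lemma mollifier_exists:
  obtains \<phi> :: "'a::euclidean_space \<Rightarrow> real"
  where "\<phi> \<in> C0_infinity UNIV" "\<And>x. \<phi> x \<ge> 0" "\<And>x. norm x \<ge> 1 \<Longrightarrow> \<phi> x = 0"
    "integral\<^sup>N lborel (\<lambda>x. ennreal (\<phi> x)) = 1"
proof -
  \<comment> \<open>Written through coordinates because their smoothness is known. The value is 1
    minus the squared norm, so \<psi> is positive exactly on the open unit ball.\<close>
  define q :: "'a \<Rightarrow> real" where "q x = 1 - (\<Sum>b\<in>Basis. ((x - 0) \<bullet> b) ^ 2)" for x
  define \<psi> where "\<psi> x = flat_exp 0 (q x)" for x
  have q: "q x = 1 - (norm x)\<^sup>2" for x
    using euclidean_inner[of x x] power2_norm_eq_inner[of x] by (simp add: q_def power2_eq_square)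
  have smooth: "C_infinity \<psi>" unfolding \<psi>_def[abs_def] q_def
    by (rule C_infinity_flat_exp_comp, rule C_infinity_diff, rule C_infinity_const,
        rule C_infinity_sum, rule C_infinity_power, rule C_infinity_inner)
  have pos: "\<psi> x > 0" if "norm x < 1" for x
    using that power_less_one_iff[of "norm x" 2] by (auto simp: \<psi>_def q flat_exp_def)
  have nn: "\<psi> x \<ge> 0" for x by (auto simp: \<psi>_def flat_exp_def)
  have zero: "\<psi> x = 0" if "norm x \<ge> 1" for x
  proof -
    have "1 \<le> (norm x)\<^sup>2" using that by simp
    then show ?thesis by (auto simp: \<psi>_def q flat_exp_def)
  qed
  have C0: "\<psi> \<in> C0_infinity UNIV"
    by (rule C0_infinityI[of _ "cball 0 1"]) (use smooth zero in auto)
  obtain B where B: "B > 0" "\<And>x. norm (\<psi> x) \<le> B" using C0_infinity_bounded[OF C0] by metis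
  have [measurable]: "\<psi> \<in> borel_measurable borel" using smooth by (rule C_infinity_borel)
  define I where "I = integral\<^sup>N lborel (\<lambda>x. ennreal (\<psi> x))"
  have "I \<le> (\<integral>\<^sup>+x. ennreal B * indicator (cball (0::'a) 1) x \<partial>lborel)"
    unfolding I_def
  proof (intro nn_integral_mono)
    fix x show "ennreal (\<psi> x) \<le> ennreal B * indicator (cball 0 1) x"
      using B(2)[of x] zero[of x] nn[of x] by (auto simp: indicator_def intro!: ennreal_leI)
  qed
  also have "\<dots> < \<infinity>"
    using emeasure_lborel_cball_finite[of "0::'a" 1]
    by (auto simp: nn_integral_cmult_indicator ennreal_mult_less_top)
  finally have fin: "I < \<infinity>" .
  have "I \<noteq> 0"
  proof
    assume "I = 0"
    then have "AE x in lborel. ennreal (\<psi> x) = 0"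
      unfolding I_def by (subst (asm) nn_integral_0_iff_AE) auto
    then have "AE x in lborel. x \<notin> ball (0::'a) 1"
    proof eventually_elim
      case (elim x)
      then show ?case using pos[of x] by (auto simp: ennreal_eq_0_iff)
    qed
    then have "emeasure lborel (ball 0 1 :: 'a set) = 0"
      by (subst (asm) AE_iff_measurable[where N="ball (0::'a) 1"]) auto
    moreover have "measure lborel (ball (0::'a) 1) > 0"
      using content_ball_pos[of 1 "0::'a"] by simp
    ultimately show False by (simp add: measure_def)
  qed
  define J where "J = enn2real I"
  have J: "J > 0" "I = ennreal J" unfolding J_def using fin \<open>I \<noteq> 0\<close>
    by (auto simp: enn2real_positive_iff zero_less_iff_neq_zero)
  show ?thesis
  proof (rule that[of "\<lambda>x. (1 / J) * \<psi> x"])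
    show "(\<lambda>x. (1 / J) * \<psi> x) \<in> C0_infinity UNIV"
      by (rule C0_infinity_mult[OF C_infinity_const C0])
    have "integral\<^sup>N lborel (\<lambda>x. ennreal (1 / J * \<psi> x)) = ennreal (1 / J) * I"
      unfolding I_def using J(1) nn
      by (subst nn_integral_cmult[symmetric]) (auto simp: ennreal_mult[symmetric] intro!: nn_integral_cong)
    also have "\<dots> = 1" using J by (simp add: ennreal_mult[symmetric])
    finally show "integral\<^sup>N lborel (\<lambda>x. ennreal (1 / J * \<psi> x)) = 1" .
  qed (use J nn zero in auto)
qed

subsection \<open>Integrals over Euclidean space\<close>

lemma borel_balls [measurable]:
  "cball (x :: 'a::euclidean_space) r \<in> sets borel" "ball x r \<in> sets borel"
  by auto

lemma nn_integral_lborel_affine: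
  fixes f :: "'a::euclidean_space \<Rightarrow> ennreal"
  assumes [measurable]: "f \<in> borel_measurable borel" and c: "c \<noteq> 0"
  shows "(\<integral>\<^sup>+x. f x \<partial>lborel) = ennreal (\<bar>c\<bar> ^ DIM('a)) * (\<integral>\<^sup>+x. f (t + c *\<^sub>R x) \<partial>lborel)"
  by (subst lborel_affine[OF c, of t]) (simp add: nn_integral_density nn_integral_distr nn_integral_cmult)

lemma nn_integral_lborel_reflect:
  fixes f :: "'a::euclidean_space \<Rightarrow> ennreal"
  assumes "f \<in> borel_measurable borel"
  shows "(\<integral>\<^sup>+y. f (x - y) \<partial>lborel) = (\<integral>\<^sup>+y. f y \<partial>lborel)"
  using nn_integral_lborel_affine[OF assms, of "-1" x] by simp

lemma nn_integral_lborel_shift: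
  fixes f :: "'a::euclidean_space \<Rightarrow> ennreal"
  assumes "f \<in> borel_measurable borel"
  shows "(\<integral>\<^sup>+y. f (y + x) \<partial>lborel) = (\<integral>\<^sup>+y. f y \<partial>lborel)"
  using nn_integral_lborel_affine[OF assms, of 1 x] by (simp add: add.commute)

text \<open>The graph of the convex function \<open>t powr p\<close> lies above its tangent at
  \<open>s\<close>. Both sides are arranged without subtraction so that the inequality can be
  integrated in \<open>ennreal\<close>; the boundary cases are separate because convexity is used on
  the open half line.\<close>

lemma powr_tangent:
  assumes "p \<ge> 1" "s \<ge> 0" "t \<ge> (0::real)"
  shows "s powr p + p * s powr (p - 1) * t \<le> t powr p + p * s powr (p - 1) * s"
proof (cases "s = 0 \<or> t = 0")
  case True
  have "s powr p = s powr (p - 1) * s" if "s \<noteq> 0"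
    using powr_mult_base[of s "p - 1"] assms that by (simp add: mult.commute)
  moreover have "s powr p \<le> p * s powr p" using assms by (simp add: mult_le_cancel_right1)
  ultimately show ?thesis using True assms
    by (cases "s = 0") (auto simp: algebra_simps)
next
  case False
  then have st: "s > 0" "t > 0" using assms by auto
  have eq: "s powr p = s powr (p - 1) * s"
    using powr_mult_base[of s "p - 1"] st by (simp add: mult.commute)
  have "1 + p * (t / s - 1) \<le> (t / s) powr p"
  proof -
    have "convex_on {0<..} (\<lambda>x. x powr p)"
      using assms by (intro powr_convex)
    then have "(t / s) powr p - 1 powr p \<ge> p * 1 powr (p - 1) * (t / s - 1)"
      using st by (intro convex_on_imp_above_tangent[of "{0<..}"])
        (auto simp: interior_open intro!: derivative_eq_intros convex_connected)
    then show ?thesis by simp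
  qed
  then have "s powr p * (1 + p * (t / s - 1)) \<le> s powr p * (t / s) powr p"
    by (intro mult_left_mono) auto
  also have "s powr p * (t / s) powr p = t powr p"
    using st by (simp add: powr_divide)
  finally have "s powr p * (1 + p * (t / s - 1)) \<le> t powr p" .
  moreover have "s powr p * (1 + p * (t / s - 1))
      = s powr p + p * s powr (p - 1) * t - p * s powr (p - 1) * s"
    using st unfolding eq by (simp add: field_simps)
  ultimately show ?thesis by linarith
qed

text \<open>Integrate the tangent inequality at \<open>s\<close>. Taking \<open>s\<close> to be any
  real lower bound of the mean, instead of the mean itself, covers an infinite mean too.\<close>

lemma nn_integral_Jensen_powr:
  fixes f w :: "'c \<Rightarrow> real"
  assumes [measurable]: "f \<in> borel_measurable M" "w \<in> borel_measurable M"
    and nn: "\<And>x. f x \<ge> 0" "\<And>x. w x \<ge> 0" and w: "(\<integral>\<^sup>+x. ennreal (w x) \<partial>M) = 1"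
    and s: "s \<ge> 0" "ennreal s \<le> (\<integral>\<^sup>+x. ennreal (w x * f x) \<partial>M)" and p: "p \<ge> 1"
  shows "ennreal (s powr p) \<le> (\<integral>\<^sup>+x. ennreal (w x * f x powr p) \<partial>M)"
proof -
  define c where "c = p * s powr (p - 1)"
  have c: "c \<ge> 0" using p by (simp add: c_def)
  \<comment> \<open>The finite term c s is carried along on both sides and cancelled at the end,
    which avoids subtraction in \<open>ennreal\<close>.\<close>
  have "ennreal (s powr p) + ennreal (c * s) \<le>
      (\<integral>\<^sup>+x. ennreal (w x * s powr p) \<partial>M) + ennreal c * (\<integral>\<^sup>+x. ennreal (w x * f x) \<partial>M)"
  proof (rule add_mono)
    have "(\<integral>\<^sup>+x. ennreal (w x * s powr p) \<partial>M) = (\<integral>\<^sup>+x. ennreal (w x) * ennreal (s powr p) \<partial>M)"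
      by (simp add: ennreal_mult nn)
    also have "\<dots> = ennreal (s powr p)" using w by (subst nn_integral_multc) auto
    finally show "ennreal (s powr p) \<le> (\<integral>\<^sup>+x. ennreal (w x * s powr p) \<partial>M)" by simp
    show "ennreal (c * s) \<le> ennreal c * (\<integral>\<^sup>+x. ennreal (w x * f x) \<partial>M)"
      using s(2) by (simp add: ennreal_mult c s(1) mult_left_mono)
  qed
  also have "\<dots> = (\<integral>\<^sup>+x. ennreal (w x * s powr p) + ennreal c * ennreal (w x * f x) \<partial>M)"
    by (simp add: nn_integral_add nn_integral_cmult)
  also have "\<dots> \<le> (\<integral>\<^sup>+x. ennreal (w x * f x powr p) + ennreal (w x) * ennreal (c * s) \<partial>M)"
  proof (rule nn_integral_mono)
    fix x
    have "w x * (s powr p + c * f x) \<le> w x * (f x powr p + c * s)"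
      unfolding c_def using powr_tangent[OF p s(1) nn(1)[of x]] by (intro mult_left_mono nn) auto
    then show "ennreal (w x * s powr p) + ennreal c * ennreal (w x * f x)
        \<le> ennreal (w x * f x powr p) + ennreal (w x) * ennreal (c * s)"
      using nn[of x] c s(1)
      by (simp add: ennreal_mult[symmetric] ennreal_plus[symmetric] algebra_simps del: ennreal_plus)
  qed
  also have "\<dots> = (\<integral>\<^sup>+x. ennreal (w x * f x powr p) \<partial>M) + ennreal (c * s)"
    using w by (simp add: nn_integral_add nn_integral_multc)
  finally have "ennreal (c * s) + ennreal (s powr p)
      \<le> ennreal (c * s) + (\<integral>\<^sup>+x. ennreal (w x * f x powr p) \<partial>M)"
    by (simp add: add.commute)
  then show ?thesis by (simp add: ennreal_add_left_cancel_le)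
qed

text \<open>Stands in for the triangle inequality when p-th powers of norms are estimated without
  taking roots.\<close>

lemma powr_add_le:
  fixes x y :: "'b::real_normed_vector"
  assumes "p \<ge> 1"
  shows "norm (x + y) powr p \<le> 2 powr p * (norm x powr p + norm y powr p)"
proof -
  have "norm (x + y) \<le> 2 * max (norm x) (norm y)"
    using norm_triangle_ineq[of x y] by linarith
  then have "norm (x + y) powr p \<le> (2 * max (norm x) (norm y)) powr p"
    using assms by (intro powr_mono2) auto
  also have "\<dots> = 2 powr p * max (norm x) (norm y) powr p"
    by (simp add: powr_mult)
  also have "\<dots> \<le> 2 powr p * (norm x powr p + norm y powr p)"
    by (intro mult_left_mono) (auto simp: max_def)
  finally show ?thesis .
qed

lemma powr_sum_le:
  assumes "finite I" "\<And>i. i \<in> I \<Longrightarrow> a i \<ge> (0::real)" "p \<ge> 1"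
  shows "(\<Sum>i\<in>I. a i) powr p \<le> real (card I) powr p * (\<Sum>i\<in>I. a i powr p)"
proof (cases "I = {}")
  case False
  define m where "m = Max (a ` I)"
  have m: "a i \<le> m" if "i \<in> I" for i using that assms unfolding m_def by auto
  have "m \<in> a ` I" unfolding m_def using False assms(1) by (intro Max_in) auto
  then obtain j where j: "j \<in> I" "m = a j" by blast
  have "(\<Sum>i\<in>I. a i) \<le> real (card I) * m" using sum_bounded_above[of I a m] m by auto
  then have "(\<Sum>i\<in>I. a i) powr p \<le> (real (card I) * m) powr p"
    using assms by (intro powr_mono2 sum_nonneg) auto
  also have "\<dots> = real (card I) powr p * m powr p"
    using assms j by (simp add: powr_mult)
  also have "m powr p \<le> (\<Sum>i\<in>I. a i powr p)"
    unfolding j by (rule member_le_sum) (use assms j in auto)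
  finally show ?thesis by (simp add: mult_left_mono)
qed auto

subsection \<open>Convolution with smooth kernels\<close>

lemma frechet_derivative_eq_sum:
  fixes f :: "'a::euclidean_space \<Rightarrow> 'b::real_normed_vector"
  assumes "f differentiable (at x)"
  shows "frechet_derivative f (at x) h = (\<Sum>b\<in>Basis. (h \<bullet> b) *\<^sub>R pderiv_dir b f x)"
proof -
  have lin: "linear (frechet_derivative f (at x))" using assms by (rule linear_frechet_derivative)
  have "frechet_derivative f (at x) h = frechet_derivative f (at x) (\<Sum>b\<in>Basis. (h \<bullet> b) *\<^sub>R b)"
    by (simp add: euclidean_representation)
  also have "\<dots> = (\<Sum>b\<in>Basis. (h \<bullet> b) *\<^sub>R pderiv_dir b f x)"
    by (simp add: linear_sum[OF lin] linear_scale[OF lin] pderiv_dir_def)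
  finally show ?thesis .
qed

lemma C0_infinity_Lipschitz:
  fixes f :: "'a::euclidean_space \<Rightarrow> 'b::real_normed_vector"
  assumes "f \<in> C0_infinity \<Omega>"
  obtains L where "L \<ge> 0" "\<And>x y. norm (f x - f y) \<le> L * norm (x - y)"
proof -
  have "\<exists>B. \<forall>x. norm (pderiv_dir b f x) \<le> B" if "b \<in> Basis" for b
  proof -
    have "pderiv_dir b f \<in> C0_infinity \<Omega>" using C0_infinity_iter_pderiv[OF assms, of "[b]"] that by simp
    then show ?thesis by (metis C0_infinity_bounded)
  qed
  then obtain B where B: "\<And>b x. b \<in> Basis \<Longrightarrow> norm (pderiv_dir b f x) \<le> B b" by metis
  have d: "f differentiable (at x)" for x using C0_infinity_D[OF assms] C_infinity_differentiable by blast
  have on: "onorm (frechet_derivative f (at x)) \<le> sum B Basis" for x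
  proof (rule onorm_le)
    fix h
    have "norm (frechet_derivative f (at x) h) \<le> (\<Sum>b\<in>Basis. norm h * B b)"
      unfolding frechet_derivative_eq_sum[OF d]
      by (rule sum_norm_le) (auto intro!: mult_mono B Basis_le_norm)
    then show "norm (frechet_derivative f (at x) h) \<le> sum B Basis * norm h"
      by (simp add: sum_distrib_left mult.commute)
  qed
  have "norm (f x - f y) \<le> sum B Basis * norm (x - y)" for x y
    by (rule differentiable_bound[of UNIV f "\<lambda>x. frechet_derivative f (at x)"])
       (use d on frechet_derivative_works in auto)
  moreover have "sum B Basis \<ge> 0"
    using B norm_ge_zero order_trans by (intro sum_nonneg) blast
  ultimately show ?thesis using that by blast
qed

text \<open>First derivatives of a test function are Lipschitz, so the remainder is quadratic
  uniformly in the base point. This uniformity later replaces dominated convergence when integrals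
  are differentiated.\<close>

lemma C0_infinity_Taylor:
  fixes f :: "'a::euclidean_space \<Rightarrow> 'b::real_normed_vector"
  assumes "f \<in> C0_infinity \<Omega>"
  obtains M where "M \<ge> 0"
    "\<And>x h. norm (f (x + h) - f x - (\<Sum>b\<in>Basis. (h \<bullet> b) *\<^sub>R pderiv_dir b f x)) \<le> M * (norm h)\<^sup>2"
proof -
  have "\<exists>L\<ge>0. \<forall>x y. norm (pderiv_dir b f x - pderiv_dir b f y) \<le> L * norm (x - y)" if "b \<in> Basis" for b
  proof -
    have "pderiv_dir b f \<in> C0_infinity \<Omega>" using C0_infinity_iter_pderiv[OF assms, of "[b]"] that by simp
    then show ?thesis by (metis C0_infinity_Lipschitz)
  qed
  then obtain L where L: "\<And>b. b \<in> Basis \<Longrightarrow> L b \<ge> 0"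
    "\<And>b x y. b \<in> Basis \<Longrightarrow> norm (pderiv_dir b f x - pderiv_dir b f y) \<le> L b * norm (x - y)" by metis
  have d: "f differentiable (at x)" for x using C0_infinity_D[OF assms] C_infinity_differentiable by blast
  let ?D = "\<lambda>x. frechet_derivative f (at x)"
  have M: "sum L Basis \<ge> 0" by (rule sum_nonneg) (use L in auto)
  have "norm (f (x + h) - f x - ?D x h) \<le> sum L Basis * (norm h)\<^sup>2" for x h
  proof -
    have "norm (f (x + h) - f x - ?D x (x + h - x)) \<le> norm (x + h - x) * (sum L Basis * norm h)"
    proof (rule differentiable_bound_linearization[of x "x + h" "cball x (norm h)" f ?D x])
      fix t :: real assume "t \<in> {0..1}"
      then show "x + t *\<^sub>R (x + h - x) \<in> cball x (norm h)"
        by (auto simp: dist_norm mult_left_le_one_le)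
    next
      fix y assume "y \<in> cball x (norm h)"
      show "(f has_derivative ?D y) (at y within cball x (norm h))"
        using d frechet_derivative_works has_derivative_at_withinI by blast
    next
      fix y assume y: "y \<in> cball x (norm h)"
      show "onorm (?D y - ?D x) \<le> sum L Basis * norm h"
      proof (rule onorm_le)
        fix k
        have "norm ((?D y - ?D x) k) = norm (\<Sum>b\<in>Basis. (k \<bullet> b) *\<^sub>R (pderiv_dir b f y - pderiv_dir b f x))"
          by (simp add: frechet_derivative_eq_sum[OF d] sum_subtractf scaleR_diff_right)
        also have "\<dots> \<le> (\<Sum>b\<in>Basis. norm k * (L b * norm h))"
        proof (rule sum_norm_le)
          fix b :: 'a assume b: "b \<in> Basis"
          have "norm (pderiv_dir b f y - pderiv_dir b f x) \<le> L b * norm (y - x)" by (rule L(2)[OF b])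
          also have "\<dots> \<le> L b * norm h"
            using y L(1)[OF b] by (intro mult_left_mono) (auto simp: dist_norm norm_minus_commute)
          finally show "norm ((k \<bullet> b) *\<^sub>R (pderiv_dir b f y - pderiv_dir b f x)) \<le> norm k * (L b * norm h)"
            using b by (auto intro!: mult_mono Basis_le_norm)
        qed
        finally show "norm ((?D y - ?D x) k) \<le> sum L Basis * norm h * norm k"
          by (simp add: sum_distrib_left sum_distrib_right mult_ac)
      qed
    qed auto
    then show ?thesis by (simp add: power2_eq_square mult_ac)
  qed
  then show ?thesis using that[OF M] by (simp add: frechet_derivative_eq_sum[OF d])
qed

text \<open>The Borel counterpart of \<open>locally_integrable\<close> on the whole space:
  convolutions are formed with Borel representatives because Fubini is applied to
  \<open>lborel\<close>.\<close>

definition loc_int :: "('a::euclidean_space \<Rightarrow> 'b::euclidean_space) \<Rightarrow> bool" where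
  "loc_int g \<longleftrightarrow> g \<in> borel_measurable borel \<and>
     (\<forall>x r. (\<integral>\<^sup>+y\<in>cball x r. ennreal (norm (g y)) \<partial>lborel) < \<infinity>)"

definition conv :: "('a::euclidean_space \<Rightarrow> real) \<Rightarrow> ('a \<Rightarrow> 'b::euclidean_space) \<Rightarrow> 'a \<Rightarrow> 'b" where
  "conv \<phi> g x = (\<integral>y. \<phi> (x - y) *\<^sub>R g y \<partial>lborel)"

lemma loc_int_borel [measurable_dest]: "loc_int g \<Longrightarrow> g \<in> borel_measurable borel"
  by (simp add: loc_int_def)

lemma loc_int_integrable:
  fixes \<psi> :: "'a::euclidean_space \<Rightarrow> real"
  assumes g: "loc_int g" and [measurable]: "\<psi> \<in> borel_measurable borel"
    and b: "\<And>y. \<bar>\<psi> y\<bar> \<le> B" and z: "\<And>y. y \<notin> cball x r \<Longrightarrow> \<psi> y = 0"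
  shows "integrable lborel (\<lambda>y. \<psi> y *\<^sub>R g y)"
    "norm (\<integral>y. \<psi> y *\<^sub>R g y \<partial>lborel) \<le> B * enn2real (\<integral>\<^sup>+y\<in>cball x r. ennreal (norm (g y)) \<partial>lborel)"
proof -
  have [measurable]: "g \<in> borel_measurable borel" using g by (rule loc_int_borel)
  define I where "I = (\<integral>\<^sup>+y\<in>cball x r. ennreal (norm (g y)) \<partial>lborel)"
  have I: "I < \<infinity>" using g by (auto simp: I_def loc_int_def)
  have B: "B \<ge> 0" using b[of x] by linarith
  have le: "(\<integral>\<^sup>+y. ennreal (norm (\<psi> y *\<^sub>R g y)) \<partial>lborel) \<le> ennreal B * I"
  proof -
    have "(\<integral>\<^sup>+y. ennreal (norm (\<psi> y *\<^sub>R g y)) \<partial>lborel)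
       \<le> (\<integral>\<^sup>+y. ennreal B * (ennreal (norm (g y)) * indicator (cball x r) y) \<partial>lborel)"
  proof (rule nn_integral_mono)
    fix y show "ennreal (norm (\<psi> y *\<^sub>R g y)) \<le> ennreal B * (ennreal (norm (g y)) * indicator (cball x r) y)"
      using b[of y] z[of y] B
      by (auto simp: indicator_def ennreal_mult[symmetric] intro!: ennreal_leI mult_right_mono)
  qed
  also have "\<dots> = ennreal B * I" unfolding I_def by (rule nn_integral_cmult) measurable
  finally show ?thesis .
  qed
  also have "\<dots> < \<infinity>" using I by (simp add: ennreal_mult_less_top)
  finally show int: "integrable lborel (\<lambda>y. \<psi> y *\<^sub>R g y)"
    by (intro integrableI_bounded) auto
  have "ennreal (norm (\<integral>y. \<psi> y *\<^sub>R g y \<partial>lborel)) \<le> ennreal B * I"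
    using integral_norm_bound_ennreal[OF int] le by (rule order_trans)
  also have "\<dots> = ennreal (B * enn2real I)"
    using I B by (simp add: ennreal_mult)
  finally show "norm (\<integral>y. \<psi> y *\<^sub>R g y \<partial>lborel) \<le> B * enn2real I"
    using B by (simp add: ennreal_le_iff)
qed

lemma C0_infinity_in_cball:
  assumes "\<phi> \<in> C0_infinity \<Omega>"
  obtains r where "r > 0" "\<And>x. norm x > r \<Longrightarrow> \<phi> x = 0"
proof -
  obtain r where r: "r > 0" "\<And>x. x \<in> supp \<phi> \<Longrightarrow> norm x \<le> r"
    using compact_imp_bounded[OF C0_infinity_D(2)[OF assms]] by (auto simp: bounded_pos)
  show ?thesis by (rule that[OF r(1)]) (meson r(2) not_le supp_notin)
qed

lemma conv_integrable:
  assumes "\<phi> \<in> C0_infinity \<Omega>" "loc_int g"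
  shows "integrable lborel (\<lambda>y. \<phi> (x - y) *\<^sub>R g y)"
proof -
  obtain B where "\<And>x. norm (\<phi> x) \<le> B" using C0_infinity_bounded[OF assms(1)] by metis
  moreover obtain r where "r > 0" "\<And>x. norm x > r \<Longrightarrow> \<phi> x = 0" using C0_infinity_in_cball[OF assms(1)] by metis
  moreover have [measurable]: "\<phi> \<in> borel_measurable borel"
    using C_infinity_borel C0_infinity_D(1)[OF assms(1)] by blast
  ultimately show ?thesis
    by (intro loc_int_integrable(1)[OF assms(2), of _ B x r]) (auto simp: dist_norm)
qed

text \<open>The uniform Taylor remainder of \<phi> is integrated against \<open>g\<close>. For
  \<open>norm h \<le> 1\<close> all shifted kernels live in one ball of radius r + 1, so the error
  is a constant times the square of \<open>norm h\<close>.\<close>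

lemma conv_has_derivative:
  fixes g :: "'a::euclidean_space \<Rightarrow> 'b::euclidean_space"
  assumes \<phi>: "\<phi> \<in> C0_infinity \<Omega>" and g: "loc_int g"
  shows "(conv \<phi> g has_derivative (\<lambda>h. \<Sum>b\<in>Basis. (h \<bullet> b) *\<^sub>R conv (pderiv_dir b \<phi>) g x)) (at x)"
proof -
  obtain M where M: "M \<ge> 0"
    "\<And>x h. norm (\<phi> (x + h) - \<phi> x - (\<Sum>b\<in>Basis. (h \<bullet> b) *\<^sub>R pderiv_dir b \<phi> x)) \<le> M * (norm h)\<^sup>2"
    using C0_infinity_Taylor[OF \<phi>] by metis
  obtain r where r: "r > 0" "\<And>x. norm x > r \<Longrightarrow> \<phi> x = 0" using C0_infinity_in_cball[OF \<phi>] by metis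
  have d\<phi>: "pderiv_dir b \<phi> \<in> C0_infinity \<Omega>" if "b \<in> Basis" for b
    using C0_infinity_iter_pderiv[OF \<phi>, of "[b]"] that by simp
  have meas: "\<phi> \<in> borel_measurable borel" "\<And>b. b \<in> Basis \<Longrightarrow> pderiv_dir b \<phi> \<in> borel_measurable borel"
    using C_infinity_borel C0_infinity_D(1) d\<phi> \<phi> by blast+
  have z: "pderiv_dir b \<phi> x = 0" if "norm x > r" for b x
    by (rule pderiv_dir_eq_0_open[of "- cball 0 r"]) (use that r(2) in \<open>auto simp: open_Compl\<close>)
  define I where "I = enn2real (\<integral>\<^sup>+y\<in>cball x (r + 1). ennreal (norm (g y)) \<partial>lborel)"
  have key: "norm (conv \<phi> g (x + h) - conv \<phi> g x - (\<Sum>b\<in>Basis. (h \<bullet> b) *\<^sub>R conv (pderiv_dir b \<phi>) g x))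
      \<le> M * (norm h)\<^sup>2 * I" if h: "norm h \<le> 1" for h
  proof -
    let ?r = "\<lambda>y. \<phi> (x + h - y) - \<phi> (x - y) - (\<Sum>b\<in>Basis. (h \<bullet> b) *\<^sub>R pderiv_dir b \<phi> (x - y))"
    have "conv \<phi> g (x + h) - conv \<phi> g x - (\<Sum>b\<in>Basis. (h \<bullet> b) *\<^sub>R conv (pderiv_dir b \<phi>) g x)
       = (\<integral>y. \<phi> (x + h - y) *\<^sub>R g y - \<phi> (x - y) *\<^sub>R g y
            - (\<Sum>b\<in>Basis. (h \<bullet> b) *\<^sub>R pderiv_dir b \<phi> (x - y) *\<^sub>R g y) \<partial>lborel)"
      unfolding conv_def
      using conv_integrable[OF \<phi> g] conv_integrable[OF d\<phi> g]
      by (simp add: Bochner_Integration.integral_diff Bochner_Integration.integral_sum del: scaleR_scaleR)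
    also have "\<dots> = (\<integral>y. ?r y *\<^sub>R g y \<partial>lborel)"
      by (simp add: scaleR_diff_left scaleR_sum_left)
    also have "norm \<dots> \<le> M * (norm h)\<^sup>2 * I"
      unfolding I_def
    proof (rule loc_int_integrable(2)[OF g])
      show "?r \<in> borel_measurable borel"
        using meas by (intro borel_measurable_diff borel_measurable_sum borel_measurable_scaleR)
           (auto intro!: measurable_compose[OF _ meas(1)] measurable_compose[OF _ meas(2)])
      show "\<bar>?r y\<bar> \<le> M * (norm h)\<^sup>2" for y using M(2)[of "x - y" h] by (simp add: algebra_simps)
      fix y assume "y \<notin> cball x (r + 1)"
      then have y: "norm (x - y) > r + 1" by (simp add: dist_norm)
      have "norm (x + h - y) > r"
        using y h norm_triangle_ineq4[of "x + h - y" h] by simp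
      then show "?r y = 0" using y z r(2) by simp
    qed
    finally show ?thesis .
  qed
  show ?thesis
  proof (rule has_derivativeI_sandwich[of 1])
    show "bounded_linear (\<lambda>h. \<Sum>b\<in>Basis. (h \<bullet> b) *\<^sub>R conv (pderiv_dir b \<phi>) g x)"
      by (intro bounded_linear_sum bounded_linear_scaleR_const bounded_linear_inner_left)
    show "((\<lambda>y. M * I * norm (y - x)) \<longlongrightarrow> 0) (at x)"
      by (auto intro!: tendsto_eq_intros)
    fix y assume "y \<noteq> x" "dist y x < 1"
    then show "norm (conv \<phi> g y - conv \<phi> g x - (\<Sum>b\<in>Basis. ((y - x) \<bullet> b) *\<^sub>R conv (pderiv_dir b \<phi>) g x))
        / norm (y - x) \<le> M * I * norm (y - x)"
      using key[of "y - x"] by (simp add: dist_norm divide_simps power2_eq_square mult_ac)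
  qed simp
qed

lemma pderiv_dir_conv:
  assumes "\<phi> \<in> C0_infinity \<Omega>" "loc_int g" "b \<in> Basis"
  shows "pderiv_dir b (conv \<phi> g) = conv (pderiv_dir b \<phi>) g"
proof
  fix x
  have "pderiv_dir b (conv \<phi> g) x = (\<Sum>c\<in>Basis. (b \<bullet> c) *\<^sub>R conv (pderiv_dir c \<phi>) g x)"
    by (rule pderiv_dir_eq[OF conv_has_derivative[OF assms(1,2)]])
  also have "\<dots> = (\<Sum>c\<in>Basis. if c = b then conv (pderiv_dir c \<phi>) g x else 0)"
    by (rule sum.cong) (auto simp: inner_Basis assms(3))
  finally show "pderiv_dir b (conv \<phi> g) x = conv (pderiv_dir b \<phi>) g x"
    using assms(3) by simp
qed

lemma conv_C_infinity:
  assumes "\<phi> \<in> C0_infinity \<Omega>" "loc_int g"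
  shows "C_infinity (conv \<phi> g)"
proof -
  have diff: "conv \<psi> g differentiable (at x)" if "\<psi> \<in> C0_infinity \<Omega>" for \<psi> x
    using conv_has_derivative[OF that assms(2)] unfolding differentiable_def by blast
  have "C_k n (conv \<psi> g)" if "\<psi> \<in> C0_infinity \<Omega>" for n \<psi>
    using that
  proof (induction n arbitrary: \<psi>)
    case 0
    then show ?case using diff
      by (auto simp: continuous_on_eq_continuous_at differentiable_imp_continuous_within)
  next
    case (Suc n)
    have "pderiv_dir b \<psi> \<in> C0_infinity \<Omega>" if "b \<in> Basis" for b
      using C0_infinity_iter_pderiv[OF Suc.prems, of "[b]"] that by simp
    then show ?case using Suc diff by (auto simp: pderiv_dir_conv[OF _ assms(2)])
  qed
  then show ?thesis using assms(1) by (simp add: C_infinity_def)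
qed

lemma iter_pderiv_conv:
  assumes "\<phi> \<in> C0_infinity \<Omega>" "loc_int g" "set bs \<subseteq> Basis"
  shows "iter_pderiv bs (conv \<phi> g) = conv (iter_pderiv bs \<phi>) g"
  using assms(3)
proof (induction bs)
  case (Cons b bs)
  then show ?case
    using pderiv_dir_conv[OF C0_infinity_iter_pderiv[OF assms(1)] assms(2)] by simp
qed simp

lemma conv_eq_0:
  assumes "\<And>y. norm y \<ge> \<delta> \<Longrightarrow> \<phi> y = 0" "\<And>y. dist x y < \<delta> \<Longrightarrow> g y = 0"
  shows "conv \<phi> g x = 0"
proof -
  have "\<phi> (x - y) *\<^sub>R g y = 0" for y using assms(1)[of "x - y"] assms(2)[of y]
    by (cases "dist x y < \<delta>") (auto simp: dist_norm)
  then have "(\<lambda>y. \<phi> (x - y) *\<^sub>R g y) = (\<lambda>y. 0)" by (rule ext)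
  then show ?thesis by (simp add: conv_def del: scaleR_eq_0_iff)
qed

lemma conv_diff:
  assumes "\<phi> \<in> C0_infinity \<Omega>" "loc_int f" "loc_int g"
  shows "conv \<phi> (\<lambda>x. f x - g x) x = conv \<phi> f x - conv \<phi> g x"
  unfolding conv_def using conv_integrable[OF assms(1,2)] conv_integrable[OF assms(1,3)]
  by (simp add: scaleR_diff_right)

subsection \<open>Energies and mollification\<close>

text \<open>The p-th power of an L^p norm, without the root and allowed to be infinite, so that the
  energies of several derivatives simply add up and carry no integrability side conditions.\<close>

definition enp :: "real \<Rightarrow> 'a::euclidean_space set \<Rightarrow> ('a \<Rightarrow> 'b::real_normed_vector) \<Rightarrow> ennreal" where
  "enp p S g = (\<integral>\<^sup>+x. ennreal (norm (g x) powr p) \<partial>lebesgue_on S)"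

lemma enp_lborel:
  assumes "S \<in> sets lebesgue"
  shows "enp p S g = (\<integral>\<^sup>+x\<in>S. ennreal (norm (g x) powr p) \<partial>lborel)"
  unfolding enp_def using assms by (subst nn_integral_restrict_space) (auto simp: nn_integral_completion)

lemma enp_UNIV: "enp p UNIV g = (\<integral>\<^sup>+x. ennreal (norm (g x) powr p) \<partial>lborel)"
  by (subst enp_lborel) auto

lemma enp_mono_set:
  assumes "S \<in> sets lebesgue" "T \<in> sets lebesgue" "S \<subseteq> T"
  shows "enp p S g \<le> enp p T g"
  using assms by (auto simp: enp_lborel indicator_def intro!: nn_integral_mono)

lemma enp_cong_AE:
  assumes "AE x in lebesgue_on S. f x = g x"
  shows "enp p S f = enp p S g"
  unfolding enp_def by (intro nn_integral_cong_AE) (use assms in auto)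

lemma enp_add:
  assumes [measurable]: "f \<in> borel_measurable (lebesgue_on S)" "g \<in> borel_measurable (lebesgue_on S)"
    and p: "p \<ge> 1"
  shows "enp p S (\<lambda>x. f x + g x) \<le> ennreal (2 powr p) * (enp p S f + enp p S g)"
proof -
  have "enp p S (\<lambda>x. f x + g x) \<le>
     (\<integral>\<^sup>+x. ennreal (2 powr p) * (ennreal (norm (f x) powr p) + ennreal (norm (g x) powr p)) \<partial>lebesgue_on S)"
    unfolding enp_def using powr_add_le[OF p]
    by (intro nn_integral_mono) (simp add: ennreal_plus[symmetric] ennreal_mult[symmetric] ennreal_leI del: ennreal_plus)
  also have "\<dots> = ennreal (2 powr p) * (enp p S f + enp p S g)"
    unfolding enp_def by (simp add: nn_integral_cmult nn_integral_add)
  finally show ?thesis .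
qed

lemma enp_scale:
  assumes "f \<in> borel_measurable (lebesgue_on S)" "p \<ge> 0" "S \<in> sets lebesgue"
    "\<And>x. x \<in> S \<Longrightarrow> norm (h x) \<le> c * norm (f x)" "c \<ge> 0"
  shows "enp p S h \<le> ennreal (c powr p) * enp p S f"
proof -
  have "enp p S h \<le> (\<integral>\<^sup>+x. ennreal (c powr p) * ennreal (norm (f x) powr p) \<partial>lebesgue_on S)"
    unfolding enp_def
  proof (rule nn_integral_mono)
    fix x assume "x \<in> space (lebesgue_on S)"
    then have "norm (h x) powr p \<le> (c * norm (f x)) powr p"
      using assms by (intro powr_mono2) (auto simp: space_restrict_space)
    then show "ennreal (norm (h x) powr p) \<le> ennreal (c powr p) * ennreal (norm (f x) powr p)"
      using assms by (simp add: powr_mult ennreal_mult[symmetric] ennreal_leI)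
  qed
  also have "\<dots> = ennreal (c powr p) * enp p S f"
    unfolding enp_def using assms(1) by (subst nn_integral_cmult) auto
  finally show ?thesis .
qed

lemma enp_uminus: "enp p S (\<lambda>x. - f x) = enp p S f"
  by (simp add: enp_def)

text \<open>For t > \<delta> one has t = t^(1-p) t^p, and the first factor is at most
  \<delta>^(1-p). The free parameter makes this a substitute for Hoelder's inequality that treats p
  = 1 alike.\<close>

lemma powr_ge_Young:
  fixes t \<delta> p :: real
  assumes "p \<ge> 1" "\<delta> > 0" "t \<ge> 0"
  shows "t \<le> \<delta> + \<delta> powr (1 - p) * t powr p"
proof (cases "t \<le> \<delta>")
  case False
  have "t = t powr (1 - p) * t powr p" using False assms by (simp add: powr_add[symmetric])
  also have "\<dots> \<le> \<delta> powr (1 - p) * t powr p"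
    using False assms by (intro mult_right_mono powr_mono2') auto
  finally show ?thesis using assms by simp
next
  case True
  then show ?thesis using assms by (simp add: add_increasing2)
qed

lemma nn_norm_le_enp:
  fixes g :: "'a::euclidean_space \<Rightarrow> 'b::euclidean_space"
  assumes "g \<in> borel_measurable (lebesgue_on S)" "p \<ge> 1" "\<delta> > 0" "S \<in> sets lebesgue"
  shows "(\<integral>\<^sup>+y. ennreal (norm (g y)) \<partial>lebesgue_on S)
     \<le> ennreal \<delta> * emeasure lebesgue S + ennreal (\<delta> powr (1 - p)) * enp p S g"
proof -
  have "(\<integral>\<^sup>+y. ennreal (norm (g y)) \<partial>lebesgue_on S)
     \<le> (\<integral>\<^sup>+y. ennreal \<delta> + ennreal (\<delta> powr (1 - p)) * ennreal (norm (g y) powr p) \<partial>lebesgue_on S)"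
    using powr_ge_Young[OF assms(2,3)] assms
    by (intro nn_integral_mono) (simp add: ennreal_plus[symmetric] ennreal_mult[symmetric] ennreal_leI del: ennreal_plus)
  also have "\<dots> = ennreal \<delta> * emeasure lebesgue S + ennreal (\<delta> powr (1 - p)) * enp p S g"
    using assms by (simp add: nn_integral_add nn_integral_cmult enp_def emeasure_restrict_space space_restrict_space)
  finally show ?thesis .
qed

lemma enp_loc_int:
  fixes g :: "'a::euclidean_space \<Rightarrow> 'b::euclidean_space"
  assumes [measurable]: "g \<in> borel_measurable borel" and p: "p \<ge> 1" and fin: "enp p UNIV g < \<infinity>"
  shows "loc_int g"
  unfolding loc_int_def
proof (intro conjI allI)
  fix x :: 'a and r :: real
  have cb: "cball x r \<in> sets lebesgue" by auto
  have g: "g \<in> borel_measurable (lebesgue_on (cball x r))"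
    by (intro measurable_restrict_space1 measurable_completion) simp
  have "(\<integral>\<^sup>+y\<in>cball x r. ennreal (norm (g y)) \<partial>lborel) = (\<integral>\<^sup>+y. ennreal (norm (g y)) \<partial>lebesgue_on (cball x r))"
    using cb by (subst nn_integral_restrict_space) (auto simp: nn_integral_completion)
  also have "\<dots> \<le> ennreal 1 * emeasure lebesgue (cball x r) + ennreal (1 powr (1 - p)) * enp p (cball x r) g"
    by (rule nn_norm_le_enp[OF g p _ cb]) simp
  also have "\<dots> < \<infinity>"
  proof -
    have "enp p (cball x r) g \<le> enp p UNIV g" by (rule enp_mono_set) auto
    then have "enp p (cball x r) g < \<infinity>" using fin by (rule le_less_trans)
    moreover have "emeasure lebesgue (cball x r) < \<infinity>"
      using emeasure_lborel_cball_finite[of x r] by simp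
    ultimately show ?thesis by simp
  qed
  finally show "(\<integral>\<^sup>+y\<in>cball x r. ennreal (norm (g y)) \<partial>lborel) < \<infinity>" .
qed simp

text \<open>A predicate rather than a fixed family: results then hold for every kernel of small
  enough radius, and several smallness requirements are met by one minimum.\<close>

definition mollifier :: "real \<Rightarrow> ('a::euclidean_space \<Rightarrow> real) \<Rightarrow> bool" where
  "mollifier \<delta> \<phi> \<longleftrightarrow> \<delta> > 0 \<and> \<phi> \<in> C0_infinity UNIV \<and> (\<forall>x. \<phi> x \<ge> 0) \<and> (\<forall>x. norm x \<ge> \<delta> \<longrightarrow> \<phi> x = 0)
     \<and> integral\<^sup>N lborel (\<lambda>x. ennreal (\<phi> x)) = 1"

lemma mollifierD:
  assumes "mollifier \<delta> \<phi>"
  shows "\<delta> > 0" "\<phi> \<in> C0_infinity UNIV" "\<And>x. \<phi> x \<ge> 0" "\<And>x. norm x \<ge> \<delta> \<Longrightarrow> \<phi> x = 0"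
     "integral\<^sup>N lborel (\<lambda>x. ennreal (\<phi> x)) = 1" "\<phi> \<in> borel_measurable borel"
  using assms C_infinity_borel C0_infinity_D(1) by (auto simp: mollifier_def)

lemma mollifier_shift_integral:
  assumes "mollifier \<delta> \<phi>"
  shows "(\<integral>\<^sup>+y. ennreal (\<phi> (x - y)) \<partial>lborel) = 1" "(\<integral>\<^sup>+x. ennreal (\<phi> (x - y)) \<partial>lborel) = 1"
proof -
  have [measurable]: "\<phi> \<in> borel_measurable borel" by (rule mollifierD[OF assms])
  show "(\<integral>\<^sup>+y. ennreal (\<phi> (x - y)) \<partial>lborel) = 1"
    using nn_integral_lborel_reflect[of "\<lambda>y. ennreal (\<phi> y)" x] mollifierD[OF assms] by simp
  show "(\<integral>\<^sup>+x. ennreal (\<phi> (x - y)) \<partial>lborel) = 1"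
    using nn_integral_lborel_shift[of "\<lambda>y. ennreal (\<phi> y)" "-y"] mollifierD[OF assms] by simp
qed

lemma iter_pderiv_cmult:
  fixes f :: "'a::euclidean_space \<Rightarrow> 'b::real_normed_vector"
  assumes "C_infinity f" "set bs \<subseteq> Basis"
  shows "iter_pderiv bs (\<lambda>x. c *\<^sub>R f x) = (\<lambda>x. c *\<^sub>R iter_pderiv bs f x)"
  using assms(2)
proof (induction bs)
  case (Cons b bs)
  have d: "iter_pderiv bs f differentiable (at x)" for x
    using Cons by (auto intro!: C_infinity_differentiable C_infinity_iter_pderiv assms)
  show ?case using Cons
    by (auto simp: pderiv_dir_bounded_bilinear[OF bounded_bilinear_scaleR _ d] pderiv_dir_const)
qed simp

text \<open>Rescaling one kernel gives the bounds by homogeneity: \<delta>^(-d) from the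
  normalisation and one factor 1 / \<delta> per derivative, with \<open>B\<close> depending on
  \<open>bs\<close> only.\<close>

lemma mollifier_scaled:
  obtains \<phi> :: "real \<Rightarrow> 'a::euclidean_space \<Rightarrow> real"
  where "\<And>\<delta>. \<delta> > 0 \<Longrightarrow> mollifier \<delta> (\<phi> \<delta>)"
    "\<And>bs. set bs \<subseteq> Basis \<Longrightarrow>
       \<exists>B\<ge>0. \<forall>\<delta>>0. \<forall>x. \<bar>iter_pderiv bs (\<phi> \<delta>) x\<bar> \<le> B / (\<delta> ^ DIM('a) * \<delta> ^ length bs)"
proof -
  obtain \<psi> :: "'a \<Rightarrow> real" where \<psi>: "\<psi> \<in> C0_infinity UNIV" "\<And>x. \<psi> x \<ge> 0" "\<And>x. norm x \<ge> 1 \<Longrightarrow> \<psi> x = 0"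
    "integral\<^sup>N lborel (\<lambda>x. ennreal (\<psi> x)) = 1" using mollifier_exists by metis
  have smooth: "C_infinity \<psi>" by (rule C0_infinity_D(1)[OF \<psi>(1)])
  have [measurable]: "\<psi> \<in> borel_measurable borel" using C_infinity_borel smooth by blast
  define \<phi> where "\<phi> \<delta> x = (1 / \<delta> ^ DIM('a)) *\<^sub>R \<psi> ((1 / \<delta>) *\<^sub>R x + 0)" for \<delta> x
  have "mollifier \<delta> (\<phi> \<delta>)" if d: "\<delta> > 0" for \<delta>
  proof -
    have z: "\<phi> \<delta> x = 0" if "norm x \<ge> \<delta>" for x
      unfolding \<phi>_def using \<psi>(3)[of "(1 / \<delta>) *\<^sub>R x"] that d by (simp add: field_simps)
    have "C_infinity (\<phi> \<delta>)" unfolding \<phi>_def[abs_def]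
      by (rule C_infinity_scaleR[OF C_infinity_const C_infinity_affine[OF smooth]])
    then have "\<phi> \<delta> \<in> C0_infinity UNIV"
      by (rule C0_infinityI[of _ "cball 0 \<delta>"]) (use z in \<open>auto simp: dist_norm\<close>)
    moreover have "integral\<^sup>N lborel (\<lambda>x. ennreal (\<phi> \<delta> x)) = 1"
    proof -
      have "1 = (\<integral>\<^sup>+x. ennreal (\<psi> x) \<partial>lborel)" using \<psi> by simp
      also have "\<dots> = ennreal (\<bar>1 / \<delta>\<bar> ^ DIM('a)) * (\<integral>\<^sup>+x. ennreal (\<psi> (0 + (1 / \<delta>) *\<^sub>R x)) \<partial>lborel)"
        by (rule nn_integral_lborel_affine) (use d in auto)
      also have "\<dots> = (\<integral>\<^sup>+x. ennreal (\<bar>1 / \<delta>\<bar> ^ DIM('a)) * ennreal (\<psi> (0 + (1 / \<delta>) *\<^sub>R x)) \<partial>lborel)"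
        by (rule nn_integral_cmult[symmetric]) measurable
      also have "\<dots> = integral\<^sup>N lborel (\<lambda>x. ennreal (\<phi> \<delta> x))"
        using d \<psi>(2) by (simp add: \<phi>_def ennreal_mult[symmetric] power_one_over field_simps)
      finally show ?thesis by simp
    qed
    ultimately show ?thesis unfolding mollifier_def using z d \<psi>(2) by (auto simp: \<phi>_def)
  qed
  moreover have "\<exists>B\<ge>0. \<forall>\<delta>>0. \<forall>x. \<bar>iter_pderiv bs (\<phi> \<delta>) x\<bar> \<le> B / (\<delta> ^ DIM('a) * \<delta> ^ length bs)"
    if bs: "set bs \<subseteq> Basis" for bs
  proof -
    obtain B where B: "B > 0" "\<And>x. norm (iter_pderiv bs \<psi> x) \<le> B"
      using C0_infinity_bounded[OF C0_infinity_iter_pderiv[OF \<psi>(1) bs]] by metis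
    have "\<bar>iter_pderiv bs (\<phi> \<delta>) x\<bar> \<le> B / (\<delta> ^ DIM('a) * \<delta> ^ length bs)" if d: "\<delta> > 0" for \<delta> x
    proof -
      have "iter_pderiv bs (\<phi> \<delta>) x = (1 / \<delta> ^ DIM('a)) *\<^sub>R ((1 / \<delta>) ^ length bs *\<^sub>R iter_pderiv bs \<psi> ((1 / \<delta>) *\<^sub>R x + 0))"
        unfolding \<phi>_def[abs_def]
        by (simp only: iter_pderiv_cmult[OF C_infinity_affine[OF smooth] bs] iter_pderiv_affine[OF smooth bs])
      also have "\<bar>\<dots>\<bar> \<le> (1 / \<delta> ^ DIM('a)) * ((1 / \<delta>) ^ length bs * B)"
        unfolding abs_mult real_scaleR_def using d B(2)[of "(1 / \<delta>) *\<^sub>R x + 0"] by (intro mult_mono) auto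
      finally show ?thesis using d by (simp add: power_one_over field_simps)
    qed
    then show ?thesis using B by (intro exI[of _ B]) auto
  qed
  ultimately show ?thesis using that by blast
qed

lemma conv_norm_le_nn:
  fixes g :: "'a::euclidean_space \<Rightarrow> 'b::euclidean_space"
  assumes m: "mollifier \<delta> \<phi>" and g: "loc_int g"
  shows "ennreal (norm (conv \<phi> g x)) \<le> (\<integral>\<^sup>+y. ennreal (\<phi> (x - y) * norm (g y)) \<partial>lborel)"
  unfolding conv_def
  using integral_norm_bound_ennreal[OF conv_integrable[OF mollifierD(2)[OF m] g, of x]] mollifierD(3)[OF m]
  by simp

lemma conv_norm_le:
  fixes g :: "'a::euclidean_space \<Rightarrow> 'b::euclidean_space"
  assumes m: "mollifier \<delta> \<phi>" and g: "loc_int g" and b: "\<And>y. dist x y < \<delta> \<Longrightarrow> norm (g y) \<le> e" and e: "e \<ge> 0"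
  shows "norm (conv \<phi> g x) \<le> e"
proof -
  have [measurable]: "\<phi> \<in> borel_measurable borel" by (rule mollifierD[OF m])
  have "ennreal (norm (conv \<phi> g x)) \<le> (\<integral>\<^sup>+y. ennreal (\<phi> (x - y) * norm (g y)) \<partial>lborel)"
    by (rule conv_norm_le_nn[OF m g])
  also have "\<dots> \<le> (\<integral>\<^sup>+y. ennreal (\<phi> (x - y)) * ennreal e \<partial>lborel)"
  proof (rule nn_integral_mono)
    fix y show "ennreal (\<phi> (x - y) * norm (g y)) \<le> ennreal (\<phi> (x - y)) * ennreal e"
      using mollifierD(3,4)[OF m, of "x - y"] b[of y] e
      by (cases "dist x y < \<delta>") (auto simp: dist_norm ennreal_mult[symmetric] intro!: ennreal_leI mult_left_mono)
  qed
  also have "\<dots> = ennreal e" by (simp add: nn_integral_multc mollifier_shift_integral[OF m])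
  finally show ?thesis using e by (simp add: ennreal_le_iff)
qed

lemma conv_const:
  fixes c :: "'b::euclidean_space"
  assumes m: "mollifier \<delta> \<phi>"
  shows "conv \<phi> (\<lambda>_. c) (x :: 'a::euclidean_space) = c"
proof -
  have [measurable]: "\<phi> \<in> borel_measurable borel" by (rule mollifierD[OF m])
  have "has_bochner_integral lborel (\<lambda>y. \<phi> (x - y)) 1"
    by (rule has_bochner_integral_nn_integral)
       (use mollifierD(3)[OF m] mollifier_shift_integral[OF m] in auto)
  then have "has_bochner_integral lborel (\<lambda>y. \<phi> (x - y) *\<^sub>R c) (1 *\<^sub>R c)"
    by (rule has_bochner_integral_scaleR_left)
  then show ?thesis by (simp add: conv_def has_bochner_integral_integral_eq)
qed

text \<open>Jensen with the probability weight \<open>\<phi> (x - y)\<close>, then Fubini. The two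
  sets keep the estimate local, which the Hardy inequality near \<open>E\<close> requires.\<close>

lemma enp_conv_le:
  fixes g :: "'a::euclidean_space \<Rightarrow> 'b::euclidean_space"
  assumes m: "mollifier \<delta> \<phi>" and g: "loc_int g" and p: "p \<ge> 1"
    and S: "S \<in> sets borel" "N \<in> sets borel" "\<And>x y. x \<in> S \<Longrightarrow> dist x y < \<delta> \<Longrightarrow> y \<in> N"
  shows "enp p S (conv \<phi> g) \<le> enp p N g"
proof -
  have [measurable]: "\<phi> \<in> borel_measurable borel" by (rule mollifierD[OF m])
  have [measurable]: "g \<in> borel_measurable borel" using g by (rule loc_int_borel)
  note [measurable] = S(1,2)
  have J: "ennreal (norm (conv \<phi> g x) powr p) \<le> (\<integral>\<^sup>+y. ennreal (\<phi> (x - y) * norm (g y) powr p) \<partial>lborel)" for x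
    by (rule nn_integral_Jensen_powr[OF _ _ _ _ _ _ conv_norm_le_nn[OF m g] p])
       (use mollifierD(3)[OF m] mollifier_shift_integral[OF m] in auto)
  have "enp p S (conv \<phi> g) = (\<integral>\<^sup>+x\<in>S. ennreal (norm (conv \<phi> g x) powr p) \<partial>lborel)"
    using S by (intro enp_lborel) auto
  also have "\<dots> \<le> (\<integral>\<^sup>+x. (\<integral>\<^sup>+y. ennreal (\<phi> (x - y)) * (ennreal (norm (g y) powr p) * indicator N y) \<partial>lborel) \<partial>lborel)"
  proof (rule nn_integral_mono)
    fix x
    show "ennreal (norm (conv \<phi> g x) powr p) * indicator S x
       \<le> (\<integral>\<^sup>+y. ennreal (\<phi> (x - y)) * (ennreal (norm (g y) powr p) * indicator N y) \<partial>lborel)"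
    proof (cases "x \<in> S")
      case True
      have "(\<integral>\<^sup>+y. ennreal (\<phi> (x - y) * norm (g y) powr p) \<partial>lborel)
         \<le> (\<integral>\<^sup>+y. ennreal (\<phi> (x - y)) * (ennreal (norm (g y) powr p) * indicator N y) \<partial>lborel)"
      proof (rule nn_integral_mono)
        fix y show "ennreal (\<phi> (x - y) * norm (g y) powr p)
           \<le> ennreal (\<phi> (x - y)) * (ennreal (norm (g y) powr p) * indicator N y)"
          using S(3)[OF True, of y] mollifierD(3,4)[OF m, of "x - y"]
          by (cases "dist x y < \<delta>") (auto simp: dist_norm ennreal_mult[symmetric])
      qed
      then show ?thesis using J[of x] True by (simp add: order_trans)
    qed simp
  qed
  also have "\<dots> = (\<integral>\<^sup>+y. (\<integral>\<^sup>+x. ennreal (\<phi> (x - y)) * (ennreal (norm (g y) powr p) * indicator N y) \<partial>lborel) \<partial>lborel)"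
    by (rule lborel_pair.Fubini') measurable
  also have "\<dots> = (\<integral>\<^sup>+y. ennreal (norm (g y) powr p) * indicator N y \<partial>lborel)"
    by (simp add: nn_integral_multc mollifier_shift_integral[OF m])
  also have "\<dots> = enp p N g" using S by (intro enp_lborel[symmetric]) auto
  finally show ?thesis .
qed

subsection \<open>Smooth cutoff functions\<close>

definition nhd :: "'a::metric_space set \<Rightarrow> real \<Rightarrow> 'a set" where
  "nhd S r = (\<Union>s\<in>S. ball s r)"

lemma open_nhd [simp]: "open (nhd S r)" by (auto simp: nhd_def)

lemma nhd_borel [measurable]: "nhd S r \<in> sets borel" by (rule borel_open) simp

lemma mem_nhd_add: "x \<in> nhd S r \<Longrightarrow> dist x y < t \<Longrightarrow> y \<in> nhd S (r + t)"
proof -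
  assume x: "x \<in> nhd S r" and y: "dist x y < t"
  then obtain s where "s \<in> S" "dist s x < r" by (auto simp: nhd_def)
  moreover have "dist s y < r + t" using dist_triangle[of s y x] y \<open>dist s x < r\<close> by linarith
  ultimately show ?thesis by (auto simp: nhd_def)
qed

lemma nhd_mono: "r \<le> t \<Longrightarrow> nhd S r \<subseteq> nhd S t" by (force simp: nhd_def)

lemma subset_nhd: "r > 0 \<Longrightarrow> S \<subseteq> nhd S r" by (auto simp: nhd_def)

lemma finite_dirs_le: "finite {bs :: 'a::euclidean_space list. set bs \<subseteq> Basis \<and> length bs \<le> k}"
  by (rule finite_lists_length_le) simp

text \<open>Mollifying an indicator at scale \<epsilon> gives derivatives of size \<epsilon>^(-j)
  whatever the shape of \<open>S\<close>. That \<open>M\<close> is chosen before \<open>S\<close>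
  and \<epsilon> is essential: cutoffs around sets without any regularity are used with \<epsilon>
  tending to 0.\<close>

lemma smooth_cutoff:
  obtains M where "M \<ge> 0" "\<And>(S :: 'a::euclidean_space set) \<epsilon>. \<epsilon> > 0 \<Longrightarrow>
    \<exists>\<theta> :: 'a \<Rightarrow> real. C_infinity \<theta> \<and> (\<forall>x. 0 \<le> \<theta> x \<and> \<theta> x \<le> 1) \<and> (\<forall>x\<in>nhd S \<epsilon>. \<theta> x = 1) \<and>
      (\<forall>x. x \<notin> nhd S (3 * \<epsilon>) \<longrightarrow> \<theta> x = 0) \<and>
      (\<forall>bs x. set bs \<subseteq> Basis \<longrightarrow> length bs \<le> k \<longrightarrow> \<bar>iter_pderiv bs \<theta> x\<bar> \<le> M / \<epsilon> ^ length bs)"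
proof -
  obtain \<phi> :: "real \<Rightarrow> 'a \<Rightarrow> real"
    where m: "\<And>\<delta>. \<delta> > 0 \<Longrightarrow> mollifier \<delta> (\<phi> \<delta>)" and
      bd: "\<And>bs. set bs \<subseteq> Basis \<Longrightarrow>
       \<exists>B\<ge>0. \<forall>\<delta>>0. \<forall>x. \<bar>iter_pderiv bs (\<phi> \<delta>) x\<bar> \<le> B / (\<delta> ^ DIM('a) * \<delta> ^ length bs)"
    using mollifier_scaled by metis
  then obtain B where B: "\<And>bs. set bs \<subseteq> Basis \<Longrightarrow> B bs \<ge> 0"
    "\<And>bs \<delta> x. set bs \<subseteq> Basis \<Longrightarrow> \<delta> > 0 \<Longrightarrow> \<bar>iter_pderiv bs (\<phi> \<delta>) x\<bar> \<le> B bs / (\<delta> ^ DIM('a) * \<delta> ^ length bs)"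
    by metis
  define U where "U = unit_ball_vol (real DIM('a))"
  have U: "U \<ge> 0" by (simp add: U_def)
  \<comment> \<open>A derivative of the kernel is at most B / (\<epsilon>^d \<epsilon>^j) and is
    integrated over a ball of volume U \<epsilon>^d, so the powers \<epsilon>^d cancel. Summing
    \<open>B\<close> over all lists gives one constant.\<close>
  define M where "M = (\<Sum>bs | set bs \<subseteq> Basis \<and> length bs \<le> k. B bs) * U"
  have M: "M \<ge> 0" unfolding M_def using B U by (intro mult_nonneg_nonneg sum_nonneg) auto
  have BM: "B bs * U \<le> M" if "set bs \<subseteq> Basis" "length bs \<le> k" for bs
    unfolding M_def using that B(1) U finite_dirs_le
    by (intro mult_right_mono member_le_sum[of bs _ B]) auto
  have "\<exists>\<theta> :: 'a \<Rightarrow> real. C_infinity \<theta> \<and> (\<forall>x. 0 \<le> \<theta> x \<and> \<theta> x \<le> 1) \<and> (\<forall>x\<in>nhd S \<epsilon>. \<theta> x = 1) \<and>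
      (\<forall>x. x \<notin> nhd S (3 * \<epsilon>) \<longrightarrow> \<theta> x = 0) \<and>
      (\<forall>bs x. set bs \<subseteq> Basis \<longrightarrow> length bs \<le> k \<longrightarrow> \<bar>iter_pderiv bs \<theta> x\<bar> \<le> M / \<epsilon> ^ length bs)"
    if \<epsilon>: "\<epsilon> > 0" for S :: "'a set" and \<epsilon>
  proof -
    \<comment> \<open>The radius 2\<epsilon> leaves room \<epsilon> on either side: convolution with
      a kernel of radius \<epsilon> gives 1 on the \<epsilon>-neighbourhood and 0 off the
      3\<epsilon>-neighbourhood.\<close>
    define g :: "'a \<Rightarrow> real" where "g = indicator (nhd S (2 * \<epsilon>))"
    have gm [measurable]: "g \<in> borel_measurable borel" unfolding g_def by measurable
    have le: "(\<integral>\<^sup>+y\<in>cball x r. ennreal (norm (g y)) \<partial>lborel) \<le> emeasure lborel (cball x r)" for x r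
    proof -
      have "(\<integral>\<^sup>+y\<in>cball x r. ennreal (norm (g y)) \<partial>lborel) \<le> (\<integral>\<^sup>+y. indicator (cball x r) y \<partial>lborel)"
        by (rule nn_integral_mono) (auto simp: g_def indicator_def)
      then show ?thesis by simp
    qed
    have g: "loc_int g" unfolding loc_int_def
      using le_less_trans[OF le emeasure_lborel_cball_finite] gm by simp
    note mo = m[OF \<epsilon>]
    note mD = mollifierD[OF mo]
    have g01: "\<bar>g y\<bar> \<le> 1" "g y \<ge> 0" for y by (auto simp: g_def indicator_def)
    have "0 \<le> conv (\<phi> \<epsilon>) g x" for x
      unfolding conv_def using mD(3) g01 by (intro Bochner_Integration.integral_nonneg) auto
    moreover have "conv (\<phi> \<epsilon>) g x \<le> 1" for x
      using conv_norm_le[OF mo g, of x 1] g01 by simp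
    moreover have "conv (\<phi> \<epsilon>) g x = 1" if "x \<in> nhd S \<epsilon>" for x
    proof -
      have "loc_int (\<lambda>_::'a. 1::real)"
        unfolding loc_int_def using emeasure_lborel_cball_finite by auto
      then have "conv (\<phi> \<epsilon>) (\<lambda>y. g y - 1) x = conv (\<phi> \<epsilon>) g x - 1"
        by (simp add: conv_diff[OF mD(2) g] conv_const[OF mo])
      moreover have "conv (\<phi> \<epsilon>) (\<lambda>y. g y - 1) x = 0"
        by (rule conv_eq_0[of \<epsilon>]) (use mD(4) mem_nhd_add[OF that, of _ \<epsilon>] in \<open>auto simp: g_def\<close>)
      ultimately show ?thesis by simp
    qed
    moreover have "conv (\<phi> \<epsilon>) g x = 0" if x: "x \<notin> nhd S (3 * \<epsilon>)" for x
    proof (rule conv_eq_0[of \<epsilon>])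
      fix y assume "dist x y < \<epsilon>"
      then have "y \<notin> nhd S (2 * \<epsilon>)" using x mem_nhd_add[of y S "2 * \<epsilon>" x \<epsilon>] by (auto simp: dist_commute)
      then show "g y = 0" by (simp add: g_def)
    qed (use mD(4) in auto)
    moreover have "\<bar>iter_pderiv bs (conv (\<phi> \<epsilon>) g) x\<bar> \<le> M / \<epsilon> ^ length bs"
      if bs: "set bs \<subseteq> Basis" "length bs \<le> k" for bs x
    proof -
      have z: "iter_pderiv bs (\<phi> \<epsilon>) y = 0" if "norm y > \<epsilon>" for y
        by (rule iter_pderiv_eq_0_open[of "- cball 0 \<epsilon>"]) (use that mD(4) in \<open>auto simp: open_Compl\<close>)
      have ms: "(\<lambda>y. iter_pderiv bs (\<phi> \<epsilon>) (x - y)) \<in> borel_measurable borel"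
        by (rule measurable_compose[OF _ C_infinity_borel[OF C_infinity_iter_pderiv[OF C0_infinity_D(1)[OF mD(2)] bs(1)]]]) auto
      have "norm (\<integral>y. iter_pderiv bs (\<phi> \<epsilon>) (x - y) *\<^sub>R g y \<partial>lborel)
         \<le> B bs / (\<epsilon> ^ DIM('a) * \<epsilon> ^ length bs) * enn2real (\<integral>\<^sup>+y\<in>cball x \<epsilon>. ennreal (norm (g y)) \<partial>lborel)"
        by (rule loc_int_integrable(2)[OF g ms]) (use B(2)[OF bs(1) \<epsilon>] z in \<open>auto simp: dist_norm\<close>)
      also have "\<dots> \<le> B bs / (\<epsilon> ^ DIM('a) * \<epsilon> ^ length bs) * (U * \<epsilon> ^ DIM('a))"
      proof (rule mult_left_mono)
        have "emeasure lborel (cball x \<epsilon>) = ennreal (U * \<epsilon> ^ DIM('a))"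
          unfolding U_def using \<epsilon> by (intro emeasure_cball) simp
        then show "enn2real (\<integral>\<^sup>+y\<in>cball x \<epsilon>. ennreal (norm (g y)) \<partial>lborel) \<le> U * \<epsilon> ^ DIM('a)"
          using le[of x \<epsilon>] U \<epsilon> by (intro enn2real_leI) auto
        show "0 \<le> B bs / (\<epsilon> ^ DIM('a) * \<epsilon> ^ length bs)" using B(1)[OF bs(1)] \<epsilon> by auto
      qed
      also have "\<dots> = B bs * U / \<epsilon> ^ length bs" using \<epsilon> by (simp add: field_simps)
      also have "\<dots> \<le> M / \<epsilon> ^ length bs" using BM[OF bs] \<epsilon> by (intro divide_right_mono) auto
      finally show ?thesis
        unfolding iter_pderiv_conv[OF mD(2) g bs(1)] by (simp add: conv_def)
    qed
    moreover have "C_infinity (conv (\<phi> \<epsilon>) g)" by (rule conv_C_infinity[OF mD(2) g])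
    ultimately show ?thesis by (intro exI[of _ "conv (\<phi> \<epsilon>) g"]) blast
  qed
  then show ?thesis using that[OF M] by blast
qed

lemma compact_nhd_subset:
  fixes K :: "'a::euclidean_space set"
  assumes "compact K" "open \<Omega>" "K \<subseteq> \<Omega>"
  obtains \<epsilon> where "\<epsilon> > 0" "closure (nhd K \<epsilon>) \<subseteq> \<Omega>" "compact (closure (nhd K \<epsilon>))"
proof -
  obtain \<epsilon> where e: "\<epsilon> > 0" "(\<Union>x\<in>K. cball x \<epsilon>) \<subseteq> \<Omega>"
    using compact_subset_open_imp_cball_epsilon_subset[OF assms] by metis
  have c: "compact (\<Union>x\<in>K. cball x \<epsilon>)"
  proof -
    have "(\<Union>x\<in>K. cball x \<epsilon>) = {x + y | x y. x \<in> K \<and> y \<in> cball 0 \<epsilon>}"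
      by (auto simp: dist_norm norm_minus_commute) (metis add_diff_cancel_left' diff_add_cancel add.commute)
    then show ?thesis using compact_sums[OF assms(1) compact_cball[of 0 \<epsilon>]] by simp
  qed
  have "nhd K \<epsilon> \<subseteq> (\<Union>x\<in>K. cball x \<epsilon>)" by (auto simp: nhd_def)
  then have s: "closure (nhd K \<epsilon>) \<subseteq> (\<Union>x\<in>K. cball x \<epsilon>)"
    using compact_imp_closed[OF c] by (rule closure_minimal)
  moreover have "compact (closure (nhd K \<epsilon>))"
    using s compact_imp_bounded[OF c] bounded_subset closed_closure compact_eq_bounded_closed by metis
  ultimately show ?thesis using that e by blast
qed

lemma smooth_Urysohn:
  fixes K :: "'a::euclidean_space set"
  assumes "compact K" "open \<Omega>" "K \<subseteq> \<Omega>"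
  obtains \<theta> :: "'a \<Rightarrow> real" and \<epsilon> where "\<theta> \<in> C0_infinity \<Omega>" "\<And>x. 0 \<le> \<theta> x" "\<And>x. \<theta> x \<le> 1"
    "\<epsilon> > 0" "\<And>x. x \<in> nhd K \<epsilon> \<Longrightarrow> \<theta> x = 1"
proof -
  obtain \<epsilon> where e: "\<epsilon> > 0" "closure (nhd K \<epsilon>) \<subseteq> \<Omega>" "compact (closure (nhd K \<epsilon>))"
    using compact_nhd_subset[OF assms] .
  have "\<exists>\<theta> :: 'a \<Rightarrow> real. C_infinity \<theta> \<and> (\<forall>x. 0 \<le> \<theta> x \<and> \<theta> x \<le> 1) \<and> (\<forall>x\<in>nhd K (\<epsilon> / 3). \<theta> x = 1) \<and>
      (\<forall>x. x \<notin> nhd K (3 * (\<epsilon> / 3)) \<longrightarrow> \<theta> x = 0)"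
    using smooth_cutoff[of 0] e(1) by (metis divide_pos_pos zero_less_numeral)
  then obtain \<theta> :: "'a \<Rightarrow> real" where \<theta>: "C_infinity \<theta>" "\<And>x. 0 \<le> \<theta> x" "\<And>x. \<theta> x \<le> 1"
    "\<And>x. x \<in> nhd K (\<epsilon> / 3) \<Longrightarrow> \<theta> x = 1" "\<And>x. x \<notin> nhd K \<epsilon> \<Longrightarrow> \<theta> x = 0" by auto
  have "\<theta> \<in> C0_infinity \<Omega>"
    by (rule C0_infinityI[OF \<theta>(1) e(3,2)]) (use \<theta>(5) closure_subset in blast)
  then show ?thesis using that[of \<theta> "\<epsilon> / 3"] \<theta> e by auto
qed

subsection \<open>Convergence of mollifications in the mean\<close>

text \<open>A measurable function is an almost everywhere limit of continuous functions, but without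
  domination. Truncating \<open>g\<close> in value and in space first, and then the continuous
  approximants by the same truncation, makes both passages to the limit dominated.\<close>

lemma Cc_dense:
  fixes g :: "'a::euclidean_space \<Rightarrow> 'b::euclidean_space"
  assumes gm: "g \<in> borel_measurable borel" and p: "p \<ge> 1" and fin: "enp p UNIV g < \<infinity>" and e: "e > 0"
  obtains h r where "continuous_on UNIV h" "r > 0" "\<And>x. norm x \<ge> r \<Longrightarrow> h x = 0"
    "enp p UNIV (\<lambda>x. g x - h x) < ennreal e"
proof -
  have gl [measurable]: "g \<in> borel_measurable lebesgue" using gm by (intro measurable_completion) simp
  obtain N gn where N: "negligible N" and cont: "\<And>n. continuous_on UNIV (gn n)"
    and lim: "\<And>x. x \<notin> N \<Longrightarrow> (\<lambda>n. gn n x) \<longlonglongrightarrow> g x"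
    using lebesgue_measurable_imp_measurable_on[OF gl, of UNIV] unfolding measurable_on_def by auto
  have gnm [measurable]: "gn n \<in> borel_measurable lebesgue" for n
    using borel_measurable_continuous_onI[OF cont[of n]] by (intro measurable_completion) simp
  \<comment> \<open>\<open>tr m\<close> is the radial retraction onto the ball of radius m;
    \<open>cu m\<close> below is a continuous cutoff that is 1 where the norm is at most m and 0
    from m + 1 on.\<close>
  define tr where "tr m v = (m / max m (norm v)) *\<^sub>R v" for m :: real and v :: 'b
  have tr_cont: "continuous_on UNIV (tr m)" if "m > 0" for m
    unfolding tr_def[abs_def] using that by (intro continuous_intros) auto
  have tr_le: "norm (tr m v) \<le> m" if "m > 0" for m v
    unfolding tr_def using that by (auto simp: max_def field_simps)
  have tr_id: "tr m v = v" if "norm v \<le> m" "m > 0" for m v using that by (simp add: tr_def max_def)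
  define cu where "cu m x = max 0 (min 1 (m + 1 - norm x))" for m :: real and x :: 'a
  have cu: "0 \<le> cu m x" "cu m x \<le> 1" for m x by (auto simp: cu_def)
  have cu_cont: "continuous_on UNIV (cu m)" for m unfolding cu_def[abs_def] by (intro continuous_intros)
  define M where "M m = real (Suc m)" for m
  have M: "M m > 0" for m by (simp add: M_def)
  define G where "G m v x = cu (M m) x *\<^sub>R tr (M m) (v x)" for m and v :: "'a \<Rightarrow> 'b" and x
  have Gm: "G m v \<in> borel_measurable lebesgue" if [measurable]: "v \<in> borel_measurable lebesgue" for m v
  proof -
    have [measurable]: "tr (M m) \<in> borel_measurable borel"
      by (intro borel_measurable_continuous_onI tr_cont M)
    have [measurable]: "cu (M m) \<in> borel_measurable lebesgue"
      using borel_measurable_continuous_onI[OF cu_cont[of "M m"]] by (intro measurable_completion) simp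
    show ?thesis unfolding G_def[abs_def] by measurable
  qed
  have Ggm [measurable]: "G m g \<in> borel_measurable lebesgue" for m by (rule Gm) simp
  have Gnm [measurable]: "G m (gn n) \<in> borel_measurable lebesgue" for m n by (rule Gm) simp
  define \<eta> where "\<eta> = e / (4 * 2 powr p)"
  have \<eta>: "\<eta> > 0" using e by (simp add: \<eta>_def)
  have "(\<lambda>m. \<integral>\<^sup>+x. ennreal (norm (g x - G m g x) powr p) \<partial>lebesgue) \<longlonglongrightarrow> (\<integral>\<^sup>+x. 0 \<partial>(lebesgue :: 'a measure))"
  proof (rule nn_integral_dominated_convergence[where w="\<lambda>x. ennreal (norm (g x) powr p)"])
    show "AE x in lebesgue. ennreal (norm (g x - G m g x) powr p) \<le> ennreal (norm (g x) powr p)" for m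
    proof (rule AE_I2)
      fix x
      let ?c = "cu (M m) x * (M m / max (M m) (norm (g x)))"
      have q: "0 \<le> M m / max (M m) (norm (g x))" "M m / max (M m) (norm (g x)) \<le> 1"
        using M[of m] by (auto simp: divide_le_eq_1_pos)
      have c: "0 \<le> ?c" "?c \<le> 1"
        by (rule mult_nonneg_nonneg[OF cu(1) q(1)], rule mult_le_one[OF cu(2) q])
      have "g x - G m g x = (1 - ?c) *\<^sub>R g x" by (simp add: G_def tr_def scaleR_diff_left)
      then have "norm (g x - G m g x) \<le> norm (g x)" using c by (simp add: mult_left_le_one_le)
      then show "ennreal (norm (g x - G m g x) powr p) \<le> ennreal (norm (g x) powr p)"
        using p by (intro ennreal_leI powr_mono2) auto
    qed
    show "(\<integral>\<^sup>+x. ennreal (norm (g x) powr p) \<partial>lebesgue) < \<infinity>"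
      using fin by (simp add: enp_UNIV nn_integral_completion)
    show "AE x in lebesgue. (\<lambda>m. ennreal (norm (g x - G m g x) powr p)) \<longlonglongrightarrow> 0"
    proof (rule AE_I2)
      fix x
      obtain n where n: "real n > max (norm x) (norm (g x))" using reals_Archimedean2 by blast
      have "ennreal (norm (g x - G m g x) powr p) = 0" if "m \<ge> n" for m
      proof -
        have "norm x \<le> M m" "norm (g x) \<le> M m" using n that by (auto simp: M_def)
        then have "G m g x = g x" unfolding G_def using tr_id[OF _ M] by (simp add: cu_def)
        then show ?thesis by simp
      qed
      then have "\<forall>\<^sub>F m in sequentially. ennreal (norm (g x - G m g x) powr p) = 0"
        unfolding eventually_sequentially by blast
      then show "(\<lambda>m. ennreal (norm (g x - G m g x) powr p)) \<longlonglongrightarrow> 0" by (rule tendsto_eventually)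
    qed
  qed auto
  then have "\<forall>\<^sub>F m in sequentially. (\<integral>\<^sup>+x. ennreal (norm (g x - G m g x) powr p) \<partial>lebesgue) < ennreal \<eta>"
    using \<eta> by (intro order_tendstoD(2)) auto
  then obtain m where m: "(\<integral>\<^sup>+x. ennreal (norm (g x - G m g x) powr p) \<partial>lebesgue) < ennreal \<eta>"
    using eventually_happens'[OF sequentially_bot] by blast
  have z: "G m v x = 0" if "norm x \<ge> M m + 1" for v x using that by (simp add: G_def cu_def)
  have "(\<lambda>n. \<integral>\<^sup>+x. ennreal (norm (G m g x - G m (gn n) x) powr p) \<partial>lebesgue) \<longlonglongrightarrow> (\<integral>\<^sup>+x. 0 \<partial>(lebesgue :: 'a measure))"
  proof (rule nn_integral_dominated_convergence[where w="\<lambda>x. ennreal ((2 * M m) powr p) * indicator (cball 0 (M m + 1)) x"])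
    have Gle: "norm (G m v x) \<le> M m" for v x
    proof -
      have "norm (G m v x) \<le> 1 * M m"
        unfolding G_def norm_scaleR using cu[of "M m" x] tr_le[OF M] by (intro mult_mono) auto
      then show ?thesis by simp
    qed
    show "AE x in lebesgue. ennreal (norm (G m g x - G m (gn n) x) powr p)
       \<le> ennreal ((2 * M m) powr p) * indicator (cball 0 (M m + 1)) x" for n
    proof (rule AE_I2)
      fix x
      have "norm (G m g x - G m (gn n) x) \<le> 2 * M m"
        using norm_triangle_ineq4[of "G m g x" "G m (gn n) x"] Gle[of g x] Gle[of "gn n" x] by linarith
      then have "norm (G m g x - G m (gn n) x) powr p \<le> (2 * M m) powr p"
        using p by (intro powr_mono2) auto
      then show "ennreal (norm (G m g x - G m (gn n) x) powr p)
       \<le> ennreal ((2 * M m) powr p) * indicator (cball 0 (M m + 1)) x"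
        using z[of x] by (cases "x \<in> cball 0 (M m + 1)") (auto intro!: ennreal_leI)
    qed
    show "(\<integral>\<^sup>+x. ennreal ((2 * M m) powr p) * indicator (cball (0::'a) (M m + 1)) x \<partial>lebesgue) < \<infinity>"
      using emeasure_lborel_cball_finite[of "0::'a" "M m + 1"]
      by (subst nn_integral_cmult_indicator) (auto simp: ennreal_mult_less_top)
    have "AE x in lebesgue. x \<notin> N"
      using N by (intro AE_not_in) (simp add: negligible_iff_null_sets)
    then show "AE x in lebesgue. (\<lambda>n. ennreal (norm (G m g x - G m (gn n) x) powr p)) \<longlonglongrightarrow> 0"
    proof eventually_elim
      case (elim x)
      have "isCont (tr (M m)) (g x)" using tr_cont[OF M] by (simp add: continuous_on_eq_continuous_at)
      then have "(\<lambda>n. tr (M m) (gn n x)) \<longlonglongrightarrow> tr (M m) (g x)"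
        by (rule isCont_tendsto_compose[OF _ lim[OF elim]])
      then have "(\<lambda>n. norm (G m g x - G m (gn n) x)) \<longlonglongrightarrow> norm (G m g x - G m g x)"
        unfolding G_def by (intro tendsto_intros)
      then have "(\<lambda>n. norm (G m g x - G m (gn n) x) powr p) \<longlonglongrightarrow> 0 powr p"
        using p by (intro tendsto_powr') auto
      then have "(\<lambda>n. ennreal (norm (G m g x - G m (gn n) x) powr p)) \<longlonglongrightarrow> ennreal (0 powr p)"
        by (rule tendsto_ennrealI)
      then show ?case by simp
    qed
    show "(\<lambda>x. ennreal (norm (G m g x - G m (gn n) x) powr p)) \<in> borel_measurable lebesgue" for n
      by measurable
    show "(\<lambda>x. ennreal ((2 * M m) powr p) * indicator (cball (0::'a) (M m + 1)) x) \<in> borel_measurable lebesgue"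
      by (intro borel_measurable_times_ennreal borel_measurable_indicator) auto
  qed simp
  then have "\<forall>\<^sub>F n in sequentially. (\<integral>\<^sup>+x. ennreal (norm (G m g x - G m (gn n) x) powr p) \<partial>lebesgue) < ennreal \<eta>"
    using \<eta> by (intro order_tendstoD(2)) auto
  then obtain n where n: "(\<integral>\<^sup>+x. ennreal (norm (G m g x - G m (gn n) x) powr p) \<partial>lebesgue) < ennreal \<eta>"
    using eventually_happens'[OF sequentially_bot] by blast
  show ?thesis
  proof (rule that[of "G m (gn n)" "M m + 1"])
    have "continuous_on UNIV (\<lambda>x. tr (M m) (gn n x))"
      by (rule continuous_on_compose2[OF tr_cont[OF M] cont]) auto
    then show "continuous_on UNIV (G m (gn n))"
      unfolding G_def[abs_def] by (intro continuous_intros cu_cont)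
    have "enp p UNIV (\<lambda>x. (g x - G m g x) + (G m g x - G m (gn n) x))
       \<le> ennreal (2 powr p) * (enp p UNIV (\<lambda>x. g x - G m g x) + enp p UNIV (\<lambda>x. G m g x - G m (gn n) x))"
      by (rule enp_add[OF _ _ p]) simp_all
    also have "\<dots> \<le> ennreal (2 powr p) * (ennreal \<eta> + ennreal \<eta>)"
      using m n by (intro mult_left_mono add_mono) (auto simp: enp_UNIV nn_integral_completion)
    also have "\<dots> = ennreal (e / 2)"
      using \<eta> by (simp add: ennreal_plus[symmetric] ennreal_mult[symmetric] \<eta>_def del: ennreal_plus)
    also have "\<dots> < ennreal e" using e by (intro ennreal_lessI) auto
    finally show "enp p UNIV (\<lambda>x. g x - G m (gn n) x) < ennreal e" by simp
  qed (use M z in \<open>auto simp: add_pos_nonneg\<close>)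
qed

text \<open>Uniform continuity settles the claim for continuous functions of compact support;
  density and the contraction property \<open>enp_conv_le\<close> carry it over.\<close>

lemma conv_converges:
  fixes g :: "'a::euclidean_space \<Rightarrow> 'b::euclidean_space"
  assumes gm: "g \<in> borel_measurable borel" and p: "p \<ge> 1" and fin: "enp p UNIV g < \<infinity>" and e: "e > 0"
  obtains \<delta>0 where "\<delta>0 > 0"
    "\<And>\<delta> \<phi>. \<delta> \<le> \<delta>0 \<Longrightarrow> mollifier \<delta> \<phi> \<Longrightarrow> enp p UNIV (\<lambda>x. conv \<phi> g x - g x) \<le> ennreal e"
proof -
  \<comment> \<open>Two uses of \<open>enp_add\<close> put factors of at most 2^p 2^p on three
    errors of size e1.\<close>
  define e1 where "e1 = e / (3 * (2 powr p * 2 powr p))"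
  have e1: "e1 > 0" using e by (simp add: e1_def)
  obtain h r where h: "continuous_on UNIV h" "r > 0" "\<And>x. norm x \<ge> r \<Longrightarrow> h x = 0"
    "enp p UNIV (\<lambda>x. g x - h x) < ennreal e1" using Cc_dense[OF gm p fin e1] by metis
  have hm [measurable]: "h \<in> borel_measurable borel" using h(1) by (rule borel_measurable_continuous_onI)
  have m: "f \<in> borel_measurable (lebesgue_on UNIV)" if "f \<in> borel_measurable borel" for f :: "'a \<Rightarrow> 'b"
    using that by (intro measurable_restrict_space1 measurable_completion) simp
  have lg: "loc_int g" using enp_loc_int[OF gm p fin] .
  have lh: "loc_int h" unfolding loc_int_def
  proof (intro conjI allI hm)
    fix x :: 'a and s
    have "compact (h ` cball 0 r)" by (intro compact_continuous_image continuous_on_subset[OF h(1)]) auto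
    then obtain B where B: "B > 0" "\<And>x. norm x \<le> r \<Longrightarrow> norm (h x) \<le> B"
      using compact_imp_bounded[of "h ` cball 0 r"] by (auto simp: bounded_pos)
    have "norm (h x) \<le> B" for x using B h(3)[of x] by (cases "norm x \<le> r") auto
    then have "(\<integral>\<^sup>+y\<in>cball x s. ennreal (norm (h y)) \<partial>lborel) \<le> (\<integral>\<^sup>+y. ennreal B * indicator (cball x s) y \<partial>lborel)"
      by (intro nn_integral_mono mult_right_mono) (auto intro: ennreal_leI)
    also have "\<dots> < \<infinity>"
      using emeasure_lborel_cball_finite[of x s] by (simp add: nn_integral_cmult_indicator ennreal_mult_less_top)
    finally show "(\<integral>\<^sup>+y\<in>cball x s. ennreal (norm (h y)) \<partial>lborel) < \<infinity>" .
  qed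
  define V where "V = measure lborel (cball (0::'a) (r + 1))"
  have V: "V \<ge> 0" by (simp add: V_def)
  \<comment> \<open>A uniform error \<eta> on a ball of volume V contributes \<eta>^p V, which this
    choice keeps below e1. Only V \<ge> 0 is recorded, hence V + 1 in the denominator.\<close>
  define \<eta> where "\<eta> = (e1 / (V + 1)) powr (1 / p)"
  have \<eta>: "\<eta> > 0" using e1 V by (simp add: \<eta>_def)
  have "uniformly_continuous_on (cball 0 (r + 1)) h"
    by (intro compact_uniformly_continuous continuous_on_subset[OF h(1)]) auto
  then obtain d where d: "d > 0" "\<And>x y. x \<in> cball 0 (r + 1) \<Longrightarrow> y \<in> cball 0 (r + 1) \<Longrightarrow> dist x y < d \<Longrightarrow> dist (h x) (h y) < \<eta>"
    unfolding uniformly_continuous_on_def using \<eta> by (metis dist_commute)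
  define \<delta>0 where "\<delta>0 = min d 1"
  have unif: "norm (h y - h x) \<le> \<eta>" if "dist x y < \<delta>0" for x y
  proof (cases "norm x > r + 1 \<or> norm y > r + 1")
    case True
    have "norm (x - y) < 1" using that by (simp add: \<delta>0_def dist_norm)
    then have "norm x \<ge> r" "norm y \<ge> r"
      using True norm_triangle_ineq2[of x y] norm_triangle_ineq2[of y x] by (auto simp: norm_minus_commute)
    then show ?thesis using h(3) \<eta> by simp
  next
    case False
    then show ?thesis using d(2)[of x y] that by (simp add: \<delta>0_def dist_norm norm_minus_commute)
  qed
  show ?thesis
  proof (rule that[of \<delta>0])
    show "\<delta>0 > 0" using d by (simp add: \<delta>0_def)
    fix \<delta> :: real and \<phi> :: "'a \<Rightarrow> real"
    assume \<delta>: "\<delta> \<le> \<delta>0" and mo: "mollifier \<delta> \<phi>"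
    note mD = mollifierD[OF mo]
    have cm: "conv \<phi> f \<in> borel_measurable borel" if "loc_int f" for f :: "'a \<Rightarrow> 'b"
      by (rule C_infinity_borel[OF conv_C_infinity[OF mD(2) that]])
    have lc: "loc_int (\<lambda>_::'a. c)" for c :: 'b
      unfolding loc_int_def using emeasure_lborel_cball_finite
      by (auto simp: nn_integral_cmult_indicator ennreal_mult_less_top)
    have 1: "norm (conv \<phi> h x - h x) \<le> \<eta>" for x
    proof -
      have "conv \<phi> h x - h x = conv \<phi> (\<lambda>y. h y - h x) x"
        by (simp add: conv_diff[OF mD(2) lh lc] conv_const[OF mo])
      also have "norm \<dots> \<le> \<eta>"
      proof (rule conv_norm_le[OF mo])
        show "loc_int (\<lambda>y. h y - h x)" unfolding loc_int_def
        proof (intro conjI allI)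
          fix z :: 'a and s
          have "(\<integral>\<^sup>+y\<in>cball z s. ennreal (norm (h y - h x)) \<partial>lborel)
             \<le> (\<integral>\<^sup>+y. ennreal (norm (h y)) * indicator (cball z s) y + ennreal (norm (h x)) * indicator (cball z s) y \<partial>lborel)"
            by (intro nn_integral_mono)
              (auto simp: indicator_def ennreal_plus[symmetric] norm_triangle_ineq4 simp del: ennreal_plus intro!: ennreal_leI)
          also have "\<dots> = (\<integral>\<^sup>+y\<in>cball z s. ennreal (norm (h y)) \<partial>lborel) + (\<integral>\<^sup>+y\<in>cball z s. ennreal (norm (h x)) \<partial>lborel)"
            by (rule nn_integral_add) measurable
          also have "\<dots> < \<infinity>" using lh lc[of "h x"] unfolding loc_int_def by simp
          finally show "(\<integral>\<^sup>+y\<in>cball z s. ennreal (norm (h y - h x)) \<partial>lborel) < \<infinity>" .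
        qed (use hm in measurable)
        show "norm (h y - h x) \<le> \<eta>" if "dist x y < \<delta>" for y using unif that \<delta> by force
      qed (use \<eta> in auto)
      finally show ?thesis .
    qed
    have 2: "conv \<phi> h x - h x = 0" if "x \<notin> cball 0 (r + 1)" for x
    proof -
      have "conv \<phi> h x = 0"
      proof (rule conv_eq_0[of \<delta>])
        fix y assume "dist x y < \<delta>"
        then have "norm (x - y) < 1" using \<delta> by (simp add: \<delta>0_def dist_norm)
        then have "norm y \<ge> r" using that norm_triangle_ineq2[of x y] by (auto simp: dist_norm)
        then show "h y = 0" by (rule h(3))
      qed (use mD in auto)
      then show ?thesis using h(3)[of x] that by (simp add: dist_norm)
    qed
    have "enp p UNIV (\<lambda>x. conv \<phi> h x - h x) \<le> (\<integral>\<^sup>+x. ennreal (\<eta> powr p) * indicator (cball (0::'a) (r + 1)) x \<partial>lborel)"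
      unfolding enp_UNIV
    proof (rule nn_integral_mono)
      fix x show "ennreal (norm (conv \<phi> h x - h x) powr p) \<le> ennreal (\<eta> powr p) * indicator (cball (0::'a) (r + 1)) x"
        using 1[of x] 2[of x] p
        by (cases "x \<in> cball 0 (r + 1)") (auto intro!: ennreal_leI powr_mono2)
    qed
    also have "\<dots> = ennreal (\<eta> powr p) * ennreal V"
      unfolding V_def using emeasure_lborel_cball_finite[of "0::'a" "r + 1"]
      by (simp add: nn_integral_cmult_indicator emeasure_eq_ennreal_measure)
    also have "\<dots> = ennreal (e1 / (V + 1) * V)"
      using p e1 V by (simp add: \<eta>_def powr_powr ennreal_mult[symmetric])
    also have "\<dots> \<le> ennreal e1" using e1 V by (intro ennreal_leI) (simp add: field_simps)
    finally have 3: "enp p UNIV (\<lambda>x. conv \<phi> h x - h x) \<le> ennreal e1" .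
    have lgh: "loc_int (\<lambda>x. g x - h x)"
      by (rule enp_loc_int[OF _ p less_trans[OF h(4)]]) (use gm hm in auto)
    have "enp p UNIV (conv \<phi> (\<lambda>x. g x - h x)) \<le> enp p UNIV (\<lambda>x. g x - h x)"
      by (rule enp_conv_le[OF mo lgh p]) auto
    then have 4: "enp p UNIV (\<lambda>x. conv \<phi> g x - conv \<phi> h x) \<le> ennreal e1"
      using h(4) by (simp add: conv_diff[OF mD(2) lg lh, abs_def])
    have 5: "enp p UNIV (\<lambda>x. h x - g x) \<le> ennreal e1"
      using h(4) enp_uminus[of p UNIV "\<lambda>x. g x - h x"] by simp
    have "enp p UNIV (\<lambda>x. (conv \<phi> g x - conv \<phi> h x) + ((conv \<phi> h x - h x) + (h x - g x)))
      \<le> ennreal (2 powr p) * (enp p UNIV (\<lambda>x. conv \<phi> g x - conv \<phi> h x) + enp p UNIV (\<lambda>x. (conv \<phi> h x - h x) + (h x - g x)))"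
      by (rule enp_add[OF _ _ p]) (use cm[OF lg] cm[OF lh] hm gm in \<open>auto intro!: m borel_measurable_diff borel_measurable_add\<close>)
    also have "\<dots> \<le> ennreal (2 powr p) * (ennreal e1 + ennreal (2 powr p) * (ennreal e1 + ennreal e1))"
    proof (intro mult_left_mono add_mono 4)
      have "enp p UNIV (\<lambda>x. (conv \<phi> h x - h x) + (h x - g x))
        \<le> ennreal (2 powr p) * (enp p UNIV (\<lambda>x. conv \<phi> h x - h x) + enp p UNIV (\<lambda>x. h x - g x))"
        by (rule enp_add[OF _ _ p]) (use cm[OF lg] cm[OF lh] hm gm in \<open>auto intro!: m borel_measurable_diff borel_measurable_add\<close>)
      also have "\<dots> \<le> ennreal (2 powr p) * (ennreal e1 + ennreal e1)"
        by (intro mult_left_mono add_mono 3 5) auto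
      finally show "enp p UNIV (\<lambda>x. (conv \<phi> h x - h x) + (h x - g x)) \<le> \<dots>" .
    qed auto
    also have "\<dots> = ennreal (2 powr p * (e1 + 2 powr p * (e1 + e1)))"
      using e1 by (simp add: ennreal_plus[symmetric] ennreal_mult[symmetric] del: ennreal_plus)
    also have "\<dots> \<le> ennreal e"
    proof (rule ennreal_leI)
      have "1 \<le> (2::real) powr p" using p by (simp add: ge_one_powr_ge_zero)
      then have "2 powr p * (e1 + 2 powr p * (e1 + e1)) \<le> 2 powr p * (2 powr p * e1 + 2 powr p * (e1 + e1))"
        using e1 by (intro mult_left_mono add_mono) (auto simp: mult_le_cancel_right1)
      also have "\<dots> = e" by (simp add: e1_def field_simps)
      finally show "2 powr p * (e1 + 2 powr p * (e1 + e1)) \<le> e" .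
    qed
    finally show "enp p UNIV (\<lambda>x. conv \<phi> g x - g x) \<le> ennreal e" by simp
  qed
qed

subsection \<open>The fundamental lemma of the calculus of variations\<close>

lemma integrable_lebesgue_on_subset:
  fixes f :: "'a::euclidean_space \<Rightarrow> 'b::euclidean_space"
  assumes "integrable (lebesgue_on K) f" "K \<in> sets lebesgue" "K \<subseteq> \<Omega>" "\<Omega> \<in> sets lebesgue"
  shows "integrable (lebesgue_on \<Omega>) (\<lambda>x. indicator K x *\<^sub>R f x)"
    "(\<integral>x. indicator K x *\<^sub>R f x \<partial>lebesgue_on \<Omega>) = (\<integral>x. f x \<partial>lebesgue_on K)"
proof -
  have eq: "indicator \<Omega> x *\<^sub>R indicator K x *\<^sub>R f x = indicator K x *\<^sub>R f x" for x
    using assms(3) by (auto simp: indicator_def)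
  show "integrable (lebesgue_on \<Omega>) (\<lambda>x. indicator K x *\<^sub>R f x)"
    using assms by (simp add: integrable_restrict_space eq del: scaleR_scaleR)
  show "(\<integral>x. indicator K x *\<^sub>R f x \<partial>lebesgue_on \<Omega>) = (\<integral>x. f x \<partial>lebesgue_on K)"
    using assms by (simp add: integral_restrict_space eq del: scaleR_scaleR)
qed

text \<open>Cutoffs shrinking to a compact set show that \<open>f\<close> has integral 0 over every
  compact subset. The set where a component of \<open>f\<close> is positive is, up to a null set, a
  countable union of compact sets, and on each of these a positive function with integral 0 forces
  measure 0.\<close>

lemma fundamental_lemma:
  fixes f :: "'a::euclidean_space \<Rightarrow> 'b::euclidean_space"
  assumes \<Omega>: "open \<Omega>" and fm [measurable]: "f \<in> borel_measurable (lebesgue_on \<Omega>)"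
    and li: "\<And>K. compact K \<Longrightarrow> K \<subseteq> \<Omega> \<Longrightarrow> integrable (lebesgue_on K) f"
    and z: "\<And>\<phi> :: 'a \<Rightarrow> real. \<phi> \<in> C0_infinity \<Omega> \<Longrightarrow> (\<integral>x. \<phi> x *\<^sub>R f x \<partial>lebesgue_on \<Omega>) = 0"
  shows "AE x in lebesgue_on \<Omega>. f x = 0"
proof -
  have \<Omega>l: "\<Omega> \<in> sets lebesgue" using \<Omega> by auto
  have int0: "(\<integral>x. f x \<partial>lebesgue_on K) = 0" if K: "compact K" "K \<subseteq> \<Omega>" for K
  proof -
    obtain \<epsilon> where e: "\<epsilon> > 0" "closure (nhd K \<epsilon>) \<subseteq> \<Omega>" "compact (closure (nhd K \<epsilon>))"
      using compact_nhd_subset[OF K(1) \<Omega> K(2)] .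
    define K' where "K' = closure (nhd K \<epsilon>)"
    define d where "d n = \<epsilon> / (3 * real (Suc n))" for n
    have d: "d n > 0" "3 * d n \<le> \<epsilon>" for n using e by (auto simp: d_def field_simps)
    have "\<exists>\<theta> :: 'a \<Rightarrow> real. C_infinity \<theta> \<and> (\<forall>x. 0 \<le> \<theta> x \<and> \<theta> x \<le> 1) \<and> (\<forall>x\<in>nhd K (d n). \<theta> x = 1) \<and>
      (\<forall>x. x \<notin> nhd K (3 * d n) \<longrightarrow> \<theta> x = 0)" for n
      using smooth_cutoff[of 0] d(1) by metis
    then obtain \<theta> :: "nat \<Rightarrow> 'a \<Rightarrow> real" where \<theta>: "\<And>n. C_infinity (\<theta> n)" "\<And>n x. 0 \<le> \<theta> n x" "\<And>n x. \<theta> n x \<le> 1"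
      "\<And>n x. x \<in> nhd K (d n) \<Longrightarrow> \<theta> n x = 1" "\<And>n x. x \<notin> nhd K (3 * d n) \<Longrightarrow> \<theta> n x = 0" by metis
    have sub: "nhd K (3 * d n) \<subseteq> K'" for n
      unfolding K'_def using nhd_mono[OF d(2)[of n], of K] closure_subset by blast
    have C0: "\<theta> n \<in> C0_infinity \<Omega>" for n
      by (rule C0_infinityI[of _ K']) (use \<theta>(1,5) sub e K'_def in blast)+
    have K': "compact K'" "K' \<subseteq> \<Omega>" "K' \<in> sets lebesgue" using e by (auto simp: K'_def)
    have Kl: "K \<in> sets lebesgue" using compact_imp_closed[OF K(1)] by auto
    have \<theta>m: "\<theta> n \<in> borel_measurable (lebesgue_on \<Omega>)" for n
      by (intro measurable_restrict_space1 measurable_completion) (use C_infinity_borel[OF \<theta>(1)] in simp)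
    have "(\<lambda>n. \<integral>x. \<theta> n x *\<^sub>R f x \<partial>lebesgue_on \<Omega>) \<longlonglongrightarrow> (\<integral>x. indicator K x *\<^sub>R f x \<partial>lebesgue_on \<Omega>)"
    proof (rule integral_dominated_convergence[where w="\<lambda>x. norm (indicator K' x *\<^sub>R f x)"])
      show "(\<lambda>x. indicator K x *\<^sub>R f x) \<in> borel_measurable (lebesgue_on \<Omega>)"
        using integrable_lebesgue_on_subset(1)[OF li[OF K] Kl K(2) \<Omega>l] by (rule borel_measurable_integrable)
      show "(\<lambda>x. \<theta> n x *\<^sub>R f x) \<in> borel_measurable (lebesgue_on \<Omega>)" for n
        using \<theta>m[of n] by measurable
      show "integrable (lebesgue_on \<Omega>) (\<lambda>x. norm (indicator K' x *\<^sub>R f x))"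
        by (rule integrable_norm, rule integrable_lebesgue_on_subset(1)[OF li[OF K'(1,2)] K'(3,2) \<Omega>l])
      show "AE x in lebesgue_on \<Omega>. norm (\<theta> n x *\<^sub>R f x) \<le> norm (indicator K' x *\<^sub>R f x)" for n
      proof (rule AE_I2)
        fix x show "norm (\<theta> n x *\<^sub>R f x) \<le> norm (indicator K' x *\<^sub>R f x)"
        proof (cases "x \<in> K'")
          case False
          then have "\<theta> n x = 0" using \<theta>(5) sub by blast
          then show ?thesis by simp
        qed (use \<theta>(2,3)[of n x] in \<open>auto simp: mult_left_le_one_le\<close>)
      qed
      show "AE x in lebesgue_on \<Omega>. (\<lambda>n. \<theta> n x *\<^sub>R f x) \<longlonglongrightarrow> indicator K x *\<^sub>R f x"
      proof (rule AE_I2)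
        fix x
        have "\<forall>\<^sub>F n in sequentially. \<theta> n x = indicator K x"
        proof (cases "x \<in> K")
          case True
          then have "\<theta> n x = 1" for n using \<theta>(4) subset_nhd[OF d(1)] by blast
          then show ?thesis using True by simp
        next
          case False
          then have "open (- K)" "x \<in> - K" using compact_imp_closed[OF K(1)] by auto
          then obtain r where r: "r > 0" "ball x r \<subseteq> - K" using open_contains_ball by metis
          have "d \<longlonglongrightarrow> 0"             using tendsto_mult[OF tendsto_const[of "\<epsilon> / 3"] LIMSEQ_inverse_real_of_nat]
            by (simp add: d_def[abs_def] field_simps)
          then have "\<forall>\<^sub>F n in sequentially. d n < r / 3" using r by (intro order_tendstoD(2)) auto
          then show ?thesis
          proof eventually_elim
            case (elim n)
            have "x \<notin> nhd K (3 * d n)"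
              using r(2) elim by (force simp: nhd_def dist_commute)
            then show ?case using \<theta>(5) False by simp
          qed
        qed
        then have "\<forall>\<^sub>F n in sequentially. \<theta> n x *\<^sub>R f x = indicator K x *\<^sub>R f x"
          by eventually_elim simp
        then show "(\<lambda>n. \<theta> n x *\<^sub>R f x) \<longlonglongrightarrow> indicator K x *\<^sub>R f x" by (rule tendsto_eventually)
      qed
    qed
    then have "(\<integral>x. indicator K x *\<^sub>R f x \<partial>lebesgue_on \<Omega>) = 0"
      using z[OF C0] by (simp add: LIMSEQ_const_iff)
    then show ?thesis using integrable_lebesgue_on_subset(2)[OF li[OF K] Kl K(2) \<Omega>l] by simp
  qed
  have null: "{x \<in> \<Omega>. f x \<bullet> c > 0} \<in> null_sets lebesgue" for c
  proof -
    let ?A = "{x \<in> \<Omega>. f x \<bullet> c > 0}"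
    have "{x \<in> space (lebesgue_on \<Omega>). f x \<bullet> c > 0} \<in> sets (lebesgue_on \<Omega>)" by measurable
    then have A: "?A \<in> sets lebesgue"
      using \<Omega>l by (auto simp: space_restrict_space sets_restrict_space_iff)
    have Knull: "K \<in> null_sets lebesgue" if K: "compact K" "K \<subseteq> ?A" for K
    proof -
      have K\<Omega>: "K \<subseteq> \<Omega>" using K by auto
      have Kl: "K \<in> sets lebesgue" using compact_imp_closed[OF K(1)] by auto
      have i: "integrable (lebesgue_on K) f" by (rule li[OF K(1) K\<Omega>])
      have ii: "integrable (lebesgue_on K) (\<lambda>x. f x \<bullet> c)" using i by simp
      have "(\<integral>x. f x \<bullet> c \<partial>lebesgue_on K) = 0" using int0[OF K(1) K\<Omega>] i by simp
      then have "AE x in lebesgue_on K. f x \<bullet> c = 0"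
        using K(2) by (subst (asm) integral_nonneg_eq_0_iff_AE[OF ii])
          (auto intro!: AE_I2 simp: space_restrict_space intro: less_imp_le)
      then have "AE x in lebesgue. x \<notin> K"
        using Kl K(2) by (subst (asm) AE_restrict_space_iff) (auto elim!: eventually_mono)
      then show ?thesis using Kl by (simp add: AE_iff_null_sets)
    qed
    obtain C T where CT: "fsigma C" "T \<in> null_sets lebesgue" "C \<union> T = ?A"
      using lebesgue_set_almost_fsigma[OF A] by metis
    then obtain F :: "nat \<Rightarrow> 'a set" where F: "range F \<subseteq> Collect compact" "C = \<Union>(range F)"
      using fsigma_Union_compact by metis
    have "F n \<in> null_sets lebesgue" for n by (rule Knull) (use F CT in auto)
    then have "C \<in> null_sets lebesgue" unfolding F(2) by (intro null_sets_UN) auto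
    then show ?thesis using CT by (metis null_sets.Un)
  qed
  \<comment> \<open>Using c and -c excludes positive as well as negative components.\<close>
  have "AE x in lebesgue. \<forall>c\<in>Basis. x \<notin> {x \<in> \<Omega>. f x \<bullet> c > 0} \<and> x \<notin> {x \<in> \<Omega>. f x \<bullet> (- c) > 0}"
    by (intro AE_finite_allI AE_conjI AE_not_in null) auto
  then have "AE x in lebesgue. x \<in> \<Omega> \<longrightarrow> f x = 0"
  proof eventually_elim
    case (elim x)
    then show ?case by (auto intro!: euclidean_eqI[where 'a='b] simp: not_less antisym)
  qed
  then show ?thesis using \<Omega>l by (subst AE_restrict_space_iff) auto
qed

subsection \<open>Weak derivatives\<close>

lemma Lp_space_iff:
  "f \<in> Lp_space p \<Omega> \<longleftrightarrow> f \<in> borel_measurable (lebesgue_on \<Omega>) \<and> enp p \<Omega> f < \<infinity>"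
  unfolding Lp_space_def enp_def
  by (auto simp: integrable_iff_bounded)

lemma lebesgue_on_mono:
  "f \<in> borel_measurable (lebesgue_on \<Omega>) \<Longrightarrow> S \<subseteq> \<Omega> \<Longrightarrow> f \<in> borel_measurable (lebesgue_on S)"
  by (rule measurable_restrict_mono)

lemma borel_lebesgue_on: "f \<in> borel_measurable borel \<Longrightarrow> f \<in> borel_measurable (lebesgue_on S)"
  by (intro measurable_restrict_space1 measurable_completion) simp

lemma Lp_add:
  assumes "f \<in> Lp_space p \<Omega>" "g \<in> Lp_space p \<Omega>" "p \<ge> 1"
  shows "(\<lambda>x. f x + g x) \<in> Lp_space p \<Omega>"
proof -
  have "enp p \<Omega> (\<lambda>x. f x + g x) \<le> ennreal (2 powr p) * (enp p \<Omega> f + enp p \<Omega> g)"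
    by (rule enp_add) (use assms in \<open>auto simp: Lp_space_iff\<close>)
  also have "\<dots> < \<infinity>" using assms by (simp add: Lp_space_iff ennreal_mult_less_top)
  finally show ?thesis using assms by (auto simp: Lp_space_iff)
qed

lemma Lp_scale:
  assumes "f \<in> Lp_space p \<Omega>" "h \<in> borel_measurable (lebesgue_on \<Omega>)"
    "\<And>x. x \<in> \<Omega> \<Longrightarrow> norm (h x) \<le> c * norm (f x)" "c \<ge> 0" "p \<ge> 1" "open \<Omega>"
  shows "h \<in> Lp_space p \<Omega>"
proof -
  have "enp p \<Omega> h \<le> ennreal (c powr p) * enp p \<Omega> f"
    by (rule enp_scale) (use assms in \<open>auto simp: Lp_space_iff\<close>)
  also have "\<dots> < \<infinity>" using assms by (simp add: Lp_space_iff ennreal_mult_less_top)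
  finally show ?thesis using assms by (auto simp: Lp_space_iff)
qed

lemma locally_integrableD:
  assumes "locally_integrable \<Omega> f"
  shows "f \<in> borel_measurable (lebesgue_on \<Omega>)" "compact K \<Longrightarrow> K \<subseteq> \<Omega> \<Longrightarrow> integrable (lebesgue_on K) f"
  using assms by (auto simp: locally_integrable_def)

lemma Lp_locally_integrable:
  assumes f: "f \<in> Lp_space p \<Omega>" and p: "p \<ge> 1" and \<Omega>: "open \<Omega>"
  shows "locally_integrable \<Omega> f"
  unfolding locally_integrable_def
proof (intro conjI allI impI)
  show fm: "f \<in> borel_measurable (lebesgue_on \<Omega>)" using f by (simp add: Lp_space_iff)
  fix K assume K: "compact K \<and> K \<subseteq> \<Omega>"
  have Kl: "K \<in> sets lebesgue" using compact_imp_closed[of K] K by auto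
  have fK: "f \<in> borel_measurable (lebesgue_on K)" using lebesgue_on_mono[OF fm] K by blast
  have "(\<integral>\<^sup>+y. ennreal (norm (f y)) \<partial>lebesgue_on K)
     \<le> ennreal 1 * emeasure lebesgue K + ennreal (1 powr (1 - p)) * enp p K f"
    by (rule nn_norm_le_enp[OF fK p _ Kl]) simp
  also have "\<dots> < \<infinity>"
  proof -
    have "enp p K f \<le> enp p \<Omega> f" by (rule enp_mono_set) (use Kl K \<Omega> in auto)
    then have "enp p K f < \<infinity>" using f by (auto simp: Lp_space_iff intro: le_less_trans)
    moreover have "emeasure lebesgue K < \<infinity>"
      using K lmeasurable_compact[of K] by (auto simp: fmeasurable_def)
    ultimately show ?thesis by simp
  qed
  finally show "integrable (lebesgue_on K) f" using fK by (intro integrableI_bounded) auto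
qed

lemma locally_integrable_add:
  assumes "locally_integrable \<Omega> f" "locally_integrable \<Omega> g"
  shows "locally_integrable \<Omega> (\<lambda>x. f x + g x)"
  using assms unfolding locally_integrable_def by auto

lemma locally_integrable_bounded_linear:
  assumes "bounded_linear L" "locally_integrable \<Omega> f"
  shows "locally_integrable \<Omega> (\<lambda>x. L (f x))"
  using assms unfolding locally_integrable_def
  by (auto intro!: integrable_bounded_linear[OF assms(1)] borel_measurable_continuous_onI
        measurable_compose[OF _ borel_measurable_continuous_onI[OF linear_continuous_on[OF assms(1)]]])

lemma locally_integrable_subset:
  assumes "locally_integrable \<Omega> f" "\<Omega>' \<subseteq> \<Omega>"
  shows "locally_integrable \<Omega>' f"
  using assms lebesgue_on_mono unfolding locally_integrable_def by blast

lemma locally_integrable_scaleR: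
  fixes f :: "'a::euclidean_space \<Rightarrow> 'b::euclidean_space" and \<eta> :: "'a \<Rightarrow> real"
  assumes f: "locally_integrable \<Omega> f" and \<eta>: "continuous_on UNIV \<eta>"
  shows "locally_integrable \<Omega> (\<lambda>x. \<eta> x *\<^sub>R f x)"
  unfolding locally_integrable_def
proof (intro conjI allI impI)
  have \<eta>m: "\<eta> \<in> borel_measurable (lebesgue_on S)" for S
    by (rule borel_lebesgue_on[OF borel_measurable_continuous_onI[OF \<eta>]])
  show "(\<lambda>x. \<eta> x *\<^sub>R f x) \<in> borel_measurable (lebesgue_on \<Omega>)"
    using \<eta>m[of \<Omega>] locally_integrableD(1)[OF f] by measurable
  fix K assume K: "compact K \<and> K \<subseteq> \<Omega>"
  have i: "integrable (lebesgue_on K) f" using locally_integrableD(2)[OF f] K by blast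
  have "compact (\<eta> ` K)" using K by (intro compact_continuous_image continuous_on_subset[OF \<eta>]) auto
  then obtain B where B: "\<And>x. x \<in> K \<Longrightarrow> norm (\<eta> x) \<le> B"
    using compact_imp_bounded bounded_iff by (metis imageI)
  show "integrable (lebesgue_on K) (\<lambda>x. \<eta> x *\<^sub>R f x)"
  proof (rule Bochner_Integration.integrable_bound)
    show "integrable (lebesgue_on K) (\<lambda>x. B * norm (f x))" using i by simp
    show "(\<lambda>x. \<eta> x *\<^sub>R f x) \<in> borel_measurable (lebesgue_on K)"
      using \<eta>m[of K] borel_measurable_integrable[OF i] by measurable
    show "AE x in lebesgue_on K. norm (\<eta> x *\<^sub>R f x) \<le> norm (B * norm (f x))"
    proof (rule AE_I2)
      fix x assume "x \<in> space (lebesgue_on K)"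
      then have "norm (\<eta> x) \<le> B" using B by (simp add: space_restrict_space)
      then have "norm (\<eta> x) * norm (f x) \<le> B * norm (f x)" by (intro mult_right_mono) auto
      then show "norm (\<eta> x *\<^sub>R f x) \<le> norm (B * norm (f x))" by simp
    qed
  qed
qed

lemma integral_lebesgue_on_supported:
  fixes h :: "'a::euclidean_space \<Rightarrow> 'b::euclidean_space"
  assumes "\<And>x. x \<in> \<Omega> \<Longrightarrow> x \<notin> K \<Longrightarrow> h x = 0" "K \<subseteq> \<Omega>" "K \<in> sets lebesgue" "\<Omega> \<in> sets lebesgue"
  shows "(\<integral>x. h x \<partial>lebesgue_on \<Omega>) = (\<integral>x. h x \<partial>lebesgue_on K)"
    "integrable (lebesgue_on \<Omega>) h \<longleftrightarrow> integrable (lebesgue_on K) h"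
proof -
  have "(\<lambda>x. indicator \<Omega> x *\<^sub>R h x) = (\<lambda>x. indicator K x *\<^sub>R h x)"
    using assms by (auto simp: indicator_def fun_eq_iff)
  then show "(\<integral>x. h x \<partial>lebesgue_on \<Omega>) = (\<integral>x. h x \<partial>lebesgue_on K)"
    "integrable (lebesgue_on \<Omega>) h \<longleftrightarrow> integrable (lebesgue_on K) h"
    using assms by (simp_all add: integral_restrict_space integrable_restrict_space)
qed

lemma test_integrable:
  fixes f :: "'a::euclidean_space \<Rightarrow> 'b::euclidean_space"
  assumes "locally_integrable \<Omega> f" "\<phi> \<in> C0_infinity \<Omega>" "open \<Omega>"
  shows "integrable (lebesgue_on \<Omega>) (\<lambda>x. \<phi> x *\<^sub>R f x)"
proof -
  note \<phi> = C0_infinity_D[OF assms(2)]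
  have "locally_integrable \<Omega> (\<lambda>x. \<phi> x *\<^sub>R f x)"
    by (rule locally_integrable_scaleR[OF assms(1) C_infinity_continuous[OF \<phi>(1)]])
  then have "integrable (lebesgue_on (supp \<phi>)) (\<lambda>x. \<phi> x *\<^sub>R f x)"
    using \<phi> locally_integrableD(2) by blast
  then show ?thesis
    by (subst integral_lebesgue_on_supported(2)[of _ "supp \<phi>"]) (use \<phi> assms in \<open>auto simp: supp_notin\<close>)
qed

lemma has_weak_derivD:
  assumes "has_weak_deriv \<Omega> u bs g"
  shows "locally_integrable \<Omega> u" "locally_integrable \<Omega> g"
    "\<phi> \<in> C0_infinity \<Omega> \<Longrightarrow> (\<integral>x. iter_pderiv bs \<phi> x *\<^sub>R u x \<partial>lebesgue_on \<Omega>)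
          = (-1) ^ length bs *\<^sub>R (\<integral>x. \<phi> x *\<^sub>R g x \<partial>lebesgue_on \<Omega>)"
  using assms by (auto simp: has_weak_deriv_def)

lemma has_weak_deriv_Nil: "locally_integrable \<Omega> u \<Longrightarrow> has_weak_deriv \<Omega> u [] u"
  by (simp add: has_weak_deriv_def)

text \<open>The difference of two weak derivatives is annihilated by every test function.\<close>

lemma has_weak_deriv_unique:
  assumes "has_weak_deriv \<Omega> u bs g" "has_weak_deriv \<Omega> u bs g'" "open \<Omega>"
  shows "AE x in lebesgue_on \<Omega>. g x = g' x"
proof -
  note l = has_weak_derivD(2)[OF assms(1)] has_weak_derivD(2)[OF assms(2)]
  have "AE x in lebesgue_on \<Omega>. g x - g' x = 0"
  proof (rule fundamental_lemma[OF assms(3)])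
    show "(\<lambda>x. g x - g' x) \<in> borel_measurable (lebesgue_on \<Omega>)"
      using l by (intro borel_measurable_diff locally_integrableD)
    show "integrable (lebesgue_on K) (\<lambda>x. g x - g' x)" if "compact K" "K \<subseteq> \<Omega>" for K
      using l that by (intro Bochner_Integration.integrable_diff locally_integrableD)
    fix \<phi> :: "'a \<Rightarrow> real" assume \<phi>: "\<phi> \<in> C0_infinity \<Omega>"
    have "(-1) ^ length bs *\<^sub>R (\<integral>x. \<phi> x *\<^sub>R g x \<partial>lebesgue_on \<Omega>)
        = (-1) ^ length bs *\<^sub>R (\<integral>x. \<phi> x *\<^sub>R g' x \<partial>lebesgue_on \<Omega>)"
      using has_weak_derivD(3)[OF assms(1) \<phi>] has_weak_derivD(3)[OF assms(2) \<phi>] by simp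
    then have "(\<integral>x. \<phi> x *\<^sub>R g x \<partial>lebesgue_on \<Omega>) = (\<integral>x. \<phi> x *\<^sub>R g' x \<partial>lebesgue_on \<Omega>)" by simp
    then show "(\<integral>x. \<phi> x *\<^sub>R (g x - g' x) \<partial>lebesgue_on \<Omega>) = 0"
      using test_integrable[OF l(1) \<phi> assms(3)] test_integrable[OF l(2) \<phi> assms(3)]
      by (simp add: scaleR_diff_right)
  qed
  then show ?thesis by simp
qed

lemma has_weak_deriv_cong_AE:
  assumes "has_weak_deriv \<Omega> u bs g" "AE x in lebesgue_on \<Omega>. u x = u' x" "AE x in lebesgue_on \<Omega>. g x = g' x"
    "locally_integrable \<Omega> u'" "locally_integrable \<Omega> g'" "set bs \<subseteq> Basis"
  shows "has_weak_deriv \<Omega> u' bs g'"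
  unfolding has_weak_deriv_def
proof (intro conjI allI impI assms)
  fix \<phi> :: "'a \<Rightarrow> real" assume \<phi>: "\<phi> \<in> C0_infinity \<Omega>"
  note l = has_weak_derivD(1,2)[OF assms(1)]
  have d: "iter_pderiv bs \<phi> \<in> C0_infinity \<Omega>" using C0_infinity_iter_pderiv[OF \<phi> assms(6)] .
  have m: "f \<in> borel_measurable (lebesgue_on \<Omega>)" if "f \<in> C0_infinity \<Omega>" for f :: "'a \<Rightarrow> real"
    by (rule borel_lebesgue_on[OF C_infinity_borel[OF C0_infinity_D(1)[OF that]]])
  have "(\<integral>x. iter_pderiv bs \<phi> x *\<^sub>R u' x \<partial>lebesgue_on \<Omega>) = (\<integral>x. iter_pderiv bs \<phi> x *\<^sub>R u x \<partial>lebesgue_on \<Omega>)"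
    by (intro integral_cong_AE borel_measurable_scaleR m[OF d] locally_integrableD(1)[OF l(1)] locally_integrableD(1)[OF assms(4)])
       (use assms(2) in \<open>auto elim!: eventually_mono\<close>)
  moreover have "(\<integral>x. \<phi> x *\<^sub>R g' x \<partial>lebesgue_on \<Omega>) = (\<integral>x. \<phi> x *\<^sub>R g x \<partial>lebesgue_on \<Omega>)"
    by (intro integral_cong_AE borel_measurable_scaleR m[OF \<phi>] locally_integrableD(1)[OF l(2)] locally_integrableD(1)[OF assms(5)])
       (use assms(3) in \<open>auto elim!: eventually_mono\<close>)
  ultimately show "(\<integral>x. iter_pderiv bs \<phi> x *\<^sub>R u' x \<partial>lebesgue_on \<Omega>)
      = (-1) ^ length bs *\<^sub>R (\<integral>x. \<phi> x *\<^sub>R g' x \<partial>lebesgue_on \<Omega>)"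
    using has_weak_derivD(3)[OF assms(1) \<phi>] by simp
qed

lemma has_weak_deriv_add:
  assumes "has_weak_deriv \<Omega> u bs g" "has_weak_deriv \<Omega> v bs h" "open \<Omega>" "set bs \<subseteq> Basis"
  shows "has_weak_deriv \<Omega> (\<lambda>x. u x + v x) bs (\<lambda>x. g x + h x)"
  unfolding has_weak_deriv_def
proof (intro conjI allI impI locally_integrable_add)
  note l = has_weak_derivD(1,2)[OF assms(1)] has_weak_derivD(1,2)[OF assms(2)]
  show "locally_integrable \<Omega> u" "locally_integrable \<Omega> g" "locally_integrable \<Omega> v" "locally_integrable \<Omega> h"
    by (fact l)+
  fix \<phi> :: "'a \<Rightarrow> real" assume \<phi>: "\<phi> \<in> C0_infinity \<Omega>"
  have d: "iter_pderiv bs \<phi> \<in> C0_infinity \<Omega>" using C0_infinity_iter_pderiv[OF \<phi> assms(4)] .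
  note i = test_integrable[OF l(1) d assms(3)] test_integrable[OF l(3) d assms(3)]
    test_integrable[OF l(2) \<phi> assms(3)] test_integrable[OF l(4) \<phi> assms(3)]
  show "(\<integral>x. iter_pderiv bs \<phi> x *\<^sub>R (u x + v x) \<partial>lebesgue_on \<Omega>)
      = (-1) ^ length bs *\<^sub>R (\<integral>x. \<phi> x *\<^sub>R (g x + h x) \<partial>lebesgue_on \<Omega>)"
    using i has_weak_derivD(3)[OF assms(1) \<phi>] has_weak_derivD(3)[OF assms(2) \<phi>]
    by (simp add: scaleR_add_right)
qed

lemma has_weak_deriv_bounded_linear:
  fixes L :: "'b::euclidean_space \<Rightarrow> 'b"
  assumes "bounded_linear L" "has_weak_deriv \<Omega> u bs g" "open \<Omega>" "set bs \<subseteq> Basis"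
  shows "has_weak_deriv \<Omega> (\<lambda>x. L (u x)) bs (\<lambda>x. L (g x))"
  unfolding has_weak_deriv_def
proof (intro conjI allI impI locally_integrable_bounded_linear[OF assms(1)])
  note l = has_weak_derivD(1,2)[OF assms(2)]
  show "locally_integrable \<Omega> u" "locally_integrable \<Omega> g" by (fact l)+
  fix \<phi> :: "'a \<Rightarrow> real" assume \<phi>: "\<phi> \<in> C0_infinity \<Omega>"
  have d: "iter_pderiv bs \<phi> \<in> C0_infinity \<Omega>" using C0_infinity_iter_pderiv[OF \<phi> assms(4)] .
  have "(\<integral>x. \<psi> x *\<^sub>R L (f x) \<partial>lebesgue_on \<Omega>) = L (\<integral>x. \<psi> x *\<^sub>R f x \<partial>lebesgue_on \<Omega>)"
    if "\<psi> \<in> C0_infinity \<Omega>" "locally_integrable \<Omega> f" for \<psi> :: "'a \<Rightarrow> real" and f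
    using integral_bounded_linear[OF assms(1) test_integrable[OF that(2,1) assms(3)]]
    by (simp add: linear_scale[OF bounded_linear.linear[OF assms(1)]])
  then show "(\<integral>x. iter_pderiv bs \<phi> x *\<^sub>R L (u x) \<partial>lebesgue_on \<Omega>)
      = (-1) ^ length bs *\<^sub>R (\<integral>x. \<phi> x *\<^sub>R L (g x) \<partial>lebesgue_on \<Omega>)"
    using d \<phi> l has_weak_derivD(3)[OF assms(2) \<phi>]
    by (simp add: linear_scale[OF bounded_linear.linear[OF assms(1)]])
qed

lemma has_weak_deriv_subset:
  assumes "has_weak_deriv \<Omega> u bs g" "\<Omega>' \<subseteq> \<Omega>" "open \<Omega>" "open \<Omega>'" "set bs \<subseteq> Basis"
  shows "has_weak_deriv \<Omega>' u bs g"
  unfolding has_weak_deriv_def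
proof (intro conjI allI impI)
  note l = has_weak_derivD(1,2)[OF assms(1)]
  show "locally_integrable \<Omega>' u" "locally_integrable \<Omega>' g"
    using l locally_integrable_subset[OF _ assms(2)] by auto
  fix \<phi> :: "'a \<Rightarrow> real" assume \<phi>: "\<phi> \<in> C0_infinity \<Omega>'"
  have \<phi>': "\<phi> \<in> C0_infinity \<Omega>" using C0_infinity_mono[OF \<phi> assms(2)] .
  have "(\<integral>x. iter_pderiv cs \<phi> x *\<^sub>R f x \<partial>lebesgue_on \<Omega>) = (\<integral>x. iter_pderiv cs \<phi> x *\<^sub>R f x \<partial>lebesgue_on \<Omega>')"
    for cs and f :: "'a \<Rightarrow> 'b"
    by (rule integral_lebesgue_on_supported)
       (use C0_infinity_D(3)[OF \<phi>] assms in \<open>auto intro!: iter_pderiv_notin_supp\<close>)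
  from this[of bs u] this[of "[]" g] show "(\<integral>x. iter_pderiv bs \<phi> x *\<^sub>R u x \<partial>lebesgue_on \<Omega>')
      = (-1) ^ length bs *\<^sub>R (\<integral>x. \<phi> x *\<^sub>R g x \<partial>lebesgue_on \<Omega>')"
    using has_weak_derivD(3)[OF assms(1) \<phi>'] by simp
qed

text \<open>Test the identity for \<open>bs\<close> with \<open>iter_pderiv cs \<phi>\<close>.
  Consequently a list is read from the left for weak derivatives, whereas \<open>iter_pderiv\<close>
  applies its last entry first; this is why \<open>rev\<close> appears as soon as the two
  meet.\<close>

lemma has_weak_deriv_append:
  assumes "has_weak_deriv \<Omega> u bs g" "set cs \<subseteq> Basis"
  shows "has_weak_deriv \<Omega> g cs h \<longleftrightarrow> has_weak_deriv \<Omega> u (bs @ cs) h"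
proof -
  have "(\<integral>x. iter_pderiv (bs @ cs) \<phi> x *\<^sub>R u x \<partial>lebesgue_on \<Omega>)
     = (-1) ^ length bs *\<^sub>R (\<integral>x. iter_pderiv cs \<phi> x *\<^sub>R g x \<partial>lebesgue_on \<Omega>)"
    if "\<phi> \<in> C0_infinity \<Omega>" for \<phi> :: "'a \<Rightarrow> real"
    using has_weak_derivD(3)[OF assms(1) C0_infinity_iter_pderiv[OF that assms(2)]]
    by (simp add: iter_pderiv_append)
  then show ?thesis
    using has_weak_derivD(1,2)[OF assms(1)] unfolding has_weak_deriv_def
    by (auto simp: power_add scaleR_scaleR[symmetric] simp del: scaleR_scaleR)
qed

text \<open>By translation invariance the integral of w(x + t b) - w(x) - t D(x) equals -t times the
  integral of the derivative D. The integrand is O(t^2) on a fixed ball, so dividing by t and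
  letting t tend to 0 leaves 0.\<close>

lemma integral_pderiv_dir_eq_0:
  fixes w :: "'a::euclidean_space \<Rightarrow> 'b::euclidean_space"
  assumes w: "w \<in> C0_infinity \<Omega>" and b: "b \<in> Basis"
  shows "(\<integral>x. pderiv_dir b w x \<partial>lborel) = 0"
proof -
  let ?D = "pderiv_dir b w"
  have D: "?D \<in> C0_infinity \<Omega>" using C0_infinity_iter_pderiv[OF w, of "[b]"] b by simp
  obtain M where M: "M \<ge> 0"
    "\<And>x h. norm (w (x + h) - w x - (\<Sum>b\<in>Basis. (h \<bullet> b) *\<^sub>R pderiv_dir b w x)) \<le> M * (norm h)\<^sup>2"
    using C0_infinity_Taylor[OF w] by metis
  obtain r where r: "r > 0" "\<And>x. norm x > r \<Longrightarrow> w x = 0" using C0_infinity_in_cball[OF w] by metis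
  have Dz: "?D x = 0" if "norm x > r" for x
    by (rule pderiv_dir_eq_0_open[of "- cball 0 r"]) (use that r(2) in \<open>auto simp: open_Compl\<close>)
  have int: "integrable lborel f" if f: "continuous_on UNIV f" "\<And>x. norm x > s \<Longrightarrow> f x = 0" for f :: "'a \<Rightarrow> 'b" and s
  proof -
    have "integrable lborel (\<lambda>x. indicator (cball 0 s) x *\<^sub>R f x)"
      by (rule borel_integrable_compact) (use continuous_on_subset[OF f(1)] in auto)
    moreover have "(\<lambda>x. indicator (cball 0 s) x *\<^sub>R f x) = f" using f(2) by (force simp: indicator_def)
    ultimately show ?thesis by simp
  qed
  have cw: "continuous_on UNIV w" and cD: "continuous_on UNIV ?D"
    using C_infinity_continuous C0_infinity_D(1) w D by blast+
  have iw: "integrable lborel w" using int[OF cw r(2)] .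
  have iD: "integrable lborel ?D" using int[OF cD Dz] .
  define V where "V = measure lborel (cball (0::'a) (r + 1))"
  have key: "norm (\<integral>x. ?D x \<partial>lborel) \<le> M * V * t" if t: "0 < t" "t \<le> 1" for t
  proof -
    have isft: "integrable lborel (\<lambda>x. w (x + t *\<^sub>R b))"
    proof (rule int[where s="r + 1"])
      show "continuous_on UNIV (\<lambda>x. w (x + t *\<^sub>R b))"
        by (rule continuous_on_compose2[OF cw]) (auto intro!: continuous_intros)
      fix x :: 'a assume "norm x > r + 1"
      then have "norm (x + t *\<^sub>R b) > r"
        using norm_triangle_ineq4[of "x + t *\<^sub>R b" "t *\<^sub>R b"] t b by simp
      then show "w (x + t *\<^sub>R b) = 0" by (rule r(2))
    qed
    have "(\<integral>x. w x \<partial>lborel) = (\<integral>x. w x \<partial>distr lborel borel ((+) (t *\<^sub>R b)))"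
      by (simp add: lborel_distr_plus)
    also have "\<dots> = (\<integral>x. w (x + t *\<^sub>R b) \<partial>lborel)"
      by (subst integral_distr) (auto simp: add.commute C_infinity_borel C0_infinity_D(1)[OF w])
    finally have "(\<integral>x. w (x + t *\<^sub>R b) - w x - t *\<^sub>R ?D x \<partial>lborel) = - (t *\<^sub>R (\<integral>x. ?D x \<partial>lborel))"
      using isft iw iD by simp
    then have "t * norm (\<integral>x. ?D x \<partial>lborel) = norm (\<integral>x. w (x + t *\<^sub>R b) - w x - t *\<^sub>R ?D x \<partial>lborel)"
      using t by simp
    also have "\<dots> \<le> (\<integral>x. (M * t\<^sup>2) * indicator (cball (0::'a) (r + 1)) x \<partial>lborel)"
    proof (rule order_trans[OF integral_norm_bound Bochner_Integration.integral_mono])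
      show "integrable lborel (\<lambda>x. norm (w (x + t *\<^sub>R b) - w x - t *\<^sub>R ?D x))"
        using isft iw iD by (intro integrable_norm Bochner_Integration.integrable_diff integrable_scaleR_right)
      show "integrable lborel (\<lambda>x::'a. (M * t\<^sup>2) * indicator (cball 0 (r + 1)) x)"
        using emeasure_lborel_cball_finite[of "0::'a" "r + 1"] by simp
      fix x :: 'a
      show "norm (w (x + t *\<^sub>R b) - w x - t *\<^sub>R ?D x) \<le> (M * t\<^sup>2) * indicator (cball 0 (r + 1)) x"
      proof (cases "x \<in> cball 0 (r + 1)")
        case True
        have "(\<Sum>c\<in>Basis. ((t *\<^sub>R b) \<bullet> c) *\<^sub>R pderiv_dir c w x) = (\<Sum>c\<in>Basis. if c = b then t *\<^sub>R ?D x else 0)"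
          by (rule sum.cong) (auto simp: inner_Basis b)
        also have "\<dots> = t *\<^sub>R ?D x" using b by simp
        finally show ?thesis using M(2)[of x "t *\<^sub>R b"] True t b by simp
      next
        case False
        then have "norm (x + t *\<^sub>R b) > r" "norm x > r"
          using norm_triangle_ineq4[of "x + t *\<^sub>R b" "t *\<^sub>R b"] t b by auto
        then show ?thesis using False r(2) Dz by simp
      qed
    qed
    also have "\<dots> = t * (M * V * t)" by (simp add: V_def power2_eq_square)
    finally show ?thesis using t by (simp add: mult_le_cancel_left_pos)
  qed
  have "norm (\<integral>x. ?D x \<partial>lborel) \<le> 0"
  proof (rule field_le_epsilon)
    fix e :: real assume e: "e > 0"
    define t where "t = min 1 (e / (M * V + 1))"
    have MV: "M * V \<ge> 0" using M by (simp add: V_def)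
    have t: "0 < t" "t \<le> 1" using e MV by (auto simp: t_def add_nonneg_pos)
    have "M * V * t \<le> M * V * (e / (M * V + 1))" using MV by (intro mult_left_mono) (auto simp: t_def)
    also have "\<dots> \<le> e" using MV e by (simp add: field_simps)
    finally show "norm (\<integral>x. ?D x \<partial>lborel) \<le> 0 + e" using key[OF t] by simp
  qed
  then show ?thesis by simp
qed

lemma C_infinity_locally_integrable:
  fixes v :: "'a::euclidean_space \<Rightarrow> 'b::euclidean_space"
  assumes "C_infinity v"
  shows "locally_integrable \<Omega> v"
  unfolding locally_integrable_def
proof (intro conjI allI impI)
  show "v \<in> borel_measurable (lebesgue_on \<Omega>)" by (rule borel_lebesgue_on[OF C_infinity_borel[OF assms]])
  fix K assume K: "compact K \<and> K \<subseteq> \<Omega>"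
  then have "integrable lborel (\<lambda>x. indicator K x *\<^sub>R v x)"
    using continuous_on_subset[OF C_infinity_continuous[OF assms]]
    by (intro borel_integrable_compact) auto
  then have "integrable lebesgue (\<lambda>x. indicator K x *\<^sub>R v x)"     using K borel_measurable_continuous_onI[OF C_infinity_continuous[OF assms]]
    by (subst integrable_completion) (auto intro!: borel_measurable_scaleR borel_measurable_indicator borel_compact)
  then show "integrable (lebesgue_on K) v"
    using K compact_imp_closed[of K] by (subst integrable_restrict_space) auto
qed

text \<open>The product of \<phi> and v is a test function, so its derivative has integral 0; the
  product rule turns this into the integration by parts.\<close>

lemma has_weak_deriv_classical1:
  fixes v :: "'a::euclidean_space \<Rightarrow> 'b::euclidean_space"
  assumes v: "C_infinity v" and b: "b \<in> Basis" and \<Omega>: "open \<Omega>"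
  shows "has_weak_deriv \<Omega> v [b] (pderiv_dir b v)"
  unfolding has_weak_deriv_def
proof (intro conjI allI impI C_infinity_locally_integrable v C_infinity_pderiv_dir b)
  fix \<phi> :: "'a \<Rightarrow> real" assume \<phi>: "\<phi> \<in> C0_infinity \<Omega>"
  note \<phi>D = C0_infinity_D[OF \<phi>]
  let ?w = "\<lambda>x. \<phi> x *\<^sub>R v x"
  have w: "?w \<in> C0_infinity \<Omega>" by (rule C0_infinity_scaleR_left[OF \<phi> v])
  have dw: "pderiv_dir b ?w x = \<phi> x *\<^sub>R pderiv_dir b v x + pderiv_dir b \<phi> x *\<^sub>R v x" for x
    by (rule pderiv_dir_bounded_bilinear[OF bounded_bilinear_scaleR]) (use \<phi>D v C_infinity_differentiable in auto)
  have d\<phi>: "pderiv_dir b \<phi> \<in> C0_infinity \<Omega>" using C0_infinity_iter_pderiv[OF \<phi>, of "[b]"] b by simp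
  have i: "integrable (lebesgue_on \<Omega>) (\<lambda>x. \<phi> x *\<^sub>R pderiv_dir b v x)"
     "integrable (lebesgue_on \<Omega>) (\<lambda>x. pderiv_dir b \<phi> x *\<^sub>R v x)"
    by (intro test_integrable \<phi> d\<phi> \<Omega> C_infinity_locally_integrable v C_infinity_pderiv_dir b)+
  have dwm: "pderiv_dir b ?w \<in> borel_measurable borel"
    using C_infinity_borel C_infinity_pderiv_dir C0_infinity_D(1)[OF w] b by blast
  have "0 = (\<integral>x. pderiv_dir b ?w x \<partial>lborel)" using integral_pderiv_dir_eq_0[OF w b] by simp
  also have "\<dots> = (\<integral>x. pderiv_dir b ?w x \<partial>lebesgue)" using dwm by (simp add: integral_completion)
  also have "\<dots> = (\<integral>x. pderiv_dir b ?w x \<partial>lebesgue_on UNIV)" by (simp add: lebesgue_on_UNIV_eq)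
  also have "\<dots> = (\<integral>x. pderiv_dir b ?w x \<partial>lebesgue_on \<Omega>)"
    using iter_pderiv_notin_supp[of _ ?w "[b]"] C0_infinity_D(3)[OF w] \<Omega>
    by (intro integral_lebesgue_on_supported) auto
  also have "\<dots> = (\<integral>x. \<phi> x *\<^sub>R pderiv_dir b v x \<partial>lebesgue_on \<Omega>) + (\<integral>x. pderiv_dir b \<phi> x *\<^sub>R v x \<partial>lebesgue_on \<Omega>)"
    unfolding dw using i by simp
  finally show "(\<integral>x. iter_pderiv [b] \<phi> x *\<^sub>R v x \<partial>lebesgue_on \<Omega>)
      = (-1) ^ length [b] *\<^sub>R (\<integral>x. \<phi> x *\<^sub>R pderiv_dir b v x \<partial>lebesgue_on \<Omega>)"
    by (simp add: eq_neg_iff_add_eq_0 add.commute)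
qed

lemma has_weak_deriv_classical:
  fixes v :: "'a::euclidean_space \<Rightarrow> 'b::euclidean_space"
  assumes "C_infinity v" "set bs \<subseteq> Basis" "open \<Omega>"
  shows "has_weak_deriv \<Omega> v bs (iter_pderiv (rev bs) v)"
  using assms
proof (induction bs arbitrary: v)
  case Nil
  then show ?case by (simp add: has_weak_deriv_Nil C_infinity_locally_integrable)
next
  case (Cons b bs)
  have "has_weak_deriv \<Omega> (pderiv_dir b v) bs (iter_pderiv (rev bs) (pderiv_dir b v))"
    using Cons by (intro Cons.IH C_infinity_pderiv_dir) auto
  then show ?case
    using has_weak_deriv_append[OF has_weak_deriv_classical1[OF Cons.prems(1) _ Cons.prems(3), of b], of bs] Cons.prems
    by (simp add: iter_pderiv_append)
qed

text \<open>Test \<open>u\<close> with the product of \<eta> and \<phi> and expand the derivative of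
  that product.\<close>

lemma has_weak_deriv_mult1:
  fixes u :: "'a::euclidean_space \<Rightarrow> 'b::euclidean_space" and \<eta> :: "'a \<Rightarrow> real"
  assumes u: "has_weak_deriv \<Omega> u [b] g" and \<eta>: "C_infinity \<eta>" and b: "b \<in> Basis" and \<Omega>: "open \<Omega>"
  shows "has_weak_deriv \<Omega> (\<lambda>x. \<eta> x *\<^sub>R u x) [b] (\<lambda>x. pderiv_dir b \<eta> x *\<^sub>R u x + \<eta> x *\<^sub>R g x)"
  unfolding has_weak_deriv_def
proof (intro conjI allI impI)
  note l = has_weak_derivD(1,2)[OF u]
  have d\<eta>: "C_infinity (pderiv_dir b \<eta>)" using \<eta> b by (rule C_infinity_pderiv_dir)
  show "locally_integrable \<Omega> (\<lambda>x. \<eta> x *\<^sub>R u x)"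
    "locally_integrable \<Omega> (\<lambda>x. pderiv_dir b \<eta> x *\<^sub>R u x + \<eta> x *\<^sub>R g x)"
    by (intro locally_integrable_add locally_integrable_scaleR l C_infinity_continuous \<eta> d\<eta>)+
  fix \<phi> :: "'a \<Rightarrow> real" assume \<phi>: "\<phi> \<in> C0_infinity \<Omega>"
  let ?\<psi> = "\<lambda>x. \<eta> x * \<phi> x"
  have \<psi>: "?\<psi> \<in> C0_infinity \<Omega>" by (rule C0_infinity_mult[OF \<eta> \<phi>])
  have d\<psi>: "pderiv_dir b ?\<psi> x = \<eta> x * pderiv_dir b \<phi> x + pderiv_dir b \<eta> x * \<phi> x" for x
    by (rule pderiv_dir_bounded_bilinear[OF bounded_bilinear_mult])
      (use \<eta> C0_infinity_D(1)[OF \<phi>] C_infinity_differentiable in auto)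
  have d\<phi>: "pderiv_dir b \<phi> \<in> C0_infinity \<Omega>" using C0_infinity_iter_pderiv[OF \<phi>, of "[b]"] b by simp
  have i: "integrable (lebesgue_on \<Omega>) (\<lambda>x. (\<eta> x * pderiv_dir b \<phi> x) *\<^sub>R u x)"
     "integrable (lebesgue_on \<Omega>) (\<lambda>x. (pderiv_dir b \<eta> x * \<phi> x) *\<^sub>R u x)"
     "integrable (lebesgue_on \<Omega>) (\<lambda>x. (\<eta> x * \<phi> x) *\<^sub>R g x)"
    by (intro test_integrable l \<Omega> C0_infinity_mult \<eta> d\<eta> \<phi> d\<phi>)+
  have "(\<integral>x. (\<eta> x * pderiv_dir b \<phi> x) *\<^sub>R u x \<partial>lebesgue_on \<Omega>) + (\<integral>x. (pderiv_dir b \<eta> x * \<phi> x) *\<^sub>R u x \<partial>lebesgue_on \<Omega>)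
     = (\<integral>x. pderiv_dir b ?\<psi> x *\<^sub>R u x \<partial>lebesgue_on \<Omega>)"
    unfolding d\<psi> scaleR_add_left using i by simp
  also have "\<dots> = - (\<integral>x. (\<eta> x * \<phi> x) *\<^sub>R g x \<partial>lebesgue_on \<Omega>)"
    using has_weak_derivD(3)[OF u \<psi>] by simp
  finally have e: "(\<integral>x. (\<eta> x * pderiv_dir b \<phi> x) *\<^sub>R u x \<partial>lebesgue_on \<Omega>)
     = - ((\<integral>x. (pderiv_dir b \<eta> x * \<phi> x) *\<^sub>R u x \<partial>lebesgue_on \<Omega>) + (\<integral>x. (\<eta> x * \<phi> x) *\<^sub>R g x \<partial>lebesgue_on \<Omega>))"
    by (simp add: algebra_simps eq_neg_iff_add_eq_0)
  have "(\<integral>x. iter_pderiv [b] \<phi> x *\<^sub>R \<eta> x *\<^sub>R u x \<partial>lebesgue_on \<Omega>) = (\<integral>x. (\<eta> x * pderiv_dir b \<phi> x) *\<^sub>R u x \<partial>lebesgue_on \<Omega>)"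
    by (simp add: mult.commute)
  also have "\<dots> = - (\<integral>x. (pderiv_dir b \<eta> x * \<phi> x) *\<^sub>R u x + (\<eta> x * \<phi> x) *\<^sub>R g x \<partial>lebesgue_on \<Omega>)"
    unfolding e using i by simp
  finally show "(\<integral>x. iter_pderiv [b] \<phi> x *\<^sub>R \<eta> x *\<^sub>R u x \<partial>lebesgue_on \<Omega>)
      = (-1) ^ length [b] *\<^sub>R (\<integral>x. \<phi> x *\<^sub>R (pderiv_dir b \<eta> x *\<^sub>R u x + \<eta> x *\<^sub>R g x) \<partial>lebesgue_on \<Omega>)"
    by (simp add: scaleR_add_right mult.commute)
qed

subsection \<open>Sobolev energies\<close>

text \<open>Lists instead of multi-indices: a mixed derivative is counted once for every order of
  differentiation. This affects constants only and makes an additional direction a plain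
  \<open>Cons\<close>.\<close>

definition multi :: "nat \<Rightarrow> 'a::euclidean_space list set" where
  "multi k = {bs. set bs \<subseteq> Basis \<and> length bs \<le> k}"

lemma finite_multi [simp]: "finite (multi k)"
  unfolding multi_def by (rule finite_dirs_le)

lemma multi_D: "bs \<in> multi k \<Longrightarrow> set bs \<subseteq> Basis" by (simp add: multi_def)

lemma Nil_multi [simp]: "[] \<in> multi k" by (simp add: multi_def)

lemma multi_0: "multi 0 = {[]}" by (auto simp: multi_def)

lemma multi_Suc: "multi (Suc k) = insert [] ((\<lambda>(b, bs). b # bs) ` (Basis \<times> multi k))"
proof (intro equalityI subsetI)
  fix bs :: "'a list" assume "bs \<in> multi (Suc k)"
  then show "bs \<in> insert [] ((\<lambda>(b, bs). b # bs) ` (Basis \<times> multi k))"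
    by (cases bs) (auto simp: multi_def)
qed (auto simp: multi_def)

lemma sum_multi_Suc:
  fixes F :: "'a::euclidean_space list \<Rightarrow> ennreal"
  shows "(\<Sum>bs\<in>multi (Suc k). F bs) = F [] + (\<Sum>b\<in>Basis. \<Sum>bs\<in>multi k. F (b # bs))"
proof -
  have "(\<Sum>bs\<in>multi (Suc k). F bs) = F [] + (\<Sum>bs\<in>(\<lambda>(b, bs). b # bs) ` (Basis \<times> multi k). F bs)"
    unfolding multi_Suc by (subst sum.insert) auto
  also have "(\<Sum>bs\<in>(\<lambda>(b, bs). b # bs) ` (Basis \<times> multi k). F bs) = (\<Sum>(b, bs)\<in>Basis \<times> multi k. F (b # bs))"
    by (subst sum.reindex) (auto simp: inj_on_def case_prod_beta)
  also have "\<dots> = (\<Sum>b\<in>Basis. \<Sum>bs\<in>multi k. F (b # bs))" by (rule sum.cartesian_product[symmetric])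
  finally show ?thesis .
qed

text \<open>Any choice of weak derivatives may serve as \<open>G\<close>, which frees proofs from
  the choice operator inside \<open>weak_deriv\<close>; by \<open>SE_jet\<close> the energy can be
  computed from any of them.\<close>

definition jet :: "nat \<Rightarrow> real \<Rightarrow> 'a::euclidean_space set \<Rightarrow> ('a \<Rightarrow> 'b::euclidean_space) \<Rightarrow> ('a list \<Rightarrow> 'a \<Rightarrow> 'b) \<Rightarrow> bool"
  where "jet k p \<Omega> u G \<longleftrightarrow> (\<forall>bs\<in>multi k. G bs \<in> Lp_space p \<Omega> \<and> has_weak_deriv \<Omega> u bs (G bs))"

text \<open>Derivatives are taken in \<Omega> but integrated over \<open>S\<close>. The two sets are
  kept apart because the decisive estimates compare energies of one function on shrinking
  neighbourhoods.\<close>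

definition SE :: "nat \<Rightarrow> real \<Rightarrow> 'a::euclidean_space set \<Rightarrow> 'a set \<Rightarrow> ('a \<Rightarrow> 'b::euclidean_space) \<Rightarrow> ennreal" where
  "SE k p \<Omega> S u = (\<Sum>bs\<in>multi k. enp p S (weak_deriv \<Omega> u bs))"

lemma AE_lebesgue_on_subset:
  assumes "AE x in lebesgue_on \<Omega>. P x" "S \<subseteq> \<Omega>" "S \<in> sets lebesgue" "\<Omega> \<in> sets lebesgue"
  shows "AE x in lebesgue_on S. P x"
  using assms by (auto simp: AE_restrict_space_iff elim!: eventually_mono)

lemma Lp_cong_AE:
  assumes "f \<in> Lp_space p \<Omega>" "AE x in lebesgue_on \<Omega>. f x = g x" "g \<in> borel_measurable (lebesgue_on \<Omega>)"
  shows "g \<in> Lp_space p \<Omega>"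
  using assms enp_cong_AE[OF assms(2), of p] by (simp add: Lp_space_iff)

lemma sobolev_iff_jet:
  assumes "p \<ge> 1" "open \<Omega>"
  shows "u \<in> sobolev k p \<Omega> \<longleftrightarrow> (\<exists>G. jet k p \<Omega> u G)"
proof
  assume u: "u \<in> sobolev k p \<Omega>"
  have "\<exists>g. g \<in> Lp_space p \<Omega> \<and> has_weak_deriv \<Omega> u bs g" if "bs \<in> multi k" for bs
  proof -
    have "length bs \<le> k" "bs \<in> dirs (length bs)" using that by (auto simp: multi_def dirs_def)
    then show ?thesis using u unfolding sobolev_def by blast
  qed
  then show "\<exists>G. jet k p \<Omega> u G" unfolding jet_def by metis
next
  assume "\<exists>G. jet k p \<Omega> u G"
  then obtain G where G: "jet k p \<Omega> u G" by blast
  have 0: "G [] \<in> Lp_space p \<Omega>" "has_weak_deriv \<Omega> u [] (G [])" using G by (auto simp: jet_def)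
  have l: "locally_integrable \<Omega> u" using has_weak_derivD(1)[OF 0(2)] .
  \<comment> \<open>The entry of a jet at the empty list is a weak derivative of order 0, hence
    equals \<open>u\<close> only almost everywhere.\<close>
  have "AE x in lebesgue_on \<Omega>. G [] x = u x"
    by (rule has_weak_deriv_unique[OF 0(2) has_weak_deriv_Nil[OF l] assms(2)])
  then have "u \<in> Lp_space p \<Omega>" using Lp_cong_AE[OF 0(1)] locally_integrableD(1)[OF l] by blast
  moreover have "\<exists>g\<in>Lp_space p \<Omega>. has_weak_deriv \<Omega> u bs g" if "j \<le> k" "bs \<in> dirs j" for j bs
  proof -
    have "bs \<in> multi k" using that by (auto simp: multi_def dirs_def)
    then show ?thesis using G by (auto simp: jet_def)
  qed
  ultimately show "u \<in> sobolev k p \<Omega>" by (auto simp: sobolev_def)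
qed

lemma sobolev_Lp: "u \<in> sobolev k p \<Omega> \<Longrightarrow> u \<in> Lp_space p \<Omega>"
  by (simp add: sobolev_def)

lemma sobolev_measurable: "u \<in> sobolev k p \<Omega> \<Longrightarrow> u \<in> borel_measurable (lebesgue_on \<Omega>)"
  using sobolev_Lp Lp_space_iff by blast

lemma jet_weak_deriv:
  assumes "p \<ge> 1" "open \<Omega>" "u \<in> sobolev k p \<Omega>"
  shows "jet k p \<Omega> u (weak_deriv \<Omega> u)"
  unfolding jet_def
proof (intro ballI)
  fix bs :: "'a list" assume bs: "bs \<in> multi k"
  obtain G where G: "jet k p \<Omega> u G" using assms sobolev_iff_jet by blast
  then have g: "G bs \<in> Lp_space p \<Omega>" "has_weak_deriv \<Omega> u bs (G bs)" using bs by (auto simp: jet_def)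
  have w: "has_weak_deriv \<Omega> u bs (weak_deriv \<Omega> u bs)"
    unfolding weak_deriv_def by (rule someI[where P="has_weak_deriv \<Omega> u bs", OF g(2)])
  have "AE x in lebesgue_on \<Omega>. G bs x = weak_deriv \<Omega> u bs x"
    by (rule has_weak_deriv_unique[OF g(2) w assms(2)])
  then have "weak_deriv \<Omega> u bs \<in> Lp_space p \<Omega>"
    using Lp_cong_AE[OF g(1)] locally_integrableD(1)[OF has_weak_derivD(2)[OF w]] by blast
  with w show "weak_deriv \<Omega> u bs \<in> Lp_space p \<Omega> \<and> has_weak_deriv \<Omega> u bs (weak_deriv \<Omega> u bs)" by blast
qed

lemma jetD:
  assumes "jet k p \<Omega> u G" "bs \<in> multi k"
  shows "G bs \<in> Lp_space p \<Omega>" "has_weak_deriv \<Omega> u bs (G bs)" "G bs \<in> borel_measurable (lebesgue_on \<Omega>)"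
  using assms Lp_space_iff by (auto simp: jet_def)

lemma jet_unique:
  assumes "jet k p \<Omega> u G" "has_weak_deriv \<Omega> u bs g" "bs \<in> multi k" "open \<Omega>" "S \<subseteq> \<Omega>" "S \<in> sets lebesgue"
  shows "enp p S (G bs) = enp p S g"
proof -
  have "AE x in lebesgue_on \<Omega>. G bs x = g x"
    using has_weak_deriv_unique[OF jetD(2)[OF assms(1,3)] assms(2,4)] .
  then have "AE x in lebesgue_on S. G bs x = g x"
    by (rule AE_lebesgue_on_subset) (use assms in auto)
  then show ?thesis by (rule enp_cong_AE)
qed

lemma SE_jet:
  assumes "jet k p \<Omega> u G" "p \<ge> 1" "open \<Omega>" "S \<subseteq> \<Omega>" "S \<in> sets lebesgue"
  shows "SE k p \<Omega> S u = (\<Sum>bs\<in>multi k. enp p S (G bs))"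
proof -
  have u: "u \<in> sobolev k p \<Omega>" using assms sobolev_iff_jet by blast
  show ?thesis unfolding SE_def
    by (rule sum.cong[OF refl])
       (rule jet_unique[OF jet_weak_deriv[OF assms(2,3) u] jetD(2)[OF assms(1)] _ assms(3-5)])
qed

lemma SE_finite:
  assumes "u \<in> sobolev k p \<Omega>" "p \<ge> 1" "open \<Omega>"
  shows "SE k p \<Omega> \<Omega> u < \<infinity>"
  unfolding SE_def using jetD(1)[OF jet_weak_deriv[OF assms(2,3,1)]]
  by (simp add: Lp_space_iff)

lemma SE_mono_set:
  assumes "S \<subseteq> T" "S \<in> sets lebesgue" "T \<in> sets lebesgue"
  shows "SE k p \<Omega> S u \<le> SE k p \<Omega> T u"
  unfolding SE_def by (intro sum_mono enp_mono_set assms)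

lemma sobolev_mono:
  "u \<in> sobolev k p \<Omega> \<Longrightarrow> j \<le> k \<Longrightarrow> u \<in> sobolev j p \<Omega>"
  unfolding sobolev_def by simp (meson order_trans)

lemma SE_mono: "j \<le> k \<Longrightarrow> SE j p \<Omega> S u \<le> SE k p \<Omega> S u"
  unfolding SE_def by (rule sum_mono2[OF finite_multi]) (auto simp: multi_def)

lemma SE_0:
  assumes "u \<in> Lp_space p \<Omega>" "p \<ge> 1" "open \<Omega>" "S \<subseteq> \<Omega>" "S \<in> sets lebesgue"
  shows "jet 0 p \<Omega> u (\<lambda>_. u)" "SE 0 p \<Omega> S u = enp p S u"
proof -
  show j: "jet 0 p \<Omega> u (\<lambda>_. u)"
    unfolding jet_def multi_0 using assms by (auto intro: has_weak_deriv_Nil Lp_locally_integrable)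
  show "SE 0 p \<Omega> S u = enp p S u"
    using SE_jet[OF j assms(2-5)] by (simp add: multi_0)
qed

lemma enp_le_SE:
  assumes "u \<in> sobolev k p \<Omega>" "p \<ge> 1" "open \<Omega>" "S \<subseteq> \<Omega>" "S \<in> sets lebesgue"
  shows "enp p S u \<le> SE k p \<Omega> S u"
  using SE_0(2)[OF sobolev_Lp[OF assms(1)] assms(2-5)] SE_mono[of 0 k p \<Omega> S u] by simp

lemma enp_deriv_le_SE:
  assumes "u \<in> sobolev k p \<Omega>" "p \<ge> 1" "open \<Omega>" "S \<subseteq> \<Omega>" "S \<in> sets lebesgue"
    "has_weak_deriv \<Omega> u bs g" "bs \<in> multi k"
  shows "enp p S g \<le> SE k p \<Omega> S u"
proof -
  have "enp p S g = enp p S (weak_deriv \<Omega> u bs)"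
    using jet_unique[OF jet_weak_deriv[OF assms(2,3,1)] assms(6,7,3-5)] by simp
  also have "\<dots> \<le> SE k p \<Omega> S u" unfolding SE_def by (rule member_le_sum) (use assms in auto)
  finally show ?thesis .
qed

text \<open>Reduces membership and energy of order k + 1 to those of the first derivatives at order
  k; together with \<open>SE_Suc\<close> it carries the inductions on the order.\<close>

lemma sobolev_SucI:
  assumes p: "p \<ge> 1" and \<Omega>: "open \<Omega>" and u: "u \<in> Lp_space p \<Omega>"
    and g: "\<And>b. b \<in> Basis \<Longrightarrow> has_weak_deriv \<Omega> u [b] (g b)" "\<And>b. b \<in> Basis \<Longrightarrow> g b \<in> sobolev k p \<Omega>"
  shows "u \<in> sobolev (Suc k) p \<Omega>"
    "S \<subseteq> \<Omega> \<Longrightarrow> S \<in> sets lebesgue \<Longrightarrow> SE (Suc k) p \<Omega> S u = enp p S u + (\<Sum>b\<in>Basis. SE k p \<Omega> S (g b))"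
proof -
  \<comment> \<open>Along \<open>b # cs\<close> the derivative of \<open>u\<close> is the derivative
    along \<open>cs\<close> of its first derivative \<open>g b\<close>, by
    \<open>has_weak_deriv_append\<close>.\<close>
  define G where "G bs = (case bs of [] \<Rightarrow> u | b # cs \<Rightarrow> weak_deriv \<Omega> (g b) cs)" for bs
  have j: "jet (Suc k) p \<Omega> u G" unfolding jet_def
  proof (intro ballI)
    fix bs :: "'a list" assume bs: "bs \<in> multi (Suc k)"
    show "G bs \<in> Lp_space p \<Omega> \<and> has_weak_deriv \<Omega> u bs (G bs)"
    proof (cases bs)
      case Nil
      then show ?thesis using u Lp_locally_integrable[OF u p \<Omega>] by (simp add: G_def has_weak_deriv_Nil)
    next
      case (Cons b cs)
      then have b: "b \<in> Basis" "cs \<in> multi k" using bs by (auto simp: multi_def)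
      note jj = jetD[OF jet_weak_deriv[OF p \<Omega> g(2)[OF b(1)]] b(2)]
      show ?thesis using jj has_weak_deriv_append[OF g(1)[OF b(1)] multi_D[OF b(2)]]
        by (simp add: Cons G_def)
    qed
  qed
  then show "u \<in> sobolev (Suc k) p \<Omega>" using sobolev_iff_jet[OF p \<Omega>] by blast
  show "SE (Suc k) p \<Omega> S u = enp p S u + (\<Sum>b\<in>Basis. SE k p \<Omega> S (g b))" if "S \<subseteq> \<Omega>" "S \<in> sets lebesgue"
    unfolding SE_jet[OF j p \<Omega> that] sum_multi_Suc by (simp add: G_def SE_def)
qed

lemma sobolev_SucD:
  assumes p: "p \<ge> 1" and \<Omega>: "open \<Omega>" and u: "u \<in> sobolev (Suc k) p \<Omega>" and b: "b \<in> Basis"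
  shows "has_weak_deriv \<Omega> u [b] (weak_deriv \<Omega> u [b])" "weak_deriv \<Omega> u [b] \<in> sobolev k p \<Omega>"
proof -
  note j = jet_weak_deriv[OF p \<Omega> u]
  show 1: "has_weak_deriv \<Omega> u [b] (weak_deriv \<Omega> u [b])"
    by (rule jetD(2)[OF j]) (use b in \<open>auto simp: multi_def\<close>)
  have "jet k p \<Omega> (weak_deriv \<Omega> u [b]) (\<lambda>cs. weak_deriv \<Omega> u (b # cs))"
    unfolding jet_def
  proof (intro ballI)
    fix cs :: "'a list" assume cs: "cs \<in> multi k"
    have "b # cs \<in> multi (Suc k)" using b cs by (auto simp: multi_def)
    from jetD[OF j this] show "weak_deriv \<Omega> u (b # cs) \<in> Lp_space p \<Omega> \<and>
        has_weak_deriv \<Omega> (weak_deriv \<Omega> u [b]) cs (weak_deriv \<Omega> u (b # cs))"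
      using has_weak_deriv_append[OF 1 multi_D[OF cs]] by simp
  qed
  then show "weak_deriv \<Omega> u [b] \<in> sobolev k p \<Omega>" using sobolev_iff_jet[OF p \<Omega>] by blast
qed

lemma SE_Suc:
  assumes p: "p \<ge> 1" and \<Omega>: "open \<Omega>" and u: "u \<in> sobolev (Suc k) p \<Omega>" and S: "S \<subseteq> \<Omega>" "S \<in> sets lebesgue"
  shows "SE (Suc k) p \<Omega> S u = enp p S u + (\<Sum>b\<in>Basis. SE k p \<Omega> S (weak_deriv \<Omega> u [b]))"
  by (rule sobolev_SucI(2)[OF p \<Omega> sobolev_Lp[OF u] sobolev_SucD[OF p \<Omega> u] S])

lemma sobolev_add:
  assumes "p \<ge> 1" "open \<Omega>" "u \<in> sobolev k p \<Omega>" "v \<in> sobolev k p \<Omega>"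
  shows "(\<lambda>x. u x + v x) \<in> sobolev k p \<Omega>"
    "S \<subseteq> \<Omega> \<Longrightarrow> S \<in> sets lebesgue \<Longrightarrow>
       SE k p \<Omega> S (\<lambda>x. u x + v x) \<le> ennreal (2 powr p) * (SE k p \<Omega> S u + SE k p \<Omega> S v)"
proof -

  \<comment> \<open>Linear operations, change of domain and test functions\<close>
  note ju = jetD[OF jet_weak_deriv[OF assms(1-3)]] and jv = jetD[OF jet_weak_deriv[OF assms(1,2,4)]]
  have j: "jet k p \<Omega> (\<lambda>x. u x + v x) (\<lambda>bs x. weak_deriv \<Omega> u bs x + weak_deriv \<Omega> v bs x)"
    unfolding jet_def using ju jv assms by (auto intro!: Lp_add has_weak_deriv_add multi_D)
  then show "(\<lambda>x. u x + v x) \<in> sobolev k p \<Omega>" using sobolev_iff_jet[OF assms(1,2)] by blast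
  assume S: "S \<subseteq> \<Omega>" "S \<in> sets lebesgue"
  have "SE k p \<Omega> S (\<lambda>x. u x + v x)
     \<le> (\<Sum>bs\<in>multi k. ennreal (2 powr p) * (enp p S (weak_deriv \<Omega> u bs) + enp p S (weak_deriv \<Omega> v bs)))"
    unfolding SE_jet[OF j assms(1,2) S]
    by (intro sum_mono enp_add assms lebesgue_on_mono[OF _ S(1)] ju jv)
  then show "SE k p \<Omega> S (\<lambda>x. u x + v x) \<le> ennreal (2 powr p) * (SE k p \<Omega> S u + SE k p \<Omega> S v)"
    by (simp add: SE_def sum.distrib sum_distrib_left[symmetric])
qed

text \<open>One estimate for bounded real-linear maps of the values covers negation, real scaling
  and multiplication by elements of the scalar field.\<close>

lemma sobolev_linear:
  fixes L :: "'b::euclidean_space \<Rightarrow> 'b"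
  assumes "p \<ge> 1" "open \<Omega>" "u \<in> sobolev k p \<Omega>" "bounded_linear L" "\<And>v. norm (L v) \<le> c * norm v" "c \<ge> 0"
  shows "(\<lambda>x. L (u x)) \<in> sobolev k p \<Omega>"
    "S \<subseteq> \<Omega> \<Longrightarrow> S \<in> sets lebesgue \<Longrightarrow> SE k p \<Omega> S (\<lambda>x. L (u x)) \<le> ennreal (c powr p) * SE k p \<Omega> S u"
proof -
  note ju = jetD[OF jet_weak_deriv[OF assms(1-3)]]
  have Lm: "L \<in> borel_measurable borel"
    by (intro borel_measurable_continuous_onI linear_continuous_on assms)
  have j: "jet k p \<Omega> (\<lambda>x. L (u x)) (\<lambda>bs x. L (weak_deriv \<Omega> u bs x))"
    unfolding jet_def
  proof (intro ballI conjI)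
    fix bs :: "'a list" assume bs: "bs \<in> multi k"
    show "(\<lambda>x. L (weak_deriv \<Omega> u bs x)) \<in> Lp_space p \<Omega>"
      by (rule Lp_scale[OF ju(1)[OF bs] measurable_compose[OF ju(3)[OF bs] Lm] assms(5,6,1,2)])
    show "has_weak_deriv \<Omega> (\<lambda>x. L (u x)) bs (\<lambda>x. L (weak_deriv \<Omega> u bs x))"
      by (rule has_weak_deriv_bounded_linear[OF assms(4) ju(2)[OF bs] assms(2) multi_D[OF bs]])
  qed
  then show "(\<lambda>x. L (u x)) \<in> sobolev k p \<Omega>" using sobolev_iff_jet[OF assms(1,2)] by blast
  assume S: "S \<subseteq> \<Omega>" "S \<in> sets lebesgue"
  have "SE k p \<Omega> S (\<lambda>x. L (u x)) \<le> (\<Sum>bs\<in>multi k. ennreal (c powr p) * enp p S (weak_deriv \<Omega> u bs))"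
    unfolding SE_jet[OF j assms(1,2) S]
    using assms by (intro sum_mono enp_scale lebesgue_on_mono[OF _ S(1)] ju S) auto
  then show "SE k p \<Omega> S (\<lambda>x. L (u x)) \<le> ennreal (c powr p) * SE k p \<Omega> S u"
    by (simp add: SE_def sum_distrib_left[symmetric])
qed

lemma sobolev_uminus:
  assumes "p \<ge> 1" "open \<Omega>" "u \<in> sobolev k p \<Omega>"
  shows "(\<lambda>x. - u x) \<in> sobolev k p \<Omega>"
    "S \<subseteq> \<Omega> \<Longrightarrow> S \<in> sets lebesgue \<Longrightarrow> SE k p \<Omega> S (\<lambda>x. - u x) \<le> SE k p \<Omega> S u"
  using sobolev_linear[OF assms, of uminus 1] bounded_linear_minus[OF bounded_linear_ident] by auto

lemma sobolev_diff:
  assumes "p \<ge> 1" "open \<Omega>" "u \<in> sobolev k p \<Omega>" "v \<in> sobolev k p \<Omega>"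
  shows "(\<lambda>x. u x - v x) \<in> sobolev k p \<Omega>"
    "S \<subseteq> \<Omega> \<Longrightarrow> S \<in> sets lebesgue \<Longrightarrow>
       SE k p \<Omega> S (\<lambda>x. u x - v x) \<le> ennreal (2 powr p) * (SE k p \<Omega> S u + SE k p \<Omega> S v)"
proof -
  note n = sobolev_uminus[OF assms(1,2,4)]
  show "(\<lambda>x. u x - v x) \<in> sobolev k p \<Omega>" using sobolev_add(1)[OF assms(1-3) n(1)] by simp
  assume S: "S \<subseteq> \<Omega>" "S \<in> sets lebesgue"
  have "SE k p \<Omega> S (\<lambda>x. u x - v x) \<le> ennreal (2 powr p) * (SE k p \<Omega> S u + SE k p \<Omega> S (\<lambda>x. - v x))"
    using sobolev_add(2)[OF assms(1-3) n(1) S] by simp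
  also have "\<dots> \<le> ennreal (2 powr p) * (SE k p \<Omega> S u + SE k p \<Omega> S v)"
    by (intro mult_left_mono add_left_mono n(2) S) auto
  finally show "SE k p \<Omega> S (\<lambda>x. u x - v x) \<le> ennreal (2 powr p) * (SE k p \<Omega> S u + SE k p \<Omega> S v)" .
qed

lemma sobolev_cong_AE:
  assumes "p \<ge> 1" "open \<Omega>" "u \<in> sobolev k p \<Omega>" "AE x in lebesgue_on \<Omega>. u x = v x"
    "v \<in> borel_measurable (lebesgue_on \<Omega>)"
  shows "v \<in> sobolev k p \<Omega>"
    "S \<subseteq> \<Omega> \<Longrightarrow> S \<in> sets lebesgue \<Longrightarrow> SE k p \<Omega> S v = SE k p \<Omega> S u"
proof -
  note ju = jetD[OF jet_weak_deriv[OF assms(1-3)]]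
  have v: "v \<in> Lp_space p \<Omega>" using Lp_cong_AE[OF sobolev_Lp[OF assms(3)] assms(4,5)] .
  have j: "jet k p \<Omega> v (weak_deriv \<Omega> u)"
    unfolding jet_def
  proof (intro ballI conjI ju(1))
    fix bs :: "'a list" assume bs: "bs \<in> multi k"
    show "has_weak_deriv \<Omega> v bs (weak_deriv \<Omega> u bs)"
      by (rule has_weak_deriv_cong_AE[OF ju(2)[OF bs] assms(4)])
        (use Lp_locally_integrable[OF v assms(1,2)] has_weak_derivD(2)[OF ju(2)[OF bs]] multi_D[OF bs] in auto)
  qed
  then show "v \<in> sobolev k p \<Omega>" using sobolev_iff_jet[OF assms(1,2)] by blast
  show "S \<subseteq> \<Omega> \<Longrightarrow> S \<in> sets lebesgue \<Longrightarrow> SE k p \<Omega> S v = SE k p \<Omega> S u"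
    using SE_jet[OF j assms(1,2)] by (simp add: SE_def)
qed

lemma sobolev_subset:
  assumes "p \<ge> 1" "open \<Omega>" "u \<in> sobolev k p \<Omega>" "open \<Omega>'" "\<Omega>' \<subseteq> \<Omega>"
  shows "u \<in> sobolev k p \<Omega>'"
    "S \<subseteq> \<Omega>' \<Longrightarrow> S \<in> sets lebesgue \<Longrightarrow> SE k p \<Omega>' S u = SE k p \<Omega> S u"
proof -
  note ju = jetD[OF jet_weak_deriv[OF assms(1-3)]]
  have j: "jet k p \<Omega>' u (weak_deriv \<Omega> u)"
    unfolding jet_def
  proof (intro ballI conjI)
    fix bs :: "'a list" assume bs: "bs \<in> multi k"
    have "enp p \<Omega>' (weak_deriv \<Omega> u bs) \<le> enp p \<Omega> (weak_deriv \<Omega> u bs)"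
      by (rule enp_mono_set) (use assms in auto)
    then show "weak_deriv \<Omega> u bs \<in> Lp_space p \<Omega>'"
      using ju(1)[OF bs] lebesgue_on_mono[OF ju(3)[OF bs] assms(5)] by (auto simp: Lp_space_iff intro: le_less_trans)
    show "has_weak_deriv \<Omega>' u bs (weak_deriv \<Omega> u bs)"
      by (rule has_weak_deriv_subset[OF ju(2)[OF bs] assms(5,2,4) multi_D[OF bs]])
  qed
  then show "u \<in> sobolev k p \<Omega>'" using sobolev_iff_jet[OF assms(1,4)] by blast
  show "S \<subseteq> \<Omega>' \<Longrightarrow> S \<in> sets lebesgue \<Longrightarrow> SE k p \<Omega>' S u = SE k p \<Omega> S u"
    using SE_jet[OF j assms(1,4)] by (simp add: SE_def)
qed

lemma C0_infinity_Lp: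
  assumes "v \<in> C0_infinity UNIV" "p \<ge> 1" "open \<Omega>"
  shows "v \<in> Lp_space p \<Omega>"
proof -
  note D = C0_infinity_D[OF assms(1)]
  obtain B where B: "B > 0" "\<And>x. norm (v x) \<le> B" using C0_infinity_bounded[OF assms(1)] by metis
  have "enp p \<Omega> v \<le> enp p UNIV v" by (rule enp_mono_set) (use assms in auto)
  also have "\<dots> \<le> (\<integral>\<^sup>+x. ennreal (B powr p) * indicator (supp v) x \<partial>lborel)"
    unfolding enp_UNIV
  proof (rule nn_integral_mono)
    fix x show "ennreal (norm (v x) powr p) \<le> ennreal (B powr p) * indicator (supp v) x"
      using B(2)[of x] assms(2) by (cases "x \<in> supp v") (auto simp: supp_notin intro!: ennreal_leI powr_mono2)
  qed
  also have "\<dots> < \<infinity>"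
    using emeasure_compact_finite[OF D(2)] D(2)
    by (subst nn_integral_cmult_indicator) (auto simp: ennreal_mult_less_top borel_compact)
  finally show ?thesis using borel_lebesgue_on[OF C_infinity_borel[OF D(1)]] by (auto simp: Lp_space_iff)
qed

lemma sobolev_C0_infinity:
  assumes v: "v \<in> C0_infinity UNIV" and p: "p \<ge> 1" and \<Omega>: "open \<Omega>"
  shows "v \<in> sobolev k p \<Omega>"
    "S \<subseteq> \<Omega> \<Longrightarrow> S \<in> sets lebesgue \<Longrightarrow> SE k p \<Omega> S v = (\<Sum>bs\<in>multi k. enp p S (iter_pderiv (rev bs) v))"
proof -
  have j: "jet k p \<Omega> v (\<lambda>bs. iter_pderiv (rev bs) v)"
    unfolding jet_def
    by (auto intro!: C0_infinity_Lp[OF C0_infinity_iter_pderiv[OF v] p \<Omega>] has_weak_deriv_classical \<Omega>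
        C0_infinity_D(1)[OF v] simp: multi_def)
  then show "v \<in> sobolev k p \<Omega>" using sobolev_iff_jet[OF p \<Omega>] by blast
  show "S \<subseteq> \<Omega> \<Longrightarrow> S \<in> sets lebesgue \<Longrightarrow> SE k p \<Omega> S v = (\<Sum>bs\<in>multi k. enp p S (iter_pderiv (rev bs) v))"
    using SE_jet[OF j p \<Omega>] by simp
qed

subsection \<open>Multiplication by smooth functions\<close>

lemma enp_mult_supported:
  fixes u :: "'a::euclidean_space \<Rightarrow> 'b::euclidean_space" and \<eta> :: "'a \<Rightarrow> real"
  assumes p: "p \<ge> 1" and \<Omega>: "\<Omega> \<in> sets lebesgue" "N \<in> sets lebesgue"
    and u: "u \<in> borel_measurable (lebesgue_on \<Omega>)"
    and b: "\<And>x. \<bar>\<eta> x\<bar> \<le> M * indicator N x" and M: "M \<ge> 0"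
  shows "enp p \<Omega> (\<lambda>x. \<eta> x *\<^sub>R u x) \<le> ennreal (M powr p) * enp p (\<Omega> \<inter> N) u"
proof -
  have z: "\<eta> x = 0" if "x \<notin> N" for x using b[of x] that by simp
  have "enp p \<Omega> (\<lambda>x. \<eta> x *\<^sub>R u x) = enp p (\<Omega> \<inter> N) (\<lambda>x. \<eta> x *\<^sub>R u x)"
    using \<Omega> z by (auto simp: enp_lborel indicator_def intro!: nn_integral_cong)
  also have "\<dots> \<le> ennreal (M powr p) * enp p (\<Omega> \<inter> N) u"
  proof (rule enp_scale[OF lebesgue_on_mono[OF u]])
    fix x assume "x \<in> \<Omega> \<inter> N"
    then have "\<bar>\<eta> x\<bar> \<le> M" using b[of x] by simp
    then show "norm (\<eta> x *\<^sub>R u x) \<le> M * norm (u x)" by (simp add: mult_right_mono)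
  qed (use p \<Omega> M in auto)
  finally show ?thesis .
qed

text \<open>The cost of a cutoff at scale \<epsilon>: of at most k derivatives, j may fall on the
  cutoff, each costing 1 / \<epsilon>, and at most k - j are left for \<open>u\<close>.\<close>

definition scaled_SE :: "real \<Rightarrow> nat \<Rightarrow> real \<Rightarrow> 'a::euclidean_space set \<Rightarrow> 'a set \<Rightarrow> ('a \<Rightarrow> 'b::euclidean_space) \<Rightarrow> ennreal" where
  "scaled_SE \<epsilon> k p \<Omega> S u = (\<Sum>j\<le>k. ennreal ((1 / \<epsilon> ^ j) powr p) * SE (k - j) p \<Omega> S u)"

text \<open>Induction on k by the product rule. The constant precedes all other quantifiers because
  the induction hypothesis is applied to \<open>pderiv_dir b \<eta>\<close> with
  \<open>M / \<epsilon>\<close> in place of \<open>M\<close>, and because \<epsilon> later tends to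
  0.\<close>

lemma sobolev_mult:
  assumes p: "p \<ge> 1"
  shows "\<exists>C\<ge>0. \<forall>(\<Omega> :: 'a::euclidean_space set) N (u :: 'a \<Rightarrow> 'b::euclidean_space) (\<eta> :: 'a \<Rightarrow> real) M \<epsilon>.
     open \<Omega> \<longrightarrow> N \<in> sets lebesgue \<longrightarrow> u \<in> sobolev k p \<Omega> \<longrightarrow> C_infinity \<eta> \<longrightarrow> M \<ge> 0 \<longrightarrow> \<epsilon> > 0 \<longrightarrow>
     (\<forall>bs\<in>multi k. \<forall>x. \<bar>iter_pderiv bs \<eta> x\<bar> \<le> M / \<epsilon> ^ length bs * indicator N x) \<longrightarrow>
     (\<lambda>x. \<eta> x *\<^sub>R u x) \<in> sobolev k p \<Omega> \<and>
     SE k p \<Omega> \<Omega> (\<lambda>x. \<eta> x *\<^sub>R u x) \<le> ennreal (C * M powr p) * scaled_SE \<epsilon> k p \<Omega> (\<Omega> \<inter> N) u"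
proof -
  define Q where "Q k C \<longleftrightarrow> (\<forall>(\<Omega> :: 'a set) N (u :: 'a \<Rightarrow> 'b) (\<eta> :: 'a \<Rightarrow> real) M \<epsilon>.
     open \<Omega> \<longrightarrow> N \<in> sets lebesgue \<longrightarrow> u \<in> sobolev k p \<Omega> \<longrightarrow> C_infinity \<eta> \<longrightarrow> M \<ge> 0 \<longrightarrow> \<epsilon> > 0 \<longrightarrow>
     (\<forall>bs\<in>multi k. \<forall>x. \<bar>iter_pderiv bs \<eta> x\<bar> \<le> M / \<epsilon> ^ length bs * indicator N x) \<longrightarrow>
     (\<lambda>x. \<eta> x *\<^sub>R u x) \<in> sobolev k p \<Omega> \<and>
     SE k p \<Omega> \<Omega> (\<lambda>x. \<eta> x *\<^sub>R u x) \<le> ennreal (C * M powr p) * scaled_SE \<epsilon> k p \<Omega> (\<Omega> \<inter> N) u)" for k C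
  have "\<exists>C\<ge>0. Q k C"
proof (induction k)
  case 0
  show ?case unfolding Q_def
  proof (intro exI[of _ 1] conjI allI impI)
    fix \<Omega> N :: "'a set" and u :: "'a \<Rightarrow> 'b" and \<eta> :: "'a \<Rightarrow> real" and M \<epsilon> :: real
    assume a: "open \<Omega>" "N \<in> sets lebesgue" "u \<in> sobolev 0 p \<Omega>" "C_infinity \<eta>" "M \<ge> 0" "\<epsilon> > 0"
      and "\<forall>bs\<in>multi 0. \<forall>x. \<bar>iter_pderiv bs \<eta> x\<bar> \<le> M / \<epsilon> ^ length bs * indicator N x"
    then have b: "\<bar>\<eta> x\<bar> \<le> M * indicator N x" for x by (simp add: multi_0)
    have \<Omega>: "\<Omega> \<in> sets lebesgue" using a by auto
    have um: "u \<in> borel_measurable (lebesgue_on \<Omega>)" using sobolev_measurable a by blast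
    have "\<bar>\<eta> x\<bar> \<le> M" for x using b[of x] a(5) by (cases "x \<in> N") auto
    then have L: "(\<lambda>x. \<eta> x *\<^sub>R u x) \<in> Lp_space p \<Omega>"
      by (intro Lp_scale[OF sobolev_Lp[OF a(3)], where c=M] p a borel_measurable_scaleR um borel_lebesgue_on C_infinity_borel)
        (auto intro!: mult_right_mono)
    note S = SE_0[OF L p a(1) _ \<Omega>]
    show "(\<lambda>x. \<eta> x *\<^sub>R u x) \<in> sobolev 0 p \<Omega>" using S(1) sobolev_iff_jet[OF p a(1)] by blast
    have "SE 0 p \<Omega> \<Omega> (\<lambda>x. \<eta> x *\<^sub>R u x) \<le> ennreal (M powr p) * enp p (\<Omega> \<inter> N) u"
      using enp_mult_supported[OF p \<Omega> a(2) um b a(5)] S(2) by simp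
    then show "SE 0 p \<Omega> \<Omega> (\<lambda>x. \<eta> x *\<^sub>R u x) \<le> ennreal (1 * M powr p) * scaled_SE \<epsilon> 0 p \<Omega> (\<Omega> \<inter> N) u"
      using SE_0(2)[OF sobolev_Lp[OF a(3)] p a(1), of "\<Omega> \<inter> N"] a \<Omega> by (simp add: scaled_SE_def)
  qed simp
next
  case (Suc k)
  then obtain C where C: "C \<ge> 0" and Q: "Q k C" by blast
  note IH = Q[unfolded Q_def, rule_format]
  \<comment> \<open>One term for the product itself; then, for each of the d directions, the factor
    2^p of \<open>sobolev_add\<close> on two summands with constant C.\<close>
  define C' where "C' = 1 + real DIM('a) * (2 powr p * (2 * C))"
  have C': "C' \<ge> 0" using C by (simp add: C'_def)
  show ?case unfolding Q_def
  proof (intro exI[of _ C'] conjI allI impI C')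
    fix \<Omega> N :: "'a set" and u :: "'a \<Rightarrow> 'b" and \<eta> :: "'a \<Rightarrow> real" and M \<epsilon> :: real
    assume a: "open \<Omega>" "N \<in> sets lebesgue" "u \<in> sobolev (Suc k) p \<Omega>" "C_infinity \<eta>" "M \<ge> 0" "\<epsilon> > 0"
      and bd: "\<forall>bs\<in>multi (Suc k). \<forall>x. \<bar>iter_pderiv bs \<eta> x\<bar> \<le> M / \<epsilon> ^ length bs * indicator N x"
    define A where "A = scaled_SE \<epsilon> (Suc k) p \<Omega> (\<Omega> \<inter> N) u"
    have b0: "\<bar>\<eta> x\<bar> \<le> M * indicator N x" for x using bd[rule_format, of "[]"] by (simp add: multi_def)
    have \<Omega>: "\<Omega> \<in> sets lebesgue" using a by auto
    have um: "u \<in> borel_measurable (lebesgue_on \<Omega>)" using sobolev_measurable a by blast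
    have "\<bar>\<eta> x\<bar> \<le> M" for x using b0[of x] a(5) by (cases "x \<in> N") auto
    then have L: "(\<lambda>x. \<eta> x *\<^sub>R u x) \<in> Lp_space p \<Omega>"
      by (intro Lp_scale[OF sobolev_Lp[OF a(3)], where c=M] p a borel_measurable_scaleR um borel_lebesgue_on C_infinity_borel)
        (auto intro!: mult_right_mono)
    define g where "g b = weak_deriv \<Omega> u [b]" for b
    have g: "has_weak_deriv \<Omega> u [b] (g b)" "g b \<in> sobolev k p \<Omega>" if "b \<in> Basis" for b
      unfolding g_def using sobolev_SucD[OF p a(1,3) that] by auto
    have uk: "u \<in> sobolev k p \<Omega>" using sobolev_mono[OF a(3)] by simp
    have N: "\<Omega> \<inter> N \<subseteq> \<Omega>" "\<Omega> \<inter> N \<in> sets lebesgue" using \<Omega> a by auto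
    let ?h = "\<lambda>b x. pderiv_dir b \<eta> x *\<^sub>R u x + \<eta> x *\<^sub>R g b x"
    have h: "?h b \<in> sobolev k p \<Omega> \<and> SE k p \<Omega> \<Omega> (?h b) \<le> ennreal (2 powr p * (2 * C) * M powr p) * A"
      if b: "b \<in> Basis" for b
    proof -
      have bnd1: "\<bar>iter_pderiv bs (pderiv_dir b \<eta>) x\<bar> \<le> (M / \<epsilon>) / \<epsilon> ^ length bs * indicator N x"
        if "bs \<in> multi k" for bs x
      proof -
        have "bs @ [b] \<in> multi (Suc k)" using that b by (auto simp: multi_def)
        then show ?thesis using bd[rule_format, of "bs @ [b]" x] by (simp add: iter_pderiv_append)
      qed
      have 1: "(\<lambda>x. pderiv_dir b \<eta> x *\<^sub>R u x) \<in> sobolev k p \<Omega> \<and>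
        SE k p \<Omega> \<Omega> (\<lambda>x. pderiv_dir b \<eta> x *\<^sub>R u x) \<le> ennreal (C * (M / \<epsilon>) powr p) * scaled_SE \<epsilon> k p \<Omega> (\<Omega> \<inter> N) u"
        by (rule IH[OF a(1,2) uk C_infinity_pderiv_dir[OF a(4) b] _ a(6) bnd1]) (use a in auto)
      have 2: "(\<lambda>x. \<eta> x *\<^sub>R g b x) \<in> sobolev k p \<Omega> \<and>
        SE k p \<Omega> \<Omega> (\<lambda>x. \<eta> x *\<^sub>R g b x) \<le> ennreal (C * M powr p) * scaled_SE \<epsilon> k p \<Omega> (\<Omega> \<inter> N) (g b)"
        by (rule IH[OF a(1,2) g(2)[OF b] a(4-6)]) (use bd in \<open>auto simp: multi_def\<close>)
      \<comment> \<open>The extra factor 1 / \<epsilon> turns the weight for j into the weight for j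
        + 1, so the sum becomes the tail of the sum defining \<open>A\<close>.\<close>
      have "ennreal (C * (M / \<epsilon>) powr p) * scaled_SE \<epsilon> k p \<Omega> (\<Omega> \<inter> N) u
          = ennreal (C * M powr p) * (\<Sum>j\<le>k. ennreal ((1 / \<epsilon> ^ Suc j) powr p) * SE (Suc k - Suc j) p \<Omega> (\<Omega> \<inter> N) u)"
      proof -
        have "ennreal (C * (M / \<epsilon>) powr p) * (ennreal ((1 / \<epsilon> ^ j) powr p) * s)
           = ennreal (C * M powr p) * (ennreal ((1 / \<epsilon> ^ Suc j) powr p) * s)" for j s
        proof -
          have e: "C * (M / \<epsilon>) powr p * (1 / \<epsilon> ^ j) powr p = C * M powr p * (1 / \<epsilon> ^ Suc j) powr p"
            using a by (simp add: powr_divide powr_mult)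
          have m: "ennreal x * (ennreal y * s) = ennreal (x * y) * s" if "x \<ge> 0" "y \<ge> 0" for x y
            using that by (simp add: ennreal_mult mult.assoc)
          have nn: "0 \<le> C * (M / \<epsilon>) powr p" "0 \<le> C * M powr p" "0 \<le> (1 / \<epsilon> ^ j) powr p" "0 \<le> (1 / \<epsilon> ^ Suc j) powr p"
            using C by simp_all
          show ?thesis by (simp only: m[OF nn(1,3)] m[OF nn(2,4)] e)
        qed
        then show ?thesis by (simp add: scaled_SE_def sum_distrib_left)
      qed
      also have "\<dots> \<le> ennreal (C * M powr p) * A"
        unfolding A_def scaled_SE_def
        by (intro mult_left_mono) (auto simp: sum.atMost_Suc_shift simp del: sum.atMost_Suc)
      finally have 3: "SE k p \<Omega> \<Omega> (\<lambda>x. pderiv_dir b \<eta> x *\<^sub>R u x) \<le> ennreal (C * M powr p) * A"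
        using 1 order_trans by blast
      have "scaled_SE \<epsilon> k p \<Omega> (\<Omega> \<inter> N) (g b) \<le> A"
      proof -
        have "SE (k - j) p \<Omega> (\<Omega> \<inter> N) (g b) \<le> SE (Suc k - j) p \<Omega> (\<Omega> \<inter> N) u" if "j \<le> k" for j
        proof -
          have us: "u \<in> sobolev (Suc (k - j)) p \<Omega>" using sobolev_mono[OF a(3)] by simp
          have "SE (k - j) p \<Omega> (\<Omega> \<inter> N) (g b) \<le> (\<Sum>b\<in>Basis. SE (k - j) p \<Omega> (\<Omega> \<inter> N) (g b))"
            by (rule member_le_sum) (use b in auto)
          also have "\<dots> \<le> SE (Suc (k - j)) p \<Omega> (\<Omega> \<inter> N) u"
            unfolding SE_Suc[OF p a(1) us N] g_def by simp
          finally show ?thesis using that by (simp add: Suc_diff_le)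
        qed
        then have "scaled_SE \<epsilon> k p \<Omega> (\<Omega> \<inter> N) (g b)
           \<le> (\<Sum>j\<le>k. ennreal ((1 / \<epsilon> ^ j) powr p) * SE (Suc k - j) p \<Omega> (\<Omega> \<inter> N) u)"
          unfolding scaled_SE_def by (intro sum_mono mult_left_mono) auto
        also have "\<dots> \<le> A" unfolding A_def scaled_SE_def by simp
        finally show ?thesis .
      qed
      then have 4: "SE k p \<Omega> \<Omega> (\<lambda>x. \<eta> x *\<^sub>R g b x) \<le> ennreal (C * M powr p) * A"
        using 2 by (meson mult_left_mono order_trans zero_le)
      have "SE k p \<Omega> \<Omega> (?h b) \<le> ennreal (2 powr p) * (ennreal (C * M powr p) * A + ennreal (C * M powr p) * A)"
        using sobolev_add(2)[OF p a(1) conjunct1[OF 1] conjunct1[OF 2] order_refl \<Omega>] 3 4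
        by (meson add_mono mult_left_mono order_trans zero_le)
      also have "\<dots> = ennreal (2 powr p * (2 * C) * M powr p) * A"
        using C by (simp add: mult_2[symmetric] ennreal_mult mult_ac)
      finally show ?thesis using sobolev_add(1)[OF p a(1) conjunct1[OF 1] conjunct1[OF 2]] by simp
    qed
    have hw: "has_weak_deriv \<Omega> (\<lambda>x. \<eta> x *\<^sub>R u x) [b] (?h b)" if "b \<in> Basis" for b
      by (rule has_weak_deriv_mult1[OF g(1)[OF that] a(4) that a(1)])
    show "(\<lambda>x. \<eta> x *\<^sub>R u x) \<in> sobolev (Suc k) p \<Omega>"
      by (rule sobolev_SucI(1)[OF p a(1) L hw]) (use h in auto)
    have "SE (Suc k) p \<Omega> \<Omega> (\<lambda>x. \<eta> x *\<^sub>R u x) = enp p \<Omega> (\<lambda>x. \<eta> x *\<^sub>R u x) + (\<Sum>b\<in>Basis. SE k p \<Omega> \<Omega> (?h b))"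
      by (rule sobolev_SucI(2)[OF p a(1) L hw]) (use h \<Omega> in auto)
    also have "\<dots> \<le> ennreal (M powr p) * A + (\<Sum>b\<in>(Basis::'a set). ennreal (2 powr p * (2 * C) * M powr p) * A)"
    proof (intro add_mono sum_mono)
      have "enp p \<Omega> (\<lambda>x. \<eta> x *\<^sub>R u x) \<le> ennreal (M powr p) * enp p (\<Omega> \<inter> N) u"
        by (rule enp_mult_supported[OF p \<Omega> a(2) um b0 a(5)])
      also have "enp p (\<Omega> \<inter> N) u \<le> SE (Suc k) p \<Omega> (\<Omega> \<inter> N) u" by (rule enp_le_SE[OF a(3) p a(1) N])
      also have "\<dots> \<le> A"
      proof -
        have "(\<Sum>j\<in>{0}. ennreal ((1 / \<epsilon> ^ j) powr p) * SE (Suc k - j) p \<Omega> (\<Omega> \<inter> N) u) \<le> A"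
          unfolding A_def scaled_SE_def by (rule sum_mono2) auto
        then show ?thesis by simp
      qed
      finally show "enp p \<Omega> (\<lambda>x. \<eta> x *\<^sub>R u x) \<le> ennreal (M powr p) * A" by (simp add: mult_left_mono)
    qed (use h in auto)
    also have "\<dots> = ennreal (C' * M powr p) * A"
      using C by (simp add: C'_def distrib_right distrib_left ennreal_mult ennreal_of_nat_eq_real_of_nat mult_ac)
    finally show "SE (Suc k) p \<Omega> \<Omega> (\<lambda>x. \<eta> x *\<^sub>R u x) \<le> ennreal (C' * M powr p) * scaled_SE \<epsilon> (Suc k) p \<Omega> (\<Omega> \<inter> N) u"
      by (simp add: A_def)
  qed
qed
  then show ?thesis unfolding Q_def .
qed

lemma AE_lebesgue_on_UNIV [simp]: "(AE x in lebesgue_on UNIV. P x) \<longleftrightarrow> (AE x in lebesgue. P x)"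
  unfolding lebesgue_on_UNIV_eq ..

subsection \<open>Comparison with the Sobolev norm\<close>

text \<open>The sum of the constants needed in the two directions of \<open>sobolev_norm_SE\<close>,
  so that a single number serves both.\<close>

definition SE_const :: "'a::euclidean_space itself \<Rightarrow> nat \<Rightarrow> real \<Rightarrow> real" where
  "SE_const T k p = real (Suc k) * real (card (multi k :: 'a list set)) powr p + real (card (multi k :: 'a list set))"

lemma SE_const_pos: "SE_const TYPE('a::euclidean_space) k p > 0"
proof -
  have "card (multi k :: 'a list set) > 0" using Nil_multi finite_multi card_gt_0_iff by blast
  then show ?thesis unfolding SE_const_def by (intro add_nonneg_pos) auto
qed

text \<open>Pointwise, the p-th power of the Euclidean norm of a derivative tensor and the sum of
  the p-th powers of its finitely many entries bound each other up to constants; then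
  integrate.\<close>

lemma sobolev_norm_SE:
  fixes u :: "'a::euclidean_space \<Rightarrow> 'b::euclidean_space"
  assumes p: "p \<ge> 1" and \<Omega>: "open \<Omega>" and u: "u \<in> sobolev k p \<Omega>"
  shows "ennreal (sobolev_norm k p \<Omega> u powr p) \<le> ennreal (SE_const TYPE('a) k p) * SE k p \<Omega> \<Omega> u"
    "SE k p \<Omega> \<Omega> u \<le> ennreal (SE_const TYPE('a) k p) * ennreal (sobolev_norm k p \<Omega> u powr p)"
proof -
  let ?w = "\<lambda>j x. weak_deriv_norm \<Omega> j u x"
  define n where "n = real (card (multi k :: 'a list set))"
  define I where "I = (\<integral>\<^sup>+x. ennreal (\<Sum>j\<le>k. ?w j x powr p) \<partial>lebesgue_on \<Omega>)"
  note j = jetD[OF jet_weak_deriv[OF p \<Omega> u]]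
  have sub: "dirs i \<subseteq> multi k" if "i \<le> k" for i using that by (auto simp: dirs_def multi_def)
  have fin: "finite (dirs i :: 'a list set)" for i
    by (rule finite_subset[OF _ finite_multi[of i]]) (auto simp: dirs_def multi_def)
  have wm: "?w i \<in> borel_measurable (lebesgue_on \<Omega>)" if "i \<le> k" for i
  proof -
    have "(\<lambda>x. \<Sum>bs\<in>dirs i. (norm (weak_deriv \<Omega> u bs x))\<^sup>2) \<in> borel_measurable (lebesgue_on \<Omega>)"
    proof (rule borel_measurable_sum)
      fix bs :: "'a list" assume "bs \<in> dirs i"
      then have [measurable]: "weak_deriv \<Omega> u bs \<in> borel_measurable (lebesgue_on \<Omega>)"
        using sub[OF that] j(3) by blast
      show "(\<lambda>x. (norm (weak_deriv \<Omega> u bs x))\<^sup>2) \<in> borel_measurable (lebesgue_on \<Omega>)" by measurable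
    qed
    then show ?thesis unfolding weak_deriv_norm_def[abs_def] by measurable
  qed
  have w0: "?w i x \<ge> 0" for i x by (simp add: weak_deriv_norm_def sum_nonneg)
  have le1: "norm (weak_deriv \<Omega> u bs x) powr p \<le> (\<Sum>j\<le>k. ?w j x powr p)" if "bs \<in> multi k" for bs x
  proof -
    have "bs \<in> dirs (length bs)" "length bs \<le> k" using that by (auto simp: dirs_def multi_def)
    then have "(norm (weak_deriv \<Omega> u bs x))\<^sup>2 \<le> (\<Sum>bs\<in>dirs (length bs). (norm (weak_deriv \<Omega> u bs x))\<^sup>2)"
      by (intro member_le_sum[where f="\<lambda>bs. (norm (weak_deriv \<Omega> u bs x))\<^sup>2"]) (auto simp: fin)
    then have "norm (weak_deriv \<Omega> u bs x) \<le> ?w (length bs) x"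
      unfolding weak_deriv_norm_def by (rule real_le_rsqrt)
    then have "norm (weak_deriv \<Omega> u bs x) powr p \<le> ?w (length bs) x powr p"
      using p by (intro powr_mono2) auto
    also have "\<dots> \<le> (\<Sum>j\<le>k. ?w j x powr p)"
      by (rule member_le_sum[where f="\<lambda>j. ?w j x powr p"]) (use \<open>length bs \<le> k\<close> in auto)
    finally show ?thesis .
  qed
  have le2: "?w i x powr p \<le> n powr p * (\<Sum>bs\<in>multi k. norm (weak_deriv \<Omega> u bs x) powr p)" if "i \<le> k" for i x
  proof -
    have "?w i x \<le> (\<Sum>bs\<in>dirs i. norm (weak_deriv \<Omega> u bs x))"
      using L2_set_le_sum[of "dirs i" "\<lambda>bs. norm (weak_deriv \<Omega> u bs x)"]
      by (simp add: weak_deriv_norm_def L2_set_def)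
    also have "\<dots> \<le> (\<Sum>bs\<in>multi k. norm (weak_deriv \<Omega> u bs x))"
      by (rule sum_mono2) (use sub[OF that] in auto)
    finally have "?w i x powr p \<le> (\<Sum>bs\<in>multi k. norm (weak_deriv \<Omega> u bs x)) powr p"
      using p w0 by (intro powr_mono2) auto
    also have "\<dots> \<le> n powr p * (\<Sum>bs\<in>multi k. norm (weak_deriv \<Omega> u bs x) powr p)"
      unfolding n_def by (rule powr_sum_le) (use p in auto)
    finally show ?thesis .
  qed
  have I1: "I \<le> ennreal (real (Suc k) * n powr p) * SE k p \<Omega> \<Omega> u"
  proof -
    have "I \<le> (\<integral>\<^sup>+x. ennreal (real (Suc k) * n powr p) * (\<Sum>bs\<in>multi k. ennreal (norm (weak_deriv \<Omega> u bs x) powr p)) \<partial>lebesgue_on \<Omega>)"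
      unfolding I_def
    proof (rule nn_integral_mono)
      fix x
      have "(\<Sum>j\<le>k. ?w j x powr p) \<le> (\<Sum>j\<le>k. n powr p * (\<Sum>bs\<in>multi k. norm (weak_deriv \<Omega> u bs x) powr p))"
        by (intro sum_mono le2) auto
      then have "ennreal (\<Sum>j\<le>k. ?w j x powr p)
         \<le> ennreal (real (Suc k) * n powr p * (\<Sum>bs\<in>multi k. norm (weak_deriv \<Omega> u bs x) powr p))"
        by (intro ennreal_leI) simp
      then show "ennreal (\<Sum>j\<le>k. ?w j x powr p)
         \<le> ennreal (real (Suc k) * n powr p) * (\<Sum>bs\<in>multi k. ennreal (norm (weak_deriv \<Omega> u bs x) powr p))"
        by (subst sum_ennreal) (auto simp: ennreal_mult[symmetric] sum_nonneg simp del: of_nat_Suc)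
    qed
    also have "\<dots> = ennreal (real (Suc k) * n powr p) * SE k p \<Omega> \<Omega> u"
    proof -
      have m: "(\<lambda>x. ennreal (norm (weak_deriv \<Omega> u bs x) powr p)) \<in> borel_measurable (lebesgue_on \<Omega>)" if "bs \<in> multi k" for bs
        using j(3)[OF that] by measurable
      show ?thesis
        by (subst nn_integral_cmult, (rule borel_measurable_sum, erule m), subst nn_integral_sum, erule m)
           (simp add: SE_def enp_def)
    qed
    finally show ?thesis .
  qed
  have I2: "SE k p \<Omega> \<Omega> u \<le> ennreal n * I"
  proof -
    have "SE k p \<Omega> \<Omega> u \<le> (\<Sum>bs\<in>(multi k :: 'a list set). I)"
      unfolding SE_def enp_def I_def by (intro sum_mono nn_integral_mono ennreal_leI le1)
    then show ?thesis by (simp add: n_def ennreal_of_nat_eq_real_of_nat)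
  qed
  have eq: "ennreal (sobolev_norm k p \<Omega> u powr p) = I"
  proof -
    have If: "I < \<infinity>" using I1 SE_finite[OF u p \<Omega>]
      by (metis ennreal_less_top ennreal_mult_less_top infinity_ennreal_def le_less_trans)
    have "(\<integral>x. (\<Sum>j\<le>k. ?w j x powr p) \<partial>lebesgue_on \<Omega>) = enn2real I"
      unfolding I_def using wm
      by (intro integral_eq_nn_integral borel_measurable_sum) (auto intro!: sum_nonneg)
    then have "sobolev_norm k p \<Omega> u powr p = enn2real I"
      using p by (simp add: sobolev_norm_def powr_powr)
    then show ?thesis using If by simp
  qed
  have n: "n \<ge> 0" by (simp add: n_def)
  have "ennreal (real (Suc k) * n powr p) \<le> ennreal (SE_const TYPE('a) k p)" "ennreal n \<le> ennreal (SE_const TYPE('a) k p)"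
    by (auto simp: SE_const_def n_def[symmetric] n intro!: ennreal_leI)
  then show "ennreal (sobolev_norm k p \<Omega> u powr p) \<le> ennreal (SE_const TYPE('a) k p) * SE k p \<Omega> \<Omega> u"
    "SE k p \<Omega> \<Omega> u \<le> ennreal (SE_const TYPE('a) k p) * ennreal (sobolev_norm k p \<Omega> u powr p)"
    unfolding eq using I1 I2 by (meson mult_right_mono order_trans zero_le)+
qed

text \<open>Together with \<open>sobolev_norm_small\<close> this translates smallness between the
  norm of the definitions and the energies, so that afterwards only energies need to be
  estimated.\<close>

lemma SE_small:
  assumes p: "p \<ge> 1" and e: "e > 0"
  obtains \<eta> where "\<eta> > 0" "\<And>(\<Omega> :: 'a::euclidean_space set) (u :: 'a \<Rightarrow> 'b::euclidean_space).
     open \<Omega> \<Longrightarrow> u \<in> sobolev k p \<Omega> \<Longrightarrow> sobolev_norm k p \<Omega> u < \<eta> \<Longrightarrow> SE k p \<Omega> \<Omega> u < ennreal e"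
proof -
  let ?C = "SE_const TYPE('a) k p"
  define \<eta> where "\<eta> = (e / (2 * ?C)) powr (1 / p)"
  have C: "?C > 0" by (rule SE_const_pos)
  have \<eta>: "\<eta> > 0" using e C by (simp add: \<eta>_def)
  have "SE k p \<Omega> \<Omega> u < ennreal e" if a: "open \<Omega>" "u \<in> sobolev k p \<Omega>" "sobolev_norm k p \<Omega> u < \<eta>"
    for \<Omega> :: "'a set" and u :: "'a \<Rightarrow> 'b"
  proof -
    have "sobolev_norm k p \<Omega> u powr p \<le> \<eta> powr p"
      using a p by (intro powr_mono2) (auto simp: sobolev_norm_def)
    also have "\<dots> = e / (2 * ?C)" using p e C by (simp add: \<eta>_def powr_powr)
    finally have "ennreal ?C * ennreal (sobolev_norm k p \<Omega> u powr p) \<le> ennreal ?C * ennreal (e / (2 * ?C))"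
      by (intro mult_left_mono ennreal_leI) auto
    also have "\<dots> = ennreal (e / 2)" using C e by (simp add: ennreal_mult[symmetric])
    also have "\<dots> < ennreal e" using e by (intro ennreal_lessI) auto
    finally show ?thesis using sobolev_norm_SE(2)[OF p a(1,2)] by (rule le_less_trans[rotated])
  qed
  with \<eta> that show ?thesis by blast
qed

lemma sobolev_norm_small:
  assumes p: "p \<ge> 1" and e: "e > 0"
  obtains \<eta> where "\<eta> > 0" "\<And>(\<Omega> :: 'a::euclidean_space set) (u :: 'a \<Rightarrow> 'b::euclidean_space).
     open \<Omega> \<Longrightarrow> u \<in> sobolev k p \<Omega> \<Longrightarrow> SE k p \<Omega> \<Omega> u \<le> ennreal \<eta> \<Longrightarrow> sobolev_norm k p \<Omega> u < e"
proof -
  let ?C = "SE_const TYPE('a) k p"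
  define \<eta> where "\<eta> = (e / 2) powr p / ?C"
  have C: "?C > 0" by (rule SE_const_pos)
  have \<eta>: "\<eta> > 0" using e C by (simp add: \<eta>_def)
  have "sobolev_norm k p \<Omega> u < e" if a: "open \<Omega>" "u \<in> sobolev k p \<Omega>" "SE k p \<Omega> \<Omega> u \<le> ennreal \<eta>"
    for \<Omega> :: "'a set" and u :: "'a \<Rightarrow> 'b"
  proof (rule ccontr)
    assume "\<not> ?thesis"
    then have "e powr p \<le> sobolev_norm k p \<Omega> u powr p" using p e by (intro powr_mono2) auto
    then have "ennreal (e powr p) \<le> ennreal (sobolev_norm k p \<Omega> u powr p)" by (rule ennreal_leI)
    also have "\<dots> \<le> ennreal ?C * ennreal \<eta>"
      using sobolev_norm_SE(1)[OF p a(1,2)] a(3) by (meson mult_left_mono order_trans zero_le)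
    also have "\<dots> = ennreal ((e / 2) powr p)" using C by (simp add: ennreal_mult[symmetric] \<eta>_def)
    finally have "e powr p \<le> (e / 2) powr p" by (simp add: ennreal_le_iff)
    then show False using powr_less_mono2[of p "e / 2" e] p e by simp
  qed
  with \<eta> that show ?thesis by blast
qed

section \<open>Approximation by test functions supported off a closed set\<close>

lemma C_infinity_vanishingI:
  "v \<in> C0_infinity UNIV \<Longrightarrow> supp v \<inter> E = {} \<Longrightarrow> v \<in> C_infinity_vanishing E \<Lambda>"
  by (auto simp: C_infinity_vanishing_def)

text \<open>An element of \<open>C_infinity_vanishing\<close> is known on \<Lambda> only. Replacing
  it by the test function behind it leaves the energy on \<Lambda> unchanged and provides the
  function on the whole space to which extension operators and cutoffs are applied.\<close>

lemma sobolev_vanishing_iff: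
  fixes u :: "'a::euclidean_space \<Rightarrow> 'b::euclidean_space"
  assumes p: "p \<ge> 1" and \<Lambda>: "open \<Lambda>"
  shows "u \<in> sobolev_vanishing k p E \<Lambda> \<longleftrightarrow> u \<in> sobolev k p \<Lambda> \<and>
    (\<forall>e>0. \<exists>v\<in>C0_infinity UNIV. supp v \<inter> E = {} \<and> SE k p \<Lambda> \<Lambda> (\<lambda>x. u x - v x) < ennreal e)"
    (is "?L \<longleftrightarrow> ?R")
proof
  assume u: ?L
  then have us: "u \<in> sobolev k p \<Lambda>" by (simp add: sobolev_vanishing_def)
  have "\<exists>v\<in>C0_infinity UNIV. supp v \<inter> E = {} \<and> SE k p \<Lambda> \<Lambda> (\<lambda>x. u x - v x) < ennreal e" if e: "e > 0" for e
  proof -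
    obtain \<eta> where \<eta>: "\<eta> > 0" "\<And>(\<Omega> :: 'a set) (u :: 'a \<Rightarrow> 'b).
       open \<Omega> \<Longrightarrow> u \<in> sobolev k p \<Omega> \<Longrightarrow> sobolev_norm k p \<Omega> u < \<eta> \<Longrightarrow> SE k p \<Omega> \<Omega> u < ennreal e"
      using SE_small[OF p e] by metis
    obtain v' where v': "v' \<in> C_infinity_vanishing E \<Lambda>" "sobolev_norm k p \<Lambda> (\<lambda>x. u x - v' x) < \<eta>"
      using u \<eta>(1) unfolding sobolev_vanishing_def by blast
    obtain v where v: "v \<in> C0_infinity UNIV" "supp v \<inter> E = {}" "\<And>x. x \<in> \<Lambda> \<Longrightarrow> v' x = v x"
      using v'(1) unfolding C_infinity_vanishing_def by blast
    have d: "(\<lambda>x. u x - v x) \<in> sobolev k p \<Lambda>"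
      by (rule sobolev_diff(1)[OF p \<Lambda> us sobolev_C0_infinity(1)[OF v(1) p \<Lambda>]])
    have ae: "AE x in lebesgue_on \<Lambda>. u x - v x = u x - v' x"
      by (rule AE_I2) (auto simp: space_restrict_space v(3))
    have m: "(\<lambda>x. u x - v' x) \<in> borel_measurable (lebesgue_on \<Lambda>)"
      by (rule measurable_lebesgue_cong[THEN iffD1, OF _ sobolev_measurable[OF d]]) (simp add: v(3))
    note c = sobolev_cong_AE[OF p \<Lambda> d ae m]
    have "SE k p \<Lambda> \<Lambda> (\<lambda>x. u x - v' x) < ennreal e"
      using \<eta>(2)[OF \<Lambda> c(1) v'(2)] .
    then show ?thesis using c(2)[of \<Lambda>] v \<Lambda> by auto
  qed
  with us show ?R by blast
next
  assume R: ?R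
  show ?L unfolding sobolev_vanishing_def
  proof (intro CollectI conjI allI impI)
    show us: "u \<in> sobolev k p \<Lambda>" using R by blast
    fix e :: real assume e: "e > 0"
    obtain \<eta> where \<eta>: "\<eta> > 0" "\<And>(\<Omega> :: 'a set) (u :: 'a \<Rightarrow> 'b).
       open \<Omega> \<Longrightarrow> u \<in> sobolev k p \<Omega> \<Longrightarrow> SE k p \<Omega> \<Omega> u \<le> ennreal \<eta> \<Longrightarrow> sobolev_norm k p \<Omega> u < e"
      using sobolev_norm_small[OF p e] by metis
    obtain v where v: "v \<in> C0_infinity UNIV" "supp v \<inter> E = {}" "SE k p \<Lambda> \<Lambda> (\<lambda>x. u x - v x) < ennreal \<eta>"
      using R \<eta>(1) by blast
    have d: "(\<lambda>x. u x - v x) \<in> sobolev k p \<Lambda>"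
      by (rule sobolev_diff(1)[OF p \<Lambda> us sobolev_C0_infinity(1)[OF v(1) p \<Lambda>]])
    show "\<exists>v\<in>C_infinity_vanishing E \<Lambda>. sobolev_norm k p \<Lambda> (\<lambda>x. u x - v x) < e"
      using \<eta>(2)[OF \<Lambda> d less_imp_le[OF v(3)]] C_infinity_vanishingI[OF v(1,2)] by blast
  qed
qed

text \<open>Admits approximants that are themselves only limits of test functions; the two errors
  are combined by \<open>sobolev_add\<close>.\<close>

lemma sobolev_vanishing_closed:
  fixes u :: "'a::euclidean_space \<Rightarrow> 'b::euclidean_space"
  assumes p: "p \<ge> 1" and \<Lambda>: "open \<Lambda>" and u: "u \<in> sobolev k p \<Lambda>"
    and ap: "\<And>e. e > 0 \<Longrightarrow> \<exists>w\<in>sobolev_vanishing k p E \<Lambda>. SE k p \<Lambda> \<Lambda> (\<lambda>x. u x - w x) < ennreal e"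
  shows "u \<in> sobolev_vanishing k p E \<Lambda>"
  unfolding sobolev_vanishing_iff[OF p \<Lambda>]
proof (intro conjI u allI impI)
  fix e :: real assume e: "e > 0"
  define e' where "e' = e / (4 * 2 powr p)"
  have e': "e' > 0" using e by (simp add: e'_def)
  obtain w where w: "w \<in> sobolev_vanishing k p E \<Lambda>" "SE k p \<Lambda> \<Lambda> (\<lambda>x. u x - w x) < ennreal e'"
    using ap[OF e'] by blast
  then have ws: "w \<in> sobolev k p \<Lambda>" by (simp add: sobolev_vanishing_def)
  obtain v where v: "v \<in> C0_infinity UNIV" "supp v \<inter> E = {}" "SE k p \<Lambda> \<Lambda> (\<lambda>x. w x - v x) < ennreal e'"
    using w(1) e' unfolding sobolev_vanishing_iff[OF p \<Lambda>] by blast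
  have vs: "v \<in> sobolev k p \<Lambda>" by (rule sobolev_C0_infinity(1)[OF v(1) p \<Lambda>])
  have "SE k p \<Lambda> \<Lambda> (\<lambda>x. (u x - w x) + (w x - v x))
     \<le> ennreal (2 powr p) * (SE k p \<Lambda> \<Lambda> (\<lambda>x. u x - w x) + SE k p \<Lambda> \<Lambda> (\<lambda>x. w x - v x))"
    by (rule sobolev_add(2)[OF p \<Lambda>]) (use sobolev_diff(1)[OF p \<Lambda>] u ws vs \<Lambda> in auto)
  also have "\<dots> \<le> ennreal (2 powr p) * (ennreal e' + ennreal e')"
    using w(2) v(3) by (intro mult_left_mono add_mono) auto
  also have "\<dots> = ennreal (e / 2)"
    using e' by (simp add: ennreal_plus[symmetric] ennreal_mult[symmetric] e'_def del: ennreal_plus)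
  also have "\<dots> < ennreal e" using e by (intro ennreal_lessI) auto
  finally show "\<exists>v\<in>C0_infinity UNIV. supp v \<inter> E = {} \<and> SE k p \<Lambda> \<Lambda> (\<lambda>x. u x - v x) < ennreal e"
    using v by auto
qed

lemma SE_zero:
  assumes p: "p \<ge> 1" and \<Omega>: "open \<Omega>"
  shows "(\<lambda>_. 0) \<in> sobolev k p \<Omega>" "SE k p \<Omega> \<Omega> (\<lambda>_. 0) = 0"
proof -
  have z: "(\<lambda>_. 0) \<in> C0_infinity UNIV" by (rule C0_infinityI[of _ "{}"]) (auto simp: C_infinity_const)
  show "(\<lambda>_. 0) \<in> sobolev k p \<Omega>" by (rule sobolev_C0_infinity(1)[OF z p \<Omega>])
  show "SE k p \<Omega> \<Omega> (\<lambda>_. 0) = 0"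
    using sobolev_C0_infinity(2)[OF z p \<Omega>, of \<Omega> k] \<Omega> by (simp add: iter_pderiv_zero enp_def)
qed

lemma sobolev_scaleR:
  assumes "p \<ge> 1" "open \<Omega>" "u \<in> sobolev k p \<Omega>"
  shows "(\<lambda>x. c *\<^sub>R u x) \<in> sobolev k p \<Omega>"
    "S \<subseteq> \<Omega> \<Longrightarrow> S \<in> sets lebesgue \<Longrightarrow> SE k p \<Omega> S (\<lambda>x. c *\<^sub>R u x) \<le> ennreal (\<bar>c\<bar> powr p) * SE k p \<Omega> S u"
  using sobolev_linear[OF assms bounded_linear_scaleR_right[of c], of "\<bar>c\<bar>"] by auto

text \<open>Continuity at the origin gives a bound on the energies by homogeneity.\<close>

lemma extension_operator_bounded:
  fixes T :: "('a::euclidean_space \<Rightarrow> 'b::{real_normed_field,euclidean_space}) \<Rightarrow> 'a \<Rightarrow> 'b"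
  assumes p: "p \<ge> 1" and \<Omega>: "open \<Omega>"
    and T: "continuous_extension_operator k p \<Omega> (sobolev k p \<Omega>) (sobolev k p UNIV) T"
  obtains C where "C \<ge> 0" "\<And>u. u \<in> sobolev k p \<Omega> \<Longrightarrow> SE k p UNIV UNIV (T u) \<le> ennreal C * SE k p \<Omega> \<Omega> u"
proof -
  have Ts: "T u \<in> sobolev k p UNIV" if "u \<in> sobolev k p \<Omega>" for u
    using T that by (simp add: continuous_extension_operator_def)
  have lin: "AE x in lebesgue. T (\<lambda>y. a * u y + b * v y) x = a * T u x + b * T v x"
    if "u \<in> sobolev k p \<Omega>" "v \<in> sobolev k p \<Omega>" for u v a b
    using T that unfolding continuous_extension_operator_def by blast
  have cont: "\<forall>u\<in>sobolev k p \<Omega>. \<forall>\<epsilon>>0. \<exists>\<delta>>0. \<forall>v\<in>sobolev k p \<Omega>.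
      sobolev_norm k p \<Omega> (\<lambda>x. v x - u x) < \<delta> \<longrightarrow> sobolev_norm k p UNIV (\<lambda>x. T v x - T u x) < \<epsilon>"
    using T unfolding continuous_extension_operator_def by (elim conjE)
  let ?z = "\<lambda>_::'a. 0::'b"
  note z = SE_zero(1)[OF p \<Omega>, of k, where ?'b='b]
  \<comment> \<open>Linearity holds only almost everywhere, so the image of the zero function is
    only almost everywhere 0.\<close>
  have T0: "AE x in lebesgue. T ?z x = 0" using lin[OF z z, of 0 0] by simp
  obtain \<eta>1 where \<eta>1: "\<eta>1 > 0" "\<And>(\<Omega> :: 'a set) (u :: 'a \<Rightarrow> 'b).
       open \<Omega> \<Longrightarrow> u \<in> sobolev k p \<Omega> \<Longrightarrow> sobolev_norm k p \<Omega> u < \<eta>1 \<Longrightarrow> SE k p \<Omega> \<Omega> u < ennreal 1"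
    using SE_small[OF p zero_less_one] by metis
  obtain \<delta> where \<delta>: "\<delta> > 0" "\<And>v. v \<in> sobolev k p \<Omega> \<Longrightarrow> sobolev_norm k p \<Omega> (\<lambda>x. v x - ?z x) < \<delta> \<Longrightarrow>
        sobolev_norm k p UNIV (\<lambda>x. T v x - T ?z x) < \<eta>1"
    using cont[rule_format, OF z \<eta>1(1)] by blast
  obtain \<eta> where \<eta>: "\<eta> > 0" "\<And>(\<Omega> :: 'a set) (u :: 'a \<Rightarrow> 'b).
       open \<Omega> \<Longrightarrow> u \<in> sobolev k p \<Omega> \<Longrightarrow> SE k p \<Omega> \<Omega> u \<le> ennreal \<eta> \<Longrightarrow> sobolev_norm k p \<Omega> u < \<delta>"
    using sobolev_norm_small[OF p \<delta>(1)] by metis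
  have small: "SE k p UNIV UNIV (T v) \<le> 1" if v: "v \<in> sobolev k p \<Omega>" "SE k p \<Omega> \<Omega> v \<le> ennreal \<eta>" for v
  proof -
    have d: "(\<lambda>x. T v x - T ?z x) \<in> sobolev k p UNIV"
      by (rule sobolev_diff(1)[OF p open_UNIV Ts[OF v(1)] Ts[OF z]])
    have "sobolev_norm k p \<Omega> (\<lambda>x. v x - ?z x) < \<delta>" using \<eta>(2)[OF \<Omega> v] by simp
    then have "SE k p UNIV UNIV (\<lambda>x. T v x - T ?z x) < ennreal 1"
      using \<eta>1(2)[OF open_UNIV d] \<delta>(2)[OF v(1)] by blast
    moreover have "SE k p UNIV UNIV (T v) = SE k p UNIV UNIV (\<lambda>x. T v x - T ?z x)"
      by (rule sobolev_cong_AE(2)[OF p open_UNIV d])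
        (use T0 sobolev_measurable[OF Ts[OF v(1)]] in \<open>auto simp: lebesgue_on_UNIV_eq elim!: eventually_mono\<close>)
    ultimately show ?thesis by simp
  qed
  have bd: "SE k p UNIV UNIV (T u) \<le> ennreal (s / \<eta>)"
    if u: "u \<in> sobolev k p \<Omega>" "SE k p \<Omega> \<Omega> u \<le> ennreal s" and s: "s > 0" for u s
  proof -
    \<comment> \<open>Chosen so that scaling \<open>u\<close> by c turns the energy bound s into
      \<eta>, where \<open>small\<close> applies.\<close>
    define c where "c = (\<eta> / s) powr (1 / p)"
    have c: "c > 0" "c powr p = \<eta> / s" using \<eta> s p by (auto simp: c_def powr_powr)
    let ?v = "\<lambda>y. c *\<^sub>R u y"
    have v: "?v \<in> sobolev k p \<Omega>" by (rule sobolev_scaleR(1)[OF p \<Omega> u(1)])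
    have "SE k p \<Omega> \<Omega> ?v \<le> ennreal (\<bar>c\<bar> powr p) * SE k p \<Omega> \<Omega> u"
      by (rule sobolev_scaleR(2)[OF p \<Omega> u(1)]) (use \<Omega> in auto)
    also have "\<dots> \<le> ennreal (\<eta> / s) * ennreal s" using c u(2) by (intro mult_mono) auto
    also have "\<dots> = ennreal \<eta>" using s \<eta> by (simp add: ennreal_mult[symmetric])
    finally have Tv: "SE k p UNIV UNIV (T ?v) \<le> 1" by (rule small[OF v])
    have "AE x in lebesgue. T (\<lambda>y. of_real c * u y + 0 * u y) x = of_real c * T u x + 0 * T u x"
      by (rule lin[OF u(1) u(1)])
    then have ae: "AE x in lebesgue. (1 / c) *\<^sub>R T ?v x = T u x"
      by eventually_elim (use c in \<open>simp add: scaleR_conv_of_real\<close>)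
    have "SE k p UNIV UNIV (T u) = SE k p UNIV UNIV (\<lambda>x. (1 / c) *\<^sub>R T ?v x)"
      by (rule sobolev_cong_AE(2)[OF p open_UNIV sobolev_scaleR(1)[OF p open_UNIV Ts[OF v]]])
        (use ae sobolev_measurable[OF Ts[OF u(1)]] in \<open>auto simp: lebesgue_on_UNIV_eq\<close>)
    also have "\<dots> \<le> ennreal (\<bar>1 / c\<bar> powr p) * SE k p UNIV UNIV (T ?v)"
      by (rule sobolev_scaleR(2)[OF p open_UNIV Ts[OF v]]) auto
    also have "\<dots> \<le> ennreal (\<bar>1 / c\<bar> powr p) * 1" by (intro mult_left_mono Tv) auto
    also have "\<bar>1 / c\<bar> powr p = s / \<eta>" using c by (simp add: powr_divide)
    finally show ?thesis by simp
  qed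
  show ?thesis
  proof (rule that[of "1 / \<eta>"])
    fix u :: "'a \<Rightarrow> 'b" assume u: "u \<in> sobolev k p \<Omega>"
    define s where "s = enn2real (SE k p \<Omega> \<Omega> u)"
    have s: "SE k p \<Omega> \<Omega> u = ennreal s" "s \<ge> 0" using SE_finite[OF u p \<Omega>] by (auto simp: s_def)
    \<comment> \<open>\<open>bd\<close> asks for a positive bound. Enlarging s by e \<eta> covers
      energy 0 as well, and e is removed afterwards.\<close>
    have L: "SE k p UNIV UNIV (T u) \<le> ennreal (s / \<eta>) + ennreal e" if "e > 0" for e
    proof -
      have "SE k p UNIV UNIV (T u) \<le> ennreal ((s + e * \<eta>) / \<eta>)"
        by (rule bd[OF u]) (use s that \<eta> in \<open>auto intro!: ennreal_leI add_nonneg_pos\<close>)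
      also have "(s + e * \<eta>) / \<eta> = s / \<eta> + e" using \<eta> by (simp add: field_simps)
      finally show ?thesis using s \<eta> that by (simp add: ennreal_plus)
    qed
    have "SE k p UNIV UNIV (T u) \<le> ennreal (s / \<eta>)" by (rule ennreal_le_epsilon, rule L)
    also have "\<dots> = ennreal (1 / \<eta>) * SE k p \<Omega> \<Omega> u" using s \<eta> by (simp add: ennreal_mult[symmetric])
    finally show "SE k p UNIV UNIV (T u) \<le> ennreal (1 / \<eta>) * SE k p \<Omega> \<Omega> u" .
  qed (use \<eta> in auto)
qed

subsection \<open>Mollification of Sobolev functions\<close>

lemma borel_representative:
  fixes u :: "'a::euclidean_space \<Rightarrow> 'b::euclidean_space"
  assumes u: "u \<in> borel_measurable lebesgue"
  obtains u' where "u' \<in> borel_measurable borel" "AE x in lebesgue. u x = u' x"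
proof -
  have "\<exists>g\<in>borel_measurable lborel. AE x in lborel. u x \<bullet> b = g x" for b
    by (rule completion_ex_borel_measurable_real) (use u in simp)
  then obtain g where g: "\<And>b. g b \<in> borel_measurable lborel" "\<And>b. AE x in lborel. u x \<bullet> b = g b x" by metis
  show ?thesis
  proof (rule that[of "\<lambda>x. \<Sum>b\<in>Basis. g b x *\<^sub>R b"])
    show "(\<lambda>x. \<Sum>b\<in>Basis. g b x *\<^sub>R b) \<in> borel_measurable borel"
      using g(1) by (intro borel_measurable_sum borel_measurable_scaleR) auto
    have "AE x in lebesgue. \<forall>b\<in>Basis. u x \<bullet> b = g b x"
      using g(2) by (intro AE_finite_allI) (auto intro: AE_completion)
    then show "AE x in lebesgue. u x = (\<Sum>b\<in>Basis. g b x *\<^sub>R b)"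
    proof eventually_elim
      case (elim x)
      then have "(\<Sum>b\<in>Basis. g b x *\<^sub>R b) = (\<Sum>b\<in>Basis. (u x \<bullet> b) *\<^sub>R b)" by simp
      then show ?case by (simp add: euclidean_representation)
    qed
  qed
qed

text \<open>For fixed x the reflected kernel, sending y to \<open>\<phi> (x - y)\<close>, is an
  admissible test function; its derivative carries a minus sign that cancels the one in the
  definition of the weak derivative.\<close>

lemma pderiv_dir_conv_weak:
  fixes u g :: "'a::euclidean_space \<Rightarrow> 'b::euclidean_space"
  assumes w: "has_weak_deriv UNIV u [b] g" and u: "loc_int u" and g: "loc_int g"
    and \<phi>: "\<phi> \<in> C0_infinity UNIV" and b: "b \<in> Basis"
  shows "pderiv_dir b (conv \<phi> u) = conv \<phi> g"
proof
  fix x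
  define \<psi> where "\<psi> y = \<phi> ((-1) *\<^sub>R y + x)" for y
  have smooth: "C_infinity \<phi>" by (rule C0_infinity_D(1)[OF \<phi>])
  have \<psi>s: "C_infinity \<psi>" unfolding \<psi>_def[abs_def] by (rule C_infinity_affine[OF smooth])
  obtain r where r: "r > 0" "\<And>x. norm x > r \<Longrightarrow> \<phi> x = 0" using C0_infinity_in_cball[OF \<phi>] by metis
  have \<psi>: "\<psi> \<in> C0_infinity UNIV"
    by (rule C0_infinityI[OF \<psi>s compact_cball[of x r]]) (use r in \<open>auto simp: \<psi>_def dist_norm\<close>)
  have d: "iter_pderiv [b] \<psi> = (\<lambda>y. - pderiv_dir b \<phi> (x - y))"
    using iter_pderiv_affine[OF smooth, of "[b]" "-1" x] b by (simp add: \<psi>_def[abs_def] fun_eq_iff)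
  have d\<phi>: "pderiv_dir b \<phi> \<in> C0_infinity UNIV" using C0_infinity_iter_pderiv[OF \<phi>, of "[b]"] b by simp
  have L: "(\<integral>y. \<theta> (x - y) *\<^sub>R f y \<partial>lebesgue_on UNIV) = conv \<theta> f x"
    if "\<theta> \<in> C0_infinity UNIV" "loc_int f" for \<theta> and f :: "'a \<Rightarrow> 'b"
    unfolding conv_def lebesgue_on_UNIV_eq
    by (rule integral_completion, rule borel_measurable_integrable, rule conv_integrable[OF that])
  have "- conv (pderiv_dir b \<phi>) u x = (\<integral>y. iter_pderiv [b] \<psi> y *\<^sub>R u y \<partial>lebesgue_on UNIV)"
    unfolding d L[OF d\<phi> u, symmetric] by simp
  also have "\<dots> = - (\<integral>y. \<psi> y *\<^sub>R g y \<partial>lebesgue_on UNIV)"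
    using has_weak_derivD(3)[OF w \<psi>] by simp
  also have "(\<integral>y. \<psi> y *\<^sub>R g y \<partial>lebesgue_on UNIV) = conv \<phi> g x"
    unfolding L[OF \<phi> g, symmetric] \<psi>_def by simp
  finally show "pderiv_dir b (conv \<phi> u) x = conv \<phi> g x"
    using pderiv_dir_conv[OF \<phi> u b] by simp
qed

lemma mollifier_ex:
  assumes "\<delta> > 0"
  shows "\<exists>\<phi> :: 'a::euclidean_space \<Rightarrow> real. mollifier \<delta> \<phi>"
  by (rule mollifier_scaled) (use assms in blast)

lemma Lp_borel_loc_int:
  assumes "g \<in> Lp_space p UNIV" "g \<in> borel_measurable borel" "p \<ge> 1"
  shows "loc_int g"
  using enp_loc_int[OF assms(2,3)] assms(1) by (simp add: Lp_space_iff)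

lemma sobolev_borel_deriv:
  fixes u :: "'a::euclidean_space \<Rightarrow> 'b::euclidean_space"
  assumes p: "p \<ge> 1" and u: "u \<in> sobolev (Suc k) p UNIV" and b: "b \<in> Basis"
  obtains g where "g \<in> borel_measurable borel" "has_weak_deriv UNIV u [b] g" "g \<in> sobolev k p UNIV"
proof -
  note w = sobolev_SucD[OF p open_UNIV u b]
  obtain g where g: "g \<in> borel_measurable borel" "AE x in lebesgue. weak_deriv UNIV u [b] x = g x"
    using borel_representative[of "weak_deriv UNIV u [b]"] sobolev_measurable[OF w(2)]
    by (auto simp: lebesgue_on_UNIV_eq)
  have ae: "AE x in lebesgue_on UNIV. weak_deriv UNIV u [b] x = g x" unfolding lebesgue_on_UNIV_eq by (rule g(2))
  have s: "g \<in> sobolev k p UNIV"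
    by (rule sobolev_cong_AE(1)[OF p open_UNIV w(2) ae borel_lebesgue_on[OF g(1)]])
  have "has_weak_deriv UNIV u [b] g"
    by (rule has_weak_deriv_cong_AE[OF w(1) _ ae])
      (use has_weak_derivD(1)[OF w(1)] Lp_locally_integrable[OF sobolev_Lp[OF s] p open_UNIV] b in auto)
  then show ?thesis using that g(1) s by blast
qed

text \<open>Mollification commutes with weak derivatives, so the claim reduces to
  \<open>conv_converges\<close> for each of them. A threshold is good for all smaller kernels at
  once, so the thresholds of the finitely many directions can be replaced by their minimum.\<close>

lemma sobolev_conv:
  fixes u :: "'a::euclidean_space \<Rightarrow> 'b::euclidean_space"
  assumes p: "p \<ge> 1" and u: "u \<in> sobolev k p UNIV" "u \<in> borel_measurable borel" and e: "e > 0"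
  shows "\<exists>\<delta>0>0. \<forall>\<delta> \<phi>. \<delta> \<le> \<delta>0 \<longrightarrow> mollifier \<delta> \<phi> \<longrightarrow>
     conv \<phi> u \<in> sobolev k p UNIV \<and> SE k p UNIV UNIV (\<lambda>x. conv \<phi> u x - u x) \<le> ennreal e"
  using u e
proof (induction k arbitrary: u e)
  case (0 u e)
  have L: "u \<in> Lp_space p UNIV" using sobolev_Lp 0 by blast
  have li: "loc_int u" using Lp_borel_loc_int[OF L 0(2) p] .
  obtain \<delta>0 where \<delta>0: "\<delta>0 > 0" "\<And>\<delta> \<phi>. \<delta> \<le> \<delta>0 \<Longrightarrow> mollifier \<delta> \<phi> \<Longrightarrow> enp p UNIV (\<lambda>x. conv \<phi> u x - u x) \<le> ennreal e"
    using conv_converges[OF 0(2) p _ 0(3)] L by (metis Lp_space_iff)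
  have "conv \<phi> u \<in> sobolev 0 p UNIV \<and> SE 0 p UNIV UNIV (\<lambda>x. conv \<phi> u x - u x) \<le> ennreal e"
    if "\<delta> \<le> \<delta>0" and m: "mollifier \<delta> \<phi>" for \<delta> \<phi>
  proof -
    have cm: "conv \<phi> u \<in> borel_measurable borel"
      by (rule C_infinity_borel[OF conv_C_infinity[OF mollifierD(2)[OF m] li]])
    have "enp p UNIV (conv \<phi> u) \<le> enp p UNIV u" by (rule enp_conv_le[OF m li p]) auto
    then have Lc: "conv \<phi> u \<in> Lp_space p UNIV"
      using L borel_lebesgue_on[OF cm] by (auto simp: Lp_space_iff intro: le_less_trans)
    have "conv \<phi> u \<in> sobolev 0 p UNIV"
      using SE_0(1)[OF Lc p open_UNIV, of UNIV] sobolev_iff_jet[OF p open_UNIV] by auto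
    moreover have "(\<lambda>x. conv \<phi> u x - u x) \<in> Lp_space p UNIV"
      by (rule sobolev_Lp[OF sobolev_diff(1)[OF p open_UNIV calculation 0(1)]])
    ultimately show ?thesis using SE_0(2)[of "\<lambda>x. conv \<phi> u x - u x" p UNIV UNIV] p \<delta>0(2)[OF that] by simp
  qed
  then show ?case using \<delta>0(1) by blast
next
  case (Suc k u e)
  have "\<exists>g. g \<in> borel_measurable borel \<and> has_weak_deriv UNIV u [b] g \<and> g \<in> sobolev k p UNIV" if "b \<in> Basis" for b
    using sobolev_borel_deriv[OF p Suc.prems(1) that] by metis
  then obtain g where g: "\<And>b. b \<in> Basis \<Longrightarrow> g b \<in> borel_measurable borel"
    "\<And>b. b \<in> Basis \<Longrightarrow> has_weak_deriv UNIV u [b] (g b)" "\<And>b. b \<in> Basis \<Longrightarrow> g b \<in> sobolev k p UNIV" by metis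
  \<comment> \<open>One share for the function and one for each of the d directions.\<close>
  define e' where "e' = e / (1 + real DIM('a))"
  have e': "e' > 0" using Suc.prems(3) by (simp add: e'_def add_pos_nonneg)
  have L: "u \<in> Lp_space p UNIV" using sobolev_Lp Suc.prems(1) by blast
  have li: "loc_int u" using Lp_borel_loc_int[OF L Suc.prems(2) p] .
  have lig: "loc_int (g b)" if "b \<in> Basis" for b
    using Lp_borel_loc_int[OF sobolev_Lp[OF g(3)[OF that]] g(1)[OF that] p] .
  obtain \<delta>1 where \<delta>1: "\<delta>1 > 0" "\<And>\<delta> \<phi>. \<delta> \<le> \<delta>1 \<Longrightarrow> mollifier \<delta> \<phi> \<Longrightarrow> enp p UNIV (\<lambda>x. conv \<phi> u x - u x) \<le> ennreal e'"
    using conv_converges[OF Suc.prems(2) p _ e'] L by (metis Lp_space_iff)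
  have "\<exists>\<delta>0>0. \<forall>\<delta> \<phi>. \<delta> \<le> \<delta>0 \<longrightarrow> mollifier \<delta> \<phi> \<longrightarrow>
     conv \<phi> (g b) \<in> sobolev k p UNIV \<and> SE k p UNIV UNIV (\<lambda>x. conv \<phi> (g b) x - g b x) \<le> ennreal e'"
    if "b \<in> Basis" for b by (rule Suc.IH[OF g(3)[OF that] g(1)[OF that] e'])
  then obtain \<delta>2 where \<delta>2: "\<And>b. b \<in> Basis \<Longrightarrow> \<delta>2 b > 0"
    "\<And>b \<delta> \<phi>. b \<in> Basis \<Longrightarrow> \<delta> \<le> \<delta>2 b \<Longrightarrow> mollifier \<delta> \<phi> \<Longrightarrow>
     conv \<phi> (g b) \<in> sobolev k p UNIV \<and> SE k p UNIV UNIV (\<lambda>x. conv \<phi> (g b) x - g b x) \<le> ennreal e'" by metis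
  define \<delta>0 where "\<delta>0 = min \<delta>1 (Min (\<delta>2 ` Basis))"
  have "\<delta>0 > 0" using \<delta>1 \<delta>2(1) by (auto simp: \<delta>0_def)
  moreover have "conv \<phi> u \<in> sobolev (Suc k) p UNIV \<and> SE (Suc k) p UNIV UNIV (\<lambda>x. conv \<phi> u x - u x) \<le> ennreal e"
    if \<delta>: "\<delta> \<le> \<delta>0" and m: "mollifier \<delta> \<phi>" for \<delta> \<phi>
  proof -
    note mD = mollifierD[OF m]
    have smooth: "C_infinity (conv \<phi> u)" by (rule conv_C_infinity[OF mD(2) li])
    have "enp p UNIV (conv \<phi> u) \<le> enp p UNIV u" by (rule enp_conv_le[OF m li p]) auto
    then have Lc: "conv \<phi> u \<in> Lp_space p UNIV"
      using L borel_lebesgue_on[OF C_infinity_borel[OF smooth]] by (auto simp: Lp_space_iff intro: le_less_trans)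
    have gb: "conv \<phi> (g b) \<in> sobolev k p UNIV \<and> SE k p UNIV UNIV (\<lambda>x. conv \<phi> (g b) x - g b x) \<le> ennreal e'"
      if "b \<in> Basis" for b
      by (rule \<delta>2(2)[OF that _ m]) (use \<delta> that in \<open>auto simp: \<delta>0_def\<close>)
    have w: "has_weak_deriv UNIV (conv \<phi> u) [b] (conv \<phi> (g b))" if "b \<in> Basis" for b
      using has_weak_deriv_classical1[OF smooth that open_UNIV]
      unfolding pderiv_dir_conv_weak[OF g(2)[OF that] li lig[OF that] mD(2) that] .
    have c: "conv \<phi> u \<in> sobolev (Suc k) p UNIV"
      by (rule sobolev_SucI(1)[OF p open_UNIV Lc w]) (use gb in auto)
    have wd: "has_weak_deriv UNIV (\<lambda>x. conv \<phi> u x - u x) [b] (\<lambda>x. conv \<phi> (g b) x - g b x)" if "b \<in> Basis" for b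
      using has_weak_deriv_add[OF w[OF that] has_weak_deriv_bounded_linear[OF bounded_linear_minus[OF bounded_linear_ident] g(2)[OF that]]]
        that by simp
    have ds: "(\<lambda>x. conv \<phi> (g b) x - g b x) \<in> sobolev k p UNIV" if "b \<in> Basis" for b
      using sobolev_diff(1)[OF p open_UNIV conjunct1[OF gb[OF that]] g(3)[OF that]] .
    have dL: "(\<lambda>x. conv \<phi> u x - u x) \<in> Lp_space p UNIV"
      by (rule sobolev_Lp[OF sobolev_diff(1)[OF p open_UNIV c Suc.prems(1)]])
    have "SE (Suc k) p UNIV UNIV (\<lambda>x. conv \<phi> u x - u x) = enp p UNIV (\<lambda>x. conv \<phi> u x - u x)
       + (\<Sum>b\<in>Basis. SE k p UNIV UNIV (\<lambda>x. conv \<phi> (g b) x - g b x))"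
      by (rule sobolev_SucI(2)[OF p open_UNIV dL wd ds]) auto
    also have "\<dots> \<le> ennreal e' + (\<Sum>b\<in>(Basis :: 'a set). ennreal e')"
      by (intro add_mono sum_mono \<delta>1(2)[OF _ m]) (use \<delta> gb in \<open>auto simp: \<delta>0_def\<close>)
    also have "\<dots> = ennreal (e' + real DIM('a) * e')"
      using e' by (simp add: ennreal_of_nat_eq_real_of_nat ennreal_mult[symmetric] ennreal_plus)
    also have "e' + real DIM('a) * e' = e" by (simp add: e'_def field_simps add_nonneg_eq_0_iff)
    finally show ?thesis using c by blast
  qed
  ultimately show ?case by blast
qed

text \<open>Mollify at a scale below the distance from \<open>K\<close> to \<open>E\<close>: the
  result is a test function whose support still misses \<open>E\<close>.\<close>

lemma sobolev_vanishing_compact_support: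
  fixes f :: "'a::euclidean_space \<Rightarrow> 'b::euclidean_space"
  assumes p: "p \<ge> 1" and f: "f \<in> sobolev k p UNIV" and K: "compact K" "K \<inter> E = {}" and E: "closed E"
    and z: "AE x in lebesgue. x \<notin> K \<longrightarrow> f x = 0"
  shows "f \<in> sobolev_vanishing k p E UNIV"
  unfolding sobolev_vanishing_iff[OF p open_UNIV]
proof (intro conjI f allI impI)
  fix e :: real assume e: "e > 0"
  obtain f0 where f0: "f0 \<in> borel_measurable borel" "AE x in lebesgue. f x = f0 x"
    using borel_representative[of f] sobolev_measurable[OF f] by (auto simp: lebesgue_on_UNIV_eq)
  \<comment> \<open>Borel, and zero at every point off \<open>K\<close> instead of almost every one,
    so that the convolution vanishes pointwise away from \<open>K\<close>.\<close>
  define f' where "f' x = indicator K x *\<^sub>R f0 x" for x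
  have f'm: "f' \<in> borel_measurable borel" unfolding f'_def[abs_def] using f0(1) borel_compact[OF K(1)] by measurable
  have ae: "AE x in lebesgue_on UNIV. f x = f' x"
    using z f0(2) unfolding lebesgue_on_UNIV_eq by eventually_elim (auto simp: f'_def indicator_def)
  have f's: "f' \<in> sobolev k p UNIV"
    by (rule sobolev_cong_AE(1)[OF p open_UNIV f ae borel_lebesgue_on[OF f'm]])
  have li: "loc_int f'" using Lp_borel_loc_int[OF sobolev_Lp[OF f's] f'm p] .
  obtain \<delta>1 where \<delta>1: "\<delta>1 > 0" "\<And>\<delta> \<phi>. \<delta> \<le> \<delta>1 \<Longrightarrow> mollifier \<delta> \<phi> \<Longrightarrow>
     conv \<phi> f' \<in> sobolev k p UNIV \<and> SE k p UNIV UNIV (\<lambda>x. conv \<phi> f' x - f' x) \<le> ennreal (e / 2)"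
    using sobolev_conv[OF p f's f'm, of "e / 2"] e by auto
  obtain \<delta>2 where \<delta>2: "\<delta>2 > 0" "closure (nhd K \<delta>2) \<subseteq> - E" "compact (closure (nhd K \<delta>2))"
    using compact_nhd_subset[OF K(1), of "- E"] E K(2) by (auto simp: open_Compl)
  define \<delta> where "\<delta> = min \<delta>1 \<delta>2"
  have \<delta>: "\<delta> > 0" "\<delta> \<le> \<delta>1" "\<delta> \<le> \<delta>2" using \<delta>1 \<delta>2 by (auto simp: \<delta>_def)
  obtain \<phi> :: "'a \<Rightarrow> real" where m: "mollifier \<delta> \<phi>"
    using mollifier_ex[where ?'a='a, OF \<delta>(1)] by (elim exE)
  note mD = mollifierD[OF m]
  let ?v = "conv \<phi> f'"
  have vz: "?v x = 0" if "x \<notin> closure (nhd K \<delta>2)" for x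
  proof (rule conv_eq_0[of \<delta>])
    fix y assume y: "dist x y < \<delta>"
    have "x \<notin> nhd K \<delta>2" using that closure_subset by blast
    then have "y \<notin> K" using y \<delta>(3) by (auto simp: nhd_def dist_commute)
    then show "f' y = 0" by (simp add: f'_def)
  qed (use mD in auto)
  have v: "?v \<in> C0_infinity UNIV"
    by (rule C0_infinityI[OF conv_C_infinity[OF mD(2) li] \<delta>2(3)]) (use vz in auto)
  have "supp ?v \<subseteq> closure (nhd K \<delta>2)" by (rule supp_subset) (use vz in auto)
  then have "supp ?v \<inter> E = {}" using \<delta>2(2) by auto
  moreover have "SE k p UNIV UNIV (\<lambda>x. f x - ?v x) < ennreal e"
  proof -
    have c: "?v \<in> sobolev k p UNIV" "SE k p UNIV UNIV (\<lambda>x. ?v x - f' x) \<le> ennreal (e / 2)"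
      using \<delta>1(2)[OF \<delta>(2) m] by auto
    have d: "(\<lambda>x. ?v x - f' x) \<in> sobolev k p UNIV" by (rule sobolev_diff(1)[OF p open_UNIV c(1) f's])
    have d': "(\<lambda>x. f' x - ?v x) \<in> sobolev k p UNIV" by (rule sobolev_diff(1)[OF p open_UNIV f's c(1)])
    have "SE k p UNIV UNIV (\<lambda>x. f x - ?v x) = SE k p UNIV UNIV (\<lambda>x. f' x - ?v x)"
      by (rule sobolev_cong_AE(2)[OF p open_UNIV d'])
        (use ae sobolev_measurable[OF sobolev_diff(1)[OF p open_UNIV f c(1)]] in \<open>auto elim!: eventually_mono\<close>)
    also have "\<dots> \<le> ennreal (e / 2)"
      using sobolev_uminus(2)[OF p open_UNIV d, of UNIV] c(2) by simp
    also have "\<dots> < ennreal e" using e by (intro ennreal_lessI) auto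
    finally show ?thesis .
  qed
  ultimately show "\<exists>v\<in>C0_infinity UNIV. supp v \<inter> E = {} \<and> SE k p UNIV UNIV (\<lambda>x. f x - v x) < ennreal e"
    using v by blast
qed

subsection \<open>Translation estimates\<close>

definition gradp :: "real \<Rightarrow> ('a::euclidean_space \<Rightarrow> 'b::real_normed_vector) \<Rightarrow> 'a \<Rightarrow> real" where
  "gradp p g z = (\<Sum>b\<in>Basis. norm (pderiv_dir b g z) powr p)"

lemma gradp_nonneg: "gradp p g z \<ge> 0"
  by (simp add: gradp_def sum_nonneg)

lemma gradp_borel:
  assumes "C_infinity g"
  shows "gradp p g \<in> borel_measurable borel"
  unfolding gradp_def[abs_def]
proof (rule borel_measurable_sum)
  fix b :: 'a assume "b \<in> Basis"
  then have [measurable]: "pderiv_dir b g \<in> borel_measurable borel"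
    using C_infinity_borel C_infinity_pderiv_dir assms by blast
  show "(\<lambda>x. norm (pderiv_dir b g x) powr p) \<in> borel_measurable borel" by measurable
qed

text \<open>The fundamental theorem of calculus along the segment from x to x + h, then Jensen in
  the parameter t. The factor \<open>real DIM('a) powr p\<close> compares the p-th power of a sum of
  d terms with the sum of their p-th powers.\<close>

lemma translation_pointwise:
  fixes g :: "'a::euclidean_space \<Rightarrow> 'b::euclidean_space"
  assumes g: "C_infinity g" and p: "p \<ge> 1"
  shows "ennreal (norm (g (x + h) - g x) powr p)
    \<le> (\<integral>\<^sup>+t. indicator {0..1} t * ennreal (norm h powr p * (real DIM('a) powr p * gradp p g (x + t *\<^sub>R h))) \<partial>lborel)"
proof -
  define \<gamma> where "\<gamma> t = (\<Sum>b\<in>Basis. (h \<bullet> b) *\<^sub>R pderiv_dir b g (x + t *\<^sub>R h))" for t :: real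
  define N where "N t = norm h * (\<Sum>b\<in>Basis. norm (pderiv_dir b g (x + t *\<^sub>R h)))" for t :: real
  have dc: "continuous_on UNIV (pderiv_dir b g)" if "b \<in> Basis" for b
    using C_infinity_continuous C_infinity_pderiv_dir g that by blast
  have dct: "continuous_on UNIV (\<lambda>t. pderiv_dir b g (x + t *\<^sub>R h))" if "b \<in> Basis" for b
    by (rule continuous_on_compose2[OF dc[OF that]]) (auto intro!: continuous_intros)
  have c\<gamma>: "continuous_on UNIV \<gamma>" unfolding \<gamma>_def[abs_def] by (intro continuous_intros dct)
  have cN: "continuous_on UNIV N" unfolding N_def[abs_def] by (intro continuous_intros dct)
  have [measurable]: "N \<in> borel_measurable borel" "\<gamma> \<in> borel_measurable borel"
    using cN c\<gamma> by (auto intro: borel_measurable_continuous_onI)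
  have N0: "N t \<ge> 0" for t by (simp add: N_def sum_nonneg)
  have "has_bochner_integral lborel (\<lambda>t. indicator {0..1} t *\<^sub>R \<gamma> t) (g (x + 1 *\<^sub>R h) - g (x + 0 *\<^sub>R h))"
  proof (rule has_bochner_integral_FTC_Icc)
    fix t :: real
    have D: "(g has_derivative frechet_derivative g (at (x + t *\<^sub>R h))) (at (x + t *\<^sub>R h))"
      using C_infinity_differentiable[OF g] frechet_derivative_works by blast
    have "((\<lambda>t. g (x + t *\<^sub>R h)) has_derivative (\<lambda>s. frechet_derivative g (at (x + t *\<^sub>R h)) (s *\<^sub>R h))) (at t within {0..1})"
      by (rule has_derivative_compose[where g=g and f="\<lambda>t. x + t *\<^sub>R h"
            and g'="frechet_derivative g (at (x + t *\<^sub>R h))", OF _ D]) (auto intro!: derivative_eq_intros)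
    moreover have "frechet_derivative g (at (x + t *\<^sub>R h)) (s *\<^sub>R h) = s *\<^sub>R \<gamma> t" for s
      by (simp add: frechet_derivative_eq_sum[OF C_infinity_differentiable[OF g]] \<gamma>_def scaleR_sum_right)
    ultimately show "((\<lambda>t. g (x + t *\<^sub>R h)) has_vector_derivative \<gamma> t) (at t within {0..1})"
      by (simp add: has_vector_derivative_def)
  qed (auto intro: continuous_on_subset[OF c\<gamma>])
  then have "integrable lborel (\<lambda>t. indicator {0..1} t *\<^sub>R \<gamma> t)"
    "(\<integral>t. indicator {0..1} t *\<^sub>R \<gamma> t \<partial>lborel) = g (x + h) - g x"
    by (simp_all add: has_bochner_integral_iff)
  then have "ennreal (norm (g (x + h) - g x)) \<le> (\<integral>\<^sup>+t. ennreal (norm (indicator {0..1} t *\<^sub>R \<gamma> t)) \<partial>lborel)"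
    using integral_norm_bound_ennreal by metis
  also have "\<dots> \<le> (\<integral>\<^sup>+t. ennreal (indicator {0..1} t * N t) \<partial>lborel)"
  proof (rule nn_integral_mono, rule ennreal_leI)
    fix t
    have "norm (\<gamma> t) \<le> (\<Sum>b\<in>Basis. norm h * norm (pderiv_dir b g (x + t *\<^sub>R h)))"
      unfolding \<gamma>_def by (rule sum_norm_le) (auto intro!: mult_right_mono Basis_le_norm)
    then show "norm (indicator {0..1} t *\<^sub>R \<gamma> t) \<le> indicator {0..1} t * N t"
      by (auto simp: N_def sum_distrib_left indicator_def)
  qed
  finally have 1: "ennreal (norm (g (x + h) - g x)) \<le> (\<integral>\<^sup>+t. ennreal (indicator {0..1} t * N t) \<partial>lborel)" .
  have "ennreal (norm (g (x + h) - g x) powr p) \<le> (\<integral>\<^sup>+t. ennreal (indicator {0..1} t * N t powr p) \<partial>lborel)"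
  proof (rule nn_integral_Jensen_powr[OF _ _ _ _ _ _ 1 p])
    show "(\<integral>\<^sup>+t. ennreal (indicator {0..1::real} t) \<partial>lborel) = 1" by (simp add: ennreal_indicator)
  qed (use N0 in auto)
  also have "\<dots> \<le> (\<integral>\<^sup>+t. indicator {0..1} t * ennreal (norm h powr p * (real DIM('a) powr p * gradp p g (x + t *\<^sub>R h))) \<partial>lborel)"
  proof (rule nn_integral_mono)
    fix t
    have "N t powr p = norm h powr p * (\<Sum>b\<in>Basis. norm (pderiv_dir b g (x + t *\<^sub>R h))) powr p"
      unfolding N_def by (rule powr_mult)
    also have "\<dots> \<le> norm h powr p * (real DIM('a) powr p * gradp p g (x + t *\<^sub>R h))"
      unfolding gradp_def by (intro mult_left_mono powr_sum_le p) auto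
    finally show "ennreal (indicator {0..1} t * N t powr p)
       \<le> indicator {0..1} t * ennreal (norm h powr p * (real DIM('a) powr p * gradp p g (x + t *\<^sub>R h)))"
      by (auto simp: indicator_def intro: ennreal_leI)
  qed
  finally show ?thesis .
qed

text \<open>Only x is confined to \<open>A\<close>; its partner x + h is free within distance
  \<open>R\<close>. The pair is parametrised by h because the points x + t h of the segment are
  later substituted either for x or for h.\<close>

definition shift_energy :: "real \<Rightarrow> 'a::euclidean_space set \<Rightarrow> real \<Rightarrow> ('a \<Rightarrow> 'b::euclidean_space) \<Rightarrow> ennreal" where
  "shift_energy p A R g = (\<integral>\<^sup>+x. \<integral>\<^sup>+h. indicator A x * indicator (ball 0 R) h *
      ennreal (norm (g (x + h) - g x) powr p) \<partial>lborel \<partial>lborel)"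

definition vball :: "'a::euclidean_space itself \<Rightarrow> real \<Rightarrow> real" where
  "vball T R = measure lborel (ball (0::'a) R)"

lemma emeasure_ball_vball:
  fixes x :: "'a::euclidean_space"
  shows "emeasure lborel (ball x R) = ennreal (vball TYPE('a) R)"
proof (cases "R \<ge> 0")
  case True
  then show ?thesis unfolding vball_def measure_def by (simp add: emeasure_ball)
next
  case False
  then have "ball x R = {}" "ball (0::'a) R = {}" by auto
  then show ?thesis unfolding vball_def by (metis emeasure_empty ennreal_0 measure_empty)
qed

lemma vball_eq: "R \<ge> 0 \<Longrightarrow> vball TYPE('a::euclidean_space) R = unit_ball_vol (real DIM('a)) * R ^ DIM('a)"
  unfolding vball_def by (rule content_ball)

lemma vball_nonneg [simp]: "vball T R \<ge> 0" by (simp add: vball_def)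

text \<open>The parameter t is moved to the outermost integral, since the better bound for the inner
  double integral depends on whether t is small.\<close>

lemma shift_energy_smooth:
  fixes g :: "'a::euclidean_space \<Rightarrow> 'b::euclidean_space"
  assumes g: "C_infinity g" and p: "p \<ge> 1" and A [measurable]: "A \<in> sets borel"
  shows "shift_energy p A R g \<le> ennreal (R powr p * real DIM('a) powr p) *
     (\<integral>\<^sup>+t. indicator {0..1} t * (\<integral>\<^sup>+x. \<integral>\<^sup>+h. indicator A x * indicator (ball 0 R) h * ennreal (gradp p g (x + t *\<^sub>R h)) \<partial>lborel \<partial>lborel) \<partial>lborel)"
proof -
  have [measurable]: "g \<in> borel_measurable borel" using C_infinity_borel g by blast
  have [measurable]: "gradp p g \<in> borel_measurable borel" by (rule gradp_borel[OF g])
  let ?c = "ennreal (R powr p * real DIM('a) powr p)"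
  let ?F = "\<lambda>x h t. indicator {0..1} t * (indicator A x * indicator (ball 0 R) h * ennreal (gradp p g (x + t *\<^sub>R h)))"
  have "shift_energy p A R g \<le> (\<integral>\<^sup>+x. \<integral>\<^sup>+h. \<integral>\<^sup>+t. ?c * ?F x h t \<partial>lborel \<partial>lborel \<partial>lborel)"
    unfolding shift_energy_def
  proof (intro nn_integral_mono)
    fix x h :: 'a
    show "indicator A x * indicator (ball 0 R) h * ennreal (norm (g (x + h) - g x) powr p)
       \<le> (\<integral>\<^sup>+t. ?c * ?F x h t \<partial>lborel)"
    proof (cases "x \<in> A \<and> h \<in> ball 0 R")
      case True
      have "(\<integral>\<^sup>+t. indicator {0..1} t * ennreal (norm h powr p * (real DIM('a) powr p * gradp p g (x + t *\<^sub>R h))) \<partial>lborel)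
        \<le> (\<integral>\<^sup>+t. ?c * ?F x h t \<partial>lborel)"
      proof (rule nn_integral_mono)
        fix t
        have "norm h powr p \<le> R powr p" using True p by (intro powr_mono2) auto
        then have "norm h powr p * (real DIM('a) powr p * gradp p g (x + t *\<^sub>R h))
            \<le> R powr p * (real DIM('a) powr p * gradp p g (x + t *\<^sub>R h))"
          by (intro mult_right_mono mult_nonneg_nonneg gradp_nonneg) auto
        then show "indicator {0..1} t * ennreal (norm h powr p * (real DIM('a) powr p * gradp p g (x + t *\<^sub>R h))) \<le> ?c * ?F x h t"
          using True by (cases "t \<in> {0..1}") (auto simp: ennreal_mult[symmetric] gradp_nonneg mult.assoc intro!: ennreal_leI)
      qed
      note le = order_trans[OF translation_pointwise[OF g p, of x h] this]
      have "indicator A x * indicator (ball 0 R) h * ennreal (norm (g (x + h) - g x) powr p)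
          = ennreal (norm (g (x + h) - g x) powr p)" using True by simp
      then show ?thesis using le by (rule ord_eq_le_trans)
    qed (auto simp: indicator_def)
  qed
  also have "\<dots> = (\<integral>\<^sup>+x. \<integral>\<^sup>+t. \<integral>\<^sup>+h. ?c * ?F x h t \<partial>lborel \<partial>lborel \<partial>lborel)"
    by (intro nn_integral_cong lborel_pair.Fubini') measurable
  also have "\<dots> = (\<integral>\<^sup>+t. \<integral>\<^sup>+x. \<integral>\<^sup>+h. ?c * ?F x h t \<partial>lborel \<partial>lborel \<partial>lborel)"
    by (intro lborel_pair.Fubini') measurable
  also have "\<dots> = (\<integral>\<^sup>+t. ?c * (indicator {0..1} t * (\<integral>\<^sup>+x. \<integral>\<^sup>+h. indicator A x * indicator (ball 0 R) h * ennreal (gradp p g (x + t *\<^sub>R h)) \<partial>lborel \<partial>lborel)) \<partial>lborel)"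
  proof (rule nn_integral_cong)
    fix t :: real
    let ?f = "\<lambda>x h. indicator A x * indicator (ball 0 R) h * ennreal (gradp p g (x + t *\<^sub>R h))"
    define a where "a = ?c * indicator {0..1} t"
    have 1: "(\<integral>\<^sup>+h. a * ?f x h \<partial>lborel) = a * (\<integral>\<^sup>+h. ?f x h \<partial>lborel)" for x
      by (rule nn_integral_cmult) measurable
    have 2: "(\<integral>\<^sup>+x. a * (\<integral>\<^sup>+h. ?f x h \<partial>lborel) \<partial>lborel) = a * (\<integral>\<^sup>+x. \<integral>\<^sup>+h. ?f x h \<partial>lborel \<partial>lborel)"
      by (rule nn_integral_cmult) measurable
    have "(\<integral>\<^sup>+x. \<integral>\<^sup>+h. ?c * ?F x h t \<partial>lborel \<partial>lborel) = (\<integral>\<^sup>+x. \<integral>\<^sup>+h. a * ?f x h \<partial>lborel \<partial>lborel)"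
      by (simp only: a_def mult.assoc)
    then show "(\<integral>\<^sup>+x. \<integral>\<^sup>+h. ?c * ?F x h t \<partial>lborel \<partial>lborel) = ?c * (indicator {0..1} t * (\<integral>\<^sup>+x. \<integral>\<^sup>+h. ?f x h \<partial>lborel \<partial>lborel))"
      unfolding 1 2 by (simp only: a_def mult.assoc)
  qed
  also have "\<dots> = ?c * (\<integral>\<^sup>+t. indicator {0..1} t * (\<integral>\<^sup>+x. \<integral>\<^sup>+h. indicator A x * indicator (ball 0 R) h * ennreal (gradp p g (x + t *\<^sub>R h)) \<partial>lborel \<partial>lborel) \<partial>lborel)"
    by (rule nn_integral_cmult) measurable
  finally show ?thesis .
qed

text \<open>For fixed h and t the map from x to x + t h is a translation, so integrating over x
  first costs nothing, and h contributes the volume of a ball.\<close>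

lemma shift_bound_local:
  fixes G :: "'a::euclidean_space \<Rightarrow> ennreal"
  assumes [measurable]: "G \<in> borel_measurable borel" "A \<in> sets borel" "N \<in> sets borel"
    and N: "\<And>x y. x \<in> A \<Longrightarrow> dist x y < R \<Longrightarrow> y \<in> N" and t: "t \<in> {0..1}"
  shows "(\<integral>\<^sup>+x. \<integral>\<^sup>+h. indicator A x * indicator (ball 0 R) h * G (x + t *\<^sub>R h) \<partial>lborel \<partial>lborel)
    \<le> ennreal (vball TYPE('a) R) * (\<integral>\<^sup>+z. indicator N z * G z \<partial>lborel)"
proof -
  let ?I = "\<integral>\<^sup>+z. indicator N z * G z \<partial>lborel"
  have "(\<integral>\<^sup>+x. \<integral>\<^sup>+h. indicator A x * indicator (ball 0 R) h * G (x + t *\<^sub>R h) \<partial>lborel \<partial>lborel)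
     = (\<integral>\<^sup>+h. \<integral>\<^sup>+x. indicator A x * indicator (ball 0 R) h * G (x + t *\<^sub>R h) \<partial>lborel \<partial>lborel)"
    by (rule lborel_pair.Fubini') measurable
  also have "\<dots> \<le> (\<integral>\<^sup>+h. indicator (ball (0::'a) R) h * ?I \<partial>lborel)"
  proof (rule nn_integral_mono)
    fix h :: 'a
    show "(\<integral>\<^sup>+x. indicator A x * indicator (ball 0 R) h * G (x + t *\<^sub>R h) \<partial>lborel) \<le> indicator (ball 0 R) h * ?I"
    proof (cases "h \<in> ball 0 R")
      case True
      have "(\<integral>\<^sup>+x. indicator A x * indicator (ball 0 R) h * G (x + t *\<^sub>R h) \<partial>lborel)
         \<le> (\<integral>\<^sup>+x. indicator N (x + t *\<^sub>R h) * G (x + t *\<^sub>R h) \<partial>lborel)"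
      proof (rule nn_integral_mono)
        fix x
        have "dist x (x + t *\<^sub>R h) < R"
        proof -
          have "t * norm h \<le> 1 * norm h" using t by (intro mult_right_mono) auto
          then show ?thesis using True t by (simp add: dist_norm)
        qed
        then show "indicator A x * indicator (ball 0 R) h * G (x + t *\<^sub>R h) \<le> indicator N (x + t *\<^sub>R h) * G (x + t *\<^sub>R h)"
          using N[of x "x + t *\<^sub>R h"] True by (cases "x \<in> A") auto
      qed
      also have "\<dots> = ?I"
        by (rule nn_integral_lborel_shift[of "\<lambda>z. indicator N z * G z"]) measurable
      finally show ?thesis using True by simp
    qed simp
  qed
  also have "\<dots> = emeasure lborel (ball (0::'a) R) * ?I"
    by (subst nn_integral_multc) auto
  finally show ?thesis by (simp add: emeasure_ball_vball)
qed

text \<open>For fixed x the map from h to x + t h has Jacobian t^d. Integrating over h first thus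
  costs 1 / t^d but replaces the volume of the ball by that of \<open>A\<close>, which wins when
  \<open>A\<close> is small and t is not.\<close>

lemma shift_bound_global:
  fixes G :: "'a::euclidean_space \<Rightarrow> ennreal"
  assumes [measurable]: "G \<in> borel_measurable borel" "A \<in> sets borel"
    and t: "\<tau> \<le> t" "\<tau> > 0"
  shows "(\<integral>\<^sup>+x. \<integral>\<^sup>+h. indicator A x * indicator (ball 0 R) h * G (x + t *\<^sub>R h) \<partial>lborel \<partial>lborel)
    \<le> emeasure lborel A * ennreal (1 / \<tau> ^ DIM('a)) * (\<integral>\<^sup>+z. G z \<partial>lborel)"
proof -
  let ?I = "\<integral>\<^sup>+z. G z \<partial>lborel"
  have "(\<integral>\<^sup>+x. \<integral>\<^sup>+h. indicator A x * indicator (ball 0 R) h * G (x + t *\<^sub>R h) \<partial>lborel \<partial>lborel)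
     \<le> (\<integral>\<^sup>+x. indicator A x * (ennreal (1 / \<tau> ^ DIM('a)) * ?I) \<partial>lborel)"
  proof (rule nn_integral_mono)
    fix x
    have "?I = ennreal (\<bar>t\<bar> ^ DIM('a)) * (\<integral>\<^sup>+h. G (x + t *\<^sub>R h) \<partial>lborel)"
      by (rule nn_integral_lborel_affine) (use t in auto)
    then have "ennreal (1 / t ^ DIM('a)) * ?I
        = (ennreal (1 / t ^ DIM('a)) * ennreal (\<bar>t\<bar> ^ DIM('a))) * (\<integral>\<^sup>+h. G (x + t *\<^sub>R h) \<partial>lborel)"
      by (simp add: mult.assoc)
    also have "ennreal (1 / t ^ DIM('a)) * ennreal (\<bar>t\<bar> ^ DIM('a)) = 1"
      using t by (simp add: ennreal_mult[symmetric])
    finally have e: "(\<integral>\<^sup>+h. G (x + t *\<^sub>R h) \<partial>lborel) = ennreal (1 / t ^ DIM('a)) * ?I" by simp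
    have "(\<integral>\<^sup>+h. indicator A x * indicator (ball 0 R) h * G (x + t *\<^sub>R h) \<partial>lborel)
      \<le> (\<integral>\<^sup>+h. indicator A x * G (x + t *\<^sub>R h) \<partial>lborel)"
      by (intro nn_integral_mono) (auto simp: indicator_def)
    also have "\<dots> = indicator A x * (ennreal (1 / t ^ DIM('a)) * ?I)"
      by (subst nn_integral_cmult) (auto simp: e)
    also have "\<dots> \<le> indicator A x * (ennreal (1 / \<tau> ^ DIM('a)) * ?I)"
    proof -
      have "1 / t ^ DIM('a) \<le> 1 / \<tau> ^ DIM('a)" using t by (intro divide_left_mono power_mono mult_pos_pos) auto
      then show ?thesis by (intro mult_left_mono mult_right_mono ennreal_leI) auto
    qed
    finally show "(\<integral>\<^sup>+h. indicator A x * indicator (ball 0 R) h * G (x + t *\<^sub>R h) \<partial>lborel)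
      \<le> indicator A x * (ennreal (1 / \<tau> ^ DIM('a)) * ?I)" .
  qed
  also have "\<dots> = emeasure lborel A * (ennreal (1 / \<tau> ^ DIM('a)) * ?I)"
    by (subst nn_integral_multc) auto
  finally show ?thesis by (simp add: mult.assoc)
qed

lemma nn_gradp:
  assumes g: "C_infinity g" and [measurable]: "N \<in> sets borel"
  shows "(\<integral>\<^sup>+z. indicator N z * ennreal (gradp p g z) \<partial>lborel) = (\<Sum>b\<in>Basis. enp p N (pderiv_dir b g))"
proof -
  have m: "pderiv_dir b g \<in> borel_measurable borel" if "b \<in> Basis" for b
    using C_infinity_borel C_infinity_pderiv_dir g that by blast
  have "(\<integral>\<^sup>+z. indicator N z * ennreal (gradp p g z) \<partial>lborel)
      = (\<integral>\<^sup>+z. (\<Sum>b\<in>Basis. ennreal (norm (pderiv_dir b g z) powr p) * indicator N z) \<partial>lborel)"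
  proof (rule nn_integral_cong)
    fix z show "indicator N z * ennreal (gradp p g z) = (\<Sum>b\<in>Basis. ennreal (norm (pderiv_dir b g z) powr p) * indicator N z)"
      by (cases "z \<in> N") (simp_all add: gradp_def)
  qed
  also have "\<dots> = (\<Sum>b\<in>Basis. \<integral>\<^sup>+z. ennreal (norm (pderiv_dir b g z) powr p) * indicator N z \<partial>lborel)"
  proof (rule nn_integral_sum)
    fix b :: 'a assume "b \<in> Basis"
    note [measurable] = m[OF this]
    show "(\<lambda>z. ennreal (norm (pderiv_dir b g z) powr p) * indicator N z) \<in> borel_measurable lborel" by measurable
  qed
  also have "\<dots> = (\<Sum>b\<in>Basis. enp p N (pderiv_dir b g))" by (simp add: enp_lborel)
  finally show ?thesis .
qed

lemma shift_energy_smooth_local: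
  fixes g :: "'a::euclidean_space \<Rightarrow> 'b::euclidean_space"
  assumes g: "C_infinity g" and p: "p \<ge> 1" and [measurable]: "A \<in> sets borel" "N \<in> sets borel"
    and N: "\<And>x y. x \<in> A \<Longrightarrow> dist x y < R \<Longrightarrow> y \<in> N"
  shows "shift_energy p A R g \<le> ennreal (R powr p * real DIM('a) powr p * vball TYPE('a) R) *
     (\<Sum>b\<in>Basis. enp p N (pderiv_dir b g))"
proof -
  have [measurable]: "gradp p g \<in> borel_measurable borel" by (rule gradp_borel[OF g])
  let ?c = "ennreal (R powr p * real DIM('a) powr p)"
  let ?I = "\<integral>\<^sup>+z. indicator N z * ennreal (gradp p g z) \<partial>lborel"
  have "shift_energy p A R g \<le> ?c * (\<integral>\<^sup>+t. indicator {0..1::real} t * (ennreal (vball TYPE('a) R) * ?I) \<partial>lborel)"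
  proof (rule order_trans[OF shift_energy_smooth[OF g p assms(3)]], rule mult_left_mono, rule nn_integral_mono)
    fix t :: real
    have "(\<integral>\<^sup>+x. \<integral>\<^sup>+h. indicator A x * indicator (ball 0 R) h * ennreal (gradp p g (x + t *\<^sub>R h)) \<partial>lborel \<partial>lborel)
      \<le> ennreal (vball TYPE('a) R) * ?I" if "t \<in> {0..1}"
      by (rule shift_bound_local[OF _ _ _ N that]) measurable
    then show "indicator {0..1} t * (\<integral>\<^sup>+x. \<integral>\<^sup>+h. indicator A x * indicator (ball 0 R) h * ennreal (gradp p g (x + t *\<^sub>R h)) \<partial>lborel \<partial>lborel)
      \<le> indicator {0..1} t * (ennreal (vball TYPE('a) R) * ?I)"
      by (cases "t \<in> {0..1}") auto
  qed simp
  also have "(\<integral>\<^sup>+t. indicator {0..1::real} t * (ennreal (vball TYPE('a) R) * ?I) \<partial>lborel) = ennreal (vball TYPE('a) R) * ?I"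
    by (subst nn_integral_multc) auto
  finally show ?thesis by (simp add: nn_gradp[OF g] ennreal_mult mult.assoc)
qed

text \<open>Split at \<tau>: \<open>shift_bound_local\<close> for t \<le> \<tau> contributes the
  length \<tau>, \<open>shift_bound_global\<close> handles the rest. The value of \<tau> stays free
  until \<open>one_set_estimate\<close>.\<close>

lemma shift_energy_smooth_global:
  fixes g :: "'a::euclidean_space \<Rightarrow> 'b::euclidean_space"
  assumes g: "C_infinity g" and p: "p \<ge> 1" and [measurable]: "A \<in> sets borel" and \<tau>: "\<tau> > 0"
  shows "shift_energy p A R g \<le> ennreal (R powr p * real DIM('a) powr p) *
     (ennreal \<tau> * ennreal (vball TYPE('a) R) + emeasure lborel A * ennreal (1 / \<tau> ^ DIM('a))) * (\<Sum>b\<in>Basis. enp p UNIV (pderiv_dir b g))"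
proof -
  have [measurable]: "gradp p g \<in> borel_measurable borel" by (rule gradp_borel[OF g])
  let ?c = "ennreal (R powr p * real DIM('a) powr p)"
  let ?I = "\<integral>\<^sup>+z. ennreal (gradp p g z) \<partial>lborel"
  let ?J = "\<lambda>t. \<integral>\<^sup>+x. \<integral>\<^sup>+h. indicator A x * indicator (ball 0 R) h * ennreal (gradp p g (x + t *\<^sub>R h)) \<partial>lborel \<partial>lborel"
  have "shift_energy p A R g \<le> ?c * (\<integral>\<^sup>+t. indicator {0..1::real} t * ?J t \<partial>lborel)"
    by (rule shift_energy_smooth[OF g p assms(3)])
  also have "\<dots> \<le> ?c * (\<integral>\<^sup>+t. indicator {0..\<tau>} t * (ennreal (vball TYPE('a) R) * ?I)
       + indicator {0..1} t * (emeasure lborel A * ennreal (1 / \<tau> ^ DIM('a)) * ?I) \<partial>lborel)"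
  proof (intro mult_left_mono nn_integral_mono)
    fix t :: real
    have 1: "?J t \<le> ennreal (vball TYPE('a) R) * ?I" if "t \<in> {0..1}"
      using shift_bound_local[of "\<lambda>z. ennreal (gradp p g z)" A UNIV R t] that by simp
    have 2: "?J t \<le> emeasure lborel A * ennreal (1 / \<tau> ^ DIM('a)) * ?I" if "\<tau> \<le> t"
      using shift_bound_global[of "\<lambda>z. ennreal (gradp p g z)" A \<tau> t R] that \<tau> by simp
    show "indicator {0..1} t * ?J t \<le> indicator {0..\<tau>} t * (ennreal (vball TYPE('a) R) * ?I)
       + indicator {0..1} t * (emeasure lborel A * ennreal (1 / \<tau> ^ DIM('a)) * ?I)"
    proof (cases "t \<in> {0..1}")
      case True
      show ?thesis
      proof (cases "t \<le> \<tau>")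
        case a: True
        then show ?thesis using True 1 by (simp add: add_increasing2)
      next
        case False
        then show ?thesis using True 2 by (simp add: add_increasing)
      qed
    qed simp
  qed simp
  also have "(\<integral>\<^sup>+t. indicator {0..\<tau>} t * (ennreal (vball TYPE('a) R) * ?I)
       + indicator {0..1} t * (emeasure lborel A * ennreal (1 / \<tau> ^ DIM('a)) * ?I) \<partial>lborel)
     = ennreal \<tau> * (ennreal (vball TYPE('a) R) * ?I) + emeasure lborel A * ennreal (1 / \<tau> ^ DIM('a)) * ?I"
    using \<tau> by (simp add: nn_integral_add nn_integral_multc)
  also have "\<dots> = (ennreal \<tau> * ennreal (vball TYPE('a) R) + emeasure lborel A * ennreal (1 / \<tau> ^ DIM('a))) * ?I"
    by (simp add: distrib_right mult.assoc)
  finally show ?thesis using nn_gradp[OF g, of UNIV p] by (simp add: mult.assoc)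
qed

text \<open>A bound without derivatives, for the error made when a function is replaced by its
  mollification.\<close>

lemma shift_energy_UNIV:
  fixes f :: "'a::euclidean_space \<Rightarrow> 'b::euclidean_space"
  assumes [measurable]: "f \<in> borel_measurable borel" "A \<in> sets borel" and p: "p \<ge> 1"
  shows "shift_energy p A R f \<le> ennreal (2 powr p * (2 * vball TYPE('a) R)) * enp p UNIV f"
proof -
  let ?N = "\<lambda>z. ennreal (norm (f z) powr p)"
  have "shift_energy p A R f \<le> (\<integral>\<^sup>+x. \<integral>\<^sup>+h. ennreal (2 powr p) * (indicator (ball 0 R) h * ?N (x + h) + indicator (ball 0 R) h * ?N x) \<partial>lborel \<partial>lborel)"
    unfolding shift_energy_def
  proof (intro nn_integral_mono)
    fix x h :: 'a
    have "norm (f (x + h) - f x) powr p \<le> 2 powr p * (norm (f (x + h)) powr p + norm (f x) powr p)"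
      using powr_add_le[OF p, of "f (x + h)" "- f x"] by simp
    then have "ennreal (norm (f (x + h) - f x) powr p) \<le> ennreal (2 powr p) * (?N (x + h) + ?N x)"
      by (simp add: ennreal_plus[symmetric] ennreal_mult[symmetric] ennreal_leI del: ennreal_plus)
    then show "indicator A x * indicator (ball 0 R) h * ennreal (norm (f (x + h) - f x) powr p)
      \<le> ennreal (2 powr p) * (indicator (ball 0 R) h * ?N (x + h) + indicator (ball 0 R) h * ?N x)"
      by (cases "x \<in> A"; cases "h \<in> ball 0 R") auto
  qed
  also have "\<dots> = ennreal (2 powr p) * ((\<integral>\<^sup>+x. \<integral>\<^sup>+h. indicator (ball 0 R) h * ?N (x + h) \<partial>lborel \<partial>lborel)
       + (\<integral>\<^sup>+x. \<integral>\<^sup>+h. indicator (ball (0::'a) R) h * ?N x \<partial>lborel \<partial>lborel))"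
    by (simp add: nn_integral_cmult nn_integral_add)
  also have "(\<integral>\<^sup>+x. \<integral>\<^sup>+h. indicator (ball 0 R) h * ?N (x + h) \<partial>lborel \<partial>lborel)
     = (\<integral>\<^sup>+h. \<integral>\<^sup>+x. indicator (ball 0 R) h * ?N (x + h) \<partial>lborel \<partial>lborel)"
    by (rule lborel_pair.Fubini') measurable
  also have "\<dots> = (\<integral>\<^sup>+h. indicator (ball (0::'a) R) h * enp p UNIV f \<partial>lborel)"
    by (intro nn_integral_cong) (simp add: nn_integral_cmult nn_integral_lborel_shift[of ?N] enp_UNIV)
  also have "\<dots> = ennreal (vball TYPE('a) R) * enp p UNIV f"
    by (subst nn_integral_multc) (auto simp: emeasure_ball_vball)
  also have "(\<integral>\<^sup>+x. \<integral>\<^sup>+h. indicator (ball (0::'a) R) h * ?N x \<partial>lborel \<partial>lborel) = ennreal (vball TYPE('a) R) * enp p UNIV f"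
    by (simp add: nn_integral_multc emeasure_ball_vball enp_UNIV nn_integral_cmult)
  finally show ?thesis by (simp add: mult_2[symmetric] ennreal_mult mult_ac)
qed

lemma shift_energy_add:
  fixes f g :: "'a::euclidean_space \<Rightarrow> 'b::euclidean_space"
  assumes [measurable]: "f \<in> borel_measurable borel" "g \<in> borel_measurable borel" "A \<in> sets borel" and p: "p \<ge> 1"
  shows "shift_energy p A R (\<lambda>x. f x + g x) \<le> ennreal (2 powr p) * (shift_energy p A R f + shift_energy p A R g)"
proof -
  let ?s = "\<lambda>f x h. indicator A x * indicator (ball 0 R) h * ennreal (norm (f (x + h) - f x) powr p)"
  have "shift_energy p A R (\<lambda>x. f x + g x) \<le> (\<integral>\<^sup>+x. \<integral>\<^sup>+h. ennreal (2 powr p) * (?s f x h + ?s g x h) \<partial>lborel \<partial>lborel)"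
    unfolding shift_energy_def
  proof (intro nn_integral_mono)
    fix x h :: 'a
    have "norm (f (x + h) + g (x + h) - (f x + g x)) powr p
        \<le> 2 powr p * (norm (f (x + h) - f x) powr p + norm (g (x + h) - g x) powr p)"
      using powr_add_le[OF p, of "f (x + h) - f x" "g (x + h) - g x"] by (simp add: algebra_simps)
    then have "ennreal (norm (f (x + h) + g (x + h) - (f x + g x)) powr p)
        \<le> ennreal (2 powr p) * (ennreal (norm (f (x + h) - f x) powr p) + ennreal (norm (g (x + h) - g x) powr p))"
      by (simp add: ennreal_plus[symmetric] ennreal_mult[symmetric] ennreal_leI del: ennreal_plus)
    then show "?s (\<lambda>x. f x + g x) x h \<le> ennreal (2 powr p) * (?s f x h + ?s g x h)"
      by (cases "x \<in> A"; cases "h \<in> ball 0 R") auto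
  qed
  also have "\<dots> = ennreal (2 powr p) * (shift_energy p A R f + shift_energy p A R g)"
    by (simp add: shift_energy_def nn_integral_cmult nn_integral_add)
  finally show ?thesis .
qed

text \<open>Passage from smooth to weakly differentiable functions: both sides are stable under mollification.\<close>

lemma shift_energy_weak:
  fixes g :: "'a::euclidean_space \<Rightarrow> 'b::euclidean_space"
  assumes p: "p \<ge> 1" and g: "g \<in> Lp_space p UNIV" "g \<in> borel_measurable borel"
    and D: "\<And>b. b \<in> Basis \<Longrightarrow> has_weak_deriv UNIV g [b] (D b)"
      "\<And>b. b \<in> Basis \<Longrightarrow> D b \<in> Lp_space p UNIV" "\<And>b. b \<in> Basis \<Longrightarrow> D b \<in> borel_measurable borel"
    and A: "A \<in> sets borel" and N: "N \<in> sets borel" "N' \<in> sets borel"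
    and \<eta>: "\<eta> > 0" "\<And>x y. x \<in> N \<Longrightarrow> dist x y < \<eta> \<Longrightarrow> y \<in> N'"
    and bound: "\<And>h :: 'a \<Rightarrow> 'b. C_infinity h \<Longrightarrow> shift_energy p A R h \<le> K * (\<Sum>b\<in>Basis. enp p N (pderiv_dir b h))"
  shows "shift_energy p A R g \<le> ennreal (2 powr p) * K * (\<Sum>b\<in>Basis. enp p N' (D b))"
proof -
  define V where "V = 2 powr p * (2 * vball TYPE('a) R)"
  have V: "V \<ge> 0" by (simp add: V_def)
  have li: "loc_int g" using Lp_borel_loc_int[OF g p] .
  have liD: "loc_int (D b)" if "b \<in> Basis" for b using Lp_borel_loc_int[OF D(2,3)[OF that] p] .
  have L: "shift_energy p A R g \<le> ennreal (2 powr p) * K * (\<Sum>b\<in>Basis. enp p N' (D b)) + ennreal e" if e: "e > 0" for e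
  proof -
    define e' where "e' = e / (2 powr p * V + 1)"
    have e': "e' > 0" using e V by (simp add: e'_def add_nonneg_pos)
    obtain \<delta>0 where \<delta>0: "\<delta>0 > 0" "\<And>\<delta> \<phi>. \<delta> \<le> \<delta>0 \<Longrightarrow> mollifier \<delta> \<phi> \<Longrightarrow> enp p UNIV (\<lambda>x. conv \<phi> g x - g x) \<le> ennreal e'"
      using conv_converges[OF g(2) p _ e'] g(1) by (metis Lp_space_iff)
    \<comment> \<open>At most \<delta>0 for the mollification error, and at most \<eta> so that the
      smoothed derivatives on \<open>N\<close> see the original ones on \<open>N'\<close>
      only.\<close>
    define \<delta> where "\<delta> = min \<delta>0 \<eta>"
    have \<delta>: "\<delta> > 0" "\<delta> \<le> \<delta>0" "\<delta> \<le> \<eta>" using \<delta>0 \<eta> by (auto simp: \<delta>_def)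
    obtain \<phi> :: "'a \<Rightarrow> real" where m: "mollifier \<delta> \<phi>"
      using mollifier_ex[where ?'a='a, OF \<delta>(1)] by (elim exE)
    note mD = mollifierD[OF m]
    let ?h = "conv \<phi> g"
    have smooth: "C_infinity ?h" by (rule conv_C_infinity[OF mD(2) li])
    have hm: "?h \<in> borel_measurable borel" by (rule C_infinity_borel[OF smooth])
    have "shift_energy p A R ?h \<le> K * (\<Sum>b\<in>Basis. enp p N (pderiv_dir b ?h))" by (rule bound[OF smooth])
    also have "\<dots> \<le> K * (\<Sum>b\<in>Basis. enp p N' (D b))"
    proof (intro mult_left_mono sum_mono)
      fix b :: 'a assume b: "b \<in> Basis"
      have "pderiv_dir b ?h = conv \<phi> (D b)"
        by (rule pderiv_dir_conv_weak[OF D(1)[OF b] li liD[OF b] mD(2) b])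
      then show "enp p N (pderiv_dir b ?h) \<le> enp p N' (D b)"
        using enp_conv_le[OF m liD[OF b] p N] \<eta>(2) \<delta>(3) by (metis less_le_trans)
    qed simp
    finally have 1: "shift_energy p A R ?h \<le> K * (\<Sum>b\<in>Basis. enp p N' (D b))" .
    have "enp p UNIV (\<lambda>x. g x - ?h x) = enp p UNIV (\<lambda>x. ?h x - g x)"
      using enp_uminus[of p UNIV "\<lambda>x. g x - ?h x"] by simp
    also have "\<dots> \<le> ennreal e'" by (rule \<delta>0(2)[OF \<delta>(2) m])
    finally have le: "enp p UNIV (\<lambda>x. g x - ?h x) \<le> ennreal e'" .
    have "shift_energy p A R (\<lambda>x. g x - ?h x) \<le> ennreal V * enp p UNIV (\<lambda>x. g x - ?h x)"
      unfolding V_def by (rule shift_energy_UNIV) (use g(2) hm A p in auto)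
    also have "\<dots> \<le> ennreal V * ennreal e'" by (rule mult_left_mono[OF le]) simp
    finally have "shift_energy p A R (\<lambda>x. g x - ?h x) \<le> ennreal V * ennreal e'" .
    then have 2: "shift_energy p A R (\<lambda>x. g x - ?h x) \<le> ennreal (V * e')" using V e' by (simp add: ennreal_mult)
    have "shift_energy p A R (\<lambda>x. ?h x + (g x - ?h x))
        \<le> ennreal (2 powr p) * (shift_energy p A R ?h + shift_energy p A R (\<lambda>x. g x - ?h x))"
      by (rule shift_energy_add) (use hm g A p in auto)
    also have "\<dots> \<le> ennreal (2 powr p) * (K * (\<Sum>b\<in>Basis. enp p N' (D b)) + ennreal (V * e'))"
      by (intro mult_left_mono add_mono 1 2) auto
    also have "\<dots> = ennreal (2 powr p) * K * (\<Sum>b\<in>Basis. enp p N' (D b)) + ennreal (2 powr p * (V * e'))"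
      using V e' by (simp add: distrib_left mult.assoc ennreal_mult)
    also have "ennreal (2 powr p * (V * e')) \<le> ennreal e"
    proof (rule ennreal_leI)
      have "2 powr p * (V * e') = (2 powr p * V) * (e / (2 powr p * V + 1))" by (simp add: e'_def)
      also have "\<dots> \<le> (2 powr p * V + 1) * (e / (2 powr p * V + 1))" using V e by (intro mult_right_mono) auto
      also have "\<dots> = e" using V by (simp add: add_nonneg_eq_0_iff)
      finally show "2 powr p * (V * e') \<le> e" .
    qed
    finally show ?thesis by simp
  qed
  show ?thesis by (rule ennreal_le_epsilon, rule L)
qed

subsection \<open>Measure density of extension domains\<close>

text \<open>Almost every pair in \<open>S\<close> times \<open>Y\<close> is within range and
  contributes at least (1/2)^p.\<close>

lemma shift_energy_lower:
  fixes g :: "'a::euclidean_space \<Rightarrow> 'b::euclidean_space"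
  assumes [measurable]: "g \<in> borel_measurable borel" "S \<in> sets borel" "Y \<in> sets borel"
    and s: "AE x in lborel. x \<in> S \<longrightarrow> g x = s" and Y: "\<And>y. y \<in> Y \<Longrightarrow> norm (g y - s) \<ge> 1 / 2"
    and d: "\<And>x y. x \<in> S \<Longrightarrow> y \<in> Y \<Longrightarrow> dist x y < R" and p: "p \<ge> 1"
  shows "emeasure lborel S * (emeasure lborel Y * ennreal ((1 / 2) powr p)) \<le> shift_energy p S R g"
proof -
  let ?c = "ennreal ((1 / 2) powr p)"
  have "emeasure lborel S * (emeasure lborel Y * ?c) = (\<integral>\<^sup>+x. indicator S x * (emeasure lborel Y * ?c) \<partial>lborel)"
    by (subst nn_integral_multc) auto
  also have "\<dots> \<le> shift_energy p S R g"
    unfolding shift_energy_def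
  proof (rule nn_integral_mono_AE)
    show "AE x in lborel. indicator S x * (emeasure lborel Y * ?c)
      \<le> (\<integral>\<^sup>+h. indicator S x * indicator (ball 0 R) h * ennreal (norm (g (x + h) - g x) powr p) \<partial>lborel)"
      using s
    proof eventually_elim
      case (elim x)
      show ?case
      proof (cases "x \<in> S")
        case True
        have "emeasure lborel Y * ?c = (\<integral>\<^sup>+y. indicator Y y * ?c \<partial>lborel)"
          by (subst nn_integral_multc) auto
        also have "\<dots> = (\<integral>\<^sup>+h. indicator Y (h + x) * ?c \<partial>lborel)"
          by (rule nn_integral_lborel_shift[symmetric]) measurable
        also have "\<dots> \<le> (\<integral>\<^sup>+h. indicator S x * indicator (ball 0 R) h * ennreal (norm (g (x + h) - g x) powr p) \<partial>lborel)"
        proof (rule nn_integral_mono)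
          fix h
          show "indicator Y (h + x) * ?c \<le> indicator S x * indicator (ball 0 R) h * ennreal (norm (g (x + h) - g x) powr p)"
          proof (cases "h + x \<in> Y")
            case h: True
            have "norm h < R" using d[OF True h] by (simp add: dist_norm)
            moreover have "(1 / 2) powr p \<le> norm (g (x + h) - g x) powr p"
              using Y[OF h] elim True p by (intro powr_mono2) (auto simp: add.commute)
            ultimately show ?thesis using True h by (simp add: ennreal_leI)
          qed simp
        qed
        finally show ?thesis using True by simp
      qed simp
    qed
  qed
  finally show ?thesis .
qed

text \<open>Origin of the factors: 2 and one 2^p from the lower bound, where half a ball and
  differences of 1/2 are used; the other 2^p from \<open>shift_energy_weak\<close>; 4^p and 4^d from
  the range 4 R; d^p from \<open>translation_pointwise\<close>. The final division comes from
  solving for \<tau>^d.\<close>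

definition set_const :: "'a::euclidean_space itself \<Rightarrow> real \<Rightarrow> real" where
  "set_const T p = 2 * (2 powr p * 2 powr p) * (4 powr p * real DIM('a) powr p)
     * (unit_ball_vol (real DIM('a)) * 4 ^ DIM('a) + 1) / unit_ball_vol (real DIM('a))"

lemma set_const_nonneg: "set_const T p \<ge> 0"
  unfolding set_const_def by (intro divide_nonneg_nonneg mult_nonneg_nonneg add_nonneg_nonneg) auto

text \<open>Upper and lower bounds of the shift energy are compared. With \<tau>^(d+1) = \<sigma> /
  R^d the two quantities \<tau> R^d and \<sigma> / \<tau>^d in the upper bound coincide, while the
  lower bound contains \<sigma> = \<tau> \<tau>^d R^d; cancelling \<tau> leaves \<tau>^d.\<close>

lemma one_set_estimate:
  fixes g :: "'a::euclidean_space \<Rightarrow> 'b::euclidean_space"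
  assumes p: "p \<ge> 1" and g: "g \<in> Lp_space p UNIV" "g \<in> borel_measurable borel"
    and D: "\<And>b. b \<in> Basis \<Longrightarrow> has_weak_deriv UNIV g [b] (D b)"
      "\<And>b. b \<in> Basis \<Longrightarrow> D b \<in> Lp_space p UNIV" "\<And>b. b \<in> Basis \<Longrightarrow> D b \<in> borel_measurable borel"
    and S: "S \<in> sets borel" "emeasure lborel S = ennreal \<sigma>" "\<sigma> > 0"
    and Y: "Y \<in> sets borel" "ennreal (vball TYPE('a) R / 2) \<le> emeasure lborel Y"
    and s: "AE x in lborel. x \<in> S \<longrightarrow> g x = s" "\<And>y. y \<in> Y \<Longrightarrow> norm (g y - s) \<ge> 1 / 2"
    and d: "\<And>x y. x \<in> S \<Longrightarrow> y \<in> Y \<Longrightarrow> dist x y < 4 * R" and R: "R > 0"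
    and I: "(\<Sum>b\<in>Basis. enp p UNIV (D b)) \<le> ennreal I" "I \<ge> 0"
    and \<tau>: "\<tau> > 0" "\<tau> ^ Suc DIM('a) = \<sigma> / R ^ DIM('a)"
  shows "\<tau> ^ DIM('a) \<le> set_const TYPE('a) p * (R powr p / R ^ DIM('a)) * I"
proof -
  define \<omega> where "\<omega> = unit_ball_vol (real DIM('a))"
  define n where "n = DIM('a)"
  have \<omega>: "\<omega> > 0" by (simp add: \<omega>_def)
  let ?V = "vball TYPE('a) (4 * R)"
  let ?c = "(4 * R) powr p * real DIM('a) powr p"
  have "shift_energy p S (4 * R) g \<le> ennreal (2 powr p) *
     (ennreal ?c * (ennreal \<tau> * ennreal ?V + emeasure lborel S * ennreal (1 / \<tau> ^ DIM('a)))) * (\<Sum>b\<in>Basis. enp p UNIV (D b))"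
    by (rule shift_energy_weak[OF p g D S(1), where N=UNIV and \<eta>=1])
      (use shift_energy_smooth_global[OF _ p S(1) \<tau>(1)] in auto)
  also have "\<dots> \<le> ennreal (2 powr p) * (ennreal ?c * (ennreal \<tau> * ennreal ?V + ennreal \<sigma> * ennreal (1 / \<tau> ^ DIM('a)))) * ennreal I"
    unfolding S(2) by (intro mult_left_mono I) auto
  also have "\<dots> = ennreal (2 powr p * (?c * (\<tau> * ?V + \<sigma> * (1 / \<tau> ^ DIM('a)))) * I)"
  proof -
    define q where "q = 1 / \<tau> ^ DIM('a)"
    have "q \<ge> 0" using \<tau> by (simp add: q_def)
    then show ?thesis unfolding q_def[symmetric] using \<tau>(1) S(3) R I by (simp add: ennreal_mult ennreal_plus)
  qed
  finally have up: "shift_energy p S (4 * R) g \<le> ennreal (2 powr p * (?c * (\<tau> * ?V + \<sigma> * (1 / \<tau> ^ DIM('a)))) * I)" .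
  have "ennreal (\<sigma> * (vball TYPE('a) R / 2 * (1 / 2) powr p)) = ennreal \<sigma> * (ennreal (vball TYPE('a) R / 2) * ennreal ((1 / 2) powr p))"
  proof -
    have "vball TYPE('a) R / 2 \<ge> 0" "(1 / 2) powr p \<ge> (0::real)" by simp_all
    then show ?thesis using S(3) by (simp only: ennreal_mult less_imp_le mult_nonneg_nonneg)
  qed
  also have "\<dots> \<le> emeasure lborel S * (emeasure lborel Y * ennreal ((1 / 2) powr p))"
    unfolding S(2) by (intro mult_left_mono mult_right_mono Y(2)) auto
  also have "\<dots> \<le> shift_energy p S (4 * R) g"
    by (rule shift_energy_lower[OF g(2) S(1) Y(1) s d p])
  also note up
  finally have "\<sigma> * (vball TYPE('a) R / 2 * (1 / 2) powr p) \<le> 2 powr p * (?c * (\<tau> * ?V + \<sigma> * (1 / \<tau> ^ DIM('a)))) * I"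
    using \<tau> S R I by (subst (asm) ennreal_le_iff) (auto intro!: mult_nonneg_nonneg add_nonneg_nonneg)
  moreover have "vball TYPE('a) R = \<omega> * R ^ n" "?V = \<omega> * 4 ^ n * R ^ n"
    using R by (simp_all add: vball_eq \<omega>_def n_def power_mult_distrib)
  moreover have \<sigma>: "\<sigma> = \<tau> * \<tau> ^ n * R ^ n" using \<tau> R by (simp add: n_def field_simps)
  ultimately have "\<tau> * \<tau> ^ n * R ^ n * (\<omega> * R ^ n / 2 * (1 / 2) powr p)
      \<le> 2 powr p * (?c * (\<tau> * (\<omega> * 4 ^ n * R ^ n) + \<tau> * \<tau> ^ n * R ^ n * (1 / \<tau> ^ n))) * I"
    by (simp add: n_def)
  also have "\<dots> = \<tau> * R ^ n * (2 powr p * (?c * (\<omega> * 4 ^ n + 1)) * I)"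
    using \<tau> by (simp add: field_simps)
  finally have "\<tau> * R ^ n * (\<tau> ^ n * (\<omega> * R ^ n / 2 * (1 / 2) powr p)) \<le> \<tau> * R ^ n * (2 powr p * (?c * (\<omega> * 4 ^ n + 1)) * I)"
    by (simp add: mult_ac)
  then have "\<tau> ^ n * (\<omega> * R ^ n / 2 * (1 / 2) powr p) \<le> 2 powr p * (?c * (\<omega> * 4 ^ n + 1)) * I"
    using \<tau> R by (subst (asm) mult_le_cancel_left_pos) auto
  then have "\<tau> ^ n \<le> 2 powr p * (?c * (\<omega> * 4 ^ n + 1)) * I / (\<omega> * R ^ n / 2 * (1 / 2) powr p)"
    using \<omega> R by (subst pos_le_divide_eq) auto
  also have "\<dots> = set_const TYPE('a) p * (R powr p / R ^ n) * I"
    using R \<omega> unfolding set_const_def unfolding \<omega>_def[symmetric] unfolding n_def[symmetric]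
    by (simp add: powr_mult powr_divide divide_simps)
  finally show ?thesis by (simp add: n_def)
qed

text \<open>No value is closer than 1/2 to both 0 and 1, so on at least half of the ball
  \<open>g\<close> stays away from one of its two prescribed values. If that value is 0, the
  estimate is obtained for the larger set \<open>A'\<close> and passes to \<open>A\<close> by
  monotonicity.\<close>

lemma two_set_estimate:
  fixes g :: "'a::euclidean_space \<Rightarrow> 'b::{real_normed_field, euclidean_space}"
  assumes p: "p \<ge> 1" and g: "g \<in> Lp_space p UNIV" "g \<in> borel_measurable borel"
    and D: "\<And>b. b \<in> Basis \<Longrightarrow> has_weak_deriv UNIV g [b] (D b)"
      "\<And>b. b \<in> Basis \<Longrightarrow> D b \<in> Lp_space p UNIV" "\<And>b. b \<in> Basis \<Longrightarrow> D b \<in> borel_measurable borel"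
    and A: "A \<in> sets borel" "emeasure lborel A = ennreal \<alpha>" "\<alpha> > 0"
    and A': "A' \<in> sets borel" "emeasure lborel A' = ennreal \<alpha>'" "\<alpha> \<le> \<alpha>'"
    and ae: "AE x in lborel. x \<in> A \<longrightarrow> g x = 1" "AE x in lborel. x \<in> A' \<longrightarrow> g x = 0"
    and d: "\<And>x y. x \<in> A \<union> A' \<Longrightarrow> y \<in> ball c R \<Longrightarrow> dist x y < 4 * R" and R: "R > 0"
    and I: "(\<Sum>b\<in>Basis. enp p UNIV (D b)) \<le> ennreal I" "I \<ge> 0"
    and \<tau>: "\<tau> > 0" "\<tau> ^ Suc DIM('a) = \<alpha> / R ^ DIM('a)"
  shows "\<tau> ^ DIM('a) \<le> set_const TYPE('a) p * (R powr p / R ^ DIM('a)) * I"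
proof -
  note [measurable] = g(2)
  define Y1 where "Y1 = {y \<in> ball c R. norm (g y - 1) \<ge> 1 / 2}"
  define Y0 where "Y0 = {y \<in> ball c R. norm (g y - 0) \<ge> 1 / 2}"
  have m: "Y1 \<in> sets borel" "Y0 \<in> sets borel" unfolding Y1_def Y0_def by measurable
  have "ball c R \<subseteq> Y1 \<union> Y0"
  proof
    fix y assume y: "y \<in> ball c R"
    have "1 \<le> norm (g y - 1) + norm (g y)"
      using norm_triangle_ineq4[of "g y" "g y - 1"] by simp
    then show "y \<in> Y1 \<union> Y0" using y unfolding Y1_def Y0_def by auto
  qed
  then have "emeasure lborel (ball c R) \<le> emeasure lborel (Y1 \<union> Y0)" by (rule emeasure_mono) (use m in auto)
  also have "\<dots> \<le> emeasure lborel Y1 + emeasure lborel Y0" by (rule emeasure_subadditive) (use m in auto)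
  finally have le: "ennreal (vball TYPE('a) R) \<le> emeasure lborel Y1 + emeasure lborel Y0"
    by (simp add: emeasure_ball_vball)
  have or: "ennreal (vball TYPE('a) R / 2) \<le> emeasure lborel Y1 \<or> ennreal (vball TYPE('a) R / 2) \<le> emeasure lborel Y0"
  proof (rule ccontr)
    assume "\<not> ?thesis"
    then have "emeasure lborel Y1 + emeasure lborel Y0 < ennreal (vball TYPE('a) R / 2) + ennreal (vball TYPE('a) R / 2)"
      by (intro add_strict_mono) (auto simp: not_le)
    also have "\<dots> = ennreal (vball TYPE('a) R)" by (simp add: ennreal_plus[symmetric] del: ennreal_plus)
    finally show False using le by simp
  qed
  show ?thesis
  proof (cases "ennreal (vball TYPE('a) R / 2) \<le> emeasure lborel Y1")
    case True
    show ?thesis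
      by (rule one_set_estimate[OF p g D A m(1) True ae(1) _ _ R I \<tau>]) (use d in \<open>auto simp: Y1_def\<close>)
  next
    case False
    then have Y0: "ennreal (vball TYPE('a) R / 2) \<le> emeasure lborel Y0" using or by blast
    define \<tau>' where "\<tau>' = root (Suc DIM('a)) (\<alpha>' / R ^ DIM('a))"
    have \<alpha>': "\<alpha>' > 0" using A A' by linarith
    have \<tau>': "\<tau>' > 0" "\<tau>' ^ Suc DIM('a) = \<alpha>' / R ^ DIM('a)"
      unfolding \<tau>'_def using \<alpha>' R by (auto simp: real_root_pow_pos2 simp del: power_Suc)
    have "\<tau>' ^ DIM('a) \<le> set_const TYPE('a) p * (R powr p / R ^ DIM('a)) * I"
      by (rule one_set_estimate[OF p g D A'(1,2) \<alpha>' m(2) Y0 ae(2) _ _ R I \<tau>']) (use d in \<open>auto simp: Y0_def\<close>)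
    moreover have "\<tau> \<le> \<tau>'"
    proof (rule ccontr)
      assume "\<not> \<tau> \<le> \<tau>'"
      then have "\<tau>' ^ Suc DIM('a) < \<tau> ^ Suc DIM('a)" using \<tau>'(1) by (intro power_strict_mono) auto
      moreover have "\<alpha> / R ^ DIM('a) \<le> \<alpha>' / R ^ DIM('a)" using A' R by (intro divide_right_mono) auto
      ultimately show False unfolding \<tau>'(2) \<tau>(2) by linarith
    qed
    then have "\<tau> ^ DIM('a) \<le> \<tau>' ^ DIM('a)" using \<tau>(1) by (intro power_mono) auto
    ultimately show ?thesis by linarith
  qed
qed

text \<open>The translation estimates want Borel representatives of one derivative of order below k
  together with all first derivatives of it.\<close>

lemma sobolev_borel_deriv_at:
  fixes f :: "'a::euclidean_space \<Rightarrow> 'b::euclidean_space"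
  assumes p: "p \<ge> 1" and f: "f \<in> sobolev k p UNIV" and bs: "set bs \<subseteq> Basis" "length bs < k"
  obtains g D where "g \<in> borel_measurable borel" "g \<in> Lp_space p UNIV" "has_weak_deriv UNIV f bs g"
    "\<And>b. b \<in> Basis \<Longrightarrow> D b \<in> borel_measurable borel" "\<And>b. b \<in> Basis \<Longrightarrow> D b \<in> Lp_space p UNIV"
    "\<And>b. b \<in> Basis \<Longrightarrow> has_weak_deriv UNIV g [b] (D b)"
    "\<And>b. b \<in> Basis \<Longrightarrow> has_weak_deriv UNIV f (bs @ [b]) (D b)"
proof -
  have rep: "\<exists>g. g \<in> borel_measurable borel \<and> g \<in> Lp_space p UNIV \<and> has_weak_deriv UNIV f cs g"
    if "cs \<in> multi k" for cs
  proof -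
    note j = jetD[OF jet_weak_deriv[OF p open_UNIV f] that]
    obtain g where g: "g \<in> borel_measurable borel" "AE x in lebesgue. weak_deriv UNIV f cs x = g x"
      using borel_representative[of "weak_deriv UNIV f cs"] j(3) by (auto simp: lebesgue_on_UNIV_eq)
    have L: "g \<in> Lp_space p UNIV" by (rule Lp_cong_AE[OF j(1)]) (use g borel_lebesgue_on in auto)
    have "has_weak_deriv UNIV f cs g"
      by (rule has_weak_deriv_cong_AE[OF j(2)])
        (use g L multi_D[OF that] has_weak_derivD(1)[OF j(2)] Lp_locally_integrable[OF L p open_UNIV] in auto)
    with g L show ?thesis by blast
  qed
  have "bs \<in> multi k" using bs by (simp add: multi_def)
  from rep[OF this] obtain g where g: "g \<in> borel_measurable borel" "g \<in> Lp_space p UNIV" "has_weak_deriv UNIV f bs g" by blast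
  have "bs @ [b] \<in> multi k" if "b \<in> Basis" for b using bs that by (simp add: multi_def)
  from rep[OF this] obtain D where D: "\<And>b. b \<in> Basis \<Longrightarrow> D b \<in> borel_measurable borel" "\<And>b. b \<in> Basis \<Longrightarrow> D b \<in> Lp_space p UNIV"
    "\<And>b. b \<in> Basis \<Longrightarrow> has_weak_deriv UNIV f (bs @ [b]) (D b)" by metis
  have "has_weak_deriv UNIV g [b] (D b)" if "b \<in> Basis" for b
    using has_weak_deriv_append[OF g(3), of "[b]"] D(3)[OF that] that by simp
  then show ?thesis using that g D by blast
qed

section \<open>Derivative bounds for a cutoff times a monomial\<close>

lemma pderiv_dir_cong_open:
  assumes "open S" "x \<in> S" "\<And>y. y \<in> S \<Longrightarrow> f y = g y" "g differentiable (at x)"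
  shows "pderiv_dir b f x = pderiv_dir b g x"
proof -
  have "(g has_derivative frechet_derivative g (at x)) (at x)" using assms(4) frechet_derivative_works by blast
  then have "(f has_derivative frechet_derivative g (at x)) (at x)"
    by (rule has_derivative_transform_within_open[OF _ assms(1,2)]) (simp add: assms(3))
  then show ?thesis by (simp add: pderiv_dir_def[of b g] pderiv_dir_eq)
qed

lemma iter_pderiv_cong_open:
  assumes "open S" "\<And>y. y \<in> S \<Longrightarrow> f y = g y" "C_infinity g" "set bs \<subseteq> Basis"
  shows "x \<in> S \<Longrightarrow> iter_pderiv bs f x = iter_pderiv bs g x"
  using assms(4)
proof (induction bs arbitrary: x)
  case (Cons b bs)
  then show ?case
    using pderiv_dir_cong_open[OF assms(1), of x "iter_pderiv bs f" "iter_pderiv bs g" b]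
      C_infinity_differentiable[OF C_infinity_iter_pderiv[OF assms(3)]] by simp
qed (use assms in auto)

text \<open>Each application of the product rule doubles the number of terms, whence
  \<open>2 ^ length bs\<close>. The list is peeled off at its end because \<open>iter_pderiv\<close>
  applies the last direction first.\<close>

lemma iter_pderiv_mult_bound:
  fixes f g :: "'a::euclidean_space \<Rightarrow> real"
  assumes "C_infinity f" "C_infinity g" "\<epsilon> > 0" "A \<ge> 0" "B \<ge> 0"
    "\<And>bs. bs \<in> multi n \<Longrightarrow> \<bar>iter_pderiv bs f x\<bar> \<le> A / \<epsilon> ^ length bs"
    "\<And>bs. bs \<in> multi n \<Longrightarrow> \<bar>iter_pderiv bs g x\<bar> \<le> B / \<epsilon> ^ length bs"
    "bs \<in> multi n"
  shows "\<bar>iter_pderiv bs (\<lambda>x. f x * g x) x\<bar> \<le> 2 ^ length bs * (A * B) / \<epsilon> ^ length bs"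
  using assms
proof (induction n arbitrary: f g A B bs)
  case 0
  then have bs: "bs = []" by (simp add: multi_0)
  have "\<bar>f x\<bar> \<le> A" "\<bar>g x\<bar> \<le> B" using 0(6)[of "[]"] 0(7)[of "[]"] by auto
  then have "\<bar>f x\<bar> * \<bar>g x\<bar> \<le> A * B" using 0 by (intro mult_mono) auto
  then show ?case by (simp add: bs abs_mult)
next
  case (Suc n)
  show ?case
  proof (cases bs rule: rev_cases)
    case Nil
    have "\<bar>f x\<bar> \<le> A" "\<bar>g x\<bar> \<le> B" using Suc.prems(6)[of "[]"] Suc.prems(7)[of "[]"] by auto
    then have "\<bar>f x\<bar> * \<bar>g x\<bar> \<le> A * B" using Suc by (intro mult_mono) auto
    then show ?thesis by (simp add: Nil abs_mult)
  next
    case (snoc cs b)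
    then have cs: "cs \<in> multi n" "b \<in> Basis" using Suc.prems(8) by (auto simp: multi_def)
    let ?f = "pderiv_dir b f" and ?g = "pderiv_dir b g"
    have sm: "C_infinity ?f" "C_infinity ?g" using C_infinity_pderiv_dir Suc.prems(1,2) cs(2) by blast+
    have up: "ds @ [b] \<in> multi (Suc n)" "ds \<in> multi (Suc n)" if "ds \<in> multi n" for ds using that cs(2) by (auto simp: multi_def)
    have bf: "\<bar>iter_pderiv ds ?f x\<bar> \<le> (A / \<epsilon>) / \<epsilon> ^ length ds" if "ds \<in> multi n" for ds
      using Suc.prems(6)[OF up(1)[OF that]] by (simp add: iter_pderiv_append)
    have bg: "\<bar>iter_pderiv ds ?g x\<bar> \<le> (B / \<epsilon>) / \<epsilon> ^ length ds" if "ds \<in> multi n" for ds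
      using Suc.prems(7)[OF up(1)[OF that]] by (simp add: iter_pderiv_append)
    have 1: "\<bar>iter_pderiv cs (\<lambda>x. f x * ?g x) x\<bar> \<le> 2 ^ length cs * (A * (B / \<epsilon>)) / \<epsilon> ^ length cs"
      by (rule Suc.IH[OF Suc.prems(1) sm(2) Suc.prems(3,4) _ _ bg cs(1)]) (use Suc.prems up in auto)
    have 2: "\<bar>iter_pderiv cs (\<lambda>x. ?f x * g x) x\<bar> \<le> 2 ^ length cs * ((A / \<epsilon>) * B) / \<epsilon> ^ length cs"
      by (rule Suc.IH[OF sm(1) Suc.prems(2,3) _ Suc.prems(5) bf _ cs(1)]) (use Suc.prems up in auto)
    have "pderiv_dir b (\<lambda>x. f x * g x) = (\<lambda>x. f x * ?g x + ?f x * g x)"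
      by (rule ext, rule pderiv_dir_bounded_bilinear[OF bounded_bilinear_mult])
        (use Suc.prems C_infinity_differentiable in blast)+
    then have "iter_pderiv bs (\<lambda>x. f x * g x) x = iter_pderiv cs (\<lambda>x. f x * ?g x) x + iter_pderiv cs (\<lambda>x. ?f x * g x) x"
      using iter_pderiv_add[OF C_infinity_mult[OF Suc.prems(1) sm(2)] C_infinity_mult[OF sm(1) Suc.prems(2)] multi_D[OF cs(1)]]
      by (simp add: snoc iter_pderiv_append)
    also have "\<bar>\<dots>\<bar> \<le> 2 ^ length cs * (A * (B / \<epsilon>)) / \<epsilon> ^ length cs + 2 ^ length cs * ((A / \<epsilon>) * B) / \<epsilon> ^ length cs"
      using 1 2 by linarith
    also have "\<dots> = 2 ^ length bs * (A * B) / \<epsilon> ^ length bs"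
      using Suc.prems(3) by (simp add: snoc field_simps)
    finally show ?thesis .
  qed
qed

text \<open>Divided by \<open>fact m\<close> so that differentiating m times in direction b gives
  exactly 1. On a ball of radius R about x0 it has size R^m, which compensates all but one of m + 1
  derivatives of a cutoff at scale R.\<close>

definition mono_dir :: "'a::euclidean_space \<Rightarrow> 'a \<Rightarrow> nat \<Rightarrow> 'a \<Rightarrow> real" where
  "mono_dir x0 b m z = ((z - x0) \<bullet> b) ^ m / fact m"

lemma mono_dir_smooth: "C_infinity (mono_dir x0 b m)"
  unfolding mono_dir_def[abs_def] divide_inverse
  by (rule C_infinity_mult, rule C_infinity_power, rule C_infinity_inner, rule C_infinity_const)

lemma pderiv_mono_dir:
  assumes "b \<in> Basis" "c \<in> Basis"
  shows "pderiv_dir c (mono_dir x0 b m) = (if c = b \<and> m > 0 then mono_dir x0 b (m - 1) else (\<lambda>_. 0))"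
proof
  fix z
  have "(mono_dir x0 b m has_derivative (\<lambda>h. real m * (h \<bullet> b) * ((z - x0) \<bullet> b) ^ (m - 1) / fact m)) (at z)"
    unfolding mono_dir_def[abs_def] by (auto intro!: derivative_eq_intros)
  then have "pderiv_dir c (mono_dir x0 b m) z = real m * (c \<bullet> b) * ((z - x0) \<bullet> b) ^ (m - 1) / fact m"
    by (rule pderiv_dir_eq)
  also have "\<dots> = (if c = b \<and> m > 0 then mono_dir x0 b (m - 1) else (\<lambda>_. 0)) z"
  proof (cases m)
    case (Suc j)
    have "real (Suc j) * x / fact (Suc j) = x / fact j" for x
      by (simp add: fact_Suc del: of_nat_Suc)
    then show ?thesis using assms by (simp add: Suc mono_dir_def inner_Basis del: of_nat_Suc fact_Suc)
  qed simp
  finally show "pderiv_dir c (mono_dir x0 b m) z = \<dots>" .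
qed

lemma iter_mono_dir_replicate:
  assumes "b \<in> Basis"
  shows "iter_pderiv (replicate m b) (mono_dir x0 b m) = (\<lambda>_. 1)"
proof (induction m)
  case 0 then show ?case by (simp add: mono_dir_def fun_eq_iff)
next
  case (Suc m)
  have "replicate (Suc m) b = replicate m b @ [b]" by (simp add: replicate_append_same)
  then show ?case using Suc assms by (simp only: iter_pderiv_append iter_pderiv.simps pderiv_mono_dir) simp
qed

text \<open>A derivative in direction b lowers the power of R by one, which the factor 1 /
  \<epsilon> outweighs because \<epsilon> \<le> R; any other direction gives 0.\<close>

lemma iter_mono_dir_bound:
  assumes b: "b \<in> Basis" and z: "norm (z - x0) \<le> R" and \<epsilon>: "0 < \<epsilon>" "\<epsilon> \<le> R" and bs: "set bs \<subseteq> Basis"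
  shows "\<bar>iter_pderiv bs (mono_dir x0 b m) z\<bar> \<le> R ^ m / \<epsilon> ^ length bs"
  using bs
proof (induction bs arbitrary: m rule: rev_induct)
  case Nil
  have "\<bar>(z - x0) \<bullet> b\<bar> \<le> R" using Basis_le_norm[OF b, of "z - x0"] z by linarith
  then have "\<bar>(z - x0) \<bullet> b\<bar> ^ m \<le> R ^ m" by (intro power_mono) auto
  moreover have "\<bar>(z - x0) \<bullet> b\<bar> ^ m / fact m \<le> \<bar>(z - x0) \<bullet> b\<bar> ^ m / 1"
    by (intro divide_left_mono) auto
  ultimately show ?case by (simp add: mono_dir_def power_abs)
next
  case (snoc c bs)
  have R: "R > 0" using \<epsilon> by linarith
  show ?case
  proof (cases "c = b \<and> m > 0")
    case True
    then obtain j where j: "m = Suc j" using gr0_implies_Suc by blast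
    have "\<bar>iter_pderiv (bs @ [c]) (mono_dir x0 b m) z\<bar> = \<bar>iter_pderiv bs (mono_dir x0 b j) z\<bar>"
      using True b j by (simp add: iter_pderiv_append pderiv_mono_dir)
    also have "\<dots> \<le> R ^ j / \<epsilon> ^ length bs" using snoc by simp
    also have "\<dots> \<le> R ^ m / \<epsilon> ^ length (bs @ [c])"
      using \<epsilon> R by (simp add: j divide_simps)
    finally show ?thesis .
  next
    case False
    then have "pderiv_dir c (mono_dir x0 b m) = (\<lambda>_. 0)"
      using snoc.prems pderiv_mono_dir[OF b, of c x0 m] by auto
    then have "iter_pderiv (bs @ [c]) (mono_dir x0 b m) = (\<lambda>_. 0)"
      by (simp add: iter_pderiv_append iter_pderiv_zero)
    then show ?thesis using R \<epsilon> by simp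
  qed
qed

text \<open>If \<open>K * t 0\<close> were at most c^(-n), induction would give \<open>t i\<close>
  at most \<open>t 0\<close> times c^(-i): the surplus power of \<open>t i\<close> on the right
  absorbs the growing factor c^i. But the sequence stays above \<mu> > 0.\<close>

lemma superlinear_iteration:
  fixes t :: "nat \<Rightarrow> real"
  assumes step: "\<And>i. t (Suc i) ^ n \<le> K * c ^ i * t i ^ Suc n" and pos: "\<And>i. t i \<ge> \<mu>" "\<mu> > 0"
    and K: "K > 0" "c > 1" "n > 0"
  shows "t 0 \<ge> 1 / (K * c ^ n)"
proof (rule ccontr)
  assume "\<not> ?thesis"
  then have small: "K * t 0 \<le> (1 / c) ^ n"
    using K by (simp add: not_le field_simps)
  have t0: "t i > 0" for i using pos by (meson less_le_trans)
  have cl: "t i \<le> t 0 * (1 / c) ^ i" for i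
  proof (induction i)
    case (Suc i)
    have "t (Suc i) ^ n \<le> K * c ^ i * t i ^ Suc n" by (rule step)
    also have "\<dots> \<le> K * c ^ i * (t 0 * (1 / c) ^ i) ^ Suc n"
      using Suc K less_imp_le[OF t0] by (intro mult_left_mono power_mono) auto
    also have "\<dots> = (K * t 0) * (t 0 ^ n * ((1 / c) ^ i) ^ n)"
      using K by (simp add: power_mult_distrib power_one_over field_simps)
    also have "\<dots> \<le> (1 / c) ^ n * (t 0 ^ n * ((1 / c) ^ i) ^ n)"
      using small K less_imp_le[OF t0] by (intro mult_right_mono) auto
    also have "\<dots> = (t 0 * (1 / c) ^ Suc i) ^ n" by (simp only: power_Suc power_mult_distrib mult_ac)
    finally have "t (Suc i) ^ n \<le> (t 0 * (1 / c) ^ Suc i) ^ n" .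
    then show ?case using K less_imp_le[OF t0[of 0]]
      by (subst (asm) power_mono_iff) (auto simp: less_imp_le[OF t0])
  qed simp
  have "(\<lambda>i. t 0 * (1 / c) ^ i) \<longlonglongrightarrow> t 0 * 0"
    using K by (intro tendsto_mult tendsto_const LIMSEQ_power_zero) auto
  then have "\<forall>\<^sub>F i in sequentially. t 0 * (1 / c) ^ i < \<mu>"
    using pos(2) by (intro order_tendstoD(2)) auto
  then obtain i where "t 0 * (1 / c) ^ i < \<mu>" using eventually_happens'[OF sequentially_bot] by blast
  then show False using cl[of i] pos(1)[of i] by linarith
qed

lemma iter_pderiv_scaleR_const:
  assumes "C_infinity f" "set bs \<subseteq> Basis"
  shows "iter_pderiv bs (\<lambda>x. f x *\<^sub>R c) = (\<lambda>x. iter_pderiv bs f x *\<^sub>R c)"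
  using assms(2)
proof (induction bs)
  case (Cons b bs)
  have d: "iter_pderiv bs f differentiable (at x)" for x
    using Cons by (auto intro!: C_infinity_differentiable C_infinity_iter_pderiv assms)
  show ?case using Cons
    by (auto simp: pderiv_dir_bounded_bilinear[OF bounded_bilinear_scaleR d] pderiv_dir_const)
qed simp

lemma enp_bounded_supported:
  assumes p: "p \<ge> 1" and \<Omega>: "open \<Omega>" and B: "B \<ge> 0"
    and b: "\<And>x. norm (h x) \<le> B" "\<And>x. x \<notin> ball x0 r \<Longrightarrow> h x = 0"
  shows "enp p \<Omega> h \<le> ennreal (B powr p) * emeasure lborel (\<Omega> \<inter> ball x0 r)"
proof -
  have "enp p \<Omega> h = (\<integral>\<^sup>+x\<in>\<Omega>. ennreal (norm (h x) powr p) \<partial>lborel)" using \<Omega> by (intro enp_lborel) auto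
  also have "\<dots> \<le> (\<integral>\<^sup>+x. ennreal (B powr p) * indicator (\<Omega> \<inter> ball x0 r) x \<partial>lborel)"
  proof (rule nn_integral_mono)
    fix x
    have "norm (h x) powr p \<le> B powr p" using b(1) p by (intro powr_mono2) auto
    then show "ennreal (norm (h x) powr p) * indicator \<Omega> x \<le> ennreal (B powr p) * indicator (\<Omega> \<inter> ball x0 r) x"
      using b(2)[of x] by (cases "x \<in> ball x0 r"; cases "x \<in> \<Omega>") (auto intro!: ennreal_leI)
  qed
  also have "\<dots> = ennreal (B powr p) * emeasure lborel (\<Omega> \<inter> ball x0 r)"
    using \<Omega> by (intro nn_integral_cmult_indicator) auto
  finally show ?thesis .
qed

text \<open>The bound is the scale invariant ratio R / (r - r') to the power m + 1, divided by a
  single R. \<open>C\<close> depends neither on the open set nor on centre and radii, as the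
  iteration over radii requires.\<close>

lemma density_test_function:
  assumes p: "p \<ge> 1"
  obtains C where "C \<ge> 0" "\<And>(\<Omega> :: 'a::euclidean_space set) x0 b r r' R. open \<Omega> \<Longrightarrow> b \<in> Basis \<Longrightarrow>
    0 < r' \<Longrightarrow> r' < r \<Longrightarrow> r \<le> R \<Longrightarrow> R \<le> 1 \<Longrightarrow>
    \<exists>w :: 'a \<Rightarrow> 'b::{real_normed_field,euclidean_space}. w \<in> C0_infinity UNIV \<and> (\<forall>z\<in>ball x0 r'. w z = mono_dir x0 b m z *\<^sub>R 1) \<and>
      (\<forall>z. z \<notin> ball x0 r \<longrightarrow> w z = 0) \<and>
      SE (Suc m) p \<Omega> \<Omega> w \<le> ennreal (C * ((R / (r - r')) ^ Suc m / R) powr p) * emeasure lborel (\<Omega> \<inter> ball x0 r)"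
proof -
  define k where "k = Suc m"
  obtain M where M: "M \<ge> 0" "\<And>(S :: 'a set) \<epsilon>. \<epsilon> > 0 \<Longrightarrow>
    \<exists>\<theta> :: 'a \<Rightarrow> real. C_infinity \<theta> \<and> (\<forall>x. 0 \<le> \<theta> x \<and> \<theta> x \<le> 1) \<and> (\<forall>x\<in>nhd S \<epsilon>. \<theta> x = 1) \<and>
      (\<forall>x. x \<notin> nhd S (3 * \<epsilon>) \<longrightarrow> \<theta> x = 0) \<and>
      (\<forall>bs x. set bs \<subseteq> Basis \<longrightarrow> length bs \<le> k \<longrightarrow> \<bar>iter_pderiv bs \<theta> x\<bar> \<le> M / \<epsilon> ^ length bs)"
    using smooth_cutoff[of k] by blast
  define N where "N = real (card (multi k :: 'a list set))"
  define C where "C = N * (2 ^ k * M * 4 ^ k) powr p"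
  have C: "C \<ge> 0" by (simp add: C_def N_def)
  have "\<exists>w :: 'a \<Rightarrow> 'b. w \<in> C0_infinity UNIV \<and> (\<forall>z\<in>ball x0 r'. w z = mono_dir x0 b m z *\<^sub>R 1) \<and>
      (\<forall>z. z \<notin> ball x0 r \<longrightarrow> w z = 0) \<and>
      SE (Suc m) p \<Omega> \<Omega> w \<le> ennreal (C * ((R / (r - r')) ^ Suc m / R) powr p) * emeasure lborel (\<Omega> \<inter> ball x0 r)"
    if a: "open \<Omega>" "b \<in> Basis" "0 < r'" "r' < r" "r \<le> R" "R \<le> 1" for \<Omega> :: "'a set" and x0 b r r' R
  proof -
    \<comment> \<open>A quarter of the gap, so that a cutoff reaching out by 3\<epsilon> stays in a
      closed ball of radius smaller than r.\<close>
    define \<epsilon> where "\<epsilon> = (r - r') / 4"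
    have \<epsilon>: "\<epsilon> > 0" "\<epsilon> \<le> R" "\<epsilon> \<le> 1" "r' + 3 * \<epsilon> < r" using a by (auto simp: \<epsilon>_def field_simps)
    have R: "R > 0" using a by linarith
    obtain \<theta> :: "'a \<Rightarrow> real" where \<theta>: "C_infinity \<theta>" "\<And>x. x \<in> nhd (ball x0 r') \<epsilon> \<Longrightarrow> \<theta> x = 1"
      "\<And>x. x \<notin> nhd (ball x0 r') (3 * \<epsilon>) \<Longrightarrow> \<theta> x = 0"
      "\<And>bs x. bs \<in> multi k \<Longrightarrow> \<bar>iter_pderiv bs \<theta> x\<bar> \<le> M / \<epsilon> ^ length bs"
      using M(2)[OF \<epsilon>(1), of "ball x0 r'"] unfolding multi_def by blast
    have sub: "nhd (ball x0 r') (3 * \<epsilon>) \<subseteq> cball x0 (r' + 3 * \<epsilon>)"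
    proof
      fix z assume "z \<in> nhd (ball x0 r') (3 * \<epsilon>)"
      then obtain s where "dist x0 s < r'" "dist s z < 3 * \<epsilon>" by (auto simp: nhd_def)
      then show "z \<in> cball x0 (r' + 3 * \<epsilon>)" using dist_triangle[of x0 z s] by simp
    qed
    have \<theta>z: "\<theta> z = 0" if "z \<notin> cball x0 (r' + 3 * \<epsilon>)" for z using \<theta>(3) sub that by blast
    let ?P = "mono_dir x0 b m"
    let ?q = "\<lambda>z. \<theta> z * ?P z"
    define w where "w z = ?q z *\<^sub>R (1::'b)" for z
    have qs: "C_infinity ?q" by (rule C_infinity_mult[OF \<theta>(1) mono_dir_smooth])
    have ws: "C_infinity w" unfolding w_def[abs_def] by (rule C_infinity_scaleR[OF qs C_infinity_const])
    have wz: "w z = 0" if "z \<notin> cball x0 (r' + 3 * \<epsilon>)" for z using \<theta>z[OF that] by (simp add: w_def)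
    have w0: "w \<in> C0_infinity UNIV"
      by (rule C0_infinityI[OF ws compact_cball[of x0 "r' + 3 * \<epsilon>"]]) (use wz in auto)
    have out: "z \<notin> cball x0 (r' + 3 * \<epsilon>)" if "z \<notin> ball x0 r" for z using that \<epsilon>(4) by auto
    \<comment> \<open>The bounds of all orders are replaced by the one of order k, which is the
      worst since \<epsilon> \<le> 1; this is where R \<le> 1 enters.\<close>
    define B where "B = 2 ^ k * M * R ^ m / \<epsilon> ^ k"
    have B: "B \<ge> 0" using M R \<epsilon> by (simp add: B_def)
    have bd: "norm (iter_pderiv bs w z) \<le> B" "z \<notin> ball x0 r \<Longrightarrow> iter_pderiv bs w z = 0" if bs: "bs \<in> multi k" for bs z
    proof -
      have z0: "iter_pderiv bs w z = 0" if "z \<notin> cball x0 (r' + 3 * \<epsilon>)"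
        by (rule iter_pderiv_eq_0_open[of "- cball x0 (r' + 3 * \<epsilon>)"]) (use wz that in \<open>auto simp: open_Compl\<close>)
      then show "z \<notin> ball x0 r \<Longrightarrow> iter_pderiv bs w z = 0" using out by blast
      show "norm (iter_pderiv bs w z) \<le> B"
      proof (cases "z \<in> cball x0 (r' + 3 * \<epsilon>)")
        case True
        then have zR: "norm (z - x0) \<le> R" using \<epsilon>(4) a(5) by (simp add: dist_norm norm_minus_commute)
        have "\<bar>iter_pderiv bs ?q z\<bar> \<le> 2 ^ length bs * (M * R ^ m) / \<epsilon> ^ length bs"
          by (rule iter_pderiv_mult_bound[OF \<theta>(1) mono_dir_smooth \<epsilon>(1) M(1) _ \<theta>(4) iter_mono_dir_bound[OF a(2) zR \<epsilon>(1,2) multi_D] bs])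
            (use R in auto)
        also have "\<dots> \<le> 2 ^ k * (M * R ^ m) / \<epsilon> ^ k"
        proof (rule frac_le)
          have "length bs \<le> k" using bs by (simp add: multi_def)
          then show "2 ^ length bs * (M * R ^ m) \<le> 2 ^ k * (M * R ^ m)"
            using M R by (intro mult_right_mono power_increasing) auto
          show "\<epsilon> ^ k \<le> \<epsilon> ^ length bs" using \<epsilon> \<open>length bs \<le> k\<close> by (intro power_decreasing) auto
        qed (use M R \<epsilon> in auto)
        finally show ?thesis
          unfolding w_def[abs_def] iter_pderiv_scaleR_const[OF qs multi_D[OF bs]] by (simp add: B_def)
      qed (use z0 B in simp)
    qed
    have "SE k p \<Omega> \<Omega> w = (\<Sum>bs\<in>multi k. enp p \<Omega> (iter_pderiv (rev bs) w))"
      by (rule sobolev_C0_infinity(2)[OF w0 p a(1)]) (use a in auto)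
    also have "\<dots> \<le> (\<Sum>bs\<in>(multi k :: 'a list set). ennreal (B powr p) * emeasure lborel (\<Omega> \<inter> ball x0 r))"
    proof (rule sum_mono)
      fix bs :: "'a list" assume "bs \<in> multi k"
      then have "rev bs \<in> multi k" by (simp add: multi_def)
      then show "enp p \<Omega> (iter_pderiv (rev bs) w) \<le> ennreal (B powr p) * emeasure lborel (\<Omega> \<inter> ball x0 r)"
        by (intro enp_bounded_supported[OF p a(1) B] bd)
    qed
    also have "\<dots> = ennreal (N * B powr p) * emeasure lborel (\<Omega> \<inter> ball x0 r)"
      by (simp add: N_def ennreal_of_nat_eq_real_of_nat ennreal_mult mult.assoc)
    also have "N * B powr p = C * ((R / (r - r')) ^ Suc m / R) powr p"
    proof -
      have "B = (2 ^ k * M * 4 ^ k) * ((R / (r - r')) ^ Suc m / R)"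
        using R a(4) by (simp add: B_def \<epsilon>_def k_def power_divide field_simps)
      then have "B powr p = (2 ^ k * M * 4 ^ k) powr p * ((R / (r - r')) ^ Suc m / R) powr p"
        by (simp add: powr_mult)
      then show ?thesis by (simp add: C_def)
    qed
    finally have "SE (Suc m) p \<Omega> \<Omega> w \<le> ennreal (C * ((R / (r - r')) ^ Suc m / R) powr p) * emeasure lborel (\<Omega> \<inter> ball x0 r)"
      by (simp only: k_def)
    moreover have "w z = ?P z *\<^sub>R 1" if "z \<in> ball x0 r'" for z
      using \<theta>(2)[of z] that subset_nhd[OF \<epsilon>(1), of "ball x0 r'"] by (simp add: w_def subset_iff)
    ultimately show ?thesis using w0 wz out by blast
  qed
  with C that show ?thesis by blast
qed

lemma weak_deriv_local:
  fixes f w :: "'a::euclidean_space \<Rightarrow> 'b::euclidean_space"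
  assumes A: "open A" and w: "C_infinity w" and ae: "AE x in lebesgue_on A. f x = w x"
    and g: "has_weak_deriv UNIV f bs g" and bs: "set bs \<subseteq> Basis"
  shows "AE x in lborel. x \<in> A \<longrightarrow> g x = iter_pderiv (rev bs) w x"
proof -
  have gA: "has_weak_deriv A f bs g" by (rule has_weak_deriv_subset[OF g _ open_UNIV A bs]) auto
  have "has_weak_deriv A w bs g"
    by (rule has_weak_deriv_cong_AE[OF gA ae _ _ has_weak_derivD(2)[OF gA] bs])
      (use C_infinity_locally_integrable[OF w] in auto)
  then have "AE x in lebesgue_on A. g x = iter_pderiv (rev bs) w x"
    by (rule has_weak_deriv_unique[OF _ has_weak_deriv_classical[OF w bs A] A])
  then show ?thesis using A by (simp add: AE_restrict_space_iff AE_completion_iff)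
qed

section \<open>Volume of the domain in balls\<close>

lemma finite_measure_Int_ball:
  fixes x :: "'a::euclidean_space"
  assumes "open \<Omega>"
  shows "emeasure lborel (\<Omega> \<inter> ball x r) = ennreal (measure lborel (\<Omega> \<inter> ball x r))"
proof -
  have "emeasure lborel (\<Omega> \<inter> ball x r) \<le> emeasure lborel (ball x r)" by (rule emeasure_mono) auto
  also have "\<dots> < \<infinity>" by (rule emeasure_lborel_ball_finite)
  finally show ?thesis by (simp add: emeasure_eq_ennreal_measure)
qed

lemma measure_Int_ball_mono:
  fixes x :: "'a::euclidean_space"
  assumes "open \<Omega>" "\<Omega> \<inter> ball x r \<subseteq> \<Omega> \<inter> ball y s"
  shows "measure lborel (\<Omega> \<inter> ball x r) \<le> measure lborel (\<Omega> \<inter> ball y s)"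
  using emeasure_mono[OF assms(2), of lborel] assms(1) by (simp add: finite_measure_Int_ball)

lemma measure_Int_ball_pos:
  fixes x :: "'a::euclidean_space"
  assumes "open \<Omega>" "x \<in> closure \<Omega>" "r > 0"
  shows "measure lborel (\<Omega> \<inter> ball x r) > 0"
proof -
  obtain y where "y \<in> \<Omega>" "dist y x < r" using assms closure_approachable by blast
  then have "y \<in> \<Omega> \<inter> ball x r" by (simp add: dist_commute)
  moreover have "open (\<Omega> \<inter> ball x r)" using assms by auto
  ultimately obtain e where e: "e > 0" "ball y e \<subseteq> \<Omega> \<inter> ball x r" using open_contains_ball by metis
  have "0 < measure lborel (ball y e)" using content_ball_pos[OF e(1)] by simp
  also have "\<dots> \<le> measure lborel (\<Omega> \<inter> ball x r)"
    using emeasure_mono[OF e(2), of lborel] assms(1) emeasure_lborel_ball_finite[of y e]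
    by (simp add: finite_measure_Int_ball emeasure_eq_ennreal_measure)
  finally show ?thesis .
qed

text \<open>Extend by \<open>T\<close> a cutoff monomial living in the ball of radius
  \<open>r i\<close> about x. The derivative of order k - 1 of the extension is 1 on the domain
  within \<open>r (Suc i)\<close> of x and 0 on the domain within R of y. So
  \<open>two_set_estimate\<close> controls the volume at \<open>r (Suc i)\<close> by the energy,
  hence by the volume at \<open>r i\<close>, and with a larger exponent on the right.\<close>

lemma measure_density_pair:
  fixes T :: "('a::euclidean_space \<Rightarrow> 'b::{real_normed_field,euclidean_space}) \<Rightarrow> 'a \<Rightarrow> 'b"
  assumes p: "p \<ge> 1" and k: "k \<ge> 1" and \<Omega>: "open \<Omega>"
    and T: "continuous_extension_operator k p \<Omega> (sobolev k p \<Omega>) (sobolev k p UNIV) T"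
  obtains c where "c > 0" "\<And>x y R. x \<in> closure \<Omega> \<Longrightarrow> y \<in> closure \<Omega> \<Longrightarrow> dist x y = 2 * R \<Longrightarrow> 0 < R \<Longrightarrow> R \<le> 1 \<Longrightarrow>
     measure lborel (\<Omega> \<inter> ball x R) \<le> measure lborel (\<Omega> \<inter> ball y R) \<Longrightarrow> c * R ^ DIM('a) \<le> measure lborel (\<Omega> \<inter> ball x R)"
proof -
  obtain m where km: "k = Suc m" using k not0_implies_Suc by (metis not_one_le_zero)
  define n where "n = DIM('a)"
  obtain C1 where C1: "C1 \<ge> 0" "\<And>u. u \<in> sobolev k p \<Omega> \<Longrightarrow> SE k p UNIV UNIV (T u) \<le> ennreal C1 * SE k p \<Omega> \<Omega> u"
    using extension_operator_bounded[OF p \<Omega> T] by blast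
  obtain C2 where C2: "C2 \<ge> 0" "\<And>(\<Omega> :: 'a set) x0 b r r' R. open \<Omega> \<Longrightarrow> b \<in> Basis \<Longrightarrow>
    0 < r' \<Longrightarrow> r' < r \<Longrightarrow> r \<le> R \<Longrightarrow> R \<le> 1 \<Longrightarrow>
    \<exists>w :: 'a \<Rightarrow> 'b. w \<in> C0_infinity UNIV \<and> (\<forall>z\<in>ball x0 r'. w z = mono_dir x0 b m z *\<^sub>R 1) \<and>
      (\<forall>z. z \<notin> ball x0 r \<longrightarrow> w z = 0) \<and>
      SE (Suc m) p \<Omega> \<Omega> w \<le> ennreal (C2 * ((R / (r - r')) ^ Suc m / R) powr p) * emeasure lborel (\<Omega> \<inter> ball x0 r)"
    using density_test_function[OF p] by blast
  have Ts: "T u \<in> sobolev k p UNIV" "AE x in lebesgue_on \<Omega>. T u x = u x" if "u \<in> sobolev k p \<Omega>" for u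
    using T that by (auto simp: continuous_extension_operator_def)
  define C3 where "C3 = real n * (C1 * C2)"
  have C3: "C3 \<ge> 0" using C1 C2 by (simp add: C3_def)
  \<comment> \<open>K and q separate the fixed from the growing part of (4 2^i)^(k p), the cost of
    the gap between consecutive radii; the added 1 makes K positive.\<close>
  define K where "K = set_const TYPE('a) p * C3 * (4 ^ k) powr p + 1"
  define q where "q = (2 ^ k) powr p"
  have K: "K > 0" using set_const_nonneg C3 by (auto simp: K_def intro!: add_nonneg_pos mult_nonneg_nonneg)
  have q: "q > 1"
  proof -
    have "(2::real) ^ k > 1" using k by (intro one_less_power) auto
    then show ?thesis unfolding q_def using p by (intro gr_one_powr) auto
  qed
  have n: "n > 0" by (simp add: n_def)
  \<comment> \<open>\<open>superlinear_iteration\<close> bounds \<open>t 0\<close> from below, and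
    its power n + 1 is the normalised volume at radius R.\<close>
  define c where "c = (1 / (K * q ^ n)) ^ Suc n"
  have c: "c > 0" using K q by (simp add: c_def)
  have "c * R ^ n \<le> measure lborel (\<Omega> \<inter> ball x R)"
    if x: "x \<in> closure \<Omega>" and y: "y \<in> closure \<Omega>" and d: "dist x y = 2 * R" and R: "0 < R" "R \<le> 1"
      and le: "measure lborel (\<Omega> \<inter> ball x R) \<le> measure lborel (\<Omega> \<inter> ball y R)" for x y R
  proof -
    define \<mu> where "\<mu> s = measure lborel (\<Omega> \<inter> ball x s)" for s
    \<comment> \<open>Radii decreasing from R at i = 0 towards R / 2, with gaps R 2^(-i) / 4.
      Staying above R / 2 gives the sequence \<open>t\<close> a positive lower bound.\<close>
    define r where "r i = R * (1 / 2 + (1 / 2) ^ Suc i)" for i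
    define t where "t i = root (Suc n) (\<mu> (r i) / R ^ n)" for i
    have r: "R / 2 < r i" "r i \<le> R" "r (Suc i) < r i" "R / (r i - r (Suc i)) = 4 * 2 ^ i" for i
    proof -
      have h: "0 < (1 / 2 :: real) ^ i" "(1 / 2 :: real) ^ i \<le> 1" by (auto simp: power_le_one)
      show "R / 2 < r i" "r i \<le> R" using h R by (auto simp: r_def field_simps)
      have e: "r i - r (Suc i) = R * (1 / 2) ^ i / 4" by (simp add: r_def field_simps)
      then show "r (Suc i) < r i" using h R by (smt (verit, ccfv_SIG) divide_pos_pos mult_pos_pos)
      show "R / (r i - r (Suc i)) = 4 * 2 ^ i" unfolding e using R by (simp add: power_one_over)
    qed
    have \<mu>pos: "\<mu> s > 0" if "s > 0" for s unfolding \<mu>_def by (rule measure_Int_ball_pos[OF \<Omega> x that])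
    have \<mu>mono: "\<mu> s \<le> \<mu> s'" if "s \<le> s'" for s s'
      unfolding \<mu>_def by (rule measure_Int_ball_mono[OF \<Omega>]) (use that in auto)
    have rp: "r i > 0" for i using r(1)[of i] R by linarith
    have tpow: "t i ^ Suc n = \<mu> (r i) / R ^ n" "t i > 0" for i
      unfolding t_def using \<mu>pos[OF rp[of i]] R by (auto simp: real_root_pow_pos2 simp del: power_Suc)
    have step: "t (Suc i) ^ n \<le> K * q ^ i * t i ^ Suc n" for i
    proof -
      obtain b :: 'a where b: "b \<in> Basis" using nonempty_Basis by blast
      obtain w :: "'a \<Rightarrow> 'b" where w: "w \<in> C0_infinity UNIV" "\<And>z. z\<in>ball x (r (Suc i)) \<Longrightarrow> w z = mono_dir x b m z *\<^sub>R 1"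
        "\<And>z. z \<notin> ball x (r i) \<Longrightarrow> w z = 0"
        "SE (Suc m) p \<Omega> \<Omega> w \<le> ennreal (C2 * ((R / (r i - r (Suc i))) ^ Suc m / R) powr p) * emeasure lborel (\<Omega> \<inter> ball x (r i))"
        using C2(2)[OF \<Omega> b rp r(3,2) R(2)] by blast
      have wS: "w \<in> sobolev k p \<Omega>" by (rule sobolev_C0_infinity(1)[OF w(1) p \<Omega>])
      have smooth: "C_infinity w" by (rule C0_infinity_D(1)[OF w(1)])
      let ?bs = "replicate m b"
      have bs: "set ?bs \<subseteq> Basis" "length ?bs < k" using b by (auto simp: km)
      obtain g D where g: "g \<in> borel_measurable borel" "g \<in> Lp_space p UNIV" "has_weak_deriv UNIV (T w) ?bs g"
        "\<And>b. b \<in> Basis \<Longrightarrow> D b \<in> borel_measurable borel" "\<And>b. b \<in> Basis \<Longrightarrow> D b \<in> Lp_space p UNIV"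
        "\<And>b. b \<in> Basis \<Longrightarrow> has_weak_deriv UNIV g [b] (D b)"
        "\<And>b. b \<in> Basis \<Longrightarrow> has_weak_deriv UNIV (T w) (?bs @ [b]) (D b)"
        using sobolev_borel_deriv_at[OF p Ts(1)[OF wS] bs] by metis
      let ?A = "\<Omega> \<inter> ball x (r (Suc i))" and ?A' = "\<Omega> \<inter> ball y R"
      have oA: "open ?A" "open ?A'" using \<Omega> by auto
      have loc: "AE z in lborel. z \<in> A \<longrightarrow> g z = iter_pderiv (rev ?bs) w z" if "open A" "A \<subseteq> \<Omega>" for A
        by (rule weak_deriv_local[OF that(1) smooth AE_lebesgue_on_subset[OF Ts(2)[OF wS]] g(3) bs(1)])
          (use that \<Omega> in auto)
      have A1: "AE z in lborel. z \<in> ?A \<longrightarrow> g z = 1"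
        using loc[OF oA(1) Int_lower1]
      proof (rule AE_mp, intro AE_I2 impI)
        fix z assume z: "z \<in> ?A \<longrightarrow> g z = iter_pderiv (rev ?bs) w z" "z \<in> ?A"
        have "iter_pderiv ?bs w z = iter_pderiv ?bs (\<lambda>z. mono_dir x b m z *\<^sub>R 1) z"
          by (rule iter_pderiv_cong_open[of "ball x (r (Suc i))"])
            (use w(2) z bs C_infinity_scaleR[OF mono_dir_smooth C_infinity_const] in auto)
        also have "\<dots> = 1"
          unfolding iter_pderiv_scaleR_const[OF mono_dir_smooth bs(1)] iter_mono_dir_replicate[OF b] by simp
        finally show "g z = 1" using z by simp
      qed
      \<comment> \<open>The centres are 2 R apart and \<open>r i\<close> is at most R, so the test
        function vanishes on the ball about y.\<close>
      have dis: "z \<notin> ball x (r i)" if "z \<in> ball y R" for z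
        using that d r(2)[of i] dist_triangle2[of x y z] by (auto simp: dist_commute)
      have A0: "AE z in lborel. z \<in> ?A' \<longrightarrow> g z = 0"
        using loc[OF oA(2) Int_lower1]
      proof (rule AE_mp, intro AE_I2 impI)
        fix z assume z: "z \<in> ?A' \<longrightarrow> g z = iter_pderiv (rev ?bs) w z" "z \<in> ?A'"
        have "iter_pderiv ?bs w z = 0"
          by (rule iter_pderiv_eq_0_open[of "ball y R"]) (use w(3) dis z in auto)
        then show "g z = 0" using z by simp
      qed
      \<comment> \<open>The power R^(-p) in this energy cancels the R^p of
        \<open>two_set_estimate\<close>; what remains is scale invariant.\<close>
      define I where "I = C3 * ((4 * 2 ^ i) ^ k / R) powr p * \<mu> (r i)"
      have I0: "I \<ge> 0" using C3 \<mu>pos[OF rp[of i]] by (simp add: I_def)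
      have "(\<Sum>b\<in>Basis. enp p UNIV (D b)) \<le> (\<Sum>b\<in>(Basis::'a set). SE k p UNIV UNIV (T w))"
      proof (rule sum_mono)
        fix b' :: 'a assume b': "b' \<in> Basis"
        show "enp p UNIV (D b') \<le> SE k p UNIV UNIV (T w)"
          by (rule enp_deriv_le_SE[OF Ts(1)[OF wS] p open_UNIV _ _ g(7)[OF b']]) (use b b' in \<open>auto simp: multi_def km\<close>)
      qed
      also have "\<dots> = ennreal (real n) * SE k p UNIV UNIV (T w)"
        by (simp add: n_def ennreal_of_nat_eq_real_of_nat)
      also have "\<dots> \<le> ennreal (real n) * (ennreal C1 * (ennreal (C2 * ((4 * 2 ^ i) ^ k / R) powr p) * ennreal (\<mu> (r i))))"
        using w(4) order_trans[OF C1(2)[OF wS] mult_left_mono[OF w(4)[folded km]]]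
        by (intro mult_left_mono) (simp_all add: r(4) km \<mu>_def finite_measure_Int_ball[OF \<Omega>])
      also have "\<dots> = ennreal I"
      proof -
        have "ennreal (real n) * (ennreal C1 * (ennreal (C2 * ((4 * 2 ^ i) ^ k / R) powr p) * ennreal (\<mu> (r i))))
          = ennreal (real n * (C1 * ((C2 * ((4 * 2 ^ i) ^ k / R) powr p) * \<mu> (r i))))"
          using C1(1) C2(1) less_imp_le[OF \<mu>pos[OF rp[of i]]]
          by (simp only: ennreal_mult mult_nonneg_nonneg of_nat_0_le_iff powr_ge_zero)
        then show ?thesis by (simp add: I_def C3_def mult_ac)
      qed
      finally have I: "(\<Sum>b\<in>Basis. enp p UNIV (D b)) \<le> ennreal I" .
      have "t (Suc i) ^ DIM('a) \<le> set_const TYPE('a) p * (R powr p / R ^ DIM('a)) * I"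
      proof (rule two_set_estimate[OF p g(2,1,6,5,4) _ _ _ _ _ _ A1 A0 _ R(1) I I0, where c=x])
        show "emeasure lborel ?A = ennreal (\<mu> (r (Suc i)))" unfolding \<mu>_def by (rule finite_measure_Int_ball[OF \<Omega>])
        show "emeasure lborel ?A' = ennreal (measure lborel ?A')" by (rule finite_measure_Int_ball[OF \<Omega>])
        show "0 < \<mu> (r (Suc i))" by (rule \<mu>pos[OF rp])
        show "\<mu> (r (Suc i)) \<le> measure lborel ?A'"
          using \<mu>mono[OF r(2)[of "Suc i"]] le by (simp add: \<mu>_def)
        show "t (Suc i) > 0" by (rule tpow)
        show "t (Suc i) ^ Suc DIM('a) = \<mu> (r (Suc i)) / R ^ DIM('a)" using tpow(1)[of "Suc i"] by (simp add: n_def)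
        fix u v assume u: "u \<in> ?A \<union> ?A'" and v: "v \<in> ball x R"
        have "dist u x < 3 * R"
          using u d r(2)[of "Suc i"] R dist_triangle[of u x y] by (auto simp: dist_commute)
        then show "dist u v < 4 * R" using v dist_triangle[of u v x] by simp
      qed (use oA in auto)
      also have "\<dots> = set_const TYPE('a) p * C3 * ((4 * 2 ^ i) ^ k) powr p * (\<mu> (r i) / R ^ n)"
        using R by (simp add: I_def n_def powr_divide field_simps)
      also have "((4 * 2 ^ i :: real) ^ k) powr p = (4 ^ k) powr p * q ^ i"
      proof -
        have "(4 * 2 ^ i :: real) ^ k = 4 ^ k * (2 ^ k) ^ i"
          by (simp add: power_mult_distrib power_mult[symmetric] mult.commute)
        moreover have "((2 ^ k) ^ i) powr p = q ^ i" unfolding q_def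
          by (induction i) (simp_all add: powr_mult)
        ultimately show ?thesis by (simp add: powr_mult)
      qed
      also have "set_const TYPE('a) p * C3 * ((4 ^ k) powr p * q ^ i) * (\<mu> (r i) / R ^ n)
         \<le> K * q ^ i * t i ^ Suc n"
      proof -
        have "set_const TYPE('a) p * C3 * (4 ^ k) powr p * (q ^ i * t i ^ Suc n) \<le> K * (q ^ i * t i ^ Suc n)"
          using q less_imp_le[OF tpow(2)[of i]] unfolding K_def by (intro mult_right_mono) auto
        then show ?thesis unfolding tpow(1)[symmetric] by (simp only: mult.assoc)
      qed
      finally show ?thesis by (simp add: n_def)
    qed
    \<comment> \<open>May depend on x and R: it only has to be positive and does not enter the bound
      for \<open>t 0\<close>.\<close>
    define \<mu>0 where "\<mu>0 = root (Suc n) (\<mu> (R / 2) / R ^ n)"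
    have "\<mu>0 > 0" unfolding \<mu>0_def using \<mu>pos[of "R / 2"] R by simp
    moreover have "t i \<ge> \<mu>0" for i
      unfolding t_def \<mu>0_def using \<mu>mono[OF less_imp_le[OF r(1)[of i]]] R
      by (simp add: divide_right_mono)
    ultimately have t0: "1 / (K * q ^ n) \<le> t 0"
      using superlinear_iteration[of t n K q \<mu>0, OF step _ _ K q n] by blast
    then have "c \<le> t 0 ^ Suc n" unfolding c_def using K q by (intro power_mono) auto
    also have "\<dots> = \<mu> R / R ^ n" using tpow(1)[of 0] by (simp add: r_def)
    finally show ?thesis using R by (simp add: \<mu>_def field_simps)
  qed
  then show ?thesis using that[OF c] by (simp add: n_def)
qed

text \<open>
  Two equal balls with centres in the closure at distance twice the radius: the one carrying less
  of the measure of the domain satisfies the density bound, hence so does the other.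
\<close>

lemma measure_density:
  fixes T :: "('a::euclidean_space \<Rightarrow> 'b::{real_normed_field,euclidean_space}) \<Rightarrow> 'a \<Rightarrow> 'b"
  assumes p: "p \<ge> 1" and k: "k \<ge> 1" and \<Omega>: "is_domain \<Omega>"
    and T: "continuous_extension_operator k p \<Omega> (sobolev k p \<Omega>) (sobolev k p UNIV) T"
  obtains c R0 where "c > 0" "R0 > 0" "\<And>x R. x \<in> closure \<Omega> \<Longrightarrow> 0 < R \<Longrightarrow> R \<le> R0 \<Longrightarrow>
     c * R ^ DIM('a) \<le> measure lborel (\<Omega> \<inter> ball x R)"
proof -
  have o: "open \<Omega>" "connected \<Omega>" "\<Omega> \<noteq> {}" using \<Omega> by (auto simp: is_domain_def)
  obtain c where c: "c > 0" "\<And>x y R. x \<in> closure \<Omega> \<Longrightarrow> y \<in> closure \<Omega> \<Longrightarrow> dist x y = 2 * R \<Longrightarrow> 0 < R \<Longrightarrow> R \<le> 1 \<Longrightarrow>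
     measure lborel (\<Omega> \<inter> ball x R) \<le> measure lborel (\<Omega> \<inter> ball y R) \<Longrightarrow> c * R ^ DIM('a) \<le> measure lborel (\<Omega> \<inter> ball x R)"
    using measure_density_pair[OF p k o(1) T] by metis
  obtain a where a: "a \<in> \<Omega>" using o by blast
  \<comment> \<open>An open set is never a single point; the distance from \<open>a\<close> to a
    second point limits the admissible radii.\<close>
  have "\<not> \<Omega> \<subseteq> {a}"
  proof
    assume "\<Omega> \<subseteq> {a}"
    then have "\<Omega> = {a}" using a by auto
    then show False using o(1) not_open_singleton by metis
  qed
  then obtain b where b: "b \<in> \<Omega>" "b \<noteq> a" by blast
  define R0 where "R0 = min 1 (dist a b / 4)"
  have R0: "R0 > 0" using b by (simp add: R0_def)
  have "c * R ^ DIM('a) \<le> measure lborel (\<Omega> \<inter> ball x R)" if x: "x \<in> closure \<Omega>" and R: "0 < R" "R \<le> R0" for x R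
  proof -
    have R': "R \<le> 1" "4 * R \<le> dist a b" using R by (auto simp: R0_def)
    \<comment> \<open>As a and b are at least 4 R apart, they cannot both be closer than 2 R to x.
      Connectedness of the closure then yields a point at distance exactly 2 R.\<close>
    have "\<exists>z\<in>closure \<Omega>. 2 * R \<le> dist x z"
    proof (rule ccontr)
      assume "\<not> ?thesis"
      then have "dist x a < 2 * R" "dist x b < 2 * R" using a b closure_subset[of \<Omega>] by (auto simp: not_le)
      then show False using R'(2) dist_triangle3[of a b x] by linarith
    qed
    then obtain z where z: "z \<in> closure \<Omega>" "2 * R \<le> dist x z" by blast
    have "connected (dist x ` closure \<Omega>)"
      by (intro connected_continuous_image continuous_intros connected_imp_connected_closure o(2))
    moreover have "0 \<in> dist x ` closure \<Omega>" using x by force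
    moreover have "dist x z \<in> dist x ` closure \<Omega>" using z by blast
    ultimately have "2 * R \<in> dist x ` closure \<Omega>"
      using z(2) R unfolding connected_iff_interval by (meson less_imp_le mult_pos_pos zero_less_numeral)
    then obtain y where y: "y \<in> closure \<Omega>" "dist x y = 2 * R" by force
    show ?thesis
    proof (cases "measure lborel (\<Omega> \<inter> ball x R) \<le> measure lborel (\<Omega> \<inter> ball y R)")
      case True
      then show ?thesis using c(2)[OF x y R(1) R'(1)] by blast
    next
      case False
      then have "c * R ^ DIM('a) \<le> measure lborel (\<Omega> \<inter> ball y R)"
        using c(2)[OF y(1) x _ R(1) R'(1)] y(2) by (simp add: dist_commute)
      with False show ?thesis by linarith
    qed
  qed
  with c(1) R0 that show ?thesis by blast
qed

subsection \<open>Functions vanishing on a set of positive density\<close>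

text \<open>Applied with \<open>Z\<close> the extension domain, where the extended function is
  known, and \<open>K\<close> the part of \<open>E\<close> in the support of the cutoff. There
  \<open>K\<close> is disjoint from \<open>Z\<close>, so the condition concerns \<open>Z\<close> as
  seen from its boundary.\<close>

definition thick :: "'a::euclidean_space set \<Rightarrow> 'a set \<Rightarrow> real \<Rightarrow> real \<Rightarrow> bool" where
  "thick Z K c \<rho>0 \<longleftrightarrow> c > 0 \<and> \<rho>0 > 0 \<and>
     (\<forall>x\<in>K. \<forall>\<rho>. 0 < \<rho> \<longrightarrow> \<rho> \<le> \<rho>0 \<longrightarrow> c * \<rho> ^ DIM('a) \<le> measure lborel (Z \<inter> ball x \<rho>))"

text \<open>A point x within \<rho> of some e in \<open>K\<close> has the whole ball of radius
  \<rho> about e inside its own ball of radius 2\<rho>.\<close>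

lemma thick_nhd:
  fixes K :: "'a::euclidean_space set"
  assumes th: "thick Z K c \<rho>0" and Z: "open Z" and \<rho>: "0 < \<rho>" "\<rho> \<le> \<rho>0" and x: "x \<in> nhd K \<rho>"
  shows "ennreal (c * \<rho> ^ DIM('a)) \<le> (\<integral>\<^sup>+h. indicator (Z \<inter> nhd K \<rho>) (x + h) * indicator (ball 0 (2 * \<rho>)) h \<partial>lborel)"
proof -
  obtain e where e: "e \<in> K" "dist e x < \<rho>" using x by (auto simp: nhd_def)
  have "ennreal (c * \<rho> ^ DIM('a)) \<le> ennreal (measure lborel (Z \<inter> ball e \<rho>))"
    using th e(1) \<rho> by (intro ennreal_leI) (auto simp: thick_def)
  also have "\<dots> = emeasure lborel (Z \<inter> ball e \<rho>)" by (rule finite_measure_Int_ball[OF Z, symmetric])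
  also have "\<dots> = (\<integral>\<^sup>+y. indicator (Z \<inter> ball e \<rho>) y \<partial>lborel)" using Z by simp
  also have "\<dots> = (\<integral>\<^sup>+h. indicator (Z \<inter> ball e \<rho>) (h + x) \<partial>lborel)"
    by (rule nn_integral_lborel_shift[symmetric], rule borel_measurable_indicator) (use Z in auto)
  also have "\<dots> \<le> (\<integral>\<^sup>+h. indicator (Z \<inter> nhd K \<rho>) (x + h) * indicator (ball 0 (2 * \<rho>)) h \<partial>lborel)"
  proof (rule nn_integral_mono)
    fix h
    show "indicator (Z \<inter> ball e \<rho>) (h + x) \<le> (indicator (Z \<inter> nhd K \<rho>) (x + h) * indicator (ball 0 (2 * \<rho>)) h :: ennreal)"
    proof (cases "h + x \<in> Z \<inter> ball e \<rho>")
      case True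
      then have "h + x \<in> Z \<inter> nhd K \<rho>" using e(1) by (auto simp: nhd_def)
      moreover have "norm h < 2 * \<rho>"
        using True e(2) dist_triangle[of "h + x" x e] by (simp add: dist_commute dist_norm)
      moreover have "indicator (Z \<inter> ball e \<rho>) (h + x) \<le> (1::ennreal)" by (auto simp: indicator_def)
      ultimately show ?thesis by (simp add: add.commute)
    qed simp
  qed
  finally show ?thesis .
qed

text \<open>Integrating \<open>thick_nhd\<close> over the \<rho>-neighbourhood and using Fubini
  bounds its volume, hence that of \<open>K\<close>, by a constant times the volume of
  \<open>Z\<close> inside it. These sets decrease to the empty set because \<open>K\<close> is
  closed and misses \<open>Z\<close>.\<close>

lemma thick_negligible:
  fixes K :: "'a::euclidean_space set"
  assumes th: "thick Z K c \<rho>0" and Z: "open Z" and K: "compact K" "K \<inter> Z = {}"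
  shows "emeasure lborel K = 0"
proof -
  have c: "c > 0" "\<rho>0 > 0" using th by (auto simp: thick_def)
  have fin: "emeasure lborel (nhd K \<rho>) < \<infinity>" for \<rho>
  proof -
    obtain r where "K \<subseteq> ball 0 r" using compact_imp_bounded[OF K(1)] bounded_subset_ballD by blast
    then have "nhd K \<rho> \<subseteq> ball 0 (r + \<rho>)"
      by (auto simp: nhd_def) (smt (verit, best) dist_0_norm dist_triangle mem_ball subset_iff)
    then have "emeasure lborel (nhd K \<rho>) \<le> emeasure lborel (ball (0::'a) (r + \<rho>))" by (intro emeasure_mono) auto
    also have "\<dots> < \<infinity>" by (rule emeasure_lborel_ball_finite)
    finally show ?thesis .
  qed
  define \<omega> where "\<omega> = unit_ball_vol (real DIM('a)) * 2 ^ DIM('a)"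
  have \<omega>: "\<omega> \<ge> 0" by (simp add: \<omega>_def)
  have key: "ennreal c * emeasure lborel K \<le> ennreal \<omega> * emeasure lborel (Z \<inter> nhd K \<rho>)" if \<rho>: "0 < \<rho>" "\<rho> \<le> \<rho>0" for \<rho>
  proof -
    let ?U = "nhd K \<rho>" and ?Y = "Z \<inter> nhd K \<rho>"
    have Y [measurable]: "?Y \<in> sets borel" using Z by auto
    have "ennreal (c * \<rho> ^ DIM('a)) * emeasure lborel ?U = (\<integral>\<^sup>+x. ennreal (c * \<rho> ^ DIM('a)) * indicator ?U x \<partial>lborel)"
      by (simp add: nn_integral_cmult_indicator)
    also have "\<dots> \<le> (\<integral>\<^sup>+x. \<integral>\<^sup>+h. indicator ?Y (x + h) * indicator (ball 0 (2 * \<rho>)) h \<partial>lborel \<partial>lborel)"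
    proof (rule nn_integral_mono)
      fix x show "ennreal (c * \<rho> ^ DIM('a)) * indicator ?U x
         \<le> (\<integral>\<^sup>+h. indicator ?Y (x + h) * indicator (ball 0 (2 * \<rho>)) h \<partial>lborel)"
        using thick_nhd[OF th Z \<rho>, of x] by (cases "x \<in> ?U") auto
    qed
    also have "\<dots> = (\<integral>\<^sup>+h. \<integral>\<^sup>+x. indicator ?Y (x + h) * indicator (ball 0 (2 * \<rho>)) h \<partial>lborel \<partial>lborel)"
      by (rule lborel_pair.Fubini') measurable
    also have "\<dots> = (\<integral>\<^sup>+h. emeasure lborel ?Y * indicator (ball (0::'a) (2 * \<rho>)) h \<partial>lborel)"
    proof (rule nn_integral_cong)
      fix h :: 'a
      have "(\<integral>\<^sup>+x. indicator ?Y (x + h) * indicator (ball 0 (2 * \<rho>)) h \<partial>lborel)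
          = (\<integral>\<^sup>+x. indicator ?Y (x + h) \<partial>lborel) * indicator (ball 0 (2 * \<rho>)) h"
        by (rule nn_integral_multc) measurable
      also have "(\<integral>\<^sup>+x. indicator ?Y (x + h) \<partial>lborel) = (\<integral>\<^sup>+x. indicator ?Y x \<partial>lborel)"
        by (rule nn_integral_lborel_shift) measurable
      finally show "(\<integral>\<^sup>+x. indicator ?Y (x + h) * indicator (ball 0 (2 * \<rho>)) h \<partial>lborel)
          = emeasure lborel ?Y * indicator (ball 0 (2 * \<rho>)) h" using Y by simp
    qed
    also have "\<dots> = emeasure lborel ?Y * ennreal (\<omega> * \<rho> ^ DIM('a))"
      using \<rho> by (simp add: nn_integral_cmult_indicator emeasure_ball_vball vball_eq \<omega>_def power_mult_distrib mult_ac)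
    \<comment> \<open>The ball of radius 2\<rho> supplies the same power \<rho>^d as the density
      bound; it cancels, leaving constants free of \<rho>.\<close>
    finally have "ennreal (\<rho> ^ DIM('a)) * (ennreal c * emeasure lborel ?U) \<le> ennreal (\<rho> ^ DIM('a)) * (ennreal \<omega> * emeasure lborel ?Y)"
      using c \<omega> \<rho> by (simp add: ennreal_mult mult_ac)
    then have "ennreal c * emeasure lborel ?U \<le> ennreal \<omega> * emeasure lborel ?Y"
      using \<rho> by (subst (asm) ennreal_mult_le_mult_iff) auto
    moreover have "emeasure lborel K \<le> emeasure lborel ?U"
      using subset_nhd[OF \<rho>(1)] by (intro emeasure_mono) auto
    ultimately show ?thesis by (meson mult_left_mono order_trans zero_le)
  qed
  define \<rho> where "\<rho> i = \<rho>0 / real (Suc i)" for i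
  have \<rho>: "0 < \<rho> i" "\<rho> i \<le> \<rho>0" for i using c by (auto simp: \<rho>_def field_simps)
  have lim: "(\<lambda>i. emeasure lborel (Z \<inter> nhd K (\<rho> i))) \<longlonglongrightarrow> emeasure lborel (\<Inter>i. Z \<inter> nhd K (\<rho> i))"
  proof (rule Lim_emeasure_decseq)
    show "decseq (\<lambda>i. Z \<inter> nhd K (\<rho> i))"
    proof (rule decseq_SucI)
      fix i have "\<rho> (Suc i) \<le> \<rho> i" unfolding \<rho>_def using c by (intro divide_left_mono) auto
      then show "Z \<inter> nhd K (\<rho> (Suc i)) \<subseteq> Z \<inter> nhd K (\<rho> i)" using nhd_mono by blast
    qed
    show "emeasure lborel (Z \<inter> nhd K (\<rho> i)) \<noteq> \<infinity>" for i
    proof -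
      have "emeasure lborel (Z \<inter> nhd K (\<rho> i)) \<le> emeasure lborel (nhd K (\<rho> i))" by (intro emeasure_mono) auto
      also have "\<dots> < \<infinity>" by (rule fin)
      finally show ?thesis by simp
    qed
  qed (use Z in auto)
  have "(\<Inter>i. Z \<inter> nhd K (\<rho> i)) = {}"
  proof -
    have "x \<in> K" if x: "x \<in> Z" "\<And>i. x \<in> nhd K (\<rho> i)" for x
    proof -
      have "x \<in> closure K" unfolding closure_approachable
      proof (intro allI impI)
        fix e :: real assume e: "e > 0"
        obtain i where i: "\<rho>0 / e < real (Suc i)" using reals_Archimedean2[of "\<rho>0 / e"] less_Suc_eq
          by (metis less_trans of_nat_less_iff lessI)
        then have "\<rho> i < e" using e c by (simp add: \<rho>_def field_simps)
        moreover obtain s where "s \<in> K" "dist s x < \<rho> i" using x(2)[of i] by (auto simp: nhd_def)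
        ultimately show "\<exists>y\<in>K. dist y x < e" by force
      qed
      then show ?thesis using compact_imp_closed[OF K(1)] by simp
    qed
    then show ?thesis using K(2) by blast
  qed
  then have "(\<lambda>i. ennreal \<omega> * emeasure lborel (Z \<inter> nhd K (\<rho> i))) \<longlonglongrightarrow> ennreal \<omega> * 0"
    using lim by (intro ennreal_tendsto_cmult) auto
  then have "ennreal c * emeasure lborel K \<le> ennreal \<omega> * 0"
    by (rule tendsto_lowerbound) (use key \<rho> in auto)
  then show ?thesis using c by (simp add: ennreal_zero_less_mult_iff)
qed

text \<open>The constants of \<open>shift_energy_weak\<close> and
  \<open>shift_energy_smooth_local\<close> at range 2\<rho>, divided by the density c; the powers
  \<rho>^d have cancelled, and \<rho>^p is kept outside.\<close>

definition hardy_const :: "'a::euclidean_space itself \<Rightarrow> real \<Rightarrow> real \<Rightarrow> real" where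
  "hardy_const T p c = 2 powr p * (2 powr p * real DIM('a) powr p * (unit_ball_vol (real DIM('a)) * 2 ^ DIM('a))) / c"

text \<open>
  A point of the neighbourhood of \<open>K\<close> sees, within distance \<open>2 * \<rho>\<close>, a set of measure comparable to
  \<open>\<rho> ^ DIM('a)\<close> on which \<open>g\<close> vanishes; averaging \<open>g (x + h) - g x\<close> over this set replaces a covering by balls.
\<close>

lemma hardy_estimate:
  fixes g :: "'a::euclidean_space \<Rightarrow> 'b::euclidean_space"
  assumes p: "p \<ge> 1" and th: "thick Z K c \<rho>0" and Z: "open Z" and \<rho>: "0 < \<rho>" "\<rho> \<le> \<rho>0"
    and g: "g \<in> Lp_space p UNIV" "g \<in> borel_measurable borel"
    and D: "\<And>b. b \<in> Basis \<Longrightarrow> has_weak_deriv UNIV g [b] (D b)"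
      "\<And>b. b \<in> Basis \<Longrightarrow> D b \<in> Lp_space p UNIV" "\<And>b. b \<in> Basis \<Longrightarrow> D b \<in> borel_measurable borel"
    and z: "AE x in lborel. x \<in> Z \<inter> nhd K \<rho> \<longrightarrow> g x = 0"
  shows "enp p (nhd K \<rho>) g \<le> ennreal (hardy_const TYPE('a) p c * \<rho> powr p) * (\<Sum>b\<in>Basis. enp p (nhd K (4 * \<rho>)) (D b))"
proof -
  let ?U = "nhd K \<rho>" and ?Y = "Z \<inter> nhd K \<rho>"
  have Y [measurable]: "?Y \<in> sets borel" using Z by auto
  have c: "c > 0" using th by (simp add: thick_def)
  \<comment> \<open>Zero everywhere on \<open>?Y\<close>, so that the comparison of integrands below
    holds for every h.\<close>
  define g' where "g' x = indicator (- ?Y) x *\<^sub>R g x" for x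
  have g'm [measurable]: "g' \<in> borel_measurable borel" unfolding g'_def[abs_def] using g(2) by measurable
  have "AE x in lborel. g x = g' x" using z by eventually_elim (auto simp: g'_def indicator_def)
  then have ae: "AE x in lebesgue_on UNIV. g x = g' x" by (simp add: AE_completion)
  have g'L: "g' \<in> Lp_space p UNIV" by (rule Lp_cong_AE[OF g(1) ae borel_lebesgue_on[OF g'm]])
  have D': "has_weak_deriv UNIV g' [b] (D b)" if "b \<in> Basis" for b
    by (rule has_weak_deriv_cong_AE[OF D(1)[OF that] ae])
      (use that has_weak_derivD(2)[OF D(1)[OF that]] Lp_locally_integrable[OF g'L p open_UNIV] in auto)
  let ?S = "\<Sum>b\<in>Basis. enp p (nhd K (4 * \<rho>)) (D b)"
  let ?k = "(2 * \<rho>) powr p * real DIM('a) powr p * vball TYPE('a) (2 * \<rho>)"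
  have "ennreal (c * \<rho> ^ DIM('a)) * enp p ?U g' = (\<integral>\<^sup>+x. ennreal (c * \<rho> ^ DIM('a)) * (ennreal (norm (g' x) powr p) * indicator ?U x) \<partial>lborel)"
    by (subst enp_lborel) (auto simp: nn_integral_cmult)
  also have "\<dots> \<le> shift_energy p ?U (2 * \<rho>) g'"
    unfolding shift_energy_def
  proof (rule nn_integral_mono)
    fix x
    show "ennreal (c * \<rho> ^ DIM('a)) * (ennreal (norm (g' x) powr p) * indicator ?U x)
      \<le> (\<integral>\<^sup>+h. indicator ?U x * indicator (ball 0 (2 * \<rho>)) h * ennreal (norm (g' (x + h) - g' x) powr p) \<partial>lborel)"
    proof (cases "x \<in> ?U")
      case True
      have "ennreal (c * \<rho> ^ DIM('a)) * (ennreal (norm (g' x) powr p) * indicator ?U x)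
        \<le> (\<integral>\<^sup>+h. indicator ?Y (x + h) * indicator (ball 0 (2 * \<rho>)) h \<partial>lborel) * ennreal (norm (g' x) powr p)"
        using mult_right_mono[OF thick_nhd[OF th Z \<rho> True], of "ennreal (norm (g' x) powr p)"] True by simp
      also have "\<dots> = (\<integral>\<^sup>+h. indicator ?Y (x + h) * indicator (ball 0 (2 * \<rho>)) h * ennreal (norm (g' x) powr p) \<partial>lborel)"
        by (rule nn_integral_multc[symmetric]) measurable
      also have "\<dots> \<le> (\<integral>\<^sup>+h. indicator ?U x * indicator (ball 0 (2 * \<rho>)) h * ennreal (norm (g' (x + h) - g' x) powr p) \<partial>lborel)"
      proof (rule nn_integral_mono)
        fix h show "indicator ?Y (x + h) * indicator (ball 0 (2 * \<rho>)) h * ennreal (norm (g' x) powr p)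
          \<le> indicator ?U x * indicator (ball 0 (2 * \<rho>)) h * ennreal (norm (g' (x + h) - g' x) powr p)"
        proof (cases "x + h \<in> ?Y")
          case h: True
          then have "g' (x + h) = 0" by (simp add: g'_def)
          then show ?thesis using True h by simp
        next
          case False
          then have "indicator ?Y (x + h) = (0::ennreal)" by (rule indicator_simps(2))
          then show ?thesis by simp
        qed
      qed
      finally show ?thesis .
    qed simp
  qed
  \<comment> \<open>Shifts by less than 2\<rho> lead from the \<rho>-neighbourhood into the
    3\<rho>-neighbourhood, and mollification on to 4\<rho>: hence the factor 4 in all iterated
    radii.\<close>
  also have "\<dots> \<le> ennreal (2 powr p) * ennreal ?k * ?S"
  proof (rule shift_energy_weak[OF p g'L g'm D' D(2,3), where N="nhd K (3 * \<rho>)" and \<eta>=\<rho>])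
    show "y \<in> nhd K (4 * \<rho>)" if "x \<in> nhd K (3 * \<rho>)" "dist x y < \<rho>" for x y
      using mem_nhd_add[OF that] by simp
    fix h :: "'a \<Rightarrow> 'b" assume h: "C_infinity h"
    show "shift_energy p ?U (2 * \<rho>) h \<le> ennreal ?k * (\<Sum>b\<in>Basis. enp p (nhd K (3 * \<rho>)) (pderiv_dir b h))"
    proof (rule shift_energy_smooth_local[OF h p])
      show "y \<in> nhd K (3 * \<rho>)" if "x \<in> ?U" "dist x y < 2 * \<rho>" for x y
        using mem_nhd_add[OF that] by simp
    qed auto
  qed (use \<rho> in auto)
  finally have 1: "ennreal (c * \<rho> ^ DIM('a)) * enp p ?U g' \<le> ennreal (2 powr p) * ennreal ?k * ?S" .
  have eq: "2 powr p * ?k = c * \<rho> ^ DIM('a) * (hardy_const TYPE('a) p c * \<rho> powr p)"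
    using c \<rho> by (simp add: hardy_const_def vball_eq powr_mult power_mult_distrib)
  have hc: "hardy_const TYPE('a) p c \<ge> 0" using c by (simp add: hardy_const_def)
  have "ennreal (2 powr p) * ennreal ?k = ennreal (2 powr p * ?k)" by (rule ennreal_mult[symmetric]) auto
  also have "\<dots> = ennreal (c * \<rho> ^ DIM('a)) * ennreal (hardy_const TYPE('a) p c * \<rho> powr p)"
    unfolding eq by (rule ennreal_mult) (use c \<rho> hc in auto)
  finally have "ennreal (c * \<rho> ^ DIM('a)) * enp p ?U g'
     \<le> ennreal (c * \<rho> ^ DIM('a)) * (ennreal (hardy_const TYPE('a) p c * \<rho> powr p) * ?S)"
    using 1 by (simp add: mult.assoc)
  then have "enp p ?U g' \<le> ennreal (hardy_const TYPE('a) p c * \<rho> powr p) * ?S"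
    using c \<rho> by (subst (asm) ennreal_mult_le_mult_iff) auto
  moreover have "enp p ?U g = enp p ?U g'"
    by (rule enp_cong_AE, rule AE_lebesgue_on_subset[OF ae]) auto
  ultimately show ?thesis by simp
qed

text \<open>With \<open>f\<close>, its derivatives of order below k also vanish on the open set
  \<open>Z\<close> near \<open>K\<close>, so \<open>hardy_estimate\<close> applies to each in turn.
  Every application raises the order by one, gains \<rho>^p and enlarges the neighbourhood
  fourfold.\<close>

lemma hardy_iterated:
  fixes f :: "'a::euclidean_space \<Rightarrow> 'b::euclidean_space"
  assumes p: "p \<ge> 1" and th: "thick Z K c \<rho>0" and Z: "open Z"
    and f: "f \<in> sobolev k p UNIV" and z: "AE x in lebesgue. x \<in> Z \<inter> nhd K \<rho>0 \<longrightarrow> f x = 0"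
  shows "\<exists>C\<ge>0. \<forall>bs \<rho> G. set bs \<subseteq> Basis \<longrightarrow> length bs + l \<le> k \<longrightarrow> 0 < \<rho> \<longrightarrow> 4 ^ l * \<rho> \<le> \<rho>0 \<longrightarrow> has_weak_deriv UNIV f bs G \<longrightarrow>
     enp p (nhd K \<rho>) G \<le> ennreal (C * (\<rho> ^ l) powr p) * SE k p UNIV (nhd K (4 ^ l * \<rho>)) f"
proof (induction l)
  case 0
  show ?case
  proof (intro exI[of _ 1] conjI allI impI)
    fix bs \<rho> G
    assume a: "set bs \<subseteq> Basis" "length bs + 0 \<le> k" "has_weak_deriv UNIV f bs G"
    have "enp p (nhd K \<rho>) G \<le> SE k p UNIV (nhd K \<rho>) f"
      by (rule enp_deriv_le_SE[OF f p open_UNIV _ _ a(3)]) (use a in \<open>auto simp: multi_def\<close>)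
    then show "enp p (nhd K \<rho>) G \<le> ennreal (1 * (\<rho> ^ 0) powr p) * SE k p UNIV (nhd K (4 ^ 0 * \<rho>)) f" by simp
  qed simp
next
  case (Suc l)
  then obtain C where C: "C \<ge> 0" and IH: "\<And>bs \<rho> G. set bs \<subseteq> Basis \<Longrightarrow> length bs + l \<le> k \<Longrightarrow> 0 < \<rho> \<Longrightarrow> 4 ^ l * \<rho> \<le> \<rho>0 \<Longrightarrow>
     has_weak_deriv UNIV f bs G \<Longrightarrow>
     enp p (nhd K \<rho>) G \<le> ennreal (C * (\<rho> ^ l) powr p) * SE k p UNIV (nhd K (4 ^ l * \<rho>)) f" by blast
  define H where "H = hardy_const TYPE('a) p c"
  have c: "c > 0" using th by (simp add: thick_def)
  have H: "H \<ge> 0" using c by (simp add: H_def hardy_const_def)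
  \<comment> \<open>The Hardy constant, the number of directions, and the induction constant taken
    at radius 4\<rho>, which brings in 4^l.\<close>
  define C' where "C' = H * (real DIM('a) * (C * (4 ^ l) powr p))"
  have C': "C' \<ge> 0" using H C by (simp add: C'_def)
  show ?case
  proof (intro exI[of _ C'] conjI allI impI C')
    fix bs :: "'a list" and \<rho> G
    assume a: "set bs \<subseteq> Basis" "length bs + Suc l \<le> k" "0 < \<rho>" "4 ^ Suc l * \<rho> \<le> \<rho>0" "has_weak_deriv UNIV f bs G"
    obtain g D where g: "g \<in> borel_measurable borel" "g \<in> Lp_space p UNIV" "has_weak_deriv UNIV f bs g"
        "\<And>b. b \<in> Basis \<Longrightarrow> D b \<in> borel_measurable borel" "\<And>b. b \<in> Basis \<Longrightarrow> D b \<in> Lp_space p UNIV"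
        "\<And>b. b \<in> Basis \<Longrightarrow> has_weak_deriv UNIV g [b] (D b)"
        "\<And>b. b \<in> Basis \<Longrightarrow> has_weak_deriv UNIV f (bs @ [b]) (D b)"
      using sobolev_borel_deriv_at[OF p f a(1)] a(2) by (metis add_Suc_right less_add_Suc1 less_le_trans)
    have "1 * (4 * \<rho>) \<le> 4 ^ l * (4 * \<rho>)" using a(3) by (intro mult_right_mono) auto
    moreover have "4 ^ l * (4 * \<rho>) \<le> \<rho>0" using a(4) by (simp add: mult_ac)
    ultimately have \<rho>: "\<rho> \<le> \<rho>0" "4 ^ l * (4 * \<rho>) \<le> \<rho>0" using a(3) by linarith+
    let ?W = "Z \<inter> nhd K \<rho>"
    have W: "open ?W" using Z by auto
    have "AE x in lebesgue_on ?W. f x = 0"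
    proof -
      have "AE x in lebesgue. x \<in> ?W \<longrightarrow> f x = 0" using z
        by eventually_elim (use nhd_mono[OF \<rho>(1), of K] in auto)
      then show ?thesis using W by (subst AE_restrict_space_iff) auto
    qed
    from weak_deriv_local[OF W C_infinity_const[of 0] this g(3) a(1)]
    have z0: "AE x in lborel. x \<in> ?W \<longrightarrow> g x = 0" by (simp add: iter_pderiv_zero)
    have "enp p (nhd K \<rho>) G = enp p (nhd K \<rho>) g"
      by (rule enp_cong_AE, rule AE_lebesgue_on_subset[OF has_weak_deriv_unique[OF a(5) g(3) open_UNIV]]) auto
    also have "\<dots> \<le> ennreal (H * \<rho> powr p) * (\<Sum>b\<in>Basis. enp p (nhd K (4 * \<rho>)) (D b))"
      unfolding H_def by (rule hardy_estimate[OF p th Z a(3) \<rho>(1) g(2,1,6,5,4) z0])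
    also have "\<dots> \<le> ennreal (H * \<rho> powr p) * (\<Sum>b\<in>(Basis :: 'a set). ennreal (C * ((4 * \<rho>) ^ l) powr p) * SE k p UNIV (nhd K (4 ^ l * (4 * \<rho>))) f)"
    proof (intro mult_left_mono sum_mono)
      fix b :: 'a assume b: "b \<in> Basis"
      show "enp p (nhd K (4 * \<rho>)) (D b) \<le> ennreal (C * ((4 * \<rho>) ^ l) powr p) * SE k p UNIV (nhd K (4 ^ l * (4 * \<rho>))) f"
        by (rule IH[OF _ _ _ \<rho>(2) g(7)[OF b]]) (use a b in auto)
    qed simp
    also have "\<dots> = ennreal (H * \<rho> powr p * (real DIM('a) * (C * ((4 * \<rho>) ^ l) powr p))) * SE k p UNIV (nhd K (4 ^ Suc l * \<rho>)) f"
      using H C by (simp add: ennreal_of_nat_eq_real_of_nat ennreal_mult mult_ac)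
    also have "H * \<rho> powr p * (real DIM('a) * (C * ((4 * \<rho>) ^ l) powr p)) = C' * (\<rho> ^ Suc l) powr p"
      using a(3) by (simp add: C'_def power_mult_distrib powr_mult)
    finally show "enp p (nhd K \<rho>) G \<le> ennreal (C' * (\<rho> ^ Suc l) powr p) * SE k p UNIV (nhd K (4 ^ Suc l * \<rho>)) f" .
  qed
qed

text \<open>Dominated convergence: every point off the closed set \<open>K\<close> leaves the
  neighbourhoods eventually, and \<open>K\<close> itself is null.\<close>

lemma enp_nhd_tendsto_0:
  fixes G :: "'a::euclidean_space \<Rightarrow> 'b::euclidean_space"
  assumes G: "G \<in> Lp_space p UNIV" and K: "compact K" "emeasure lborel K = 0" and d: "d \<longlonglongrightarrow> 0"
  shows "(\<lambda>i. enp p (nhd K (d i)) G) \<longlonglongrightarrow> 0"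
proof -
  have Gm [measurable]: "G \<in> borel_measurable lebesgue" using G by (simp add: Lp_space_iff lebesgue_on_UNIV_eq)
  have m: "(\<lambda>x. ennreal (norm (G x) powr p)) \<in> borel_measurable lebesgue" by measurable
  have e: "enp p (nhd K s) G = (\<integral>\<^sup>+x. ennreal (norm (G x) powr p) * indicator (nhd K s) x \<partial>lebesgue)" for s
    by (subst enp_lborel) (auto simp: nn_integral_completion)
  have "(\<lambda>i. \<integral>\<^sup>+x. ennreal (norm (G x) powr p) * indicator (nhd K (d i)) x \<partial>lebesgue) \<longlonglongrightarrow> (\<integral>\<^sup>+x. 0 \<partial>(lebesgue :: 'a measure))"
  proof (rule nn_integral_dominated_convergence[where w="\<lambda>x. ennreal (norm (G x) powr p)"])
    show "(\<lambda>x. ennreal (norm (G x) powr p) * indicator (nhd K (d i)) x) \<in> borel_measurable lebesgue" for i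
      by (intro borel_measurable_times_ennreal m borel_measurable_indicator) auto
    show "AE x in lebesgue. ennreal (norm (G x) powr p) * indicator (nhd K (d i)) x \<le> ennreal (norm (G x) powr p)" for i
      by (rule AE_I2) (auto simp: indicator_def)
    show "(\<integral>\<^sup>+x. ennreal (norm (G x) powr p) \<partial>lebesgue) < \<infinity>"
      using G by (simp add: Lp_space_iff enp_UNIV nn_integral_completion)
    have "AE x in lborel. x \<notin> K" using K by (intro AE_not_in) (auto simp: null_sets_def borel_compact)
    then have "AE x in lebesgue. x \<notin> K" by (rule AE_completion)
    then show "AE x in lebesgue. (\<lambda>i. ennreal (norm (G x) powr p) * indicator (nhd K (d i)) x) \<longlonglongrightarrow> 0"
    proof eventually_elim
      case (elim x)
      then have "open (- K)" "x \<in> - K" using compact_imp_closed[OF K(1)] by auto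
      then obtain r where r: "r > 0" "ball x r \<subseteq> - K" using open_contains_ball by metis
      have "\<forall>\<^sub>F n in sequentially. d n < r" using d r by (intro order_tendstoD(2)) auto
      then have "\<forall>\<^sub>F n in sequentially. ennreal (norm (G x) powr p) * indicator (nhd K (d n)) x = 0"
      proof eventually_elim
        case (elim n)
        have "x \<notin> nhd K (d n)" using r(2) elim by (force simp: nhd_def dist_commute)
        then show ?case by simp
      qed
      then show ?case by (rule tendsto_eventually)
    qed
  qed (use m in auto)
  then show ?thesis by (simp add: e)
qed

text \<open>Subtract \<theta> f with a cutoff \<theta> around \<open>E \<inter> F\<close>; what
  remains has compact support off \<open>E\<close>. In the energy of \<theta> f, j derivatives on
  \<theta> cost \<epsilon>^(-j), while the others, of order at most k - j, gain \<epsilon>^j by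
  \<open>hardy_iterated\<close>. So only the energy of \<open>f\<close> near a null set is
  left.\<close>

lemma vanishing_of_thick:
  fixes f :: "'a::euclidean_space \<Rightarrow> 'b::euclidean_space"
  assumes p: "p \<ge> 1" and f: "f \<in> sobolev k p UNIV" and F: "compact F" and E: "closed E"
    and fz: "AE x in lebesgue. x \<notin> F \<longrightarrow> f x = 0"
    and th: "thick Z (E \<inter> F) c \<rho>0" and Z: "open Z" "Z \<inter> E = {}"
    and z: "AE x in lebesgue. x \<in> Z \<inter> nhd (E \<inter> F) \<rho>0 \<longrightarrow> f x = 0"
  shows "f \<in> sobolev_vanishing k p E UNIV"
proof (rule sobolev_vanishing_closed[OF p open_UNIV f])
  fix e :: real assume e: "e > 0"
  define K where "K = E \<inter> F"
  have K: "compact K" unfolding K_def using F E by (simp add: closed_Int_compact)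
  have \<rho>0: "\<rho>0 > 0" using th by (simp add: thick_def)
  have nullK: "emeasure lborel K = 0"
    unfolding K_def by (rule thick_negligible[OF th Z(1) K[unfolded K_def]]) (use Z in auto)
  obtain M where M: "M \<ge> 0" "\<And>(S :: 'a set) \<epsilon>. \<epsilon> > 0 \<Longrightarrow>
    \<exists>\<theta> :: 'a \<Rightarrow> real. C_infinity \<theta> \<and> (\<forall>x. 0 \<le> \<theta> x \<and> \<theta> x \<le> 1) \<and> (\<forall>x\<in>nhd S \<epsilon>. \<theta> x = 1) \<and>
      (\<forall>x. x \<notin> nhd S (3 * \<epsilon>) \<longrightarrow> \<theta> x = 0) \<and>
      (\<forall>bs x. set bs \<subseteq> Basis \<longrightarrow> length bs \<le> k \<longrightarrow> \<bar>iter_pderiv bs \<theta> x\<bar> \<le> M / \<epsilon> ^ length bs)"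
    using smooth_cutoff[of k] by blast
  obtain C1 where C1: "C1 \<ge> 0" and mult: "\<And>(\<Omega> :: 'a set) N (u :: 'a \<Rightarrow> 'b) (\<eta> :: 'a \<Rightarrow> real) M \<epsilon>.
     open \<Omega> \<Longrightarrow> N \<in> sets lebesgue \<Longrightarrow> u \<in> sobolev k p \<Omega> \<Longrightarrow> C_infinity \<eta> \<Longrightarrow> M \<ge> 0 \<Longrightarrow> \<epsilon> > 0 \<Longrightarrow>
     (\<forall>bs\<in>multi k. \<forall>x. \<bar>iter_pderiv bs \<eta> x\<bar> \<le> M / \<epsilon> ^ length bs * indicator N x) \<Longrightarrow>
     (\<lambda>x. \<eta> x *\<^sub>R u x) \<in> sobolev k p \<Omega> \<and>
     SE k p \<Omega> \<Omega> (\<lambda>x. \<eta> x *\<^sub>R u x) \<le> ennreal (C1 * M powr p) * scaled_SE \<epsilon> k p \<Omega> (\<Omega> \<inter> N) u"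
    using sobolev_mult[OF p, where k=k and ?'a='a and ?'b='b] by (elim exE conjE) (rule that, assumption, blast)
  have "\<exists>C\<ge>0. \<forall>bs \<rho> G. set bs \<subseteq> Basis \<longrightarrow> length bs + l \<le> k \<longrightarrow> 0 < \<rho> \<longrightarrow> 4 ^ l * \<rho> \<le> \<rho>0 \<longrightarrow> has_weak_deriv UNIV f bs G \<longrightarrow>
     enp p (nhd K \<rho>) G \<le> ennreal (C * (\<rho> ^ l) powr p) * SE k p UNIV (nhd K (4 ^ l * \<rho>)) f" for l
    unfolding K_def by (rule hardy_iterated[OF p th Z(1) f z])
  then obtain H where H: "\<And>l. H l \<ge> 0" "\<And>l bs \<rho> G. set bs \<subseteq> Basis \<Longrightarrow> length bs + l \<le> k \<Longrightarrow> 0 < \<rho> \<Longrightarrow> 4 ^ l * \<rho> \<le> \<rho>0 \<Longrightarrow>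
     has_weak_deriv UNIV f bs G \<Longrightarrow>
     enp p (nhd K \<rho>) G \<le> ennreal (H l * (\<rho> ^ l) powr p) * SE k p UNIV (nhd K (4 ^ l * \<rho>)) f" by metis
  define n where "n = real (card (multi k :: 'a list set))"
  \<comment> \<open>The constant of the multiplier estimate times, for each j, the number of
    derivatives and the Hardy constant at radius 4\<epsilon>, with the powers of \<epsilon>
    cancelled.\<close>
  define C2 where "C2 = C1 * M powr p * (\<Sum>j\<le>k. n * (H j * (4 ^ j) powr p))"
  have C2: "C2 \<ge> 0" unfolding C2_def n_def using C1 H by (intro mult_nonneg_nonneg sum_nonneg) auto
  have small: "\<exists>\<theta> :: 'a \<Rightarrow> real. C_infinity \<theta> \<and> (\<forall>x\<in>nhd K \<epsilon>. \<theta> x = 1) \<and>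
      (\<lambda>x. \<theta> x *\<^sub>R f x) \<in> sobolev k p UNIV \<and> SE k p UNIV UNIV (\<lambda>x. \<theta> x *\<^sub>R f x) \<le> ennreal C2 * SE k p UNIV (nhd K (4 ^ k * (4 * \<epsilon>))) f"
    if \<epsilon>: "\<epsilon> > 0" "4 ^ k * (4 * \<epsilon>) \<le> \<rho>0" for \<epsilon>
  proof -
    obtain \<theta> :: "'a \<Rightarrow> real" where \<theta>: "C_infinity \<theta>" "\<And>x. x\<in>nhd K \<epsilon> \<Longrightarrow> \<theta> x = 1" "\<And>x. x \<notin> nhd K (3 * \<epsilon>) \<Longrightarrow> \<theta> x = 0"
      "\<And>bs x. set bs \<subseteq> Basis \<Longrightarrow> length bs \<le> k \<Longrightarrow> \<bar>iter_pderiv bs \<theta> x\<bar> \<le> M / \<epsilon> ^ length bs"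
      using M(2)[OF \<epsilon>(1), of K] by blast
    \<comment> \<open>The cutoff vanishes off the 3\<epsilon>-neighbourhood. The extra room makes it
      vanish near every point outside \<open>?N\<close>, so that its derivatives vanish there
      too.\<close>
    let ?N = "nhd K (4 * \<epsilon>)"
    let ?S = "SE k p UNIV (nhd K (4 ^ k * (4 * \<epsilon>))) f"
    have b: "\<bar>iter_pderiv bs \<theta> x\<bar> \<le> M / \<epsilon> ^ length bs * indicator ?N x" if "bs \<in> multi k" for bs x
    proof (cases "x \<in> ?N")
      case True
      then show ?thesis using \<theta>(4)[of bs x] that by (simp add: multi_def)
    next
      case False
      have "\<theta> y = 0" if "y \<in> ball x \<epsilon>" for y
        using \<theta>(3)[of y] mem_nhd_add[of y K "3 * \<epsilon>" x \<epsilon>] False that by (auto simp: dist_commute)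
      then have "iter_pderiv bs \<theta> x = 0"
        using iter_pderiv_eq_0_open[of "ball x \<epsilon>" \<theta> x bs] \<epsilon>(1) by simp
      then show ?thesis using False by simp
    qed
    have m1: "(\<lambda>x. \<theta> x *\<^sub>R f x) \<in> sobolev k p UNIV \<and>
     SE k p UNIV UNIV (\<lambda>x. \<theta> x *\<^sub>R f x) \<le> ennreal (C1 * M powr p) * scaled_SE \<epsilon> k p UNIV (UNIV \<inter> ?N) f"
      by (rule mult[OF open_UNIV _ f \<theta>(1) M(1) \<epsilon>(1)]) (use b in auto)
    have m2: "scaled_SE \<epsilon> k p UNIV (UNIV \<inter> ?N) f \<le> ennreal (\<Sum>j\<le>k. n * (H j * (4 ^ j) powr p)) * ?S"
    proof -
      have "ennreal ((1 / \<epsilon> ^ j) powr p) * SE (k - j) p UNIV ?N f \<le> ennreal (n * (H j * (4 ^ j) powr p)) * ?S" if j: "j \<le> k" for j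
      proof -
        have le4: "(4::real) ^ j * (4 * \<epsilon>) \<le> 4 ^ k * (4 * \<epsilon>)"
          using \<epsilon>(1) j by (intro mult_right_mono power_increasing) auto
        have t: "enp p ?N (weak_deriv UNIV f bs) \<le> ennreal (H j * ((4 * \<epsilon>) ^ j) powr p) * ?S" if bs: "bs \<in> multi (k - j)" for bs
        proof -
          have bs': "set bs \<subseteq> Basis" "length bs + j \<le> k" "bs \<in> multi k" using bs j by (auto simp: multi_def)
          have "enp p ?N (weak_deriv UNIV f bs) \<le> ennreal (H j * ((4 * \<epsilon>) ^ j) powr p) * SE k p UNIV (nhd K (4 ^ j * (4 * \<epsilon>))) f"
            by (rule H(2)[OF bs'(1,2) _ order_trans[OF le4 \<epsilon>(2)] jetD(2)[OF jet_weak_deriv[OF p open_UNIV f] bs'(3)]])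
              (use \<epsilon>(1) in simp)
          also have "\<dots> \<le> ennreal (H j * ((4 * \<epsilon>) ^ j) powr p) * ?S"
            by (intro mult_left_mono SE_mono_set nhd_mono le4) auto
          finally show ?thesis .
        qed
        have "SE (k - j) p UNIV ?N f \<le> (\<Sum>bs\<in>(multi (k - j) :: 'a list set). ennreal (H j * ((4 * \<epsilon>) ^ j) powr p) * ?S)"
          unfolding SE_def[of "k - j"] by (intro sum_mono t)
        also have "\<dots> \<le> (\<Sum>bs\<in>(multi k :: 'a list set). ennreal (H j * ((4 * \<epsilon>) ^ j) powr p) * ?S)"
          by (rule sum_mono2[OF finite_multi]) (auto simp: multi_def)
        also have "\<dots> = ennreal (n * (H j * ((4 * \<epsilon>) ^ j) powr p)) * ?S"
          using H(1)[of j] by (simp add: n_def ennreal_of_nat_eq_real_of_nat ennreal_mult mult.assoc)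
        finally have "ennreal ((1 / \<epsilon> ^ j) powr p) * SE (k - j) p UNIV ?N f
          \<le> ennreal ((1 / \<epsilon> ^ j) powr p) * (ennreal (n * (H j * ((4 * \<epsilon>) ^ j) powr p)) * ?S)"
          by (rule mult_left_mono) simp
        also have "\<dots> = ennreal ((1 / \<epsilon> ^ j) powr p * (n * (H j * ((4 * \<epsilon>) ^ j) powr p))) * ?S"
        proof -
          have "0 \<le> n * (H j * ((4 * \<epsilon>) ^ j) powr p)" using H(1)[of j] by (simp add: n_def)
          then show ?thesis by (simp only: ennreal_mult powr_ge_zero mult.assoc)
        qed
        \<comment> \<open>Here the loss of the cutoff and the Hardy gain cancel.\<close>
        also have "(1 / \<epsilon> ^ j) powr p * (n * (H j * ((4 * \<epsilon>) ^ j) powr p)) = n * (H j * (4 ^ j) powr p)"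
          using \<epsilon>(1) by (simp add: power_mult_distrib powr_mult powr_divide)
        finally show ?thesis .
      qed
      then have "scaled_SE \<epsilon> k p UNIV (UNIV \<inter> ?N) f \<le> (\<Sum>j\<le>k. ennreal (n * (H j * (4 ^ j) powr p)) * ?S)"
        unfolding scaled_SE_def by (intro sum_mono) auto
      also have "\<dots> = ennreal (\<Sum>j\<le>k. n * (H j * (4 ^ j) powr p)) * ?S"
      proof -
        have "0 \<le> n * (H j * (4 ^ j) powr p)" for j using H(1)[of j] by (simp add: n_def)
        then show ?thesis by (subst sum_ennreal[symmetric]) (auto simp only: sum_distrib_right)
      qed
      finally show ?thesis .
    qed
    have "(\<lambda>x. \<theta> x *\<^sub>R f x) \<in> sobolev k p UNIV"
      "SE k p UNIV UNIV (\<lambda>x. \<theta> x *\<^sub>R f x) \<le> ennreal (C1 * M powr p) * (ennreal (\<Sum>j\<le>k. n * (H j * (4 ^ j) powr p)) * ?S)"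
      by (rule conjunct1[OF m1], rule order_trans[OF conjunct2[OF m1] mult_left_mono[OF m2]]) simp
    moreover have "ennreal (C1 * M powr p) * (ennreal (\<Sum>j\<le>k. n * (H j * (4 ^ j) powr p)) * ?S) = ennreal C2 * ?S"
    proof -
      have "0 \<le> C1 * M powr p" using C1 by simp
      moreover have "0 \<le> (\<Sum>j\<le>k. n * (H j * (4 ^ j) powr p))" unfolding n_def using H(1) by (intro sum_nonneg) auto
      ultimately show ?thesis unfolding C2_def ennreal_mult[OF \<open>0 \<le> C1 * M powr p\<close> \<open>0 \<le> (\<Sum>j\<le>k. n * (H j * (4 ^ j) powr p))\<close>] by (simp only: mult.assoc)
    qed
    ultimately show ?thesis using \<theta>(1,2) by auto
  qed
  define d where "d i = \<rho>0 / real (Suc i)" for i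
  have "(\<lambda>i. \<rho>0 * inverse (real (Suc i))) \<longlonglongrightarrow> \<rho>0 * 0"
    by (intro tendsto_mult tendsto_const LIMSEQ_inverse_real_of_nat)
  then have d0: "d \<longlonglongrightarrow> 0" by (simp add: d_def[abs_def] field_simps)
  have "(\<lambda>i. SE k p UNIV (nhd K (d i)) f) \<longlonglongrightarrow> (\<Sum>bs\<in>(multi k :: 'a list set). 0)"
    unfolding SE_def
    by (intro tendsto_sum enp_nhd_tendsto_0[OF _ K nullK d0] jetD(1)[OF jet_weak_deriv[OF p open_UNIV f]])
  then have "(\<lambda>i. ennreal C2 * SE k p UNIV (nhd K (d i)) f) \<longlonglongrightarrow> ennreal C2 * 0"
    by (intro ennreal_tendsto_cmult) auto
  then have "\<forall>\<^sub>F i in sequentially. ennreal C2 * SE k p UNIV (nhd K (d i)) f < ennreal e"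
    using e by (intro order_tendstoD(2)) auto
  then obtain i where i: "ennreal C2 * SE k p UNIV (nhd K (d i)) f < ennreal e"
    using eventually_happens'[OF sequentially_bot] by blast
  \<comment> \<open>Undoes the enlargement by 4 in \<open>?N\<close> and by 4^k in the iterated
    Hardy inequality.\<close>
  define \<epsilon> where "\<epsilon> = d i / (4 ^ k * 4)"
  have di: "d i > 0" "d i \<le> \<rho>0" using \<rho>0 by (auto simp: d_def divide_le_eq mult_le_cancel_left1)
  then have \<epsilon>: "\<epsilon> > 0" "4 ^ k * (4 * \<epsilon>) = d i" "d i \<le> \<rho>0" by (auto simp: \<epsilon>_def)
  obtain \<theta> :: "'a \<Rightarrow> real" where \<theta>: "C_infinity \<theta>" "\<And>x. x\<in>nhd K \<epsilon> \<Longrightarrow> \<theta> x = 1" "(\<lambda>x. \<theta> x *\<^sub>R f x) \<in> sobolev k p UNIV"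
      "SE k p UNIV UNIV (\<lambda>x. \<theta> x *\<^sub>R f x) \<le> ennreal C2 * SE k p UNIV (nhd K (4 ^ k * (4 * \<epsilon>))) f"
    using small[of \<epsilon>] \<epsilon> by auto
  define w where "w x = f x - \<theta> x *\<^sub>R f x" for x
  have w: "w \<in> sobolev k p UNIV" unfolding w_def[abs_def] by (rule sobolev_diff(1)[OF p open_UNIV f \<theta>(3)])
  have "w \<in> sobolev_vanishing k p E UNIV"
  proof (rule sobolev_vanishing_compact_support[OF p w _ _ E])
    show "compact (F - nhd K \<epsilon>)" by (intro compact_diff F) simp
    show "(F - nhd K \<epsilon>) \<inter> E = {}" using subset_nhd[OF \<epsilon>(1), of K] by (auto simp: K_def)
    show "AE x in lebesgue. x \<notin> F - nhd K \<epsilon> \<longrightarrow> w x = 0"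
      using fz by eventually_elim (auto simp: w_def \<theta>(2))
  qed
  moreover have "SE k p UNIV UNIV (\<lambda>x. f x - w x) < ennreal e"
    using le_less_trans[OF \<theta>(4)] i \<epsilon>(2) by (simp add: w_def)
  ultimately show "\<exists>w\<in>sobolev_vanishing k p E UNIV. SE k p UNIV UNIV (\<lambda>x. f x - w x) < ennreal e" by blast
qed

subsection \<open>Extension by zero\<close>

text \<open>\<open>nn_norm_le_enp\<close> is used with the same \<delta> whose p-th power bounds the
  energy, which makes both resulting terms linear in \<delta>.\<close>

lemma test_small:
  fixes h :: "'a::euclidean_space \<Rightarrow> 'b::euclidean_space" and a :: "'a \<Rightarrow> real"
  assumes p: "p \<ge> 1" and \<Lambda>: "open \<Lambda>" and h: "h \<in> borel_measurable (lebesgue_on \<Lambda>)" "enp p \<Lambda> h \<le> ennreal (\<delta> powr p)"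
    and a: "\<And>x. \<bar>a x\<bar> \<le> B" "\<And>x. x \<notin> K \<Longrightarrow> a x = 0" and K: "compact K" and \<delta>: "\<delta> > 0"
    and int: "integrable (lebesgue_on \<Lambda>) (\<lambda>x. a x *\<^sub>R h x)"
  shows "norm (\<integral>x. a x *\<^sub>R h x \<partial>lebesgue_on \<Lambda>) \<le> B * \<delta> * (measure lborel K + 1)"
proof -
  have B: "B \<ge> 0" using a(1)[of undefined] by linarith
  have Kl: "K \<in> sets lebesgue" "K \<in> sets borel" using compact_imp_closed[OF K] by auto
  have s: "\<Lambda> \<inter> K \<in> sets lebesgue" "\<Lambda> \<in> sets lebesgue" using \<Lambda> Kl by auto
  have hm: "h \<in> borel_measurable (lebesgue_on (\<Lambda> \<inter> K))" using lebesgue_on_mono[OF h(1)] by blast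
  have Kf: "emeasure lborel K < \<infinity>" using emeasure_compact_finite[OF K] .
  have "ennreal (norm (\<integral>x. a x *\<^sub>R h x \<partial>lebesgue_on \<Lambda>)) \<le> (\<integral>\<^sup>+x. ennreal (norm (a x *\<^sub>R h x)) \<partial>lebesgue_on \<Lambda>)"
    by (rule integral_norm_bound_ennreal[OF int])
  also have "\<dots> = (\<integral>\<^sup>+x. ennreal (norm (a x *\<^sub>R h x)) * indicator \<Lambda> x \<partial>lebesgue)"
    using s by (subst nn_integral_restrict_space) auto
  also have "\<dots> \<le> (\<integral>\<^sup>+x. ennreal (B * norm (h x)) * indicator (\<Lambda> \<inter> K) x \<partial>lebesgue)"
  proof (rule nn_integral_mono)
    fix x
    have "norm (a x *\<^sub>R h x) \<le> B * norm (h x)" using a(1) by (simp add: mult_right_mono)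
    then show "ennreal (norm (a x *\<^sub>R h x)) * indicator \<Lambda> x \<le> ennreal (B * norm (h x)) * indicator (\<Lambda> \<inter> K) x"
      using a(2)[of x] by (cases "x \<in> K"; cases "x \<in> \<Lambda>") (auto intro: ennreal_leI)
  qed
  also have "\<dots> = (\<integral>\<^sup>+x. ennreal B * ennreal (norm (h x)) \<partial>lebesgue_on (\<Lambda> \<inter> K))"
    using s B by (subst nn_integral_restrict_space) (auto simp: ennreal_mult)
  also have "\<dots> = ennreal B * (\<integral>\<^sup>+x. ennreal (norm (h x)) \<partial>lebesgue_on (\<Lambda> \<inter> K))"
    using hm by (subst nn_integral_cmult) auto
  also have "\<dots> \<le> ennreal B * (ennreal \<delta> * emeasure lebesgue (\<Lambda> \<inter> K) + ennreal (\<delta> powr (1 - p)) * enp p (\<Lambda> \<inter> K) h)"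
    by (intro mult_left_mono nn_norm_le_enp[OF hm p \<delta> s(1)]) simp
  also have "\<dots> \<le> ennreal B * (ennreal \<delta> * ennreal (measure lborel K) + ennreal (\<delta> powr (1 - p)) * ennreal (\<delta> powr p))"
  proof (intro mult_left_mono add_mono)
    have "emeasure lebesgue (\<Lambda> \<inter> K) \<le> emeasure lebesgue K" by (rule emeasure_mono) (use Kl in auto)
    also have "\<dots> = ennreal (measure lborel K)" using Kf Kl by (simp add: emeasure_eq_ennreal_measure)
    finally show "emeasure lebesgue (\<Lambda> \<inter> K) \<le> ennreal (measure lborel K)" .
    show "enp p (\<Lambda> \<inter> K) h \<le> ennreal (\<delta> powr p)"
      by (rule order_trans[OF enp_mono_set h(2)]) (use s in auto)
  qed auto
  also have "\<dots> = ennreal (B * (\<delta> * measure lborel K + \<delta> powr (1 - p) * \<delta> powr p))"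
    using B \<delta> by (simp add: ennreal_mult ennreal_plus)
  also have "\<delta> powr (1 - p) * \<delta> powr p = \<delta>" using \<delta> by (simp add: powr_add[symmetric])
  finally have "norm (\<integral>x. a x *\<^sub>R h x \<partial>lebesgue_on \<Lambda>) \<le> B * (\<delta> * measure lborel K + \<delta>)"
    using B \<delta> by (subst (asm) ennreal_le_iff) auto
  then show ?thesis by (simp add: algebra_simps)
qed

text \<open>Test functions on the whole space need not vanish near the boundary of \<Lambda>, so the
  weak derivative of the extension is not automatic. Approximants supported in \<Lambda> satisfy the
  integration by parts exactly, and the identity passes to the limit.\<close>

lemma zero_extension:
  fixes u :: "'a::euclidean_space \<Rightarrow> 'b::euclidean_space"
  assumes p: "p \<ge> 1" and \<Lambda>: "open \<Lambda>" and u: "u \<in> sobolev k p \<Lambda>" and z: "\<And>x. x \<notin> \<Lambda> \<Longrightarrow> u x = 0"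
    and ap: "\<And>e. e > 0 \<Longrightarrow> \<exists>w\<in>C0_infinity \<Lambda>. SE k p \<Lambda> \<Lambda> (\<lambda>x. u x - w x) < ennreal e"
  shows "u \<in> sobolev k p UNIV" "SE k p UNIV UNIV u \<le> SE k p \<Lambda> \<Lambda> u"
proof -
  define G where "G bs x = (if x \<in> \<Lambda> then weak_deriv \<Lambda> u bs x else 0)" for bs x
  note j = jetD[OF jet_weak_deriv[OF p \<Lambda> u]]
  have \<Lambda>l: "\<Lambda> \<in> sets lebesgue" using \<Lambda> by auto
  have ext: "(\<lambda>x. if x \<in> \<Lambda> then f x else 0) \<in> Lp_space p UNIV"
    "enp p UNIV (\<lambda>x. if x \<in> \<Lambda> then f x else 0) = enp p \<Lambda> f" if f: "f \<in> Lp_space p \<Lambda>" for f :: "'a \<Rightarrow> 'b"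
  proof -
    show e: "enp p UNIV (\<lambda>x. if x \<in> \<Lambda> then f x else 0) = enp p \<Lambda> f"
      using \<Lambda>l by (auto simp: enp_lborel indicator_def intro!: nn_integral_cong)
    have "(\<lambda>x. if x \<in> \<Lambda> then f x else 0) \<in> borel_measurable lebesgue"
      using f \<Lambda>l by (simp add: Lp_space_iff borel_measurable_if)
    then show "(\<lambda>x. if x \<in> \<Lambda> then f x else 0) \<in> Lp_space p UNIV"
      using f e by (simp add: Lp_space_iff lebesgue_on_UNIV_eq)
  qed
  have uL: "u \<in> Lp_space p UNIV"
  proof -
    have "(\<lambda>x. if x \<in> \<Lambda> then u x else 0) = u" using z by auto
    then show ?thesis using ext(1)[OF sobolev_Lp[OF u]] by simp
  qed
  have GL: "G bs \<in> Lp_space p UNIV" "enp p UNIV (G bs) = enp p \<Lambda> (weak_deriv \<Lambda> u bs)" if "bs \<in> multi k" for bs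
    unfolding G_def[abs_def] using ext[OF j(1)[OF that]] by auto
  have w: "has_weak_deriv UNIV u bs (G bs)" if bs: "bs \<in> multi k" for bs
    unfolding has_weak_deriv_def
  proof (intro conjI allI impI)
    show "locally_integrable UNIV u" "locally_integrable UNIV (G bs)"
      using Lp_locally_integrable[OF uL p open_UNIV] Lp_locally_integrable[OF GL(1)[OF bs] p open_UNIV] by auto
    fix \<phi> :: "'a \<Rightarrow> real" assume \<phi>: "\<phi> \<in> C0_infinity UNIV"
    let ?\<psi> = "iter_pderiv bs \<phi>"
    have \<psi>: "?\<psi> \<in> C0_infinity UNIV" by (rule C0_infinity_iter_pderiv[OF \<phi> multi_D[OF bs]])
    obtain B0 B1 where "\<And>x. norm (\<phi> x) \<le> B0" "\<And>x. norm (?\<psi> x) \<le> B1"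
      using C0_infinity_bounded[OF \<phi>] C0_infinity_bounded[OF \<psi>] by metis
    then have B: "\<bar>\<phi> x\<bar> \<le> max B0 B1" "\<bar>?\<psi> x\<bar> \<le> max B0 B1" for x
      by (auto intro: order_trans[OF _ max.cobounded1] order_trans[OF _ max.cobounded2])
    define B where "B = max B0 B1"
    define K where "K = supp \<phi>"
    have K: "compact K" unfolding K_def by (rule C0_infinity_D(2)[OF \<phi>])
    define s where "s = (-1 :: real) ^ length bs"
    have s: "\<bar>s\<bar> = 1" by (simp add: s_def power_abs)
    have I\<Lambda>: "(\<integral>x. a x *\<^sub>R f x \<partial>lebesgue_on UNIV) = (\<integral>x. a x *\<^sub>R f x \<partial>lebesgue_on \<Lambda>)"
      "integrable (lebesgue_on UNIV) (\<lambda>x. a x *\<^sub>R f x) = integrable (lebesgue_on \<Lambda>) (\<lambda>x. a x *\<^sub>R f x)"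
      if "\<And>x. x \<notin> \<Lambda> \<Longrightarrow> f x = 0" for a :: "'a \<Rightarrow> real" and f :: "'a \<Rightarrow> 'b"
      using integral_lebesgue_on_supported[of UNIV \<Lambda> "\<lambda>x. a x *\<^sub>R f x"] that \<Lambda>l by simp_all
    let ?L = "\<integral>x. ?\<psi> x *\<^sub>R u x \<partial>lebesgue_on UNIV" and ?R = "\<integral>x. \<phi> x *\<^sub>R G bs x \<partial>lebesgue_on UNIV"
    \<comment> \<open>Subtracting the exact identity for an approximant leaves two pairings with
      differences of small energy, one from each side.\<close>
    have key: "norm (?L - s *\<^sub>R ?R) \<le> 2 * (B * \<delta> * (measure lborel K + 1))" if \<delta>: "\<delta> > 0" for \<delta>
    proof -
      obtain w where w: "w \<in> C0_infinity \<Lambda>" "SE k p \<Lambda> \<Lambda> (\<lambda>x. u x - w x) < ennreal (\<delta> powr p)"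
        using ap[of "\<delta> powr p"] \<delta> by auto
      have wU: "w \<in> C0_infinity UNIV" by (rule C0_infinity_mono[OF w(1)]) simp
      let ?w' = "iter_pderiv (rev bs) w"
      have w'\<Lambda>: "?w' \<in> C0_infinity \<Lambda>" by (rule C0_infinity_iter_pderiv[OF w(1)]) (use multi_D[OF bs] in simp)
      have wz: "w x = 0" "?w' x = 0" if "x \<notin> \<Lambda>" for x
        using that C0_infinity_D(3)[OF w(1)] C0_infinity_D(3)[OF w'\<Lambda>] supp_notin by blast+
      have ws: "w \<in> sobolev k p \<Lambda>" by (rule sobolev_C0_infinity(1)[OF wU p \<Lambda>])
      have d: "(\<lambda>x. u x - w x) \<in> sobolev k p \<Lambda>" by (rule sobolev_diff(1)[OF p \<Lambda> u ws])
      have wU': "has_weak_deriv UNIV w bs ?w'" "has_weak_deriv \<Lambda> w bs ?w'"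
        using has_weak_deriv_classical[OF C0_infinity_D(1)[OF w(1)] multi_D[OF bs]] \<Lambda> by auto
      have lu: "locally_integrable UNIV u" "locally_integrable UNIV (G bs)" "locally_integrable UNIV w" "locally_integrable UNIV ?w'"
        using Lp_locally_integrable[OF uL p open_UNIV] Lp_locally_integrable[OF GL(1)[OF bs] p open_UNIV] has_weak_derivD(1,2)[OF wU'(1)] by auto
      note ti = test_integrable[OF lu(1) \<psi> open_UNIV] test_integrable[OF lu(3) \<psi> open_UNIV]
        test_integrable[OF lu(2) \<phi> open_UNIV] test_integrable[OF lu(4) \<phi> open_UNIV]
      have Gz: "G bs x = 0" if "x \<notin> \<Lambda>" for x using that by (simp add: G_def)
      have dz: "u x - w x = 0" "G bs x - ?w' x = 0" if "x \<notin> \<Lambda>" for x using that z wz Gz by auto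
      have 1: "norm (\<integral>x. ?\<psi> x *\<^sub>R (u x - w x) \<partial>lebesgue_on \<Lambda>) \<le> B * \<delta> * (measure lborel K + 1)"
      proof (rule test_small[OF p \<Lambda> sobolev_measurable[OF d] _ _ _ K \<delta>])
        show "enp p \<Lambda> (\<lambda>x. u x - w x) \<le> ennreal (\<delta> powr p)"
          using enp_le_SE[OF d p \<Lambda> order_refl \<Lambda>l] w(2) by simp
        show "integrable (lebesgue_on \<Lambda>) (\<lambda>x. ?\<psi> x *\<^sub>R (u x - w x))"
          using ti(1,2) I\<Lambda>(2)[where f="\<lambda>x. u x - w x" and a="?\<psi>", OF dz(1)] by (simp add: scaleR_diff_right)
      qed (use B in \<open>auto simp: B_def K_def iter_pderiv_notin_supp\<close>)
      have dd: "has_weak_deriv \<Lambda> (\<lambda>x. u x - w x) bs (\<lambda>x. weak_deriv \<Lambda> u bs x - ?w' x)"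
        using has_weak_deriv_add[OF j(2)[OF bs] has_weak_deriv_bounded_linear[OF bounded_linear_minus[OF bounded_linear_ident] wU'(2) \<Lambda> multi_D[OF bs]] \<Lambda> multi_D[OF bs]]
        by simp
      have e2: "enp p \<Lambda> (\<lambda>x. G bs x - ?w' x) = enp p \<Lambda> (\<lambda>x. weak_deriv \<Lambda> u bs x - ?w' x)"
        by (rule enp_cong_AE, rule AE_I2) (simp add: G_def space_restrict_space)
      have 2: "norm (\<integral>x. \<phi> x *\<^sub>R (G bs x - ?w' x) \<partial>lebesgue_on \<Lambda>) \<le> B * \<delta> * (measure lborel K + 1)"
      proof (rule test_small[OF p \<Lambda> _ _ _ _ K \<delta>])
        show "(\<lambda>x. G bs x - ?w' x) \<in> borel_measurable (lebesgue_on \<Lambda>)"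
          using locally_integrableD(1)[OF lu(2)] locally_integrableD(1)[OF lu(4)]
          by (intro borel_measurable_diff lebesgue_on_mono[of _ UNIV \<Lambda>]) auto
        show "enp p \<Lambda> (\<lambda>x. G bs x - ?w' x) \<le> ennreal (\<delta> powr p)"
          unfolding e2 using enp_deriv_le_SE[OF d p \<Lambda> order_refl \<Lambda>l dd bs] w(2) by simp
        show "integrable (lebesgue_on \<Lambda>) (\<lambda>x. \<phi> x *\<^sub>R (G bs x - ?w' x))"
          using ti(3,4) I\<Lambda>(2)[where f="\<lambda>x. G bs x - ?w' x" and a="\<phi>", OF dz(2)] by (simp add: scaleR_diff_right)
      qed (use B in \<open>auto simp: B_def K_def supp_notin\<close>)
      have "(\<integral>x. ?\<psi> x *\<^sub>R (u x - w x) \<partial>lebesgue_on \<Lambda>) = ?L - (\<integral>x. ?\<psi> x *\<^sub>R w x \<partial>lebesgue_on UNIV)"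
        using ti(1,2) I\<Lambda>(1)[where f="\<lambda>x. u x - w x" and a="?\<psi>", OF dz(1), symmetric] by (simp add: scaleR_diff_right)
      moreover have "(\<integral>x. \<phi> x *\<^sub>R (G bs x - ?w' x) \<partial>lebesgue_on \<Lambda>) = ?R - (\<integral>x. \<phi> x *\<^sub>R ?w' x \<partial>lebesgue_on UNIV)"
        using ti(3,4) I\<Lambda>(1)[where f="\<lambda>x. G bs x - ?w' x" and a="\<phi>", OF dz(2), symmetric] by (simp add: scaleR_diff_right)
      moreover have "(\<integral>x. ?\<psi> x *\<^sub>R w x \<partial>lebesgue_on UNIV) = s *\<^sub>R (\<integral>x. \<phi> x *\<^sub>R ?w' x \<partial>lebesgue_on UNIV)"
        unfolding s_def by (rule has_weak_derivD(3)[OF wU'(1) \<phi>])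
      ultimately have "?L - s *\<^sub>R ?R = (\<integral>x. ?\<psi> x *\<^sub>R (u x - w x) \<partial>lebesgue_on \<Lambda>) - s *\<^sub>R (\<integral>x. \<phi> x *\<^sub>R (G bs x - ?w' x) \<partial>lebesgue_on \<Lambda>)"
        by (simp add: scaleR_diff_right)
      then show ?thesis
        using norm_triangle_ineq4[of "\<integral>x. ?\<psi> x *\<^sub>R (u x - w x) \<partial>lebesgue_on \<Lambda>" "s *\<^sub>R (\<integral>x. \<phi> x *\<^sub>R (G bs x - ?w' x) \<partial>lebesgue_on \<Lambda>)"] 1 2 s
        by simp
    qed
    define V where "V = 2 * (B * (measure lborel K + 1))"
    have V: "V \<ge> 0" using B(1)[of undefined] by (auto simp: V_def B_def intro!: mult_nonneg_nonneg)
    have "norm (?L - s *\<^sub>R ?R) \<le> 0"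
    proof (rule field_le_epsilon)
      fix e :: real assume e: "e > 0"
      have "V * (e / (V + 1)) \<le> (V + 1) * (e / (V + 1))" using V e by (intro mult_right_mono) auto
      also have "\<dots> = e" using V by simp
      finally have "V * (e / (V + 1)) \<le> e" .
      moreover have "norm (?L - s *\<^sub>R ?R) \<le> V * (e / (V + 1))"
        using key[of "e / (V + 1)"] V e unfolding V_def by (simp add: mult_ac)
      ultimately show "norm (?L - s *\<^sub>R ?R) \<le> 0 + e" by linarith
    qed
    then show "?L = (-1) ^ length bs *\<^sub>R ?R" by (simp add: s_def)
  qed
  have jet: "jet k p UNIV u G" unfolding jet_def using w GL(1) by blast
  then show "u \<in> sobolev k p UNIV" using sobolev_iff_jet[OF p open_UNIV] by blast
  show "SE k p UNIV UNIV u \<le> SE k p \<Lambda> \<Lambda> u"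
    using SE_jet[OF jet p open_UNIV, of UNIV] GL(2) by (simp add: SE_def)
qed

subsection \<open>Bounded multipliers\<close>

text \<open>Weaker than being a test function, because the multiplier 1 - \<zeta> has bounded
  derivatives but no compact support.\<close>

definition bounded_derivs :: "nat \<Rightarrow> ('a::euclidean_space \<Rightarrow> real) \<Rightarrow> bool" where
  "bounded_derivs k \<eta> \<longleftrightarrow> C_infinity \<eta> \<and> (\<exists>M. \<forall>bs\<in>multi k. \<forall>x. \<bar>iter_pderiv bs \<eta> x\<bar> \<le> M)"

lemma bounded_derivs_C0_infinity:
  assumes "\<eta> \<in> C0_infinity UNIV"
  shows "bounded_derivs k \<eta>"
proof -
  have "\<exists>B. \<forall>x. \<bar>iter_pderiv bs \<eta> x\<bar> \<le> B" if "bs \<in> multi k" for bs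
    using C0_infinity_bounded[OF C0_infinity_iter_pderiv[OF assms multi_D[OF that]]] by (metis real_norm_def)
  then obtain B where B: "\<And>bs x. bs \<in> multi k \<Longrightarrow> \<bar>iter_pderiv bs \<eta> x\<bar> \<le> B bs" by metis
  have "\<bar>iter_pderiv bs \<eta> x\<bar> \<le> (\<Sum>bs\<in>multi k. B bs)" if "bs \<in> multi k" for bs x
  proof -
    have "B bs \<le> (\<Sum>bs\<in>multi k. B bs)"
      by (rule member_le_sum) (use that B order_trans[OF abs_ge_zero] in auto)
    then show ?thesis using B[OF that, of x] by linarith
  qed
  then show ?thesis unfolding bounded_derivs_def using C0_infinity_D(1)[OF assms] by blast
qed

lemma iter_pderiv_const: "iter_pderiv bs (\<lambda>_. c) = (if bs = [] then (\<lambda>_. c) else (\<lambda>_. 0))"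
  by (induction bs) (auto simp: pderiv_dir_const)

lemma bounded_derivs_one_minus:
  assumes "\<eta> \<in> C0_infinity UNIV"
  shows "bounded_derivs k (\<lambda>x. 1 - \<eta> x)"
proof -
  have C0: "(\<lambda>x. (-1) * \<eta> x) \<in> C0_infinity UNIV" by (rule C0_infinity_mult[OF C_infinity_const assms])
  obtain M where M: "\<And>bs x. bs \<in> multi k \<Longrightarrow> \<bar>iter_pderiv bs (\<lambda>x. (-1) * \<eta> x) x\<bar> \<le> M"
    using bounded_derivs_C0_infinity[OF C0, of k] unfolding bounded_derivs_def by blast
  have "\<bar>iter_pderiv bs (\<lambda>x. 1 - \<eta> x) x\<bar> \<le> 1 + M" if bs: "bs \<in> multi k" for bs x
  proof -
    have "iter_pderiv bs (\<lambda>x. 1 + (-1) * \<eta> x) x = iter_pderiv bs (\<lambda>x. 1) x + iter_pderiv bs (\<lambda>x. (-1) * \<eta> x) x"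
      by (simp only: iter_pderiv_add[OF C_infinity_const C0_infinity_D(1)[OF C0] multi_D[OF bs]])
    moreover have "\<bar>iter_pderiv bs (\<lambda>x. 1 :: real) x\<bar> \<le> 1" by (simp add: iter_pderiv_const)
    ultimately have "\<bar>iter_pderiv bs (\<lambda>x. 1 + (-1) * \<eta> x) x\<bar> \<le> 1 + M" using M[OF bs, of x] by linarith
    then show ?thesis by simp
  qed
  moreover have "C_infinity (\<lambda>x. 1 - \<eta> x)" by (rule C_infinity_diff[OF C_infinity_const C0_infinity_D(1)[OF assms]])
  ultimately show ?thesis unfolding bounded_derivs_def by blast
qed

text \<open>The case \<epsilon> = 1, \<open>N = UNIV\<close> of \<open>sobolev_mult\<close>, where
  all weights are 1.\<close>

lemma multiplier_bounded:
  assumes p: "p \<ge> 1" and \<eta>: "bounded_derivs k (\<eta> :: 'a::euclidean_space \<Rightarrow> real)"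
  obtains C where "C \<ge> 0" "\<And>(\<Omega> :: 'a set) (u :: 'a \<Rightarrow> 'b::euclidean_space). open \<Omega> \<Longrightarrow> u \<in> sobolev k p \<Omega> \<Longrightarrow>
    (\<lambda>x. \<eta> x *\<^sub>R u x) \<in> sobolev k p \<Omega> \<and> SE k p \<Omega> \<Omega> (\<lambda>x. \<eta> x *\<^sub>R u x) \<le> ennreal C * SE k p \<Omega> \<Omega> u"
proof -
  obtain M where M: "\<And>bs x. bs \<in> multi k \<Longrightarrow> \<bar>iter_pderiv bs \<eta> x\<bar> \<le> M" and smooth: "C_infinity \<eta>"
    using \<eta> unfolding bounded_derivs_def by blast
  have M0: "M \<ge> 0" using M[OF Nil_multi, of undefined] by linarith
  obtain C1 where C1: "C1 \<ge> 0" and mult: "\<And>(\<Omega> :: 'a set) N (u :: 'a \<Rightarrow> 'b) (\<eta> :: 'a \<Rightarrow> real) M \<epsilon>.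
     open \<Omega> \<Longrightarrow> N \<in> sets lebesgue \<Longrightarrow> u \<in> sobolev k p \<Omega> \<Longrightarrow> C_infinity \<eta> \<Longrightarrow> M \<ge> 0 \<Longrightarrow> \<epsilon> > 0 \<Longrightarrow>
     (\<forall>bs\<in>multi k. \<forall>x. \<bar>iter_pderiv bs \<eta> x\<bar> \<le> M / \<epsilon> ^ length bs * indicator N x) \<Longrightarrow>
     (\<lambda>x. \<eta> x *\<^sub>R u x) \<in> sobolev k p \<Omega> \<and>
     SE k p \<Omega> \<Omega> (\<lambda>x. \<eta> x *\<^sub>R u x) \<le> ennreal (C1 * M powr p) * scaled_SE \<epsilon> k p \<Omega> (\<Omega> \<inter> N) u"
    using sobolev_mult[OF p, where k=k and ?'a='a and ?'b='b] by (elim exE conjE) (rule that, assumption, blast)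
  have "(\<lambda>x. \<eta> x *\<^sub>R u x) \<in> sobolev k p \<Omega> \<and> SE k p \<Omega> \<Omega> (\<lambda>x. \<eta> x *\<^sub>R u x) \<le> ennreal (C1 * M powr p * real (Suc k)) * SE k p \<Omega> \<Omega> u"
    if a: "open \<Omega>" "u \<in> sobolev k p \<Omega>" for \<Omega> and u :: "'a \<Rightarrow> 'b"
  proof -
    have m: "(\<lambda>x. \<eta> x *\<^sub>R u x) \<in> sobolev k p \<Omega> \<and>
      SE k p \<Omega> \<Omega> (\<lambda>x. \<eta> x *\<^sub>R u x) \<le> ennreal (C1 * M powr p) * scaled_SE 1 k p \<Omega> (\<Omega> \<inter> UNIV) u"
      by (rule mult[OF a(1) _ a(2) smooth M0]) (use M in auto)
    have "scaled_SE 1 k p \<Omega> (\<Omega> \<inter> UNIV) u \<le> (\<Sum>j\<le>k. SE k p \<Omega> \<Omega> u)"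
      unfolding scaled_SE_def by (intro sum_mono) (auto intro: SE_mono)
    also have "\<dots> = ennreal (real (Suc k)) * SE k p \<Omega> \<Omega> u"
      by (simp add: ennreal_of_nat_eq_real_of_nat del: of_nat_Suc)
    finally have "ennreal (C1 * M powr p) * scaled_SE 1 k p \<Omega> (\<Omega> \<inter> UNIV) u
       \<le> ennreal (C1 * M powr p) * (ennreal (real (Suc k)) * SE k p \<Omega> \<Omega> u)" by (rule mult_left_mono) simp
    also have "\<dots> = ennreal (C1 * M powr p * real (Suc k)) * SE k p \<Omega> \<Omega> u"
      using C1 by (simp add: ennreal_mult mult.assoc del: of_nat_Suc)
    finally show ?thesis using m order_trans by blast
  qed
  moreover have "C1 * M powr p * real (Suc k) \<ge> 0" using C1 by simp
  ultimately show ?thesis using that by blast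
qed

section \<open>Linear combinations over the scalar field\<close>

lemma sobolev_vanishing_sobolev: "u \<in> sobolev_vanishing k p E \<Lambda> \<Longrightarrow> u \<in> sobolev k p \<Lambda>"
  by (simp add: sobolev_vanishing_def)

lemma sobolev_cmult:
  fixes u :: "'a::euclidean_space \<Rightarrow> 'b::{real_normed_field,euclidean_space}"
  assumes "p \<ge> 1" "open \<Omega>" "u \<in> sobolev k p \<Omega>"
  shows "(\<lambda>x. a * u x) \<in> sobolev k p \<Omega>"
    "SE k p \<Omega> \<Omega> (\<lambda>x. a * u x) \<le> ennreal (norm a powr p) * SE k p \<Omega> \<Omega> u"
  using sobolev_linear[OF assms bounded_linear_mult_right[of a], of "norm a"] assms(2) by (auto simp: norm_mult)

lemma sobolev_lincomb:
  fixes u v :: "'a::euclidean_space \<Rightarrow> 'b::{real_normed_field,euclidean_space}"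
  assumes "p \<ge> 1" "open \<Omega>" "u \<in> sobolev k p \<Omega>" "v \<in> sobolev k p \<Omega>"
  shows "(\<lambda>x. a * u x + b * v x) \<in> sobolev k p \<Omega>"
    "SE k p \<Omega> \<Omega> (\<lambda>x. a * u x + b * v x) \<le> ennreal (2 powr p) * (ennreal (norm a powr p) * SE k p \<Omega> \<Omega> u + ennreal (norm b powr p) * SE k p \<Omega> \<Omega> v)"
proof -
  note c = sobolev_cmult[OF assms(1-3), of a] sobolev_cmult[OF assms(1,2,4), of b]
  show "(\<lambda>x. a * u x + b * v x) \<in> sobolev k p \<Omega>" by (rule sobolev_add(1)[OF assms(1,2) c(1,3)])
  have "SE k p \<Omega> \<Omega> (\<lambda>x. a * u x + b * v x) \<le> ennreal (2 powr p) * (SE k p \<Omega> \<Omega> (\<lambda>x. a * u x) + SE k p \<Omega> \<Omega> (\<lambda>x. b * v x))"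
    by (rule sobolev_add(2)[OF assms(1,2) c(1,3)]) (use assms in auto)
  also have "\<dots> \<le> ennreal (2 powr p) * (ennreal (norm a powr p) * SE k p \<Omega> \<Omega> u + ennreal (norm b powr p) * SE k p \<Omega> \<Omega> v)"
    by (intro mult_left_mono add_mono c) auto
  finally show "SE k p \<Omega> \<Omega> (\<lambda>x. a * u x + b * v x) \<le> \<dots>" .
qed

lemma sobolev_vanishing_lincomb:
  fixes u v :: "'a::euclidean_space \<Rightarrow> 'b::{real_normed_field,euclidean_space}"
  assumes p: "p \<ge> 1" and \<Omega>: "open \<Omega>" and u: "u \<in> sobolev_vanishing k p E \<Omega>" and v: "v \<in> sobolev_vanishing k p E \<Omega>"
  shows "(\<lambda>x. a * u x + b * v x) \<in> sobolev_vanishing k p E \<Omega>"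
  unfolding sobolev_vanishing_iff[OF p \<Omega>]
proof (intro conjI allI impI)
  have us: "u \<in> sobolev k p \<Omega>" "v \<in> sobolev k p \<Omega>"
    by (rule sobolev_vanishing_sobolev[OF u], rule sobolev_vanishing_sobolev[OF v])
  show "(\<lambda>x. a * u x + b * v x) \<in> sobolev k p \<Omega>" by (rule sobolev_lincomb(1)[OF p \<Omega> us])
  fix e :: real assume e: "e > 0"
  define n where "n = norm a powr p + norm b powr p + 1"
  have n: "n > 0" by (simp add: n_def add_nonneg_pos)
  define e' where "e' = e / (4 * 2 powr p * n)"
  have e': "e' > 0" using e n by (simp add: e'_def)
  obtain u' where u': "u' \<in> C0_infinity UNIV" "supp u' \<inter> E = {}" "SE k p \<Omega> \<Omega> (\<lambda>x. u x - u' x) < ennreal e'"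
    using u e' unfolding sobolev_vanishing_iff[OF p \<Omega>] by blast
  obtain v' where v': "v' \<in> C0_infinity UNIV" "supp v' \<inter> E = {}" "SE k p \<Omega> \<Omega> (\<lambda>x. v x - v' x) < ennreal e'"
    using v e' unfolding sobolev_vanishing_iff[OF p \<Omega>] by blast
  let ?w = "\<lambda>x. a * u' x + b * v' x"
  have w: "?w \<in> C0_infinity UNIV"
    by (rule C0_infinityI[OF C_infinity_add[OF C_infinity_mult[OF C_infinity_const] C_infinity_mult[OF C_infinity_const]], of _ _ "supp u' \<union> supp v'"])
      (use C0_infinity_D[OF u'(1)] C0_infinity_D[OF v'(1)] in \<open>auto simp: supp_notin\<close>)
  have "supp ?w \<subseteq> supp u' \<union> supp v'" by (rule supp_subset) (auto simp: supp_notin)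
  then have sw: "supp ?w \<inter> E = {}" using u'(2) v'(2) by auto
  have d: "(\<lambda>x. u x - u' x) \<in> sobolev k p \<Omega>" "(\<lambda>x. v x - v' x) \<in> sobolev k p \<Omega>"
    using sobolev_diff(1)[OF p \<Omega>] us sobolev_C0_infinity(1)[OF _ p \<Omega>] u'(1) v'(1) by blast+
  have "SE k p \<Omega> \<Omega> (\<lambda>x. a * (u x - u' x) + b * (v x - v' x))
    \<le> ennreal (2 powr p) * (ennreal (norm a powr p) * SE k p \<Omega> \<Omega> (\<lambda>x. u x - u' x) + ennreal (norm b powr p) * SE k p \<Omega> \<Omega> (\<lambda>x. v x - v' x))"
    by (rule sobolev_lincomb(2)[OF p \<Omega> d])
  also have "\<dots> \<le> ennreal (2 powr p) * (ennreal n * ennreal e' + ennreal n * ennreal e')"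
    using u'(3) v'(3) by (intro mult_left_mono add_mono mult_mono) (auto simp: n_def intro!: ennreal_leI)
  also have "\<dots> = ennreal (e / 2)"
  proof -
    have "2 powr p * (n * e' + n * e') = e / 2" using n by (simp add: e'_def field_simps)
    moreover have "ennreal (2 powr p) * (ennreal n * ennreal e' + ennreal n * ennreal e') = ennreal (2 powr p * (n * e' + n * e'))"
      using n e' by (simp add: ennreal_mult[symmetric] ennreal_plus[symmetric] del: ennreal_plus)
    ultimately show ?thesis by (simp only:)
  qed
  also have "\<dots> < ennreal e" using e by (intro ennreal_lessI) auto
  finally have "SE k p \<Omega> \<Omega> (\<lambda>x. (a * u x + b * v x) - ?w x) < ennreal e" by (simp add: algebra_simps)
  then show "\<exists>w\<in>C0_infinity UNIV. supp w \<inter> E = {} \<and> SE k p \<Omega> \<Omega> (\<lambda>x. a * u x + b * v x - w x) < ennreal e"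
    using w sw by blast
qed

subsection \<open>Extendable multipliers\<close>

text \<open>
  The predicate \<open>extendable\<close> localises the extension problem: it is additive in the multiplier
  \<open>\<psi>\<close>, and \<open>\<psi> = 1\<close> is the extension operator itself.
\<close>

definition extends_times :: "nat \<Rightarrow> real \<Rightarrow> 'a::euclidean_space set \<Rightarrow> 'a set \<Rightarrow> ('a \<Rightarrow> real) \<Rightarrow> real \<Rightarrow>
    (('a \<Rightarrow> 'b::{real_normed_field,euclidean_space}) \<Rightarrow> 'a \<Rightarrow> 'b) \<Rightarrow> bool" where
  "extends_times k p E \<Lambda> \<psi> C T \<longleftrightarrow> C \<ge> 0 \<and>
     (\<forall>u\<in>sobolev_vanishing k p E \<Lambda>. T u \<in> sobolev_vanishing k p E UNIV) \<and>
     (\<forall>u\<in>sobolev_vanishing k p E \<Lambda>. SE k p UNIV UNIV (T u) \<le> ennreal C * SE k p \<Lambda> \<Lambda> u) \<and>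
     (\<forall>u\<in>sobolev_vanishing k p E \<Lambda>. \<forall>v\<in>sobolev_vanishing k p E \<Lambda>.
        (AE x in lebesgue_on \<Lambda>. u x = v x) \<longrightarrow> (AE x in lebesgue. T u x = T v x)) \<and>
     (\<forall>u\<in>sobolev_vanishing k p E \<Lambda>. \<forall>v\<in>sobolev_vanishing k p E \<Lambda>. \<forall>a b.
        AE x in lebesgue. T (\<lambda>y. a * u y + b * v y) x = a * T u x + b * T v x) \<and>
     (\<forall>u\<in>sobolev_vanishing k p E \<Lambda>. AE x in lebesgue_on \<Lambda>. T u x = \<psi> x *\<^sub>R u x)"

lemma extends_timesD:
  assumes "extends_times k p E \<Lambda> \<psi> C T"
  shows "C \<ge> 0"
    "u \<in> sobolev_vanishing k p E \<Lambda> \<Longrightarrow> T u \<in> sobolev_vanishing k p E UNIV"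
    "u \<in> sobolev_vanishing k p E \<Lambda> \<Longrightarrow> SE k p UNIV UNIV (T u) \<le> ennreal C * SE k p \<Lambda> \<Lambda> u"
    "u \<in> sobolev_vanishing k p E \<Lambda> \<Longrightarrow> v \<in> sobolev_vanishing k p E \<Lambda> \<Longrightarrow> AE x in lebesgue_on \<Lambda>. u x = v x \<Longrightarrow> AE x in lebesgue. T u x = T v x"
    "u \<in> sobolev_vanishing k p E \<Lambda> \<Longrightarrow> v \<in> sobolev_vanishing k p E \<Lambda> \<Longrightarrow> AE x in lebesgue. T (\<lambda>y. a * u y + b * v y) x = a * T u x + b * T v x"
    "u \<in> sobolev_vanishing k p E \<Lambda> \<Longrightarrow> AE x in lebesgue_on \<Lambda>. T u x = \<psi> x *\<^sub>R u x"
  using assms unfolding extends_times_def by (elim conjE; simp; fail)+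

definition extendable :: "'b::{real_normed_field,euclidean_space} itself \<Rightarrow> nat \<Rightarrow> real \<Rightarrow>
    'a::euclidean_space set \<Rightarrow> 'a set \<Rightarrow> ('a \<Rightarrow> real) \<Rightarrow> bool" where
  "extendable F k p E \<Lambda> \<psi> \<longleftrightarrow> (\<exists>(T :: ('a \<Rightarrow> 'b) \<Rightarrow> 'a \<Rightarrow> 'b) C. extends_times k p E \<Lambda> \<psi> C T)"

lemma extendable_add:
  assumes p: "p \<ge> 1" and 1: "extendable TYPE('b) k p E \<Lambda> \<psi>1" and 2: "extendable TYPE('b) k p E \<Lambda> \<psi>2"
  shows "extendable TYPE('b::{real_normed_field,euclidean_space}) k p E \<Lambda> (\<lambda>x::'a::euclidean_space. \<psi>1 x + \<psi>2 x)"
proof -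
  let ?X = "sobolev_vanishing k p E \<Lambda> :: ('a \<Rightarrow> 'b) set" and ?Y = "sobolev_vanishing k p E UNIV :: ('a \<Rightarrow> 'b) set"
  obtain C1 and T1 :: "('a \<Rightarrow> 'b) \<Rightarrow> 'a \<Rightarrow> 'b" where "extends_times k p E \<Lambda> \<psi>1 C1 T1"
    using 1 unfolding extendable_def by blast
  note T1 = extends_timesD[OF this]
  obtain C2 and T2 :: "('a \<Rightarrow> 'b) \<Rightarrow> 'a \<Rightarrow> 'b" where "extends_times k p E \<Lambda> \<psi>2 C2 T2"
    using 2 unfolding extendable_def by blast
  note T2 = extends_timesD[OF this]
  let ?T = "\<lambda>u x. T1 u x + T2 u x"
  show ?thesis unfolding extendable_def extends_times_def
  proof (intro exI[of _ ?T] exI[of _ "2 powr p * (C1 + C2)"] conjI ballI allI impI)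
    show "2 powr p * (C1 + C2) \<ge> 0" using T1(1) T2(1) by simp
    fix u :: "'a \<Rightarrow> 'b" assume u: "u \<in> ?X"
    show "?T u \<in> ?Y"
      using sobolev_vanishing_lincomb[OF p open_UNIV T1(2)[OF u] T2(2)[OF u], of 1 1] by simp
    have "SE k p UNIV UNIV (?T u) \<le> ennreal (2 powr p) * (SE k p UNIV UNIV (T1 u) + SE k p UNIV UNIV (T2 u))"
      by (rule sobolev_add(2)[OF p open_UNIV sobolev_vanishing_sobolev[OF T1(2)[OF u]] sobolev_vanishing_sobolev[OF T2(2)[OF u]]]) auto
    also have "\<dots> \<le> ennreal (2 powr p) * (ennreal C1 * SE k p \<Lambda> \<Lambda> u + ennreal C2 * SE k p \<Lambda> \<Lambda> u)"
      by (intro mult_left_mono add_mono T1(3) T2(3) u) simp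
    also have "\<dots> = ennreal (2 powr p * (C1 + C2)) * SE k p \<Lambda> \<Lambda> u"
      using T1(1) T2(1) by (simp add: ennreal_mult ennreal_plus distrib_right mult.assoc)
    finally show "SE k p UNIV UNIV (?T u) \<le> ennreal (2 powr p * (C1 + C2)) * SE k p \<Lambda> \<Lambda> u" .
    show "AE x in lebesgue_on \<Lambda>. ?T u x = (\<psi>1 x + \<psi>2 x) *\<^sub>R u x"
      using T1(6)[OF u] T2(6)[OF u] by eventually_elim (simp add: scaleR_add_left)
    fix v :: "'a \<Rightarrow> 'b" assume v: "v \<in> ?X"
    show "AE x in lebesgue. ?T (\<lambda>y. a * u y + b * v y) x = a * ?T u x + b * ?T v x" for a b
      using T1(5)[OF u v, of a b] T2(5)[OF u v, of a b] by eventually_elim (simp add: distrib_left)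
    assume ae: "AE x in lebesgue_on \<Lambda>. u x = v x"
    show "AE x in lebesgue. ?T u x = ?T v x"
      using T1(4)[OF u v ae] T2(4)[OF u v ae] by eventually_elim simp
  qed
qed

text \<open>For a linear operator the energy bound gives continuity at every point. Hence
  \<open>extends_times\<close> carries a bound: bounds of several operators add up at once.\<close>

lemma extendable_one:
  assumes p: "p \<ge> 1" and \<Lambda>: "open \<Lambda>" and e: "extendable TYPE('b::{real_normed_field,euclidean_space}) k p E \<Lambda> (\<lambda>_::'a::euclidean_space. 1)"
  shows "\<exists>T :: ('a \<Rightarrow> 'b) \<Rightarrow> ('a \<Rightarrow> 'b).
           continuous_extension_operator k p \<Lambda> (sobolev_vanishing k p E \<Lambda>) (sobolev_vanishing k p E UNIV) T"
proof -
  let ?X = "sobolev_vanishing k p E \<Lambda> :: ('a \<Rightarrow> 'b) set" and ?Y = "sobolev_vanishing k p E UNIV :: ('a \<Rightarrow> 'b) set"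
  obtain C and T :: "('a \<Rightarrow> 'b) \<Rightarrow> 'a \<Rightarrow> 'b" where "extends_times k p E \<Lambda> (\<lambda>_. 1) C T"
    using e unfolding extendable_def by blast
  note T = extends_timesD[OF this]
  have "continuous_extension_operator k p \<Lambda> ?X ?Y T"
    unfolding continuous_extension_operator_def
  proof (intro conjI ballI allI impI)
    fix u :: "'a \<Rightarrow> 'b" assume u: "u \<in> ?X"
    show "T u \<in> ?Y" by (rule T(2)[OF u])
    show "AE x in lebesgue_on \<Lambda>. T u x = u x" using T(6)[OF u] by simp
    show "AE x in lebesgue. T (\<lambda>y. a * u y + b * v y) x = a * T u x + b * T v x" if "v \<in> ?X" for v a b
      by (rule T(5)[OF u that])
    show "AE x in lebesgue. T u x = T v x" if "v \<in> ?X" "AE x in lebesgue_on \<Lambda>. u x = v x" for v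
      by (rule T(4)[OF u that])
    fix \<epsilon> :: real assume \<epsilon>: "\<epsilon> > 0"
    obtain \<eta> where \<eta>: "\<eta> > 0" "\<And>(\<Omega> :: 'a set) (u :: 'a \<Rightarrow> 'b).
       open \<Omega> \<Longrightarrow> u \<in> sobolev k p \<Omega> \<Longrightarrow> SE k p \<Omega> \<Omega> u \<le> ennreal \<eta> \<Longrightarrow> sobolev_norm k p \<Omega> u < \<epsilon>"
      using sobolev_norm_small[OF p \<epsilon>] by metis
    define \<eta>' where "\<eta>' = \<eta> / (C + 1)"
    have \<eta>': "\<eta>' > 0" using \<eta> T(1) by (simp add: \<eta>'_def)
    obtain \<delta> where \<delta>: "\<delta> > 0" "\<And>(\<Omega> :: 'a set) (u :: 'a \<Rightarrow> 'b).
       open \<Omega> \<Longrightarrow> u \<in> sobolev k p \<Omega> \<Longrightarrow> sobolev_norm k p \<Omega> u < \<delta> \<Longrightarrow> SE k p \<Omega> \<Omega> u < ennreal \<eta>'"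
      using SE_small[OF p \<eta>'] by metis
    show "\<exists>\<delta>>0. \<forall>v\<in>?X. sobolev_norm k p \<Lambda> (\<lambda>x. v x - u x) < \<delta> \<longrightarrow> sobolev_norm k p UNIV (\<lambda>x. T v x - T u x) < \<epsilon>"
    proof (intro exI[of _ \<delta>] conjI \<delta>(1) ballI impI)
      fix v :: "'a \<Rightarrow> 'b" assume v: "v \<in> ?X" and n: "sobolev_norm k p \<Lambda> (\<lambda>x. v x - u x) < \<delta>"
      \<comment> \<open>Written as a linear combination to fit the linearity clause
        literally.\<close>
      let ?d = "\<lambda>y. 1 * v y + (-1) * u y"
      have d: "?d \<in> ?X" by (rule sobolev_vanishing_lincomb[OF p \<Lambda> v u])
      have deq: "?d = (\<lambda>x. v x - u x)" by simp
      have "SE k p \<Lambda> \<Lambda> ?d < ennreal \<eta>'"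
        by (rule \<delta>(2)[OF \<Lambda> sobolev_vanishing_sobolev[OF d]]) (use n in \<open>simp add: deq\<close>)
      then have "SE k p UNIV UNIV (T ?d) \<le> ennreal C * ennreal \<eta>'"
        using order_trans[OF T(3)[OF d] mult_left_mono] by (meson less_imp_le zero_le)
      also have "\<dots> \<le> ennreal \<eta>"
      proof -
        have "C * \<eta>' \<le> (C + 1) * \<eta>'" using \<eta>' by simp
        also have "\<dots> = \<eta>" using T(1) by (simp add: \<eta>'_def add_nonneg_eq_0_iff)
        finally show ?thesis using T(1) \<eta>' by (simp add: ennreal_mult[symmetric] ennreal_leI)
      qed
      finally have S: "SE k p UNIV UNIV (T ?d) \<le> ennreal \<eta>" .
      have dT: "(\<lambda>x. T v x - T u x) \<in> sobolev k p UNIV"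
        by (rule sobolev_diff(1)[OF p open_UNIV sobolev_vanishing_sobolev[OF T(2)[OF v]] sobolev_vanishing_sobolev[OF T(2)[OF u]]])
      have ae: "AE x in lebesgue_on UNIV. T ?d x = T v x - T u x"
        using T(5)[OF v u, of 1 "-1"] by simp
      have "SE k p UNIV UNIV (\<lambda>x. T v x - T u x) = SE k p UNIV UNIV (T ?d)"
        by (rule sobolev_cong_AE(2)[OF p open_UNIV sobolev_vanishing_sobolev[OF T(2)[OF d]] ae sobolev_measurable[OF dT]]) auto
      then show "sobolev_norm k p UNIV (\<lambda>x. T v x - T u x) < \<epsilon>" using \<eta>(2)[OF open_UNIV dT] S by simp
    qed
  qed
  then show ?thesis by blast
qed

text \<open>The issue is membership of \<zeta> T0 u in the space vanishing on \<open>E\<close>. By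
  the energy bound it suffices to treat test functions v supported off \<open>E\<close>. Near
  \<open>E\<close> and inside the extension domain T0 v = v = 0 almost everywhere, and measure
  density makes \<open>vanishing_of_thick\<close> applicable.\<close>

lemma extendable_local:
  fixes \<zeta> :: "'a::euclidean_space \<Rightarrow> real"
  assumes p: "p \<ge> 1" and k: "k \<ge> 1" and \<Lambda>: "open \<Lambda>" and E: "closed E" "E \<subseteq> frontier \<Lambda>"
    and U: "open U" and ext: "sobolev_extension_domain TYPE('b::{real_normed_field,euclidean_space}) k p (\<Lambda> \<inter> U)"
    and \<zeta>: "\<zeta> \<in> C0_infinity U"
  shows "extendable TYPE('b) k p E \<Lambda> \<zeta>"
proof -
  let ?\<Omega> = "\<Lambda> \<inter> U"
  have dom: "is_domain ?\<Omega>" and \<Omega>: "open ?\<Omega>" using ext by (auto simp: sobolev_extension_domain_def is_domain_def)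
  obtain T0 :: "('a \<Rightarrow> 'b) \<Rightarrow> 'a \<Rightarrow> 'b" where ceo: "continuous_extension_operator k p ?\<Omega> (sobolev k p ?\<Omega>) (sobolev k p UNIV) T0"
    using ext unfolding sobolev_extension_domain_def by blast
  obtain C0 where C0: "C0 \<ge> 0" "\<And>u. u \<in> sobolev k p ?\<Omega> \<Longrightarrow> SE k p UNIV UNIV (T0 u) \<le> ennreal C0 * SE k p ?\<Omega> ?\<Omega> u"
    using extension_operator_bounded[OF p \<Omega> ceo] by blast
  obtain c \<rho>0 where den: "c > 0" "\<rho>0 > 0" "\<And>x R. x \<in> closure ?\<Omega> \<Longrightarrow> 0 < R \<Longrightarrow> R \<le> \<rho>0 \<Longrightarrow>
     c * R ^ DIM('a) \<le> measure lborel (?\<Omega> \<inter> ball x R)" using measure_density[OF p k dom ceo] by blast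
  have \<zeta>U: "\<zeta> \<in> C0_infinity UNIV" by (rule C0_infinity_mono[OF \<zeta>]) simp
  obtain C1 where C1: "C1 \<ge> 0" "\<And>(\<Omega> :: 'a set) (u :: 'a \<Rightarrow> 'b). open \<Omega> \<Longrightarrow> u \<in> sobolev k p \<Omega> \<Longrightarrow>
    (\<lambda>x. \<zeta> x *\<^sub>R u x) \<in> sobolev k p \<Omega> \<and> SE k p \<Omega> \<Omega> (\<lambda>x. \<zeta> x *\<^sub>R u x) \<le> ennreal C1 * SE k p \<Omega> \<Omega> u"
    using multiplier_bounded[OF p bounded_derivs_C0_infinity[OF \<zeta>U], where ?'b='b] by metis
  let ?T = "\<lambda>u x. \<zeta> x *\<^sub>R T0 u x"
  define C where "C = C1 * C0"
  have C: "C \<ge> 0" using C0 C1 by (simp add: C_def)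
  have sub: "u \<in> sobolev k p ?\<Omega>" "SE k p ?\<Omega> ?\<Omega> u \<le> SE k p \<Lambda> \<Lambda> u" if "u \<in> sobolev k p \<Lambda>" for u :: "'a \<Rightarrow> 'b"
  proof -
    show "u \<in> sobolev k p ?\<Omega>" by (rule sobolev_subset(1)[OF p \<Lambda> that \<Omega>]) auto
    have "SE k p ?\<Omega> ?\<Omega> u = SE k p \<Lambda> ?\<Omega> u" by (rule sobolev_subset(2)[OF p \<Lambda> that \<Omega>]) (use \<Omega> in auto)
    also have "\<dots> \<le> SE k p \<Lambda> \<Lambda> u" by (rule SE_mono_set) (use \<Omega> \<Lambda> in auto)
    finally show "SE k p ?\<Omega> ?\<Omega> u \<le> SE k p \<Lambda> \<Lambda> u" .
  qed
  have T0D: "T0 u \<in> sobolev k p UNIV" "AE x in lebesgue_on ?\<Omega>. T0 u x = u x" if "u \<in> sobolev k p \<Lambda>" for u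
    using ceo sub(1)[OF that] by (auto simp: continuous_extension_operator_def)
  have T0lin: "AE x in lebesgue. T0 (\<lambda>y. a * u y + b * v y) x = a * T0 u x + b * T0 v x"
    if "u \<in> sobolev k p \<Lambda>" "v \<in> sobolev k p \<Lambda>" for u v a b
    using ceo sub(1)[OF that(1)] sub(1)[OF that(2)] unfolding continuous_extension_operator_def by (elim conjE) blast
  have T0wd: "AE x in lebesgue. T0 u x = T0 v x"
    if "u \<in> sobolev k p \<Lambda>" "v \<in> sobolev k p \<Lambda>" "AE x in lebesgue_on ?\<Omega>. u x = v x" for u v
    using ceo sub(1)[OF that(1)] sub(1)[OF that(2)] that(3) unfolding continuous_extension_operator_def by (elim conjE) blast
  have Ts: "?T u \<in> sobolev k p UNIV" "SE k p UNIV UNIV (?T u) \<le> ennreal C * SE k p \<Lambda> \<Lambda> u" if u: "u \<in> sobolev k p \<Lambda>" for u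
  proof -
    note m = C1(2)[OF open_UNIV T0D(1)[OF u]]
    show "?T u \<in> sobolev k p UNIV" using m by blast
    have "SE k p UNIV UNIV (?T u) \<le> ennreal C1 * SE k p UNIV UNIV (T0 u)" using m by blast
    also have "\<dots> \<le> ennreal C1 * (ennreal C0 * SE k p ?\<Omega> ?\<Omega> u)" by (intro mult_left_mono C0(2) sub(1) u) simp
    also have "\<dots> \<le> ennreal C1 * (ennreal C0 * SE k p \<Lambda> \<Lambda> u)" by (intro mult_left_mono sub(2) u) simp_all
    also have "\<dots> = ennreal C * SE k p \<Lambda> \<Lambda> u" using C0 C1 by (simp add: C_def ennreal_mult mult.assoc)
    finally show "SE k p UNIV UNIV (?T u) \<le> ennreal C * SE k p \<Lambda> \<Lambda> u" .
  qed
  have smooth: "?T v \<in> sobolev_vanishing k p E UNIV" if v: "v \<in> C0_infinity UNIV" "supp v \<inter> E = {}" for v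
  proof -
    have vs: "v \<in> sobolev k p \<Lambda>" by (rule sobolev_C0_infinity(1)[OF v(1) p \<Lambda>])
    let ?F = "supp \<zeta>"
    note \<zeta>D = C0_infinity_D[OF \<zeta>]
    have K: "compact (E \<inter> ?F)" using \<zeta>D E by (simp add: closed_Int_compact)
    \<comment> \<open>The part of \<open>E\<close> in the support of \<zeta> is compact, hence at
      positive distance from the support of v.\<close>
    obtain \<epsilon> where \<epsilon>: "\<epsilon> > 0" "closure (nhd (E \<inter> ?F) \<epsilon>) \<subseteq> - supp v"
      using compact_nhd_subset[OF K, of "- supp v"] v(2) by (metis Int_lower1 closed_supp disjoint_eq_subset_Compl inf.commute open_Compl order_trans)
    define \<rho>1 where "\<rho>1 = min \<rho>0 \<epsilon>"
    \<comment> \<open>Points of \<open>E\<close> in the open set \<open>U\<close> are limits of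
      points of \<Lambda>, hence of the intersection, so the density bound is available at
      them.\<close>
    have sub': "x \<in> closure ?\<Omega>" if "x \<in> E \<inter> ?F" for x
    proof -
      have "x \<in> U \<inter> closure \<Lambda>" using that E(2) \<zeta>D(3) by (auto simp: frontier_def)
      then show ?thesis using open_Int_closure_subset[OF U, of \<Lambda>] by (auto simp: Int_commute)
    qed
    have th: "thick ?\<Omega> (E \<inter> ?F) c \<rho>1"
      unfolding thick_def using den(1,2) \<epsilon>(1) den(3)[OF sub'] by (auto simp: \<rho>1_def)
    show ?thesis
    proof (rule vanishing_of_thick[OF p Ts(1)[OF vs] \<zeta>D(2) E(1) _ th \<Omega>])
      show "AE x in lebesgue. x \<notin> ?F \<longrightarrow> \<zeta> x *\<^sub>R T0 v x = 0" by (rule AE_I2) (simp add: supp_notin)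
      show "?\<Omega> \<inter> E = {}" using E(2) \<Lambda> by (auto simp: frontier_def interior_open)
      have "AE x in lebesgue. x \<in> ?\<Omega> \<longrightarrow> T0 v x = v x"
        using T0D(2)[OF vs] \<Omega> by (subst (asm) AE_restrict_space_iff) auto
      then show "AE x in lebesgue. x \<in> ?\<Omega> \<inter> nhd (E \<inter> ?F) \<rho>1 \<longrightarrow> \<zeta> x *\<^sub>R T0 v x = 0"
      proof eventually_elim
        case (elim x)
        have "x \<in> nhd (E \<inter> ?F) \<rho>1 \<Longrightarrow> x \<notin> supp v"
          using \<epsilon>(2) nhd_mono[of \<rho>1 \<epsilon> "E \<inter> ?F"] closure_subset[of "nhd (E \<inter> ?F) \<epsilon>"] by (auto simp: \<rho>1_def)
        then show ?case using elim by (auto simp: supp_notin)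
      qed
    qed
  qed
  show ?thesis unfolding extendable_def extends_times_def
  proof (intro exI[of _ ?T] exI[of _ C] conjI ballI allI impI C)
    fix u :: "'a \<Rightarrow> 'b" assume uX: "u \<in> sobolev_vanishing k p E \<Lambda>"
    have u: "u \<in> sobolev k p \<Lambda>" by (rule sobolev_vanishing_sobolev[OF uX])
    show "SE k p UNIV UNIV (?T u) \<le> ennreal C * SE k p \<Lambda> \<Lambda> u" by (rule Ts(2)[OF u])
    show "?T u \<in> sobolev_vanishing k p E UNIV"
    proof (rule sobolev_vanishing_closed[OF p open_UNIV Ts(1)[OF u]])
      fix e :: real assume e: "e > 0"
      define e' where "e' = e / (2 * (C + 1))"
      have e': "e' > 0" using e C by (simp add: e'_def)
      obtain v where v: "v \<in> C0_infinity UNIV" "supp v \<inter> E = {}" "SE k p \<Lambda> \<Lambda> (\<lambda>x. u x - v x) < ennreal e'"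
        using uX e' unfolding sobolev_vanishing_iff[OF p \<Lambda>] by blast
      have vs: "v \<in> sobolev k p \<Lambda>" by (rule sobolev_C0_infinity(1)[OF v(1) p \<Lambda>])
      let ?d = "\<lambda>y. 1 * u y + (-1) * v y"
      have d: "?d \<in> sobolev k p \<Lambda>" by (rule sobolev_lincomb(1)[OF p \<Lambda> u vs])
      have "SE k p UNIV UNIV (?T ?d) \<le> ennreal C * SE k p \<Lambda> \<Lambda> ?d" by (rule Ts(2)[OF d])
      also have "\<dots> \<le> ennreal C * ennreal e'" using v(3) by (intro mult_left_mono) auto
      also have "\<dots> = ennreal (C * e')" using C e' by (simp add: ennreal_mult)
      also have "\<dots> < ennreal e"
      proof (rule ennreal_lessI[OF e])
        have "C * e' \<le> (C + 1) * e'" using e' by simp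
        also have "\<dots> = e / 2" using C by (simp add: e'_def divide_simps)
        also have "\<dots> < e" using e by simp
        finally show "C * e' < e" .
      qed
      finally have S: "SE k p UNIV UNIV (?T ?d) < ennreal e" .
      have dT: "(\<lambda>x. ?T u x - ?T v x) \<in> sobolev k p UNIV" by (rule sobolev_diff(1)[OF p open_UNIV Ts(1)[OF u] Ts(1)[OF vs]])
      have "AE x in lebesgue. ?T ?d x = ?T u x - ?T v x"
        using T0lin[OF u vs, of 1 "-1"] by eventually_elim (simp add: scaleR_diff_right)
      then have ae: "AE x in lebesgue_on UNIV. ?T ?d x = ?T u x - ?T v x" by simp
      have "SE k p UNIV UNIV (\<lambda>x. ?T u x - ?T v x) = SE k p UNIV UNIV (?T ?d)"
        by (rule sobolev_cong_AE(2)[OF p open_UNIV Ts(1)[OF d] ae sobolev_measurable[OF dT]]) auto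
      with S smooth[OF v(1,2)] show "\<exists>w\<in>sobolev_vanishing k p E UNIV. SE k p UNIV UNIV (\<lambda>x. ?T u x - w x) < ennreal e"
        by (intro bexI[of _ "?T v"]) auto
    qed
    show "AE x in lebesgue_on \<Lambda>. ?T u x = \<zeta> x *\<^sub>R u x"
    proof -
      have "AE x in lebesgue. x \<in> ?\<Omega> \<longrightarrow> T0 u x = u x"
        using T0D(2)[OF u] \<Omega> by (subst (asm) AE_restrict_space_iff) auto
      then have "AE x in lebesgue. x \<in> \<Lambda> \<longrightarrow> ?T u x = \<zeta> x *\<^sub>R u x"
      proof eventually_elim
        case (elim x)
        \<comment> \<open>\<open>T0 u\<close> agrees with u on the extension domain only; on the
          rest of \<Lambda> both sides are 0.\<close>
        have "x \<notin> U \<Longrightarrow> \<zeta> x = 0" using C0_infinity_D(3)[OF \<zeta>] supp_notin by blast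
        then show ?case using elim by auto
      qed
      then show ?thesis using \<Lambda> by (subst AE_restrict_space_iff) auto
    qed
    fix v :: "'a \<Rightarrow> 'b" assume "v \<in> sobolev_vanishing k p E \<Lambda>"
    then have v: "v \<in> sobolev k p \<Lambda>" by (rule sobolev_vanishing_sobolev)
    show "AE x in lebesgue. ?T (\<lambda>y. a * u y + b * v y) x = a * ?T u x + b * ?T v x" for a b
      using T0lin[OF u v, of a b] by eventually_elim (simp add: scaleR_add_right)
    assume ae: "AE x in lebesgue_on \<Lambda>. u x = v x"
    have "AE x in lebesgue_on ?\<Omega>. u x = v x" by (rule AE_lebesgue_on_subset[OF ae]) (use \<Lambda> \<Omega> in auto)
    from T0wd[OF u v this] show "AE x in lebesgue. ?T u x = ?T v x" by eventually_elim simp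
  qed
qed

text \<open>If the support of v misses \<open>E\<close>, then \<psi> v vanishes near the whole
  boundary, because \<psi> takes care of the closure of the rest. On \<Lambda> it is thus a test
  function supported inside, and \<open>zero_extension\<close> applies to limits of such
  functions.\<close>

lemma extendable_interior:
  fixes \<psi> :: "'a::euclidean_space \<Rightarrow> real"
  assumes p: "p \<ge> 1" and \<Lambda>: "open \<Lambda>" "bounded \<Lambda>" and E: "closed E" "E \<subseteq> frontier \<Lambda>"
    and \<psi>: "bounded_derivs k \<psi>" and V: "open V" "closure (frontier \<Lambda> - E) \<subseteq> V" "\<And>x. x \<in> V \<Longrightarrow> \<psi> x = 0"
  shows "extendable TYPE('b::{real_normed_field,euclidean_space}) k p E \<Lambda> \<psi>"
proof -
  obtain C where C: "C \<ge> 0" "\<And>(\<Omega> :: 'a set) (u :: 'a \<Rightarrow> 'b). open \<Omega> \<Longrightarrow> u \<in> sobolev k p \<Omega> \<Longrightarrow>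
    (\<lambda>x. \<psi> x *\<^sub>R u x) \<in> sobolev k p \<Omega> \<and> SE k p \<Omega> \<Omega> (\<lambda>x. \<psi> x *\<^sub>R u x) \<le> ennreal C * SE k p \<Omega> \<Omega> u"
    using multiplier_bounded[OF p \<psi>, where ?'b='b] by metis
  have \<Lambda>E: "\<Lambda> \<inter> E = {}" using E(2) \<Lambda> by (auto simp: frontier_def interior_open)
  have \<Lambda>l: "\<Lambda> \<in> sets lebesgue" using \<Lambda> by auto
  let ?T = "\<lambda>u x. if x \<in> \<Lambda> then \<psi> x *\<^sub>R u x else (0::'b)"
  have eqT: "?T u \<in> sobolev k p \<Lambda>" "SE k p \<Lambda> \<Lambda> (?T u) \<le> ennreal C * SE k p \<Lambda> \<Lambda> u" if u: "u \<in> sobolev k p \<Lambda>" for u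
  proof -
    note m = C(2)[OF \<Lambda>(1) u]
    have ae: "AE x in lebesgue_on \<Lambda>. \<psi> x *\<^sub>R u x = ?T u x" by (rule AE_I2) (simp add: space_restrict_space)
    have mm: "?T u \<in> borel_measurable (lebesgue_on \<Lambda>)"
      by (rule measurable_lebesgue_cong[THEN iffD1, OF _ sobolev_measurable[OF conjunct1[OF m]]]) simp
    note c = sobolev_cong_AE[OF p \<Lambda>(1) conjunct1[OF m] ae mm]
    show "?T u \<in> sobolev k p \<Lambda>" by (rule c(1))
    show "SE k p \<Lambda> \<Lambda> (?T u) \<le> ennreal C * SE k p \<Lambda> \<Lambda> u" using c(2)[of \<Lambda>] \<Lambda>l m by simp
  qed
  have w: "?T v \<in> C0_infinity \<Lambda>" if v: "v \<in> C0_infinity UNIV" "supp v \<inter> E = {}" for v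
  proof -
    \<comment> \<open>Inside \<Lambda>, since a boundary point of \<Lambda> lies in
      \<open>E\<close>, which misses the support of v, or in \<open>V\<close>.\<close>
    define K where "K = supp v \<inter> closure \<Lambda> - V"
    have Kc: "compact K" unfolding K_def using C0_infinity_D(2)[OF v(1)] V(1)
      by (intro compact_diff compact_Int_closed) auto
    have K\<Lambda>: "K \<subseteq> \<Lambda>"
    proof
      fix x assume x: "x \<in> K"
      show "x \<in> \<Lambda>"
      proof (rule ccontr)
        assume "x \<notin> \<Lambda>"
        then have "x \<in> frontier \<Lambda>" using x \<Lambda>(1) by (auto simp: K_def frontier_def interior_open)
        moreover have "x \<notin> E" using x v(2) by (auto simp: K_def)
        ultimately have "x \<in> V" using V(2) closure_subset[of "frontier \<Lambda> - E"] by blast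
        then show False using x by (simp add: K_def)
      qed
    qed
    \<comment> \<open>Multiplying by \<theta> replaces the case distinction on \<Lambda> by a smooth
      factor, which makes smoothness across the boundary evident.\<close>
    obtain \<theta> :: "'a \<Rightarrow> real" and \<epsilon> where \<theta>: "\<theta> \<in> C0_infinity \<Lambda>" "\<epsilon> > 0" "\<And>x. x \<in> nhd K \<epsilon> \<Longrightarrow> \<theta> x = 1"
      using smooth_Urysohn[OF Kc \<Lambda>(1) K\<Lambda>] by metis
    have \<psi>v: "\<psi> x *\<^sub>R v x = 0" if "x \<in> \<Lambda>" "x \<notin> K" for x
    proof -
      have "x \<notin> supp v \<or> x \<in> V" using that closure_subset[of \<Lambda>] by (auto simp: K_def)
      then show ?thesis using V(3) by (auto simp: supp_notin)
    qed
    have "?T v = (\<lambda>x. \<theta> x *\<^sub>R (\<psi> x *\<^sub>R v x))"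
    proof
      fix x show "?T v x = \<theta> x *\<^sub>R (\<psi> x *\<^sub>R v x)"
      proof (cases "x \<in> \<Lambda>")
        case True
        then show ?thesis using \<psi>v[OF True] \<theta>(3)[of x] subset_nhd[OF \<theta>(2), of K] by (cases "x \<in> K") auto
      next
        case False
        then have "\<theta> x = 0" using C0_infinity_D(3)[OF \<theta>(1)] supp_notin by blast
        then show ?thesis using False by simp
      qed
    qed
    moreover have "(\<lambda>x. \<theta> x *\<^sub>R (\<psi> x *\<^sub>R v x)) \<in> C0_infinity \<Lambda>"
      by (rule C0_infinity_scaleR_left[OF \<theta>(1) C_infinity_scaleR[OF _ C0_infinity_D(1)[OF v(1)]]])
        (use \<psi> in \<open>simp add: bounded_derivs_def\<close>)
    ultimately show ?thesis by simp
  qed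
  have approx: "\<exists>v. v \<in> C0_infinity \<Lambda> \<and> SE k p \<Lambda> \<Lambda> (\<lambda>x. ?T u x - v x) < ennreal e"
    if u: "u \<in> sobolev_vanishing k p E \<Lambda>" and e: "e > 0" for u e
  proof -
    have us: "u \<in> sobolev k p \<Lambda>" by (rule sobolev_vanishing_sobolev[OF u])
    define e' where "e' = e / (2 * (C + 1))"
    have e': "e' > 0" using e C by (simp add: e'_def)
    obtain v where v: "v \<in> C0_infinity UNIV" "supp v \<inter> E = {}" "SE k p \<Lambda> \<Lambda> (\<lambda>x. u x - v x) < ennreal e'"
      using u e' unfolding sobolev_vanishing_iff[OF p \<Lambda>(1)] by blast
    have d: "(\<lambda>x. u x - v x) \<in> sobolev k p \<Lambda>"
      by (rule sobolev_diff(1)[OF p \<Lambda>(1) us sobolev_C0_infinity(1)[OF v(1) p \<Lambda>(1)]])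
    have "?T (\<lambda>x. u x - v x) = (\<lambda>x. ?T u x - ?T v x)" by (auto simp: scaleR_diff_right)
    then have "SE k p \<Lambda> \<Lambda> (\<lambda>x. ?T u x - ?T v x) \<le> ennreal C * SE k p \<Lambda> \<Lambda> (\<lambda>x. u x - v x)"
      using eqT(2)[OF d] by (simp only:)
    also have "\<dots> \<le> ennreal C * ennreal e'" using v(3) by (intro mult_left_mono) auto
    also have "\<dots> = ennreal (C * e')" using C e' by (simp add: ennreal_mult)
    also have "\<dots> < ennreal e"
    proof (rule ennreal_lessI[OF e])
      have "C * e' \<le> (C + 1) * e'" using e' by simp
      also have "\<dots> = e / 2" using C(1) by (simp add: e'_def divide_simps)
      also have "\<dots> < e" using e by simp
      finally show "C * e' < e" .
    qed
    finally show ?thesis using w[OF v(1,2)] by blast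
  qed
  have ze: "?T u \<in> sobolev k p UNIV" "SE k p UNIV UNIV (?T u) \<le> SE k p \<Lambda> \<Lambda> (?T u)" if u: "u \<in> sobolev_vanishing k p E \<Lambda>" for u
  proof -
    have us: "u \<in> sobolev k p \<Lambda>" by (rule sobolev_vanishing_sobolev[OF u])
    have a: "\<exists>w\<in>C0_infinity \<Lambda>. SE k p \<Lambda> \<Lambda> (\<lambda>x. ?T u x - w x) < ennreal e" if "e > 0" for e
      using approx[OF u that] by blast
    show "?T u \<in> sobolev k p UNIV" "SE k p UNIV UNIV (?T u) \<le> SE k p \<Lambda> \<Lambda> (?T u)"
      using zero_extension[OF p \<Lambda>(1) eqT(1)[OF us] _ a] by auto
  qed
  show ?thesis unfolding extendable_def extends_times_def
  proof (intro exI[of _ ?T] exI[of _ C] conjI ballI allI impI C(1))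
    fix u :: "'a \<Rightarrow> 'b" assume u: "u \<in> sobolev_vanishing k p E \<Lambda>"
    have us: "u \<in> sobolev k p \<Lambda>" by (rule sobolev_vanishing_sobolev[OF u])
    show "SE k p UNIV UNIV (?T u) \<le> ennreal C * SE k p \<Lambda> \<Lambda> u" using ze(2)[OF u] eqT(2)[OF us] by (rule order_trans)
    show "?T u \<in> sobolev_vanishing k p E UNIV"
      unfolding sobolev_vanishing_iff[OF p open_UNIV]
    proof (intro conjI ze(1)[OF u] allI impI)
      fix e :: real assume e: "e > 0"
      obtain v where v: "v \<in> C0_infinity \<Lambda>" "SE k p \<Lambda> \<Lambda> (\<lambda>x. ?T u x - v x) < ennreal e" using approx[OF u e] by blast
      have vU: "v \<in> C0_infinity UNIV" by (rule C0_infinity_mono[OF v(1)]) simp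
      have vz: "v x = 0" if "x \<notin> \<Lambda>" for x using that C0_infinity_D(3)[OF v(1)] supp_notin by blast
      have d: "(\<lambda>x. ?T u x - v x) \<in> sobolev k p \<Lambda>"
        by (rule sobolev_diff(1)[OF p \<Lambda>(1) eqT(1)[OF us] sobolev_C0_infinity(1)[OF vU p \<Lambda>(1)]])
      \<comment> \<open>The difference with a fixed v is again a limit of test functions in
        \<Lambda>, so its energy on the whole space is at most that on \<Lambda>.\<close>
      have a: "\<exists>w\<in>C0_infinity \<Lambda>. SE k p \<Lambda> \<Lambda> (\<lambda>x. (?T u x - v x) - w x) < ennreal e2" if e2: "e2 > 0" for e2
      proof -
        obtain v2 where v2: "v2 \<in> C0_infinity \<Lambda>" "SE k p \<Lambda> \<Lambda> (\<lambda>x. ?T u x - v2 x) < ennreal e2" using approx[OF u e2] by blast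
        have "(\<lambda>x. v2 x - v x) \<in> C0_infinity \<Lambda>"
          by (rule C0_infinityI[OF C_infinity_diff[OF C0_infinity_D(1)[OF v2(1)] C0_infinity_D(1)[OF v(1)]], of "supp v2 \<union> supp v"])
            (use C0_infinity_D[OF v2(1)] C0_infinity_D[OF v(1)] in \<open>auto simp: supp_notin\<close>)
        then show ?thesis using v2(2) by (intro bexI[of _ "\<lambda>x. v2 x - v x"]) auto
      qed
      have "SE k p UNIV UNIV (\<lambda>x. ?T u x - v x) \<le> SE k p \<Lambda> \<Lambda> (\<lambda>x. ?T u x - v x)"
        by (rule zero_extension(2)[OF p \<Lambda>(1) d _ a]) (simp add: vz)
      then have "SE k p UNIV UNIV (\<lambda>x. ?T u x - v x) < ennreal e" using v(2) by (rule le_less_trans)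
      moreover have "supp v \<inter> E = {}" using C0_infinity_D(3)[OF v(1)] \<Lambda>E by auto
      ultimately show "\<exists>v\<in>C0_infinity UNIV. supp v \<inter> E = {} \<and> SE k p UNIV UNIV (\<lambda>x. ?T u x - v x) < ennreal e"
        using vU by blast
    qed
    show "AE x in lebesgue_on \<Lambda>. ?T u x = \<psi> x *\<^sub>R u x" by (rule AE_I2) (simp add: space_restrict_space)
    fix v :: "'a \<Rightarrow> 'b" assume v: "v \<in> sobolev_vanishing k p E \<Lambda>"
    show "AE x in lebesgue. ?T (\<lambda>y. a * u y + b * v y) x = a * ?T u x + b * ?T v x" for a b
      by (rule AE_I2) (simp add: scaleR_add_right)
    assume ae: "AE x in lebesgue_on \<Lambda>. u x = v x"
    then have "AE x in lebesgue. x \<in> \<Lambda> \<longrightarrow> u x = v x" using \<Lambda>l by (subst (asm) AE_restrict_space_iff) auto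
    then show "AE x in lebesgue. ?T u x = ?T v x" by eventually_elim auto
  qed
qed

text \<open>Induction on the cover builds \<zeta> with 1 - \<zeta> = (1 - \<theta>) (1 - \<zeta>2),
  so \<zeta> is 1 wherever \<theta> or \<zeta>2 is. The new summand \<theta> (1 - \<zeta>2) is
  supported in the added set, where \<open>extendable_local\<close> applies. Being 1 on an open set
  around \<open>S\<close> is what \<open>extendable_interior\<close> later asks of 1 -
  \<zeta>.\<close>

lemma extendable_cover:
  fixes \<Lambda> E :: "'a::euclidean_space set"
  assumes p: "p \<ge> 1" and k: "k \<ge> 1" and \<Lambda>: "open \<Lambda>" "bounded \<Lambda>" and E: "closed E" "E \<subseteq> frontier \<Lambda>"
    and fin: "finite \<C>" and \<C>: "\<And>U. U \<in> \<C> \<Longrightarrow> open U \<and> sobolev_extension_domain TYPE('b::{real_normed_field,euclidean_space}) k p (\<Lambda> \<inter> U)"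
  shows "compact S \<Longrightarrow> S \<subseteq> \<Union>\<C> \<Longrightarrow> \<exists>\<zeta> W. \<zeta> \<in> C0_infinity UNIV \<and> extendable TYPE('b) k p E \<Lambda> \<zeta> \<and> open W \<and> S \<subseteq> W \<and> (\<forall>x\<in>W. \<zeta> x = 1)"
  using fin \<C>
proof (induction \<C> arbitrary: S rule: finite_induct)
  case empty
  have z: "(\<lambda>_::'a. 0::real) \<in> C0_infinity UNIV" by (rule C0_infinityI[of _ "{}"]) (auto simp: C_infinity_const)
  \<comment> \<open>The zero multiplier vanishes on all of \<open>UNIV\<close>, so the interior case
    covers it.\<close>
  have "extendable TYPE('b) k p E \<Lambda> (\<lambda>_::'a. 0::real)"
    by (rule extendable_interior[OF p \<Lambda> E bounded_derivs_C0_infinity[OF z] open_UNIV]) auto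
  then show ?case using z empty by (intro exI[of _ "\<lambda>_. 0"] exI[of _ "{}"]) auto
next
  case (insert U \<C>)
  have U: "open U" "sobolev_extension_domain TYPE('b) k p (\<Lambda> \<inter> U)" using insert.prems(3) by auto
  have oC: "open (\<Union>\<C>)" using insert.prems(3) by auto
  \<comment> \<open>The part of \<open>S\<close> that only the added set covers. What is left after
    removing a neighbourhood of it goes to the induction hypothesis.\<close>
  have S1: "compact (S - \<Union>\<C>)" "S - \<Union>\<C> \<subseteq> U" using insert.prems(1,2) oC by (auto intro: compact_diff)
  obtain \<theta> :: "'a \<Rightarrow> real" and \<epsilon> where \<theta>: "\<theta> \<in> C0_infinity U" "\<epsilon> > 0" "\<And>x. x \<in> nhd (S - \<Union>\<C>) \<epsilon> \<Longrightarrow> \<theta> x = 1"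
    using smooth_Urysohn[OF S1(1) U(1) S1(2)] by metis
  let ?N = "nhd (S - \<Union>\<C>) \<epsilon>"
  have "compact (S - ?N)" "S - ?N \<subseteq> \<Union>\<C>" using insert.prems(1) subset_nhd[OF \<theta>(2), of "S - \<Union>\<C>"] by (auto intro: compact_diff)
  then obtain \<zeta>2 W2 where \<zeta>2: "\<zeta>2 \<in> C0_infinity UNIV" "extendable TYPE('b) k p E \<Lambda> \<zeta>2" "open W2" "S - ?N \<subseteq> W2" "\<And>x. x \<in> W2 \<Longrightarrow> \<zeta>2 x = 1"
    using insert.IH[of "S - ?N"] insert.prems(3) by blast
  have g: "(\<lambda>x. \<theta> x *\<^sub>R (1 - \<zeta>2 x)) \<in> C0_infinity U"
    by (rule C0_infinity_scaleR_left[OF \<theta>(1) C_infinity_diff[OF C_infinity_const C0_infinity_D(1)[OF \<zeta>2(1)]]])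
  have gU: "(\<lambda>x. \<theta> x *\<^sub>R (1 - \<zeta>2 x)) \<in> C0_infinity UNIV" by (rule C0_infinity_mono[OF g]) simp
  let ?\<zeta> = "\<lambda>x. \<zeta>2 x + \<theta> x *\<^sub>R (1 - \<zeta>2 x)"
  have z: "?\<zeta> x = 0" if "x \<notin> supp \<zeta>2 \<union> supp (\<lambda>x. \<theta> x *\<^sub>R (1 - \<zeta>2 x))" for x
    using supp_notin[of x \<zeta>2] supp_notin[of x "\<lambda>x. \<theta> x *\<^sub>R (1 - \<zeta>2 x)"] that by simp
  have "extendable TYPE('b) k p E \<Lambda> ?\<zeta>"
    by (rule extendable_add[OF p \<zeta>2(2) extendable_local[OF p k \<Lambda>(1) E U g]])
  moreover have "?\<zeta> \<in> C0_infinity UNIV"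
    by (rule C0_infinityI[OF C_infinity_add[OF C0_infinity_D(1)[OF \<zeta>2(1)] C0_infinity_D(1)[OF gU]], of "supp \<zeta>2 \<union> supp (\<lambda>x. \<theta> x *\<^sub>R (1 - \<zeta>2 x))"])
      (use C0_infinity_D(2)[OF \<zeta>2(1)] C0_infinity_D(2)[OF gU] z in \<open>auto intro: compact_Un simp del: scaleR_eq_0_iff real_scaleR_def mult_eq_0_iff\<close>)
  moreover have "open (?N \<union> W2)" "S \<subseteq> ?N \<union> W2" using \<zeta>2(3,4) by auto
  moreover have "\<forall>x\<in>?N \<union> W2. ?\<zeta> x = 1" using \<theta>(3) \<zeta>2(5) by auto
  ultimately show ?case by blast
qed

theorem theorem6p9:
  fixes \<Lambda> E :: "'a::euclidean_space set" and k :: nat and p :: real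
  assumes "k \<ge> 1" and "p \<ge> 1"
    and "is_domain \<Lambda>" and "bounded \<Lambda>"
    and "closed E" and "E \<subseteq> frontier \<Lambda>"
    and "\<forall>x \<in> closure (frontier \<Lambda> - E). \<exists>U. open U \<and> x \<in> U \<and>
           sobolev_extension_domain TYPE('b::{real_normed_field, euclidean_space}) k p (\<Lambda> \<inter> U)"
  shows "\<exists>T :: ('a \<Rightarrow> 'b) \<Rightarrow> ('a \<Rightarrow> 'b).
           continuous_extension_operator k p \<Lambda>
             (sobolev_vanishing k p E \<Lambda>) (sobolev_vanishing k p E UNIV) T"
proof (rule extendable_one[OF assms(2)])
  show \<Lambda>: "open \<Lambda>" using assms(3) by (simp add: is_domain_def)
  let ?S = "closure (frontier \<Lambda> - E)"
  have S: "compact ?S"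
    using bounded_subset[OF bounded_closure[OF assms(4)], of "frontier \<Lambda> - E"] by (auto simp: compact_closure frontier_def)
  let ?\<U> = "{U. open U \<and> sobolev_extension_domain TYPE('b) k p (\<Lambda> \<inter> U)}"
  have "?S \<subseteq> \<Union>?\<U>" using assms(7) by blast
  then obtain \<C> where \<C>: "\<C> \<subseteq> ?\<U>" "finite \<C>" "?S \<subseteq> \<Union>\<C>"
    using compactE[OF S, of ?\<U>] by blast
  obtain \<zeta> W where \<zeta>: "\<zeta> \<in> C0_infinity UNIV" "extendable TYPE('b) k p E \<Lambda> \<zeta>" "open W" "?S \<subseteq> W" "\<And>x. x \<in> W \<Longrightarrow> \<zeta> x = 1"
    using extendable_cover[OF assms(2,1) \<Lambda> assms(4-6) \<C>(2) _ S \<C>(3), where ?'b='b] \<C>(1) by blast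
  \<comment> \<open>\<zeta> is 1 on the open set \<open>W\<close> around \<open>?S\<close>, so 1 -
    \<zeta> vanishes there and falls under the interior case; the two multipliers add up to
    1.\<close>
  have "extendable TYPE('b) k p E \<Lambda> (\<lambda>x. 1 - \<zeta> x)"
    by (rule extendable_interior[OF assms(2) \<Lambda> assms(4-6) bounded_derivs_one_minus[OF \<zeta>(1)] \<zeta>(3,4)]) (simp add: \<zeta>(5))
  from extendable_add[OF assms(2) \<zeta>(2) this]
  show "extendable TYPE('b) k p E \<Lambda> (\<lambda>_. 1)" by simp
qed

end
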